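(* There exist constants $t^*,K^*>0$ such that if $0<t<t^*$ and $K>K^*$, then the unique global minimum over $\mathcal{A}$ of $$I(n)=\int_\Omega|\nabla n|^2+2t\,n\cdot\nabla\times n+t^2|n|^2\,dx+K\mathcal{H}^2(S_n)$$ is the smooth function $n^*(z)$ defined by $$n^*(z)=\left(\cos\theta^*(z)\cos(tz),\ \cos\theta^*(z)\sin(tz),\ \sin\theta^*(z)\right)^T,$$ where $\theta^*:[0,1]\to[0,\frac\pi2]$ is given implicitly by $$\int_0^{\theta^*(z)}\frac{du}{\left(D-t^2\cos^2u\right)^{1/2}}=z,\qquad \theta^*(1)=\frac\pi2,$$ the constant $D>t^2$ being determined by the second condition.
   Context: Let $L_1,L_2>0$ be fixed, $\Omega=(-L_1,L_1)\times(-L_2,L_2)\times(0,1)\subset\mathbb{R}^3$ with coordinates $(x,y,z)$, and $$\mathcal{A}=\left\{n\in SBV^2(\Omega,\mathbb{S}^2\cup\{0\}) : n|_{z=0}=e_1,\ n|_{z=1}=e_3,\ n|_{x=-L_1}=n|_{x=L_1},\ n|_{y=-L_2}=n|_{y=L_2}\right\}.$$ $SBV^2$ denotes the functions in $SBV$ with approximate gradient $\nabla n\in L^2$ and $\mathcal{H}^2(S_n)<\infty$, $S_n$ being the approximate discontinuity set. Boundary conditions are imposed in the weak (extended domain) sense: for a fixed $\epsilon>0$, $n$ is extended by $e_1$ to $-\epsilon<z<0$ and by $e_3$ to $1<z<1+\epsilon$, and periodically in $x,y$; $S_n$ is the discontinuity set of the extended map (counted once per period cell), so every part of the boundary where a condition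 fails in the trace sense belongs to $S_n$. *)

theory Defs
  imports "HOL-Analysis.Analysis"
begin

section \<open>Hausdorff measure\<close>

text \<open>The normalisation makes the \<open>k\<close>-dimensional measure agree with Lebesgue measure on \<open>k\<close>-planes.
  Unbounded covering sets are excluded explicitly because \<^const>\<open>diameter\<close> is unspecified on them.\<close>

definition hausdorff_premeasure :: "nat \<Rightarrow> real \<Rightarrow> 'a::metric_space set \<Rightarrow> ennreal" where
  "hausdorff_premeasure k \<delta> E =
     (INF C \<in> {C :: nat \<Rightarrow> 'a set. E \<subseteq> (\<Union>i. C i) \<and> (\<forall>i. bounded (C i) \<and> diameter (C i) < \<delta>)}.
        \<Sum>i. ennreal (if C i = {} then 0 else unit_ball_vol (real k) * (diameter (C i) / 2) ^ k))"

definition hausdorff_measure :: "nat \<Rightarrow> 'a::metric_space set \<Rightarrow> ennreal" where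
  "hausdorff_measure k E = (SUP \<delta> \<in> {0<..}. hausdorff_premeasure k \<delta> E)"


section \<open>Approximate limits and approximate gradients\<close>

text \<open>These notions are meaningful for functions that are integrable near the point in question;
  a gradient is the matrix \<open>G\<close> with \<open>G $ i $ j = \<partial>\<^sub>j u\<^sub>i\<close>.\<close>

definition has_approx_limit :: "(real^'n \<Rightarrow> real^'m) \<Rightarrow> real^'n \<Rightarrow> real^'m \<Rightarrow> bool" where
  "has_approx_limit u x a \<longleftrightarrow>
     ((\<lambda>r. (LINT y:ball x r|lebesgue. norm (u y - a)) / measure lebesgue (ball x r)) \<longlongrightarrow> 0)
       (at_right 0)"

definition approx_discont_set :: "(real^'n) set \<Rightarrow> (real^'n \<Rightarrow> real^'m) \<Rightarrow> (real^'n) set" where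
  "approx_discont_set U u = {x \<in> U. \<not> (\<exists>a. has_approx_limit u x a)}"

definition has_approx_gradient :: "(real^'n \<Rightarrow> real^'m) \<Rightarrow> real^'n \<Rightarrow> real^'n^'m \<Rightarrow> bool" where
  "has_approx_gradient u x G \<longleftrightarrow>
     (\<exists>a. has_approx_limit u x a \<and>
        ((\<lambda>r. (LINT y:ball x r|lebesgue. norm (u y - a - G *v (y - x)) / r)
               / measure lebesgue (ball x r)) \<longlongrightarrow> 0) (at_right 0))"

text \<open>For \<open>u\<close> of bounded variation this is determined at almost every point of the domain; elsewhere
  it is an unspecified matrix.\<close>

definition approx_gradient :: "(real^'n \<Rightarrow> real^'m) \<Rightarrow> real^'n \<Rightarrow> real^'n^'m" where
  "approx_gradient u x = (THE G. has_approx_gradient u x G)"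


section \<open>Special functions of bounded variation\<close>

definition test_function :: "(real^'n) set \<Rightarrow> (real^'n \<Rightarrow> real) \<Rightarrow> (real^'n \<Rightarrow> real^'n) \<Rightarrow> bool" where
  "test_function U \<phi> g \<longleftrightarrow>
     (\<forall>x. GDERIV \<phi> x :> g x) \<and> continuous_on UNIV g \<and>
     compact (closure {x. \<phi> x \<noteq> 0}) \<and> closure {x. \<phi> x \<noteq> 0} \<subseteq> U"

text \<open>The distributional derivative of \<open>u\<close> on the open set \<open>U\<close> is the finite matrix-valued measure whose
  Lebesgue decomposition is \<open>Du = G dx + \<sigma> \<mu>\<close>: the singular part \<open>D\<^sup>s u\<close> is given by its polar
  decomposition, with \<open>\<mu> = |D\<^sup>s u|\<close> and \<open>|\<sigma>| = 1\<close>. The measure \<open>\<mu>\<close> is a Borel measure on the whole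
  space concentrated on \<open>U\<close>.\<close>

definition has_BV_derivative ::
  "(real^'n) set \<Rightarrow> (real^'n \<Rightarrow> real^'m) \<Rightarrow> (real^'n \<Rightarrow> real^'n^'m) \<Rightarrow>
     (real^'n) measure \<Rightarrow> (real^'n \<Rightarrow> real^'n^'m) \<Rightarrow> bool" where
  "has_BV_derivative U u G \<mu> \<sigma> \<longleftrightarrow>
     set_integrable lebesgue U G \<and>
     sets \<mu> = sets borel \<and> finite_measure \<mu> \<and> (AE x in \<mu>. x \<in> U) \<and>
     (\<exists>N \<in> null_sets lborel. AE x in \<mu>. x \<in> N) \<and>
     \<sigma> \<in> borel_measurable borel \<and> (AE x in \<mu>. norm (\<sigma> x) = 1) \<and>
     (\<forall>\<phi> g i j. test_function U \<phi> g \<longrightarrow>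
        (LINT x:U|lebesgue. u x $ i * g x $ j) =
          - (LINT x:U|lebesgue. \<phi> x * G x $ i $ j) - (LINT x|\<mu>. \<phi> x * \<sigma> x $ i $ j))"

definition BV :: "(real^'n) set \<Rightarrow> (real^'n \<Rightarrow> real^'m) set" where
  "BV U = {u. set_integrable lebesgue U u \<and> (\<exists>G \<mu> \<sigma>. has_BV_derivative U u G \<mu> \<sigma>)}"

text \<open>The Cantor part of \<open>Du\<close> is the restriction of \<open>D\<^sup>s u\<close> to the complement of the approximate
  discontinuity set; it vanishes iff \<open>|D\<^sup>s u|\<close> is concentrated on that set.
  The decomposition is unique, so it does not matter that it is quantified existentially.\<close>

definition SBV :: "(real^'n) set \<Rightarrow> (real^'n \<Rightarrow> real^'m) set" where
  "SBV U = {u \<in> BV U. \<exists>G \<mu> \<sigma>. has_BV_derivative U u G \<mu> \<sigma> \<and>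
     (AE x in \<mu>. x \<in> approx_discont_set U u)}"

definition SBV2 :: "(real^'n) set \<Rightarrow> (real^'n \<Rightarrow> real^'m) set" where
  "SBV2 U = {u \<in> SBV U.
     set_borel_measurable lebesgue U (approx_gradient u) \<and>
     set_integrable lebesgue U (\<lambda>x. (norm (approx_gradient u x))\<^sup>2) \<and>
     hausdorff_measure (CARD('n) - 1) (approx_discont_set U u) < \<infinity>}"


section \<open>The variational problem\<close>

abbreviation e1 :: "real^3" where "e1 \<equiv> axis 1 1"
abbreviation e3 :: "real^3" where "e3 \<equiv> axis 3 1"

definition cell :: "real \<Rightarrow> real \<Rightarrow> (real^3) set" where
  "cell L1 L2 = {p. - L1 < p $ 1 \<and> p $ 1 < L1 \<and> - L2 < p $ 2 \<and> p $ 2 < L2 \<and> 0 < p $ 3 \<and> p $ 3 < 1}"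

definition slab :: "real \<Rightarrow> (real^3) set" where
  "slab \<epsilon> = {p. - \<epsilon> < p $ 3 \<and> p $ 3 < 1 + \<epsilon>}"

text \<open>The representative of \<open>x\<close> modulo \<open>2 L\<close> in \<open>[-L, L)\<close>.\<close>

definition wrap :: "real \<Rightarrow> real \<Rightarrow> real" where
  "wrap L x = x - 2 * L * of_int \<lfloor>(x + L) / (2 * L)\<rfloor>"

definition extend :: "real \<Rightarrow> real \<Rightarrow> (real^3 \<Rightarrow> real^3) \<Rightarrow> real^3 \<Rightarrow> real^3" where
  "extend L1 L2 n p =
     (if p $ 3 \<le> 0 then e1 else if 1 \<le> p $ 3 then e3
      else n (vector [wrap L1 (p $ 1), wrap L2 (p $ 2), p $ 3]))"

text \<open>The discontinuity set of the extended map, restricted to one half-open period.\<close>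

definition jump_set :: "real \<Rightarrow> real \<Rightarrow> real \<Rightarrow> (real^3 \<Rightarrow> real^3) \<Rightarrow> (real^3) set" where
  "jump_set L1 L2 \<epsilon> n =
     {p \<in> approx_discont_set (slab \<epsilon>) (extend L1 L2 n).
        - L1 \<le> p $ 1 \<and> p $ 1 < L1 \<and> - L2 \<le> p $ 2 \<and> p $ 2 < L2}"

text \<open>Maps are represented by functions on the whole space of which only the values on the cell matter.
  The boundary conditions enter through the extended map: it is locally of class \<open>SBV\<^sup>2\<close> on
  the slab, and wherever a condition fails in the trace sense the boundary point belongs to the jump
  set, which is penalised in the energy.\<close>

definition admissible :: "real \<Rightarrow> real \<Rightarrow> real \<Rightarrow> (real^3 \<Rightarrow> real^3) set" where
  "admissible L1 L2 \<epsilon> = {n.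
     n \<in> SBV2 (cell L1 L2) \<and>
     (AE p in lebesgue. p \<in> cell L1 L2 \<longrightarrow> n p \<in> sphere 0 1 \<union> {0}) \<and>
     (\<forall>V. open V \<and> bounded V \<and> V \<subseteq> slab \<epsilon> \<longrightarrow> extend L1 L2 n \<in> SBV2 V)}"

definition curl_of :: "real^3^3 \<Rightarrow> real^3" where
  "curl_of G = vector [G $ 3 $ 2 - G $ 2 $ 3, G $ 1 $ 3 - G $ 3 $ 1, G $ 2 $ 1 - G $ 1 $ 2]"

text \<open>On admissible maps the jump set has finite area, so \<^const>\<open>enn2real\<close> loses nothing there.
  The norm of a matrix is the Frobenius norm.\<close>

definition energy :: "real \<Rightarrow> real \<Rightarrow> real \<Rightarrow> real \<Rightarrow> real \<Rightarrow> (real^3 \<Rightarrow> real^3) \<Rightarrow> real" where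
  "energy L1 L2 \<epsilon> t K n =
     (LINT p:cell L1 L2|lebesgue.
        (norm (approx_gradient n p))\<^sup>2 + 2 * t * (n p \<bullet> curl_of (approx_gradient n p))
        + t\<^sup>2 * (norm (n p))\<^sup>2)
     + K * enn2real (hausdorff_measure 2 (jump_set L1 L2 \<epsilon> n))"


section \<open>The explicit profile\<close>

definition is_profile :: "real \<Rightarrow> real \<Rightarrow> (real \<Rightarrow> real) \<Rightarrow> bool" where
  "is_profile t D \<theta> \<longleftrightarrow>
     t\<^sup>2 < D \<and> \<theta> \<in> {0..1} \<rightarrow> {0..pi/2} \<and>
     (\<forall>z\<in>{0..1}. integral {0..\<theta> z} (\<lambda>u. 1 / sqrt (D - t\<^sup>2 * (cos u)\<^sup>2)) = z) \<and>
     \<theta> 1 = pi / 2"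

definition director :: "real \<Rightarrow> (real \<Rightarrow> real) \<Rightarrow> real \<Rightarrow> real^3" where
  "director t \<theta> z =
     vector [cos (\<theta> z) * cos (t * z), cos (\<theta> z) * sin (t * z), sin (\<theta> z)]"

text \<open>Infinitely differentiable on \<open>S\<close>; at the end points of an interval the derivatives are one-sided.\<close>

definition smooth_on :: "real set \<Rightarrow> (real \<Rightarrow> 'a::real_normed_vector) \<Rightarrow> bool" where
  "smooth_on S f \<longleftrightarrow>
     (\<exists>F :: nat \<Rightarrow> real \<Rightarrow> 'a. F 0 = f \<and>
        (\<forall>k. \<forall>z\<in>S. (F k has_vector_derivative F (Suc k) z) (at z within S)))"

end

theory Submission
  imports Defs
begin

text \<open>The minimality is proved by a calibration. Write \<open>N\<close> for the candidate and \<open>w = n - N\<close>. The energy density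
  minus an affine function of \<open>(n, \<nabla>n)\<close>, with coefficients depending on \<open>z\<close> only, is a sum of squares plus
  \<open>(- a' - a\<^sup>2 - \<Lambda> - t\<^sup>2) |w|\<^sup>2\<close>: here \<open>\<Lambda>\<close> is the Lagrange multiplier of the constraint \<open>|n| = 1\<close>, and
  \<open>a\<close> enters through the null Lagrangian \<open>(a |w|\<^sup>2)'\<close>, which supplies the Poincare inequality
  pointwise. On the set \<open>n = 0\<close> the same affine function lies strictly below the density. Its first-order
  part has the form \<open>A : \<nabla>n + A\<^sub>3' \<cdot> n\<close> with \<open>A\<close> a function of \<open>z\<close>, so that its integral depends on the
  boundary values and on the singular part of \<open>Dn\<close> alone, and the latter contributes at most a constant times
  \<open>H\<^sup>2(S\<^sub>n)\<close>, which \<open>K\<close> absorbs.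

  Three facts on functions of bounded variation are used: the approximate gradient is the density of the
  absolutely continuous part of the derivative; it is tangential to the sphere wherever \<open>|n| = 1\<close>; and
  the singular part is bounded by the Hausdorff measure of the jump set. The last one needs no structure
  theory: testing with functions cut off near a cover of \<open>S\<^sub>n\<close> by small balls suffices.\<close>

section \<open>Lebesgue points and translations\<close>

text \<open>The energy sees \<open>n\<close> only through \<open>approx_gradient\<close>, a
  pointwise notion, while membership in \<open>SBV\<close> is a statement about distributions; the
  calibration can be integrated only once the two are identified almost everywhere. Nor are there
  traces: the boundary conditions live in the extended map, so the test functions overlap
  neighbouring periods laterally and reach beyond the plates, where the extension is constant.
  Lateral terms cancel in the sum over periods, and the plates contribute to a number
  \<open>calib_total\<close> common to all admissible maps, so the energy of the candidate is never
  evaluated explicitly. The threshold 1/4 for \<open>t\<close> gives \<Lambda> \<le> pi^2/4 + 2 t^2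
  \<le> 2.6; against the 3 supplied by the null Lagrangian this leaves 3 - 2.6 - 1/16 > 3/10, the
  coefficient of |w|^2. The threshold for \<open>K\<close> is 300 * 100 * 9 * 3 * 9: the L^1 norm of
  the cut-off gradients per unit of squared radii, the size of the calibration, the lattice
  translates that cover the test region, the passage from Hausdorff measure to squared radii, and
  the number of matrix entries.\<close>

lemma measure_cball_density_zero:
  fixes \<nu> :: "'a::euclidean_space measure"
  assumes sets: "sets \<nu> = sets borel" and fin: "finite_measure \<nu>"
    and A: "A \<in> sets borel" and A0: "emeasure \<nu> A = 0"
  shows "AE x in lebesgue. x \<in> A \<longrightarrow>
           ((\<lambda>r. measure \<nu> (cball x r) / r ^ DIM('a)) \<longlongrightarrow> 0) (at_right 0)"
proof -
  interpret finite_measure \<nu> by fact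
  \<comment> \<open>\<open>E c\<close> collects the points of \<open>A\<close> whose density ratio
    exceeds \<open>c\<close> along arbitrarily small radii. It suffices that each of these sets is
    negligible; the claim follows along c = 1 / (k + 1).\<close>
  define E where "E c = {x\<in>A. \<forall>d>0. \<exists>r. 0 < r \<and> r < d \<and> measure \<nu> (cball x r) > c * r ^ DIM('a)}" for c
  define V where "V = unit_ball_vol (real DIM('a))"
  have Vpos: "V > 0" by (simp add: V_def)
  have cb: "emeasure lborel (cball x r) = ennreal (V * r ^ DIM('a))" if "r > 0" for x :: 'a and r
    using that by (simp add: emeasure_cball V_def)
  have negE: "negligible (E c)" if c: "c > 0" for c
    unfolding negligible_outer_le
  proof (intro allI impI)
    fix e :: real assume e: "e > 0"
    \<comment> \<open>Outer regularity at the null set \<open>A\<close>. The disjoint Vitali balls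
      lie in \<open>W\<close>, and each has Lebesgue measure at most \<open>V / c\<close> times its
      \<open>\<nu>\<close>-measure; the bound \<open>c * e / V\<close> turns this into total volume
      at most \<open>e\<close>.\<close>
    have "(INF U \<in> {U. A \<subseteq> U \<and> open U}. emeasure \<nu> U) = 0"
      using outer_regular[OF sets _ A] A0 emeasure_finite by simp
    then obtain W where W: "A \<subseteq> W" "open W" and Wm: "emeasure \<nu> W < ennreal (c * e / V)"
      using e c Vpos by (auto simp: INF_less_iff dest!: order.strict_trans1[of "Inf _" 0 "ennreal (c * e / V)", OF eq_refl])
    define K where "K = {(x, r). x \<in> E c \<and> 0 < r \<and> cball x r \<subseteq> W \<and> measure \<nu> (cball x r) > c * r ^ DIM('a)}"
    have ex: "\<exists>i. i \<in> K \<and> x \<in> cball (fst i) (snd i) \<and> snd i < d" if x: "x \<in> E c" and d: "0 < d" for x d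
    proof -
      have "x \<in> W" using x W by (auto simp: E_def)
      then obtain s where s: "s > 0" "cball x s \<subseteq> W" using W(2) open_contains_cball by blast
      have "\<forall>d>0. \<exists>r. 0 < r \<and> r < d \<and> measure \<nu> (cball x r) > c * r ^ DIM('a)"
        using x by (simp add: E_def)
      from this[rule_format, of "min s d"] s d
      obtain r where r: "0 < r" "r < min s d" "measure \<nu> (cball x r) > c * r ^ DIM('a)" by auto
      moreover have "cball x r \<subseteq> W" using s(2) r(2) using subset_cball[of r s x] by auto
      ultimately show ?thesis using x by (intro exI[of _ "(x, r)"]) (auto simp: K_def)
    qed
    have K0: "0 < snd i" if "i \<in> K" for i using that by (auto simp: K_def)
    obtain C where C: "countable C" "C \<subseteq> K"
      and pw: "pairwise (\<lambda>i j. disjnt (cball (fst i) (snd i)) (cball (fst j) (snd j))) C"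
      and neg: "negligible (E c - (\<Union>i\<in>C. cball (fst i) (snd i)))"
      by (rule Vitali_covering_theorem_cballs[of K snd "E c" fst, OF K0 ex])
    let ?U = "\<Union>i\<in>C. cball (fst i) (snd i)"
    have K1: "cball (fst i) (snd i) \<subseteq> W" if "i \<in> K" for i using that by (auto simp: K_def)
    have UW: "?U \<subseteq> W" using C(2) K1 by (intro UN_least) auto
    have dj: "disjoint_family_on (\<lambda>i. cball (fst i) (snd i)) C"
      using pw by (auto simp: disjoint_family_on_def pairwise_def disjnt_def)
    have "emeasure lebesgue ?U = (\<integral>\<^sup>+ i. emeasure lebesgue (cball (fst i) (snd i)) \<partial>count_space C)"
      by (rule emeasure_UN_countable) (use C dj in auto)
    also have "\<dots> \<le> (\<integral>\<^sup>+ i. ennreal (V / c) * emeasure \<nu> (cball (fst i) (snd i)) \<partial>count_space C)"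
    proof (rule nn_integral_mono)
      fix i assume "i \<in> space (count_space C)"
      then have i: "i \<in> K" using C by auto
      then have "V * snd i ^ DIM('a) \<le> V / c * measure \<nu> (cball (fst i) (snd i))"
        using c Vpos by (auto simp: K_def field_simps)
      then show "emeasure lebesgue (cball (fst i) (snd i)) \<le> ennreal (V / c) * emeasure \<nu> (cball (fst i) (snd i))"
        using i c Vpos by (auto simp: K_def cb emeasure_eq_measure ennreal_mult'[symmetric] intro!: ennreal_leI)
    qed
    also have "\<dots> = ennreal (V / c) * emeasure \<nu> ?U"
      by (subst nn_integral_cmult) (use C dj sets in \<open>auto intro!: arg_cong2[where f="(*)"] emeasure_UN_countable[symmetric]\<close>)
    also have "\<dots> \<le> ennreal (V / c) * ennreal (c * e / V)"
      using UW W sets by (intro mult_left_mono order.trans[OF emeasure_mono less_imp_le[OF Wm]]) auto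
    also have "\<dots> = ennreal e" using c Vpos e by (simp add: ennreal_mult'[symmetric])
    finally have m: "emeasure lebesgue ?U \<le> ennreal e" .
    have Us: "?U \<in> sets lebesgue" using C(1) by (intro sets.countable_UN') auto
    have Ul: "?U \<in> lmeasurable" using m Us by (intro fmeasurableI) (auto simp: less_top[symmetric] top_unique)
    let ?T = "?U \<union> (E c - ?U)"
    have nl: "E c - ?U \<in> null_sets lebesgue" using neg by (simp add: negligible_iff_null_sets)
    show "\<exists>T. E c \<subseteq> T \<and> T \<in> lmeasurable \<and> measure lebesgue T \<le> e"
    proof (intro exI[of _ ?T] conjI)
      show "?T \<in> lmeasurable" using Ul nl by (intro fmeasurable.Un) (auto simp: fmeasurable_def null_sets_def)
      have "measure lebesgue ?T = measure lebesgue ?U"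
        by (rule measure_Un_null_set[OF Us nl])
      also have "\<dots> \<le> e" using m e by (simp add: measure_def enn2real_leI)
      finally show "measure lebesgue ?T \<le> e" .
    qed auto
  qed
  have "negligible (\<Union>k. E (1 / real (Suc k)))"
    by (rule negligible_countable_Union[of "range _", simplified]) (auto intro!: negE)
  then have "AE x in lebesgue. x \<notin> (\<Union>k. E (1 / real (Suc k)))"
    by (intro AE_not_in) (simp add: negligible_iff_null_sets)
  then show ?thesis
  proof eventually_elim
    case (elim x)
    show ?case
    proof
      assume x: "x \<in> A"
      show "((\<lambda>r. measure \<nu> (cball x r) / r ^ DIM('a)) \<longlongrightarrow> 0) (at_right 0)"
      proof (rule tendstoI)
        fix e :: real assume "e > 0"
        then obtain k where k: "1 / real (Suc k) < e" using reals_Archimedean[of e] by (auto simp: inverse_eq_divide)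
        have "x \<notin> E (1 / real (Suc k))" using elim by auto
        then have "\<not> (\<forall>d>0. \<exists>r. 0 < r \<and> r < d \<and> measure \<nu> (cball x r) > 1 / real (Suc k) * r ^ DIM('a))"
          using x unfolding E_def by blast
        then obtain d where d: "d > 0" "\<And>r. 0 < r \<Longrightarrow> r < d \<Longrightarrow> measure \<nu> (cball x r) \<le> 1 / real (Suc k) * r ^ DIM('a)"
          by (meson not_less)
        have "dist (measure \<nu> (cball x r) / r ^ DIM('a)) 0 < e" if "0 < r" "r < d" for r
        proof -
          have "measure \<nu> (cball x r) / r ^ DIM('a) \<le> 1 / real (Suc k)"
            using d(2)[OF that] that by (simp add: field_simps)
          then show ?thesis using k that by simp
        qed
        then show "\<forall>\<^sub>F r in at_right 0. dist (measure \<nu> (cball x r) / r ^ DIM('a)) 0 < e"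
          using d(1) by (auto simp: eventually_at_right_field)
      qed
    qed
  qed
qed

text \<open>Reduction to the density lemma instead of a maximal inequality: for \<open>q\<close> in
  a countable dense set, the measure with density |f - q| off \<open>A q k\<close> gives no mass to
  \<open>A q k\<close>, hence has mass o(r^n) on balls around almost every point of it. On
  \<open>A q k\<close> itself |f - f x| is at most 2 / (k + 1) as soon as \<open>x\<close> lies
  there too.\<close>

lemma lebesgue_differentiation:
  fixes f :: "'a::euclidean_space \<Rightarrow> 'b::euclidean_space"
  assumes f: "integrable lebesgue f"
  shows "AE x in lebesgue.
    ((\<lambda>r. (LINT y:ball x r|lebesgue. norm (f y - f x)) / r ^ DIM('a)) \<longlongrightarrow> 0) (at_right 0)"
proof -
  obtain Q :: "'b set" where Q: "countable Q" "\<And>Y. open Y \<Longrightarrow> Y \<noteq> {} \<Longrightarrow> \<exists>d\<in>Q. d \<in> Y"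
    using countable_dense_setE by auto
  have fm[measurable]: "f \<in> borel_measurable lebesgue" using f by auto
  define V where "V = unit_ball_vol (real DIM('a))"
  have Vpos: "V > 0" by (simp add: V_def)
  define A where "A q k = {x. norm (f x - q) < 1 / real (Suc k)}" for q and k :: nat
  have Am[measurable]: "A q k \<in> sets lebesgue" for q k
  proof -
    have "{x\<in>space lebesgue. norm (f x - q) < 1 / real (Suc k)} \<in> sets lebesgue" by measurable
    then show ?thesis by (simp add: A_def)
  qed
  define g where "g q k R y = indicator (ball 0 (real R) - A q k) y * norm (f y - q)" for q k and R :: nat and y
  have gm[measurable]: "g q k R \<in> borel_measurable lebesgue" for q k R
    unfolding g_def
    by (intro borel_measurable_times borel_measurable_indicator borel_measurable_norm borel_measurable_diff fm
        borel_measurable_const sets.Diff Am) auto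
  have gint: "integrable lebesgue (g q k R)" for q k R
  proof (rule Bochner_Integration.integrable_bound)
    show "integrable lebesgue (\<lambda>y. norm (f y) + indicator (ball 0 (real R)) y * norm q)"
      using f by (intro Bochner_Integration.integrable_add integrable_mult_left integrable_real_indicator)
         (auto simp: emeasure_ball)
    have "norm (f y - q) \<le> norm (f y) + norm q" for y by (rule norm_triangle_ineq4)
    then show "AE y in lebesgue. norm (g q k R y) \<le> norm (norm (f y) + indicator (ball 0 (real R)) y * norm q)"
      by (auto simp: g_def indicator_def)
  qed (rule gm)
  have g0: "g q k R y \<ge> 0" for q k R y by (auto simp: g_def)
  \<comment> \<open>Transported to the Borel sets, which is where the density lemma lives; the
    truncation to a ball of radius \<open>R\<close> makes the measure finite although the constant
    \<open>q\<close> is not integrable on the whole space.\<close>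
  define \<nu> where "\<nu> q k R = distr (density lebesgue (\<lambda>y. ennreal (g q k R y))) borel (\<lambda>x. x)" for q k R
  have meas_id: "(\<lambda>x. x) \<in> density lebesgue (\<lambda>y. ennreal (g q k R y)) \<rightarrow>\<^sub>M borel" for q k R
    by (rule measurableI) (auto simp: )
  have em\<nu>: "emeasure (\<nu> q k R) B = (\<integral>\<^sup>+ y\<in>B. ennreal (g q k R y) \<partial>lebesgue)" if "B \<in> sets borel" for q k R B
    unfolding \<nu>_def using that by (subst emeasure_distr[OF meas_id]) (auto simp: emeasure_density)
  have em\<nu>': "emeasure (\<nu> q k R) B = ennreal (LINT y:B|lebesgue. g q k R y)" if "B \<in> sets borel" for q k R B
  proof -
    have "emeasure (\<nu> q k R) B = (\<integral>\<^sup>+ y. ennreal (indicator B y * g q k R y) \<partial>lebesgue)"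
      unfolding em\<nu>[OF that] by (intro nn_integral_cong) (auto simp: indicator_def)
    also have "\<dots> = ennreal (LINT y|lebesgue. indicator B y * g q k R y)"
      using g0 that by (intro nn_integral_eq_integral integrable_real_mult_indicator[OF _ gint, unfolded mult.commute[of _ "indicator _ _"]]) auto
    finally show ?thesis by (simp add: set_lebesgue_integral_def)
  qed
  have D: "AE x in lebesgue. x \<in> A q k \<longrightarrow> ((\<lambda>r. measure (\<nu> q k R) (cball x r) / r ^ DIM('a)) \<longlongrightarrow> 0) (at_right 0)" for q k R
  proof -
    \<comment> \<open>\<open>A q k\<close> is only Lebesgue measurable; it differs from the Borel
      set \<open>S\<close> by a subset of a null set.\<close>
    obtain S N N' where SN: "A q k = S \<union> N" "N \<subseteq> N'" "N' \<in> null_sets lborel" "S \<in> sets lborel"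
      by (rule sets_completionE[OF Am[of q k]]) (rule that)
    have "ennreal (g q k R y) * indicator S y = 0" for y
      using SN(1) by (auto simp: g_def indicator_def)
    then have z: "ennreal (g q k R y) * indicator S y = 0" for y .
    have "emeasure (\<nu> q k R) S = (\<integral>\<^sup>+ y\<in>S. ennreal (g q k R y) \<partial>lebesgue)"
      using SN(4) by (intro em\<nu>) simp
    then have "emeasure (\<nu> q k R) S = 0" unfolding z by simp
    then have "AE x in lebesgue. x \<in> S \<longrightarrow> ((\<lambda>r. measure (\<nu> q k R) (cball x r) / r ^ DIM('a)) \<longlongrightarrow> 0) (at_right 0)"
      using SN(4) by (intro measure_cball_density_zero) (auto simp: \<nu>_def em\<nu>'[unfolded \<nu>_def] intro!: finite_measureI)
    moreover have "AE x in lebesgue. x \<notin> N'"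
      using SN(3) by (intro AE_not_in) (auto simp: null_sets_completion_iff[symmetric] null_sets_completionI)
    ultimately show ?thesis by eventually_elim (use SN in auto)
  qed
  have "AE x in lebesgue. \<forall>q\<in>Q. \<forall>k R. x \<in> A q k \<longrightarrow> ((\<lambda>r. measure (\<nu> q k R) (cball x r) / r ^ DIM('a)) \<longlongrightarrow> 0) (at_right 0)"
  proof (rule AE_ball_countable'[OF _ Q(1)])
    fix q
    show "AE x in lebesgue. \<forall>k R. x \<in> A q k \<longrightarrow> ((\<lambda>r. measure (\<nu> q k R) (cball x r) / r ^ DIM('a)) \<longlongrightarrow> 0) (at_right 0)"
      unfolding AE_all_countable using D by blast
  qed
  then show ?thesis
  proof eventually_elim
    case (elim x)
    show ?case
    proof (rule tendstoI)
      fix e :: real assume e: "e > 0"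
      obtain k where k: "1 / real (Suc k) < e / (3 * V)"
        using reals_Archimedean[of "e / (3 * V)"] e Vpos by (auto simp: inverse_eq_divide)
      define \<eta> where "\<eta> = 1 / real (Suc k)"
      have \<eta>: "\<eta> > 0" and A\<eta>: "A q k = {x. norm (f x - q) < \<eta>}" for q
        by (simp_all add: A_def \<eta>_def)
      note k = k[folded \<eta>_def]
      obtain q where q: "q \<in> Q" "norm (f x - q) < \<eta>"
        using Q(2)[of "ball (f x) \<eta>"] \<eta> by (auto simp: dist_norm)
      obtain R :: nat where R: "norm x + 1 < real R" using reals_Archimedean2 by blast
      have "((\<lambda>r. measure (\<nu> q k R) (cball x r) / r ^ DIM('a)) \<longlongrightarrow> 0) (at_right 0)"
        using elim q by (auto simp: A\<eta>)
      then have ev: "\<forall>\<^sub>F r in at_right 0. measure (\<nu> q k R) (cball x r) / r ^ DIM('a) < e / 3"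
        using e by (intro order_tendstoD(2)[where y=0]) auto
      have ev1: "\<forall>\<^sub>F r::real in at_right 0. 0 < r \<and> r < 1" by (auto simp: eventually_at_right_field intro!: exI[of _ 1])
      show "\<forall>\<^sub>F r in at_right 0. dist ((LINT y:ball x r|lebesgue. norm (f y - f x)) / r ^ DIM('a)) 0 < e"
        using ev ev1
      proof eventually_elim
        case (elim r)
        then have r: "0 < r" "r < 1" by auto
        have bl: "emeasure lebesgue (ball x r) < \<infinity>" using r by (simp add: emeasure_ball)
        have int1: "set_integrable lebesgue (ball x r) (\<lambda>y. norm (f y - f x))"
          unfolding set_integrable_def
        proof (rule Bochner_Integration.integrable_bound[where f="\<lambda>y. indicator (ball x r) y *\<^sub>R f y - indicator (ball x r) y *\<^sub>R f x"])
          show "integrable lebesgue (\<lambda>y. indicator (ball x r) y *\<^sub>R f y - indicator (ball x r) y *\<^sub>R f x)"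
            using bl by (intro Bochner_Integration.integrable_diff integrable_mult_indicator[OF _ f] integrable_scaleR_left integrable_real_indicator) auto
          show "(\<lambda>y. indicator (ball x r) y *\<^sub>R norm (f y - f x)) \<in> borel_measurable lebesgue"
            by (intro borel_measurable_scaleR borel_measurable_indicator borel_measurable_norm borel_measurable_diff fm borel_measurable_const) auto
        qed (auto simp: indicator_def)
        have sub: "ball x r \<subseteq> ball 0 (real R)"
        proof
          fix y assume "y \<in> ball x r"
          then have "norm y \<le> norm x + r" using norm_triangle_ineq[of x "y - x"] by (simp add: dist_norm norm_minus_commute)
          then show "y \<in> ball 0 (real R)" using R r by simp
        qed
        have "(LINT y:ball x r|lebesgue. norm (f y - f x)) \<le> (LINT y:cball x r|lebesgue. g q k R y) + (LINT y:ball x r|lebesgue. 2 * \<eta>)"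
        proof -
          have i2: "integrable lebesgue (\<lambda>y. indicator (cball x r) y *\<^sub>R g q k R y)"
            by (rule integrable_mult_indicator[OF _ gint]) auto
          have i3: "integrable lebesgue (\<lambda>y. indicator (ball x r) y *\<^sub>R (2 * \<eta>))"
            using bl by (intro integrable_scaleR_left integrable_real_indicator) auto
          show ?thesis
            unfolding set_lebesgue_integral_def Bochner_Integration.integral_add[OF i2 i3, symmetric]
          proof (rule integral_mono[OF int1[unfolded set_integrable_def] Bochner_Integration.integrable_add[OF i2 i3]])
            fix y
            show "indicator (ball x r) y *\<^sub>R norm (f y - f x) \<le> indicator (cball x r) y *\<^sub>R g q k R y + indicator (ball x r) y *\<^sub>R (2 * \<eta>)"
            proof (cases "y \<in> ball x r")
              case True
              have "norm (f y - f x) \<le> norm (f y - q) + norm (f x - q)"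
                by (metis norm_triangle_ineq4 diff_diff_eq2 diff_add_cancel add_diff_cancel_right' norm_minus_commute dist_norm dist_triangle3 dist_commute dist_triangle2)
              then show ?thesis using True sub q(2) \<eta> by (auto simp: g_def A\<eta> indicator_def)
            qed (use g0 in \<open>auto simp: indicator_def\<close>)
          qed
        qed
        also have "(LINT y:cball x r|lebesgue. g q k R y) = measure (\<nu> q k R) (cball x r)"
          using g0 em\<nu>'[of "cball x r" q k R] by (simp add: measure_def set_lebesgue_integral_def)
        also have "(LINT y:ball x r|lebesgue. 2 * \<eta>) = 2 * \<eta> * (V * r ^ DIM('a))"
          using r bl by (subst set_integral_const) (auto simp: content_ball V_def)
        finally have "(LINT y:ball x r|lebesgue. norm (f y - f x)) / r ^ DIM('a) \<le> measure (\<nu> q k R) (cball x r) / r ^ DIM('a) + 2 * \<eta> * V"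
          using r by (simp add: field_simps)
        also have "\<dots> < e / 3 + 2 * (e / 3)"
          using elim(1) k Vpos by (intro add_less_le_mono) (auto simp: field_simps)
        finally have "(LINT y:ball x r|lebesgue. norm (f y - f x)) / r ^ DIM('a) < e" by simp
        moreover have "0 \<le> (LINT y:ball x r|lebesgue. norm (f y - f x)) / r ^ DIM('a)"
          using r unfolding set_lebesgue_integral_def by (intro divide_nonneg_nonneg integral_nonneg_AE) auto
        ultimately show ?case by simp
      qed
    qed
  qed
qed

lemma emeasure_ball_finite:
  "emeasure lebesgue (ball (c :: 'a::euclidean_space) r) < \<infinity>"
  using emeasure_lborel_ball_finite[of c r] by simp

section \<open>Translation invariance of Lebesgue measure\<close>

lemma lebesgue_translate: "distr lebesgue lebesgue (\<lambda>x. a + x) = (lebesgue :: 'a::euclidean_space measure)"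
proof -
  have "a + (\<Sum>j\<in>Basis. (1 * (x \<bullet> j)) *\<^sub>R j) = a + x" for x :: 'a
    by (simp add: euclidean_representation)
  then show ?thesis
    using lebesgue_affine_euclidean[of "\<lambda>_. 1" a] by (simp add: density_1)
qed

lemma measurable_lebesgue_translate [measurable]:
  "(\<lambda>x. a + x) \<in> (lebesgue :: 'a::euclidean_space measure) \<rightarrow>\<^sub>M lebesgue"
proof -
  have "a + (\<Sum>j\<in>Basis. (1 * (x \<bullet> j)) *\<^sub>R j) = a + x" for x :: 'a
    by (simp add: euclidean_representation)
  then show ?thesis
    using lebesgue_affine_measurable[of "\<lambda>_. 1" a] by simp
qed

lemma
  fixes f :: "'a::euclidean_space \<Rightarrow> 'b::{banach, second_countable_topology}"
  assumes f: "f \<in> borel_measurable lebesgue"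
  shows integral_lebesgue_translate: "(LINT x|lebesgue. f (a + x)) = (LINT x|lebesgue. f x)"
    and integrable_lebesgue_translate: "integrable lebesgue (\<lambda>x. f (a + x)) \<longleftrightarrow> integrable lebesgue f"
  using integral_distr[OF measurable_lebesgue_translate f] integrable_distr_eq[OF measurable_lebesgue_translate f]
  by (simp_all add: lebesgue_translate)

lemma AE_LIMSEQ_measurable_lebesgue:
  fixes f :: "'a::euclidean_space \<Rightarrow> real"
  assumes "\<And>k. F k \<in> borel_measurable lebesgue" "AE x in lebesgue. (\<lambda>k. F k x) \<longlonglongrightarrow> f x"
  shows "f \<in> borel_measurable lebesgue"
proof (rule borel_measurable_AE)
  show "(\<lambda>x. lim (\<lambda>k. F k x)) \<in> borel_measurable lebesgue"
    by (rule borel_measurable_lim_metric) (rule assms)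
  show "AE x in lebesgue. lim (\<lambda>k. F k x) = f x"
    using assms(2) by eventually_elim (rule limI)
qed

text \<open>Integration by parts without Fubini: difference quotients have integral zero by
  translation invariance, and the Lipschitz bound on an enlarged ball dominates them. Only almost
  everywhere convergence of the quotients enters, so kinks are allowed; this is what the Lipschitz
  extension of the candidate requires.\<close>

lemma integral_directional_derivative_zero:
  fixes w :: "'a::euclidean_space \<Rightarrow> real"
  assumes lip: "\<And>x y. \<bar>w x - w y\<bar> \<le> L * dist x y" and supp: "\<And>x. x \<notin> ball 0 R \<Longrightarrow> w x = 0"
    and lim: "AE x in lebesgue. (\<lambda>k. (w (x + (1 / real (Suc k)) *\<^sub>R e) - w x) * real (Suc k)) \<longlonglongrightarrow> D x"
  shows "integrable lebesgue D" "(LINT x|lebesgue. D x) = 0"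
proof -
  have L: "0 \<le> L * norm e"
    using lip[of e 0] by (metis abs_ge_zero order_trans dist_0_norm dist_commute)
  have "continuous_on UNIV w"
  proof (intro continuous_at_imp_continuous_on ballI)
    fix x
    have "((\<lambda>y. w y - w x) \<longlongrightarrow> 0) (at x)"
    proof (rule Lim_null_comparison)
      show "\<forall>\<^sub>F y in at x. norm (w y - w x) \<le> L * dist y x" using lip by simp
      show "((\<lambda>y. L * dist y x) \<longlongrightarrow> 0) (at x)"
        by (rule tendsto_eq_rhs, (rule tendsto_intros)+) simp
    qed
    then show "isCont w x" by (simp add: isCont_def LIM_zero_iff)
  qed
  then have wm: "w \<in> borel_measurable lebesgue"
    by (intro measurable_completion) (auto intro: borel_measurable_continuous_onI)
  have intw: "integrable lebesgue w"
  proof (rule Bochner_Integration.integrable_bound)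
    show "integrable lebesgue (\<lambda>y. indicator (ball 0 R) y * (\<bar>w 0\<bar> + \<bar>L\<bar> * R) :: real)"
      by (intro integrable_mult_left integrable_real_indicator emeasure_ball_finite) auto
    have "\<bar>w x\<bar> \<le> \<bar>w 0\<bar> + \<bar>L\<bar> * R" if "x \<in> ball 0 R" for x
    proof -
      have "\<bar>w x\<bar> \<le> \<bar>w 0\<bar> + \<bar>w x - w 0\<bar>" by simp
      also have "\<bar>w x - w 0\<bar> \<le> L * dist x 0" by (rule lip)
      also have "\<dots> \<le> \<bar>L\<bar> * R" using that by (intro mult_mono) auto
      finally show ?thesis by simp
    qed
    then show "AE x in lebesgue. norm (w x) \<le> norm (indicator (ball 0 R) x * (\<bar>w 0\<bar> + \<bar>L\<bar> * R))"
      using supp by (intro AE_I2) (force simp: indicator_def)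
  qed (rule wm)
  define F where "F k x = (w ((1 / real (Suc k)) *\<^sub>R e + x) - w x) * real (Suc k)" for k x
  have wt: "(\<lambda>x. w (a + x)) \<in> borel_measurable lebesgue" for a
    using measurable_compose[OF measurable_lebesgue_translate wm] .
  have Fint: "integrable lebesgue (F k)" for k
    unfolding F_def
    by (intro integrable_mult_left Bochner_Integration.integrable_diff intw) (simp add: integrable_lebesgue_translate[OF wm] intw)
  have F0: "(LINT x|lebesgue. F k x) = 0" for k
    unfolding F_def using intw
    by (simp add: integrable_lebesgue_translate[OF wm] integral_lebesgue_translate[OF wm])
  have lim': "AE x in lebesgue. (\<lambda>k. F k x) \<longlonglongrightarrow> D x"
    using lim by (simp add: F_def add.commute)
  have Dm: "D \<in> borel_measurable lebesgue"
    by (rule AE_LIMSEQ_measurable_lebesgue[OF _ lim']) (use Fint in auto)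
  have dom: "AE x in lebesgue. norm (F k x) \<le> indicator (ball 0 (R + norm e)) x * (L * norm e)" for k
  proof (intro AE_I2)
    fix x
    show "norm (F k x) \<le> indicator (ball 0 (R + norm e)) x * (L * norm e)"
    proof (cases "x \<in> ball 0 (R + norm e)")
      case True
      have "\<bar>w ((1 / real (Suc k)) *\<^sub>R e + x) - w x\<bar> \<le> L * dist ((1 / real (Suc k)) *\<^sub>R e + x) x"
        by (rule lip)
      also have "\<dots> = (L * norm e) / real (Suc k)" by (simp add: dist_norm)
      finally have "\<bar>w ((1 / real (Suc k)) *\<^sub>R e + x) - w x\<bar> * real (Suc k) \<le> L * norm e"
        by (simp add: field_simps)
      then show ?thesis using True by (simp add: F_def abs_mult)
    next
      case False
      have "norm x \<le> norm ((1 / real (Suc k)) *\<^sub>R e + x) + norm ((1 / real (Suc k)) *\<^sub>R e)"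
        using norm_triangle_ineq4[of "(1 / real (Suc k)) *\<^sub>R e + x" "(1 / real (Suc k)) *\<^sub>R e"] by simp
      also have "norm ((1 / real (Suc k)) *\<^sub>R e) \<le> norm e"
        using mult_right_mono[of "1 / real (Suc k)" 1 "norm e"] by simp
      finally have n: "norm x \<le> norm ((1 / real (Suc k)) *\<^sub>R e + x) + norm e" by simp
      have f: "R + norm e \<le> norm x" using False by simp
      have "R \<le> norm ((1 / real (Suc k)) *\<^sub>R e + x)" "R \<le> norm x"
        using n f norm_ge_zero[of e] by linarith+
      then show ?thesis using False by (simp add: F_def supp)
    qed
  qed
  have dint: "integrable lebesgue (\<lambda>x. indicator (ball 0 (R + norm e)) x * (L * norm e) :: real)"
    by (intro integrable_mult_left integrable_real_indicator emeasure_ball_finite) auto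
  show "integrable lebesgue D"
    by (rule integrable_dominated_convergence[OF Dm _ dint lim' dom]) (use Fint in auto)
  have "(\<lambda>k. LINT x|lebesgue. F k x) \<longlonglongrightarrow> (LINT x|lebesgue. D x)"
    by (rule integral_dominated_convergence[OF Dm _ dint lim' dom]) (use Fint in auto)
  then show "(LINT x|lebesgue. D x) = 0" unfolding F0 by (simp add: LIMSEQ_const_iff)
qed

section \<open>Test functions and cut-offs\<close>

text \<open>The part of \<open>test_function\<close> that makes sense without compact support, so
  that cut-offs equal to 1 far away and affine factors can be multiplied onto test
  functions.\<close>

definition C1_fun :: "(real^'n \<Rightarrow> real) \<Rightarrow> (real^'n \<Rightarrow> real^'n) \<Rightarrow> bool" where
  "C1_fun \<phi> g \<longleftrightarrow> (\<forall>x. GDERIV \<phi> x :> g x) \<and> continuous_on UNIV g"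

lemma C1_fun_continuous: "C1_fun \<phi> g \<Longrightarrow> continuous_on UNIV \<phi>"
  unfolding C1_fun_def gderiv_def
  by (auto intro!: continuous_at_imp_continuous_on has_derivative_continuous)

lemma C1_fun_const: "C1_fun (\<lambda>x. c) (\<lambda>x. 0)"
  by (simp add: C1_fun_def GDERIV_const)

lemma C1_fun_add: "C1_fun \<phi> g \<Longrightarrow> C1_fun \<psi> h \<Longrightarrow> C1_fun (\<lambda>x. \<phi> x + \<psi> x) (\<lambda>x. g x + h x)"
  by (auto simp: C1_fun_def intro!: GDERIV_add continuous_intros)

lemma C1_fun_diff: "C1_fun \<phi> g \<Longrightarrow> C1_fun \<psi> h \<Longrightarrow> C1_fun (\<lambda>x. \<phi> x - \<psi> x) (\<lambda>x. g x - h x)"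
  by (auto simp: C1_fun_def intro!: GDERIV_diff continuous_intros)

lemma C1_fun_mult:
  assumes "C1_fun \<phi> g" "C1_fun \<psi> h"
  shows "C1_fun (\<lambda>x. \<phi> x * \<psi> x) (\<lambda>x. \<phi> x *\<^sub>R h x + \<psi> x *\<^sub>R g x)"
  using assms C1_fun_continuous[OF assms(1)] C1_fun_continuous[OF assms(2)]
  by (auto simp: C1_fun_def intro!: GDERIV_mult continuous_intros)

lemma C1_fun_compose:
  assumes f: "\<And>s. (f has_real_derivative f' s) (at s)" "continuous_on UNIV f'" and \<phi>: "C1_fun \<phi> g"
  shows "C1_fun (\<lambda>x. f (\<phi> x)) (\<lambda>x. f' (\<phi> x) *\<^sub>R g x)"
  unfolding C1_fun_def
proof (intro conjI allI)
  show "GDERIV (\<lambda>x. f (\<phi> x)) x :> f' (\<phi> x) *\<^sub>R g x" for x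
    using \<phi> f by (intro GDERIV_DERIV_compose) (auto simp: C1_fun_def)
  show "continuous_on UNIV (\<lambda>x. f' (\<phi> x) *\<^sub>R g x)"
    using \<phi> C1_fun_continuous[OF \<phi>] f(2)
    by (intro continuous_intros continuous_on_compose2[OF f(2)]) (auto simp: C1_fun_def)
qed

lemma C1_fun_inner: "C1_fun (\<lambda>x. x \<bullet> b) (\<lambda>x. b)"
  unfolding C1_fun_def gderiv_def by (auto intro!: derivative_eq_intros)

lemma C1_fun_nth: "C1_fun (\<lambda>x. x $ i) (\<lambda>x. axis i 1)"
  using C1_fun_inner[of "axis i 1"] by (simp add: inner_axis)

lemma C1_fun_dist_sq: "C1_fun (\<lambda>x. (norm (x - c))\<^sup>2) (\<lambda>x. 2 *\<^sub>R (x - c))"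
  unfolding C1_fun_def gderiv_def power2_norm_eq_inner
  by (auto intro!: derivative_eq_intros continuous_intros simp: inner_commute algebra_simps)

lemma test_function_iff:
  "test_function U \<phi> g \<longleftrightarrow>
     C1_fun \<phi> g \<and> compact (closure {x. \<phi> x \<noteq> 0}) \<and> closure {x. \<phi> x \<noteq> 0} \<subseteq> U"
  by (auto simp: test_function_def C1_fun_def)

lemma test_function_mult:
  assumes "test_function U \<phi> g" "C1_fun \<psi> h"
  shows "test_function U (\<lambda>x. \<phi> x * \<psi> x) (\<lambda>x. \<phi> x *\<^sub>R h x + \<psi> x *\<^sub>R g x)"
proof -
  have "closure {x. \<phi> x * \<psi> x \<noteq> 0} \<subseteq> closure {x. \<phi> x \<noteq> 0}" by (intro closure_mono) auto
  then show ?thesis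
    using assms unfolding test_function_iff
    by (auto intro: C1_fun_mult simp: compact_eq_bounded_closed intro: bounded_subset)
qed

lemma test_functionI:
  assumes "C1_fun \<phi> g" "compact K" "K \<subseteq> U" "\<And>x. x \<notin> K \<Longrightarrow> \<phi> x = 0"
  shows "test_function U \<phi> g"
proof -
  have "closure {x. \<phi> x \<noteq> 0} \<subseteq> K"
    using assms by (intro closure_minimal) (auto intro: compact_imp_closed)
  then show ?thesis using assms unfolding test_function_iff
    by (auto simp: compact_eq_bounded_closed intro: bounded_subset)
qed

lemma test_function_grad_zero:
  assumes "test_function U \<phi> g" "x \<notin> closure {x. \<phi> x \<noteq> 0}"
  shows "g x = 0"
proof -
  have "(\<phi> has_derivative (\<lambda>h. h \<bullet> g x)) (at x)"
    using assms by (auto simp: test_function_def gderiv_def)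
  moreover have "(\<phi> has_derivative (\<lambda>h. 0)) (at x)"
  proof (rule has_derivative_transform_within_open[of "\<lambda>_. 0" _ _ _ "- closure {x. \<phi> x \<noteq> 0}"])
    show "0 = \<phi> y" if "y \<in> - closure {x. \<phi> x \<noteq> 0}" for y
      using that closure_subset[of "{x. \<phi> x \<noteq> 0}"] by auto
  qed (use assms in auto)
  ultimately have "(\<lambda>h. h \<bullet> g x) = (\<lambda>h. 0)" by (rule has_derivative_unique)
  then have "g x \<bullet> g x = 0" by metis
  then show ?thesis by simp
qed

lemma test_function_bounded:
  assumes "test_function U \<phi> g"
  obtains B where "B \<ge> 0" "\<And>x. \<bar>\<phi> x\<bar> \<le> B" "\<And>x. norm (g x) \<le> B"
proof -
  let ?K = "closure {x. \<phi> x \<noteq> 0}"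
  have K: "compact ?K" and c: "continuous_on ?K \<phi>" "continuous_on ?K g"
    using assms C1_fun_continuous[of \<phi> g] by (auto simp: test_function_iff C1_fun_def intro: continuous_on_subset)
  have "bounded (\<phi> ` ?K)" "bounded (g ` ?K)"
    using K c by (auto intro!: compact_imp_bounded compact_continuous_image)
  then obtain B1 B2 where B: "\<And>x. x \<in> ?K \<Longrightarrow> \<bar>\<phi> x\<bar> \<le> B1" "\<And>x. x \<in> ?K \<Longrightarrow> norm (g x) \<le> B2"
    unfolding bounded_iff by auto
  show ?thesis
  proof
    show "0 \<le> max 0 (max B1 B2)" by simp
    show "\<bar>\<phi> x\<bar> \<le> max 0 (max B1 B2)" for x
      using B(1)[of x] closure_subset[of "{x. \<phi> x \<noteq> 0}"] by (cases "\<phi> x = 0") auto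
    show "norm (g x) \<le> max 0 (max B1 B2)" for x
      using B(2)[of x] test_function_grad_zero[OF assms, of x] by (cases "x \<in> ?K") auto
  qed
qed

lemma test_function_lipschitz:
  assumes "test_function U \<phi> g" "\<And>x. norm (g x) \<le> B"
  shows "\<bar>\<phi> x - \<phi> y\<bar> \<le> B * dist x y"
proof -
  have "norm (\<phi> x - \<phi> y) \<le> B * norm (x - y)"
  proof (rule differentiable_bound[where S=UNIV and f'="\<lambda>x h. h \<bullet> g x"])
    show "(\<phi> has_derivative (\<lambda>h. h \<bullet> g z)) (at z within UNIV)" for z
      using assms(1) by (auto simp: test_function_def gderiv_def)
    show "onorm (\<lambda>h. h \<bullet> g z) \<le> B" for z
    proof (rule onorm_bound)
      show "0 \<le> B" using assms(2)[of z] norm_ge_zero order_trans by blast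
      show "norm (h \<bullet> g z) \<le> B * norm h" for h
        using Cauchy_Schwarz_ineq2[of h "g z"] mult_left_mono[OF assms(2)[of z], of "norm h"] by (simp add: mult.commute)
    qed
  qed auto
  then show ?thesis by (simp add: dist_norm)
qed

section \<open>A C^1 step function and cut-offs at balls\<close>

lemma DERIV_max_zero_square: "((\<lambda>s. (max 0 s)\<^sup>2) has_real_derivative 2 * max 0 s) (at s)"
proof -
  consider "s > 0" | "s < 0" | "s = 0" by linarith
  then show ?thesis
  proof cases
    case 1
    have "((\<lambda>s. s\<^sup>2) has_real_derivative 2 * max 0 s) (at s)"
      using 1 by (auto intro!: derivative_eq_intros)
    then show ?thesis by (rule has_field_derivative_transform_within_open[of _ _ _ "{0<..}"]) (use 1 in auto)
  next
    case 2
    have "((\<lambda>s. 0) has_real_derivative 2 * max 0 s) (at s)"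
      using 2 by (auto intro!: derivative_eq_intros)
    then show ?thesis by (rule has_field_derivative_transform_within_open[of _ _ _ "{..<0}"]) (use 2 in auto)
  next
    case 3
    have "((\<lambda>h. (max 0 h)\<^sup>2 / h) \<longlongrightarrow> 0) (at (0::real))"
    proof (rule Lim_null_comparison)
      show "\<forall>\<^sub>F h in at (0::real). norm ((max 0 h)\<^sup>2 / h) \<le> \<bar>h\<bar>"
        by (intro always_eventually allI) (auto simp: max_def power2_eq_square)
      show "((\<lambda>h. \<bar>h\<bar>) \<longlongrightarrow> 0) (at (0::real))"
        by (rule tendsto_rabs_zero) (rule tendsto_ident_at)
    qed
    then show ?thesis using 3 by (simp add: DERIV_def)
  qed
qed

text \<open>The C^1 quadratic spline rising from 0 to 1 on [0, 1], written with truncated powers;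
  its derivative is the tent of height 2 with peak at 1/2. One continuous derivative is all that
  \<open>test_function\<close> asks for.\<close>

definition smoothstep :: "real \<Rightarrow> real" where
  "smoothstep s = 2 * (max 0 s)\<^sup>2 - 4 * (max 0 (s - 1/2))\<^sup>2 + 2 * (max 0 (s - 1))\<^sup>2"

definition smoothstep' :: "real \<Rightarrow> real" where
  "smoothstep' s = 4 * max 0 s - 8 * max 0 (s - 1/2) + 4 * max 0 (s - 1)"

lemma DERIV_smoothstep: "(smoothstep has_real_derivative smoothstep' s) (at s)"
  unfolding smoothstep_def smoothstep'_def
  by (rule derivative_eq_intros DERIV_chain2[OF DERIV_max_zero_square] refl | simp)+

lemma continuous_smoothstep': "continuous_on A smoothstep'"
  unfolding smoothstep'_def by (intro continuous_intros)

lemma smoothstep_eq_0: "s \<le> 0 \<Longrightarrow> smoothstep s = 0"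
  by (simp add: smoothstep_def)

lemma smoothstep_eq_1: "1 \<le> s \<Longrightarrow> smoothstep s = 1"
  by (simp add: smoothstep_def max_def power2_eq_square algebra_simps)

lemma smoothstep'_eq_0: "s \<le> 0 \<or> 1 \<le> s \<Longrightarrow> smoothstep' s = 0"
  by (auto simp: smoothstep'_def max_def)

lemma smoothstep'_bounds: "0 \<le> smoothstep' s" "smoothstep' s \<le> 2"
  by (auto simp: smoothstep'_def max_def)

lemma smoothstep_mono: "s \<le> t \<Longrightarrow> smoothstep s \<le> smoothstep t"
  by (rule DERIV_nonneg_imp_nondecreasing) (use DERIV_smoothstep smoothstep'_bounds in blast)+

lemma smoothstep_bounds: "0 \<le> smoothstep s" "smoothstep s \<le> 1"
  using smoothstep_mono[of "min s 0" s] smoothstep_mono[of s "max s 1"]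
  by (auto simp: smoothstep_eq_0 smoothstep_eq_1)

lemma C1_fun_smoothstep:
  "C1_fun \<phi> g \<Longrightarrow> C1_fun (\<lambda>x. smoothstep (\<phi> x)) (\<lambda>x. smoothstep' (\<phi> x) *\<^sub>R g x)"
  by (rule C1_fun_compose[OF DERIV_smoothstep continuous_smoothstep'])

text \<open>The step is applied to |x - c|^2 / r^2 - 1, which is smooth at the centre, unlike the
  distance. On the doubled ball the gradient is at most 2 * (2 * |x - c| / r^2) \<le> 8 / r, the
  leading 2 being the maximal slope of \<open>smoothstep\<close>.\<close>

lemma ball_cutoff:
  fixes c :: "real^'n"
  assumes r: "r > 0"
  obtains \<zeta> g where "C1_fun \<zeta> g" "\<And>x. 0 \<le> \<zeta> x" "\<And>x. \<zeta> x \<le> 1"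
    "\<And>x. x \<in> ball c r \<Longrightarrow> \<zeta> x = 0" "\<And>x. x \<notin> ball c (2 * r) \<Longrightarrow> \<zeta> x = 1"
    "\<And>x. norm (g x) \<le> 8 / r * indicator (ball c (2 * r)) x"
proof
  let ?q = "\<lambda>x. (norm (x - c))\<^sup>2 * (1 / r\<^sup>2) - 1"
  let ?g = "\<lambda>x. smoothstep' (?q x) *\<^sub>R (((norm (x - c))\<^sup>2 *\<^sub>R 0 + (1 / r\<^sup>2) *\<^sub>R (2 *\<^sub>R (x - c))) - 0)"
  show "C1_fun (\<lambda>x. smoothstep (?q x)) ?g"
    by (intro C1_fun_smoothstep C1_fun_diff C1_fun_mult C1_fun_dist_sq C1_fun_const)
  show "0 \<le> smoothstep (?q x)" "smoothstep (?q x) \<le> 1" for x by (rule smoothstep_bounds)+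
  show "smoothstep (?q x) = 0" if "x \<in> ball c r" for x
  proof -
    have "(norm (x - c))\<^sup>2 \<le> r\<^sup>2" using that r by (intro power_mono) (auto simp: dist_norm norm_minus_commute)
    then show ?thesis using r by (intro smoothstep_eq_0) (simp add: field_simps)
  qed
  have far: "1 \<le> ?q x" if "x \<notin> ball c (2 * r)" for x
  proof -
    have "(2 * r)\<^sup>2 \<le> (norm (x - c))\<^sup>2" using that r by (intro power_mono) (auto simp: dist_norm norm_minus_commute)
    moreover have "0 < r\<^sup>2" using r by simp
    moreover have "(2 * r)\<^sup>2 = 4 * r\<^sup>2" by (simp add: power_mult_distrib)
    ultimately have "2 * r\<^sup>2 \<le> (norm (x - c))\<^sup>2" by linarith
    then show ?thesis using r by (simp add: le_divide_eq)
  qed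
  then show "smoothstep (?q x) = 1" if "x \<notin> ball c (2 * r)" for x
    using that by (intro smoothstep_eq_1)
  show "norm (?g x) \<le> 8 / r * indicator (ball c (2 * r)) x" for x
  proof (cases "x \<in> ball c (2 * r)")
    case True
    then have "norm (x - c) \<le> 2 * r" by (simp add: dist_norm norm_minus_commute)
    then have "2 * norm (x - c) / r\<^sup>2 \<le> 4 / r" using r by (simp add: field_simps power2_eq_square)
    then have "smoothstep' (?q x) * (2 * norm (x - c) / r\<^sup>2) \<le> 2 * (4 / r)"
      using smoothstep'_bounds by (intro mult_mono) auto
    then show ?thesis using True r smoothstep'_bounds(1)[of "?q x"] by (simp add: mult.assoc)
  next
    case False
    then show ?thesis using far[OF False] by (simp add: smoothstep'_eq_0)
  qed
qed

lemma integral_abs_bound_AE: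
  fixes f g :: "'a \<Rightarrow> real"
  assumes "integrable M f" "integrable M g" "AE x in M. \<bar>f x\<bar> \<le> g x"
  shows "\<bar>LINT x|M. f x\<bar> \<le> (LINT x|M. g x)"
proof -
  have "\<bar>LINT x|M. f x\<bar> \<le> (LINT x|M. \<bar>f x\<bar>)" by (rule integral_abs_bound)
  also have "\<dots> \<le> (LINT x|M. g x)" using assms by (intro integral_mono_AE) auto
  finally show ?thesis .
qed

text \<open>Truncation: the part of |f| above a high level \<open>k\<close> has small integral over
  the whole space, and the part below contributes at most \<open>k\<close> times the measure of
  \<open>W\<close>.\<close>

lemma integral_absolutely_continuous:
  fixes f :: "'a \<Rightarrow> real"
  assumes f: "integrable M f" and e: "e > 0"
  obtains d where "d > 0"
    "\<And>W. W \<in> sets M \<Longrightarrow> emeasure M W < ennreal d \<Longrightarrow> (LINT x|M. indicator W x * \<bar>f x\<bar>) < e"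
proof -
  have "(\<lambda>k. LINT x|M. max 0 (\<bar>f x\<bar> - real k)) \<longlonglongrightarrow> (LINT x|M. 0)"
  proof (rule integral_dominated_convergence[where w="\<lambda>x. \<bar>f x\<bar>"])
    have "\<forall>\<^sub>F k in sequentially. max 0 (\<bar>f x\<bar> - real k) = 0" for x
    proof -
      obtain N where "\<bar>f x\<bar> < real N" using reals_Archimedean2 by blast
      then show ?thesis by (intro eventually_sequentiallyI[of N]) (auto simp: max_def)
    qed
    then show "AE x in M. (\<lambda>k. max 0 (\<bar>f x\<bar> - real k)) \<longlonglongrightarrow> 0"
      by (intro AE_I2 tendsto_eventually) auto
  qed (use f in auto)
  then have "\<forall>\<^sub>F k in sequentially. (LINT x|M. max 0 (\<bar>f x\<bar> - real k)) < e / 2"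
    using e by (intro order_tendstoD(2)) auto
  then obtain k where k: "(LINT x|M. max 0 (\<bar>f x\<bar> - real k)) < e / 2"
    by (auto simp: eventually_sequentially)
  have int: "integrable M (\<lambda>x. max 0 (\<bar>f x\<bar> - real k))"
    by (rule Bochner_Integration.integrable_bound[OF integrable_abs[OF f]]) (use f in auto)
  show ?thesis
  proof
    show "e / (2 * (real k + 1)) > 0" using e by simp
    fix W assume W: "W \<in> sets M" "emeasure M W < ennreal (e / (2 * (real k + 1)))"
    have Wf: "emeasure M W < \<infinity>" by (rule less_trans[OF W(2)]) simp
    have mW: "measure M W \<le> e / (2 * (real k + 1))"
      using W(2) e by (simp add: measure_def enn2real_leI less_imp_le)
    have i1: "integrable M (\<lambda>x. indicator W x * real k)"
      using W Wf by (intro integrable_mult_left integrable_real_indicator)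
    have "(LINT x|M. indicator W x * \<bar>f x\<bar>) \<le> (LINT x|M. max 0 (\<bar>f x\<bar> - real k) + indicator W x * real k)"
    proof (rule integral_mono[OF _ Bochner_Integration.integrable_add[OF int i1]])
      show "integrable M (\<lambda>x. indicator W x * \<bar>f x\<bar>)"
        using integrable_mult_indicator[OF W(1) integrable_abs[OF f]] by simp
    qed (auto simp: indicator_def)
    also have "\<dots> = (LINT x|M. max 0 (\<bar>f x\<bar> - real k)) + measure M W * real k"
      using W Wf by (subst Bochner_Integration.integral_add[OF int i1]) auto
    also have "\<dots> < e / 2 + e / 2"
    proof (rule add_less_le_mono[OF k])
      have "measure M W * real k \<le> e / (2 * (real k + 1)) * (real k + 1)"
        using mW e by (intro mult_mono) auto
      also have "\<dots> = e / 2" by (simp add: nonzero_divide_eq_eq nonzero_eq_divide_eq)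
      finally show "measure M W * real k \<le> e / 2" .
    qed
    finally show "(LINT x|M. indicator W x * \<bar>f x\<bar>) < e" by simp
  qed
qed

text \<open>Product of the single cut-offs. All factors lie in [0, 1], so the product rule bounds
  the gradient by the plain sum of the individual bounds, however much the balls overlap.\<close>

lemma countable_balls_cutoff:
  fixes c :: "nat \<Rightarrow> real^'n"
  assumes r: "\<And>k. 0 < r k"
  obtains \<psi> g where "C1_fun \<psi> g" "\<And>x. 0 \<le> \<psi> x" "\<And>x. \<psi> x \<le> 1"
    "\<And>x k. k < N \<Longrightarrow> x \<in> ball (c k) (r k) \<Longrightarrow> \<psi> x = 0"
    "\<And>x. \<forall>k<N. x \<notin> ball (c k) (2 * r k) \<Longrightarrow> \<psi> x = 1"
    "\<And>x. norm (g x) \<le> (\<Sum>k<N. 8 / r k * indicator (ball (c k) (2 * r k)) x)"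
proof -
  define P where "P N \<psi> g \<longleftrightarrow> C1_fun \<psi> g \<and> (\<forall>x. 0 \<le> \<psi> x \<and> \<psi> x \<le> 1)
    \<and> (\<forall>x. \<forall>k<N. x \<in> ball (c k) (r k) \<longrightarrow> \<psi> x = 0)
    \<and> (\<forall>x. (\<forall>k<N. x \<notin> ball (c k) (2 * r k)) \<longrightarrow> \<psi> x = 1)
    \<and> (\<forall>x. norm (g x) \<le> (\<Sum>k<N. 8 / r k * indicator (ball (c k) (2 * r k)) x))" for N \<psi> g
  have D: "C1_fun \<psi> g" "0 \<le> \<psi> x" "\<psi> x \<le> 1"
    "\<And>k. k < N \<Longrightarrow> x \<in> ball (c k) (r k) \<Longrightarrow> \<psi> x = 0"
    "\<forall>k<N. x \<notin> ball (c k) (2 * r k) \<Longrightarrow> \<psi> x = 1"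
    "norm (g x) \<le> (\<Sum>k<N. 8 / r k * indicator (ball (c k) (2 * r k)) x)" if "P N \<psi> g" for N \<psi> g x
    using that unfolding P_def by (simp_all del: mem_ball)
  have "\<exists>\<psi> g. P N \<psi> g"
  proof (induction N)
    case 0
    show ?case unfolding P_def by (intro exI[of _ "\<lambda>x. 1"] exI[of _ "\<lambda>x. 0"]) (auto intro: C1_fun_const)
  next
    case (Suc N)
    then obtain \<psi> g where I: "P N \<psi> g" by (elim exE)
    obtain \<zeta> h where Z: "C1_fun \<zeta> h" "\<And>x. 0 \<le> \<zeta> x" "\<And>x. \<zeta> x \<le> 1"
      "\<And>x. x \<in> ball (c N) (r N) \<Longrightarrow> \<zeta> x = 0" "\<And>x. x \<notin> ball (c N) (2 * r N) \<Longrightarrow> \<zeta> x = 1"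
      "\<And>x. norm (h x) \<le> 8 / r N * indicator (ball (c N) (2 * r N)) x"
      by (rule ball_cutoff[OF r[of N], of "c N"]) (rule that)
    have "P (Suc N) (\<lambda>x. \<psi> x * \<zeta> x) (\<lambda>x. \<psi> x *\<^sub>R h x + \<zeta> x *\<^sub>R g x)"
      unfolding P_def
    proof (intro conjI allI impI)
      show "C1_fun (\<lambda>x. \<psi> x * \<zeta> x) (\<lambda>x. \<psi> x *\<^sub>R h x + \<zeta> x *\<^sub>R g x)" by (rule C1_fun_mult[OF D(1)[OF I] Z(1)])
      fix x
      show "0 \<le> \<psi> x * \<zeta> x" using D(2)[OF I] Z(2) by (intro mult_nonneg_nonneg)
      show "\<psi> x * \<zeta> x \<le> 1" using D(2,3)[OF I] Z(2,3) by (intro mult_le_one)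
      show "\<psi> x * \<zeta> x = 0" if "k < Suc N" "x \<in> ball (c k) (r k)" for k
      proof (cases "k = N")
        case True
        then show ?thesis using Z(4)[of x] that by simp
      next
        case False
        then show ?thesis using D(4)[OF I, of k x] that by simp
      qed
      show "\<psi> x * \<zeta> x = 1" if "\<forall>k<Suc N. x \<notin> ball (c k) (2 * r k)"
        using D(5)[OF I, of x] Z(5)[of x] that by (simp del: mem_ball)
      have "norm (\<psi> x *\<^sub>R h x + \<zeta> x *\<^sub>R g x) \<le> \<psi> x * norm (h x) + \<zeta> x * norm (g x)"
        using norm_triangle_ineq[of "\<psi> x *\<^sub>R h x" "\<zeta> x *\<^sub>R g x"] D(2)[OF I, of x] Z(2)[of x] by simp
      also have "\<dots> \<le> norm (h x) + norm (g x)"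
        using D(2,3)[OF I, of x] Z(2,3)[of x] by (intro add_mono mult_left_le_one_le) auto
      also have "\<dots> \<le> (\<Sum>k<Suc N. 8 / r k * indicator (ball (c k) (2 * r k)) x)"
        using add_mono[OF Z(6)[of x] D(6)[OF I, of x]] by (simp add: add.commute)
      finally show "norm (\<psi> x *\<^sub>R h x + \<zeta> x *\<^sub>R g x) \<le> (\<Sum>k<Suc N. 8 / r k * indicator (ball (c k) (2 * r k)) x)" .
    qed
    then show ?case by blast
  qed
  then obtain \<psi> g where I: "P N \<psi> g" by blast
  show thesis by (rule that[OF D(1)[OF I] D(2)[OF I] D(3)[OF I] D(4)[OF I] D(5)[OF I] D(6)[OF I]])
qed

lemma test_function_measurable:
  assumes "test_function U \<phi> g"
  shows "\<phi> \<in> borel_measurable borel" "(\<lambda>x. g x $ j) \<in> borel_measurable borel"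
    "\<phi> \<in> borel_measurable lebesgue" "(\<lambda>x. g x $ j) \<in> borel_measurable lebesgue"
proof -
  have c: "continuous_on UNIV \<phi>" "continuous_on UNIV (\<lambda>x. g x $ j)"
    using assms C1_fun_continuous[of \<phi> g] by (auto simp: test_function_iff C1_fun_def intro!: continuous_intros)
  show "\<phi> \<in> borel_measurable borel" "(\<lambda>x. g x $ j) \<in> borel_measurable borel"
    using c by (auto intro: borel_measurable_continuous_onI)
  then show "\<phi> \<in> borel_measurable lebesgue" "(\<lambda>x. g x $ j) \<in> borel_measurable lebesgue"
    by (auto intro!: measurable_completion)
qed

lemma set_integrable_nth:
  fixes f :: "'a \<Rightarrow> 'b::euclidean_space^'n"
  shows "set_integrable M A f \<Longrightarrow> set_integrable M A (\<lambda>x. f x $ i)"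
  unfolding set_integrable_def
  by (drule integrable_bounded_linear[OF bounded_linear_vec_nth[of i]]) simp

lemma set_integrable_bounded_mult:
  fixes f h :: "'a \<Rightarrow> real"
  assumes "set_integrable M A f" "h \<in> borel_measurable M" "\<And>x. \<bar>h x\<bar> \<le> B"
  shows "set_integrable M A (\<lambda>x. h x * f x)" "set_integrable M A (\<lambda>x. f x * h x)"
proof -
  have "integrable M (\<lambda>x. h x * (indicator A x *\<^sub>R f x))"
  proof (rule Bochner_Integration.integrable_bound[where f="\<lambda>x. B * (indicator A x *\<^sub>R f x)"])
    show "AE x in M. norm (h x * (indicator A x *\<^sub>R f x)) \<le> norm (B * (indicator A x *\<^sub>R f x))"
      using assms(3) by (intro AE_I2) (auto simp: abs_mult intro!: mult_right_mono order_trans[OF assms(3) abs_ge_self])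
  qed (use assms in \<open>auto simp: set_integrable_def intro!: integrable_mult_right\<close>)
  then show "set_integrable M A (\<lambda>x. h x * f x)" "set_integrable M A (\<lambda>x. f x * h x)"
    by (simp_all add: set_integrable_def mult_ac)
qed

lemma matrix_component_le_norm: "\<bar>A $ i $ j\<bar> \<le> norm (A :: real^'n^'m)"
  by (rule order_trans[OF component_le_norm_cart Finite_Cartesian_Product.norm_nth_le])

lemma BV_singular_integrable:
  assumes BV: "has_BV_derivative V u G \<mu> \<sigma>"
    and \<phi>: "\<phi> \<in> borel_measurable borel" "\<And>x. \<bar>\<phi> x\<bar> \<le> B"
  shows "integrable \<mu> (\<lambda>x. \<phi> x * \<sigma> x $ i $ j)" "AE x in \<mu>. \<bar>\<phi> x * \<sigma> x $ i $ j\<bar> \<le> \<bar>\<phi> x\<bar>"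
proof -
  interpret finite_measure \<mu> using BV by (simp add: has_BV_derivative_def)
  have s: "sets \<mu> = sets borel" "\<sigma> \<in> borel_measurable borel" "AE x in \<mu>. norm (\<sigma> x) = 1"
    using BV by (auto simp: has_BV_derivative_def)
  have \<sigma>m: "(\<lambda>x. \<sigma> x $ i $ j) \<in> borel_measurable borel"
  proof -
    have "(\<lambda>x. ((\<sigma> x) \<bullet> axis i (axis j 1))) \<in> borel_measurable borel"
      using s(2) by (intro borel_measurable_inner) auto
    then show ?thesis by (simp add: inner_axis)
  qed
  show ae: "AE x in \<mu>. \<bar>\<phi> x * \<sigma> x $ i $ j\<bar> \<le> \<bar>\<phi> x\<bar>"
    using s(3)
  proof eventually_elim
    case (elim x)
    then have "\<bar>\<sigma> x $ i $ j\<bar> \<le> 1" using matrix_component_le_norm[of "\<sigma> x" i j] by simp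
    then show ?case by (simp add: abs_mult mult_left_le)
  qed
  show "integrable \<mu> (\<lambda>x. \<phi> x * \<sigma> x $ i $ j)"
  proof (rule integrable_const_bound[of _ B])
    show "AE x in \<mu>. norm (\<phi> x * \<sigma> x $ i $ j) \<le> B"
      using ae by eventually_elim (use \<phi>(2) order_trans in \<open>auto simp del: abs_mult\<close>)
    show "(\<lambda>x. \<phi> x * \<sigma> x $ i $ j) \<in> borel_measurable \<mu>"
      using \<sigma>m \<phi>(1) by (simp add: measurable_cong_sets[OF s(1) refl])
  qed
qed

section \<open>The singular part and the jump set\<close>

text \<open>The size condition is on squared radii, matching surfaces in space, and is stated for
  partial sums so that no summability has to be carried along. A small \<open>\<delta>\<close> makes
  the volume of the cover, which is of order \<delta> h, small while \<open>h\<close> stays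
  fixed.\<close>

definition small_ball_cover ::
  "'a::metric_space set \<Rightarrow> real \<Rightarrow> real \<Rightarrow> (nat \<Rightarrow> 'a) \<Rightarrow> (nat \<Rightarrow> real) \<Rightarrow> bool" where
  "small_ball_cover S h \<delta> c r \<longleftrightarrow> (\<forall>k. 0 < r k \<and> r k < \<delta>) \<and> S \<subseteq> (\<Union>k. ball (c k) (r k)) \<and>
     (\<forall>N. (\<Sum>k<N. (r k)\<^sup>2) \<le> h)"

text \<open>With \<open>\<zeta>\<close> a product of cut-offs vanishing near the covering balls, \<open>\<zeta> \<phi>\<close> does not see the singular
  part, and the gradient of \<open>\<zeta>\<close> has \<open>L\<^sup>1\<close> norm at most a multiple of \<open>\<Sum> r\<^sub>k\<^sup>2\<close>.\<close>

lemma singular_part_bound_aux: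
  fixes u :: "real^3 \<Rightarrow> real^3"
  assumes BV: "has_BV_derivative V u G \<mu> \<sigma>" and V: "open V" and ui: "set_integrable lebesgue V u"
    and bd: "AE x in lebesgue. x \<in> V \<longrightarrow> \<bar>u x $ i\<bar> \<le> 1"
    and conc: "AE x in \<mu>. x \<in> S"
    and test: "test_function V \<phi> g" and B: "\<And>x. \<bar>\<phi> x\<bar> \<le> B"
    and cov: "\<And>\<delta>. \<delta> > 0 \<Longrightarrow> \<exists>c r. small_ball_cover S h \<delta> c r"
    and h0: "0 \<le> h" and e: "e > 0"
  shows "\<bar>LINT x|\<mu>. \<phi> x * \<sigma> x $ i $ j\<bar> \<le> 300 * B * h + e"
proof -
  interpret finite_measure \<mu> using BV by (simp add: has_BV_derivative_def)
  have s: "sets \<mu> = sets borel" using BV by (auto simp: has_BV_derivative_def)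
  have B0: "0 \<le> B" using B[of 0] by linarith
  obtain Bg where Bg: "Bg \<ge> 0" "\<And>x. norm (g x) \<le> Bg"
    by (rule test_function_bounded[OF test]) blast
  have Gi: "set_integrable lebesgue V (\<lambda>x. G x $ i $ j)"
  proof -
    have "set_integrable lebesgue V G" using BV by (simp add: has_BV_derivative_def)
    from set_integrable_nth[OF set_integrable_nth[OF this, of i], of j] show ?thesis .
  qed
  have uii: "set_integrable lebesgue V (\<lambda>x. u x $ i)" by (rule set_integrable_nth[OF ui])
  define fG where "fG x = indicator V x * (B * G x $ i $ j)" for x
  define fu where "fu x = indicator V x * (Bg * u x $ i)" for x
  have "integrable lebesgue (\<lambda>x. B * (indicator V x *\<^sub>R G x $ i $ j))"
    using Gi by (intro integrable_mult_right) (simp add: set_integrable_def)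
  then have fG: "integrable lebesgue fG" by (simp add: fG_def[abs_def] mult_ac)
  have "integrable lebesgue (\<lambda>x. Bg * (indicator V x *\<^sub>R u x $ i))"
    using uii by (intro integrable_mult_right) (simp add: set_integrable_def)
  then have fu: "integrable lebesgue fu" by (simp add: fu_def[abs_def] mult_ac)
  \<comment> \<open>Volumes below which the absolutely continuous part and the term with the
    gradient of the original test function contribute less than e / 4 each.\<close>
  obtain d1 where d1: "d1 > 0" "\<And>W. W \<in> sets lebesgue \<Longrightarrow> emeasure lebesgue W < ennreal d1 \<Longrightarrow> (LINT x|lebesgue. indicator W x * \<bar>fG x\<bar>) < e / 4"
    by (rule integral_absolutely_continuous[OF fG, of "e / 4"]) (use e in auto)
  obtain d2 where d2: "d2 > 0" "\<And>W. W \<in> sets lebesgue \<Longrightarrow> emeasure lebesgue W < ennreal d2 \<Longrightarrow> (LINT x|lebesgue. indicator W x * \<bar>fu x\<bar>) < e / 4"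
    by (rule integral_absolutely_continuous[OF fu, of "e / 4"]) (use e in auto)
  define d where "d = min d1 d2"
  have d: "d > 0" "d \<le> d1" "d \<le> d2" using d1 d2 by (auto simp: d_def)
  \<comment> \<open>A doubled ball has volume 32/3 pi r_k^3 \<le> 35 \<delta> r_k^2, so the total is
    at most 35 \<delta> h < d; adding 1 to \<open>h\<close> covers the case h = 0.\<close>
  define \<delta> where "\<delta> = d / (40 * (h + 1))"
  have \<delta>: "\<delta> > 0" using d h0 by (simp add: \<delta>_def)
  obtain c r where cr: "small_ball_cover S h \<delta> c r" using cov[OF \<delta>] by blast
  have r: "\<And>k. 0 < r k" "\<And>k. r k < \<delta>" and S: "S \<subseteq> (\<Union>k. ball (c k) (r k))"
    and sumr: "\<And>N. (\<Sum>k<N. (r k)\<^sup>2) \<le> h"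
    using cr by (simp_all add: small_ball_cover_def)
  \<comment> \<open>Finitely many balls already carry almost all of \<open>\<mu>\<close>, because
    \<open>\<mu>\<close> is concentrated on the covered set \<open>S\<close>; hence a finite product
    of cut-offs suffices.\<close>
  define U where "U N = (\<Union>k<N. ball (c k) (r k))" for N
  have Um: "U N \<in> sets \<mu>" for N by (auto simp: s U_def)
  have "(\<lambda>N. measure \<mu> (U N)) \<longlonglongrightarrow> measure \<mu> (\<Union>N. U N)"
    by (rule finite_Lim_measure_incseq) (use Um in \<open>auto simp: incseq_def U_def intro: less_le_trans\<close>)
  moreover have "measure \<mu> (\<Union>N. U N) = measure \<mu> (space \<mu>)"
  proof (rule finite_measure_eq_AE)
    show "AE x in \<mu>. (x \<in> (\<Union>N. U N)) = (x \<in> space \<mu>)"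
      using conc AE_space
    proof eventually_elim
      case (elim x)
      then obtain k where "x \<in> ball (c k) (r k)" using S by blast
      then have "x \<in> U (Suc k)" by (auto simp: U_def)
      then show ?case using elim by blast
    qed
  qed (use Um in auto)
  ultimately have "(\<lambda>N. B * (measure \<mu> (space \<mu>) - measure \<mu> (U N))) \<longlonglongrightarrow> B * (measure \<mu> (space \<mu>) - measure \<mu> (space \<mu>))"
    by (intro tendsto_intros) simp
  then have "\<forall>\<^sub>F N in sequentially. B * (measure \<mu> (space \<mu>) - measure \<mu> (U N)) < e / 4"
    using e by (intro order_tendstoD(2)) auto
  then obtain N where N: "B * (measure \<mu> (space \<mu>) - measure \<mu> (U N)) < e / 4"
    by (auto simp: eventually_sequentially)
  obtain \<psi> p where p: "C1_fun \<psi> p" "\<And>x. 0 \<le> \<psi> x" "\<And>x. \<psi> x \<le> 1"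
    "\<And>x k. k < N \<Longrightarrow> x \<in> ball (c k) (r k) \<Longrightarrow> \<psi> x = 0"
    "\<And>x. \<forall>k<N. x \<notin> ball (c k) (2 * r k) \<Longrightarrow> \<psi> x = 1"
    "\<And>x. norm (p x) \<le> (\<Sum>k<N. 8 / r k * indicator (ball (c k) (2 * r k)) x)"
    by (rule countable_balls_cutoff[OF r(1), of N c]) (rule that)
  have t1: "test_function V (\<lambda>x. \<phi> x * \<psi> x) (\<lambda>x. \<phi> x *\<^sub>R p x + \<psi> x *\<^sub>R g x)"
    by (rule test_function_mult[OF test p(1)])
  define \<phi>2 where "\<phi>2 x = \<phi> x * (1 - \<psi> x)" for x
  define g2 where "g2 x = \<phi> x *\<^sub>R (0 - p x) + (1 - \<psi> x) *\<^sub>R g x" for x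
  have t2: "test_function V \<phi>2 g2"
    using test_function_mult[OF test C1_fun_diff[OF C1_fun_const[of 1] p(1)]]
    by (simp add: \<phi>2_def[abs_def] g2_def[abs_def])
  have b1: "\<bar>\<phi> x * \<psi> x\<bar> \<le> B" and b2: "\<bar>\<phi>2 x\<bar> \<le> B" for x
    using mult_mono[OF B[of x], of "\<psi> x" 1] mult_mono[OF B[of x], of "1 - \<psi> x" 1] B0 p(2,3)[of x]
    by (auto simp: abs_mult \<phi>2_def)
  have i1: "integrable \<mu> (\<lambda>x. (\<phi> x * \<psi> x) * \<sigma> x $ i $ j)"
    by (rule BV_singular_integrable(1)[OF BV test_function_measurable(1)[OF t1] b1])
  have i2: "integrable \<mu> (\<lambda>x. \<phi>2 x * \<sigma> x $ i $ j)"
    by (rule BV_singular_integrable(1)[OF BV test_function_measurable(1)[OF t2] b2])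
  \<comment> \<open>\<open>\<phi> * \<psi>\<close> vanishes on \<open>U N\<close> and is controlled
    by the remaining \<open>\<mu>\<close>-mass. For \<open>\<phi> * (1 - \<psi>)\<close> the
    defining identity trades the singular integral for Lebesgue integrals over a set of small
    volume.\<close>
  have split: "(LINT x|\<mu>. \<phi> x * \<sigma> x $ i $ j) = (LINT x|\<mu>. (\<phi> x * \<psi> x) * \<sigma> x $ i $ j) + (LINT x|\<mu>. \<phi>2 x * \<sigma> x $ i $ j)"
    unfolding Bochner_Integration.integral_add[OF i1 i2, symmetric]
    by (intro Bochner_Integration.integral_cong) (simp_all add: \<phi>2_def algebra_simps)
  have A1: "\<bar>LINT x|\<mu>. (\<phi> x * \<psi> x) * \<sigma> x $ i $ j\<bar> \<le> e / 4"
  proof -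
    have "\<bar>LINT x|\<mu>. (\<phi> x * \<psi> x) * \<sigma> x $ i $ j\<bar> \<le> (LINT x|\<mu>. indicator (space \<mu> - U N) x * B)"
    proof (rule integral_abs_bound_AE)
      show "integrable \<mu> (\<lambda>x. (\<phi> x * \<psi> x) * \<sigma> x $ i $ j)" by (rule i1)
      show "integrable \<mu> (\<lambda>x. indicator (space \<mu> - U N) x * B)"
        using Um by (intro integrable_mult_left integrable_real_indicator) (auto simp: less_top[symmetric])
      show "AE x in \<mu>. \<bar>(\<phi> x * \<psi> x) * \<sigma> x $ i $ j\<bar> \<le> indicator (space \<mu> - U N) x * B"
        using BV_singular_integrable(2)[OF BV test_function_measurable(1)[OF t1] b1, of i j] AE_space
      proof eventually_elim
        case (elim x)
        show ?case
        proof (cases "x \<in> U N")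
          case True
          then have "\<psi> x = 0" using p(4) by (auto simp: U_def)
          then show ?thesis using True by simp
        next
          case False
          then show ?thesis using elim b1[of x] by (auto simp: indicator_def)
        qed
      qed
    qed
    also have "\<dots> = B * (measure \<mu> (space \<mu>) - measure \<mu> (U N))"
      using Um[of N] by (simp add: finite_measure_compl)
    finally show ?thesis using N by simp
  qed
  define W where "W = (\<Union>k<N. ball (c k) (2 * r k))"
  have Wm: "W \<in> sets lebesgue" by (auto simp: W_def)
  have vol: "measure lebesgue (ball (c k) (2 * r k)) = 32 / 3 * pi * (r k)^3" for k
    using r(1)[of k] by (simp add: content_ball unit_ball_vol_3 power_mult_distrib)
  have pi4: "pi \<le> 3.2" using pi_approx by simp
  have Wle: "measure lebesgue W \<le> 35 * \<delta> * h"
  proof -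
    have "measure lebesgue W \<le> (\<Sum>k<N. measure lebesgue (ball (c k) (2 * r k)))"
      unfolding W_def by (rule measure_UNION_le) auto
    also have "\<dots> \<le> (\<Sum>k<N. 35 * \<delta> * (r k)\<^sup>2)"
    proof (rule sum_mono)
      fix k
      have "32 / 3 * pi * (r k)^3 = (32 / 3 * pi) * (r k * (r k)\<^sup>2)" by (simp add: power3_eq_cube power2_eq_square)
      also have "\<dots> \<le> 35 * (\<delta> * (r k)\<^sup>2)"
        using pi4 r[of k] \<delta> less_imp_le[OF r(2)[of k]] by (intro mult_mono mult_right_mono) auto
      finally show "measure lebesgue (ball (c k) (2 * r k)) \<le> 35 * \<delta> * (r k)\<^sup>2" unfolding vol by simp
    qed
    also have "\<dots> = 35 * \<delta> * (\<Sum>k<N. (r k)\<^sup>2)" by (simp add: sum_distrib_left)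
    also have "\<dots> \<le> 35 * \<delta> * h" using \<delta> sumr by (intro mult_left_mono) auto
    finally show ?thesis .
  qed
  have Wfin: "emeasure lebesgue W \<noteq> \<infinity>"
  proof -
    have "bounded W" unfolding W_def by (intro bounded_UN) auto
    then have "W \<in> lmeasurable" using Wm by (intro bounded_set_imp_lmeasurable) auto
    then show ?thesis by (auto simp: fmeasurable_def)
  qed
  have "35 * \<delta> * h < d"
  proof -
    have "40 * h + 40 \<noteq> 0" using h0 by linarith
    then have "40 * (\<delta> * (h + 1)) = d" by (simp add: \<delta>_def nonzero_divide_eq_eq algebra_simps)
    moreover have "0 \<le> \<delta> * h" using \<delta> h0 by simp
    ultimately show ?thesis using \<delta> by (simp add: algebra_simps)
  qed
  then have Wd: "emeasure lebesgue W < ennreal d"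
    using Wle Wfin d by (simp add: emeasure_eq_ennreal_measure ennreal_lessI)
  have IG: "(LINT x|lebesgue. indicator W x * \<bar>fG x\<bar>) < e / 4" and Iu: "(LINT x|lebesgue. indicator W x * \<bar>fu x\<bar>) < e / 4"
    using d1(2)[OF Wm] d2(2)[OF Wm] Wd d by (meson ennreal_leI less_le_trans)+
  define q where "q x = (\<Sum>k<N. 8 / r k * indicator (ball (c k) (2 * r k)) x)" for x :: "real^3"
  have qint: "integrable lebesgue q"
    unfolding q_def
    by (intro Bochner_Integration.integrable_sum integrable_mult_right integrable_real_indicator emeasure_ball_finite) auto
  \<comment> \<open>8 / r_k times the volume of the doubled ball is 256/3 pi r_k^2 \<le> 300 r_k^2.
    The gradient of the cut-off gives the only term that does not become small, and this is the
    origin of the factor 300.\<close>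
  have Iq: "(LINT x|lebesgue. q x) \<le> 300 * h"
  proof -
    have "(LINT x|lebesgue. q x) = (\<Sum>k<N. 8 / r k * measure lebesgue (ball (c k) (2 * r k)))"
      unfolding q_def
      by (subst Bochner_Integration.integral_sum) (auto intro!: integrable_mult_right integrable_real_indicator emeasure_ball_finite simp del: emeasure_completion)
    also have "\<dots> \<le> (\<Sum>k<N. 300 * (r k)\<^sup>2)"
    proof (rule sum_mono)
      fix k
      have "8 / r k * (32 / 3 * pi * (r k)^3) = (256 / 3 * pi) * (r k)\<^sup>2"
        using r(1)[of k] by (simp add: power3_eq_cube power2_eq_square)
      also have "\<dots> \<le> 300 * (r k)\<^sup>2" using pi4 by (intro mult_right_mono) auto
      finally show "8 / r k * measure lebesgue (ball (c k) (2 * r k)) \<le> 300 * (r k)\<^sup>2" unfolding vol .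
    qed
    also have "\<dots> \<le> 300 * h" using sumr by (simp add: sum_distrib_left[symmetric])
    finally show ?thesis .
  qed
  have psi1: "\<psi> x = 1" if "x \<notin> W" for x using that p(5)[of x] by (auto simp: W_def)
  have id2: "(LINT x|\<mu>. \<phi>2 x * \<sigma> x $ i $ j) = - (LINT x:V|lebesgue. \<phi>2 x * G x $ i $ j) - (LINT x:V|lebesgue. u x $ i * g2 x $ j)"
    using BV t2 unfolding has_BV_derivative_def by force
  have A2: "\<bar>LINT x:V|lebesgue. \<phi>2 x * G x $ i $ j\<bar> \<le> e / 4"
  proof -
    have "\<bar>LINT x:V|lebesgue. \<phi>2 x * G x $ i $ j\<bar> \<le> (LINT x|lebesgue. indicator W x * \<bar>fG x\<bar>)"
      unfolding set_lebesgue_integral_def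
    proof (rule integral_abs_bound_AE)
      show "integrable lebesgue (\<lambda>x. indicator V x *\<^sub>R (\<phi>2 x * G x $ i $ j))"
        using set_integrable_bounded_mult(1)[OF Gi test_function_measurable(3)[OF t2] b2] by (simp add: set_integrable_def)
      show "integrable lebesgue (\<lambda>x. indicator W x * \<bar>fG x\<bar>)"
        using integrable_mult_indicator[OF Wm integrable_abs[OF fG]] by simp
      have "\<bar>indicator V x *\<^sub>R (\<phi>2 x * G x $ i $ j)\<bar> \<le> indicator W x * \<bar>fG x\<bar>" for x
      proof (cases "x \<in> W")
        case True
        then show ?thesis using b2[of x] B0 by (auto simp: fG_def abs_mult indicator_def intro!: mult_right_mono)
      next
        case False
        then show ?thesis using psi1[OF False] by (simp add: \<phi>2_def)
      qed
      then show "AE x in lebesgue. \<bar>indicator V x *\<^sub>R (\<phi>2 x * G x $ i $ j)\<bar> \<le> indicator W x * \<bar>fG x\<bar>" by simp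
    qed
    then show ?thesis using IG by linarith
  qed
  have A3: "\<bar>LINT x:V|lebesgue. u x $ i * g2 x $ j\<bar> \<le> e / 4 + B * (300 * h)"
  proof -
    obtain Bg2 where Bg2: "\<And>x. norm (g2 x) \<le> Bg2" by (rule test_function_bounded[OF t2]) blast
    have Bg2j: "\<bar>g2 x $ j\<bar> \<le> Bg2" for x by (rule order_trans[OF component_le_norm_cart Bg2])
    have "\<bar>LINT x:V|lebesgue. u x $ i * g2 x $ j\<bar> \<le> (LINT x|lebesgue. indicator W x * \<bar>fu x\<bar> + B * q x)"
      unfolding set_lebesgue_integral_def
    proof (rule integral_abs_bound_AE)
      show "integrable lebesgue (\<lambda>x. indicator V x *\<^sub>R (u x $ i * g2 x $ j))"
        using set_integrable_bounded_mult(2)[OF uii test_function_measurable(4)[OF t2] Bg2j] by (simp add: set_integrable_def)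
      show "integrable lebesgue (\<lambda>x. indicator W x * \<bar>fu x\<bar> + B * q x)"
        using integrable_mult_indicator[OF Wm integrable_abs[OF fu]] qint by auto
      have q0: "0 \<le> q x" for x using r(1)[THEN less_imp_le] by (auto simp: q_def intro!: sum_nonneg mult_nonneg_nonneg divide_nonneg_nonneg)
      show "AE x in lebesgue. \<bar>indicator V x *\<^sub>R (u x $ i * g2 x $ j)\<bar> \<le> indicator W x * \<bar>fu x\<bar> + B * q x"
        using bd
      proof eventually_elim
        case (elim x)
        show ?case
        proof (cases "x \<in> V")
          case True
          then have u1: "\<bar>u x $ i\<bar> \<le> 1" using elim by simp
          have "\<bar>u x $ i * g2 x $ j\<bar> = \<bar>(1 - \<psi> x) * (u x $ i * g x $ j) - u x $ i * \<phi> x * p x $ j\<bar>"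
            by (simp add: g2_def algebra_simps)
          also have "\<dots> \<le> \<bar>(1 - \<psi> x) * (u x $ i * g x $ j)\<bar> + \<bar>u x $ i * \<phi> x * p x $ j\<bar>"
            by (rule abs_triangle_ineq4)
          also have "\<bar>u x $ i * \<phi> x * p x $ j\<bar> \<le> 1 * B * q x"
            unfolding abs_mult using u1 B[of x] B0 p(6)[of x] component_le_norm_cart[of "p x" j]
            by (intro mult_mono) (auto simp: q_def)
          also have "\<bar>(1 - \<psi> x) * (u x $ i * g x $ j)\<bar> \<le> indicator W x * \<bar>fu x\<bar>"
          proof (cases "x \<in> W")
            case w: True
            have "\<bar>1 - \<psi> x\<bar> * (\<bar>u x $ i\<bar> * \<bar>g x $ j\<bar>) \<le> 1 * (\<bar>u x $ i\<bar> * Bg)"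
              using p(2,3)[of x] Bg(2)[of x] component_le_norm_cart[of "g x" j]
              by (intro mult_mono mult_left_mono) auto
            then show ?thesis using w True Bg(1) by (simp add: fu_def abs_mult mult_ac)
          next
            case False
            then show ?thesis using psi1[OF False] by simp
          qed
          finally show ?thesis using True by simp
        qed (use B0 q0 in \<open>auto simp: fu_def\<close>)
      qed
    qed
    also have "\<dots> = (LINT x|lebesgue. indicator W x * \<bar>fu x\<bar>) + B * (LINT x|lebesgue. q x)"
      using integrable_mult_indicator[OF Wm integrable_abs[OF fu]] qint by (subst Bochner_Integration.integral_add) auto
    also have "\<dots> \<le> e / 4 + B * (300 * h)"
      using Iu Iq B0 by (intro add_mono mult_left_mono) auto
    finally show ?thesis .
  qed
  have "B * (300 * h) = 300 * B * h" by simp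
  then show ?thesis unfolding split id2 using A1 A2 A3 e by linarith
qed

lemma singular_part_bound:
  fixes u :: "real^3 \<Rightarrow> real^3"
  assumes "has_BV_derivative V u G \<mu> \<sigma>" "open V" "set_integrable lebesgue V u"
    and "AE x in lebesgue. x \<in> V \<longrightarrow> \<bar>u x $ i\<bar> \<le> 1"
    and "AE x in \<mu>. x \<in> S"
    and "test_function V \<phi> g" "\<And>x. \<bar>\<phi> x\<bar> \<le> B"
    and "\<And>\<delta>. \<delta> > 0 \<Longrightarrow> \<exists>c r. small_ball_cover S h \<delta> c r" and "0 \<le> h"
  shows "\<bar>LINT x|\<mu>. \<phi> x * \<sigma> x $ i $ j\<bar> \<le> 300 * B * h"
  by (rule field_le_epsilon) (rule singular_part_bound_aux[OF assms])

section \<open>The approximate gradient of a function of bounded variation\<close>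

text \<open>Dominated convergence for the difference quotients, which the mean value theorem bounds
  by \<open>B\<close>. The bounds are local in the parameter because the rescaled kernel to which
  this is applied is singular at scale 0.\<close>

lemma DERIV_integral_parameter:
  fixes f :: "'a \<Rightarrow> real" and k k' :: "real \<Rightarrow> 'a \<Rightarrow> real"
  assumes f: "integrable M f" and \<tau>: "\<tau> \<in> {a<..<b}"
    and d: "\<And>s y. s \<in> {a<..<b} \<Longrightarrow> ((\<lambda>s. k s y) has_real_derivative k' s y) (at s)"
    and B: "\<And>s y. s \<in> {a<..<b} \<Longrightarrow> \<bar>k' s y\<bar> \<le> B"
    and C: "\<And>s y. s \<in> {a<..<b} \<Longrightarrow> \<bar>k s y\<bar> \<le> C"
    and m: "\<And>s. s \<in> {a<..<b} \<Longrightarrow> k s \<in> borel_measurable M" "k' \<tau> \<in> borel_measurable M"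
  shows "((\<lambda>s. LINT y|M. f y * k s y) has_real_derivative (LINT y|M. f y * k' \<tau> y)) (at \<tau>)"
proof -
  let ?I = "{a<..<b}"
  have int: "integrable M (\<lambda>y. f y * k s y)" if "s \<in> ?I" for s
  proof (rule Bochner_Integration.integrable_bound[where f="\<lambda>y. C * f y"])
    show "AE y in M. norm (f y * k s y) \<le> norm (C * f y)"
    proof (intro AE_I2)
      fix y
      have "\<bar>k s y\<bar> \<le> \<bar>C\<bar>" using C[OF that, of y] by linarith
      then have "\<bar>k s y\<bar> * \<bar>f y\<bar> \<le> \<bar>C\<bar> * \<bar>f y\<bar>" by (rule mult_right_mono) simp
      then show "norm (f y * k s y) \<le> norm (C * f y)" by (simp add: abs_mult mult.commute)
    qed
  qed (use f m(1)[OF that] in auto)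
  have "((\<lambda>s. ((LINT y|M. f y * k s y) - (LINT y|M. f y * k \<tau> y)) / (s - \<tau>)) \<longlongrightarrow> (LINT y|M. f y * k' \<tau> y)) (at \<tau> within ?I)"
    unfolding tendsto_at_iff_sequentially o_def
  proof (intro allI impI)
    fix X :: "nat \<Rightarrow> real"
    assume X: "\<forall>i. X i \<in> ?I - {\<tau>}" and XL: "X \<longlonglongrightarrow> \<tau>"
    have "(\<lambda>i. LINT y|M. f y * ((k (X i) y - k \<tau> y) / (X i - \<tau>))) \<longlonglongrightarrow> (LINT y|M. f y * k' \<tau> y)"
    proof (rule integral_dominated_convergence[where w="\<lambda>y. B * \<bar>f y\<bar>"])
      show "(\<lambda>y. f y * k' \<tau> y) \<in> borel_measurable M" using f m(2) by auto
      show "(\<lambda>y. f y * ((k (X i) y - k \<tau> y) / (X i - \<tau>))) \<in> borel_measurable M" for i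
      proof -
        have mm: "f \<in> borel_measurable M" "k (X i) \<in> borel_measurable M" "k \<tau> \<in> borel_measurable M"
          using f X \<tau> m(1) by auto
        show ?thesis
          by (intro borel_measurable_times borel_measurable_divide borel_measurable_diff mm borel_measurable_const)
      qed
      show "integrable M (\<lambda>y. B * \<bar>f y\<bar>)" using f by auto
      show "AE y in M. (\<lambda>i. f y * ((k (X i) y - k \<tau> y) / (X i - \<tau>))) \<longlonglongrightarrow> f y * k' \<tau> y"
      proof (intro AE_I2 tendsto_mult tendsto_const)
        fix y
        have "((\<lambda>s. (k s y - k \<tau> y) / (s - \<tau>)) \<longlongrightarrow> k' \<tau> y) (at \<tau>)"
          using d[OF \<tau>] by (simp add: has_field_derivative_iff)
        then show "(\<lambda>i. (k (X i) y - k \<tau> y) / (X i - \<tau>)) \<longlonglongrightarrow> k' \<tau> y"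
          by (rule filterlim_compose) (use X XL in \<open>auto simp: filterlim_at\<close>)
      qed
      show "AE y in M. norm (f y * ((k (X i) y - k \<tau> y) / (X i - \<tau>))) \<le> B * \<bar>f y\<bar>" for i
      proof (intro AE_I2)
        fix y
        have "norm (k (X i) y - k \<tau> y) \<le> B * norm (X i - \<tau>)"
          by (rule field_differentiable_bound[where S="?I" and f'="\<lambda>s. k' s y"])
             (use d B X \<tau> in \<open>auto intro: has_field_derivative_at_within\<close>)
        moreover have "X i \<noteq> \<tau>" using X by auto
        ultimately have "\<bar>(k (X i) y - k \<tau> y) / (X i - \<tau>)\<bar> \<le> B"
          by (simp add: divide_le_eq)
        then show "norm (f y * ((k (X i) y - k \<tau> y) / (X i - \<tau>))) \<le> B * \<bar>f y\<bar>"
          by (simp only: real_norm_def abs_mult mult.commute[of "\<bar>f y\<bar>"] mult_right_mono abs_ge_zero)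
      qed
    qed
    moreover have "(LINT y|M. f y * ((k (X i) y - k \<tau> y) / (X i - \<tau>))) = ((LINT y|M. f y * k (X i) y) - (LINT y|M. f y * k \<tau> y)) / (X i - \<tau>)" for i
    proof -
      have "(LINT y|M. f y * ((k (X i) y - k \<tau> y) / (X i - \<tau>))) = (LINT y|M. (f y * k (X i) y - f y * k \<tau> y) / (X i - \<tau>))"
        by (simp add: algebra_simps)
      also have "\<dots> = (LINT y|M. (f y * k (X i) y - f y * k \<tau> y)) / (X i - \<tau>)"
        by simp
      also have "(LINT y|M. (f y * k (X i) y - f y * k \<tau> y)) = (LINT y|M. f y * k (X i) y) - (LINT y|M. f y * k \<tau> y)"
        by (rule Bochner_Integration.integral_diff) (use X \<tau> int in auto)
      finally show ?thesis .
    qed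
    ultimately show "(\<lambda>i. ((LINT y|M. f y * k (X i) y) - (LINT y|M. f y * k \<tau> y)) / (X i - \<tau>)) \<longlonglongrightarrow> (LINT y|M. f y * k' \<tau> y)"
      by (simp only:)
  qed
  then have "((\<lambda>s. LINT y|M. f y * k s y) has_real_derivative (LINT y|M. f y * k' \<tau> y)) (at \<tau> within ?I)"
    by (simp add: has_field_derivative_iff)
  moreover have "at \<tau> within ?I = at \<tau>" by (rule at_within_open[OF \<tau>]) simp
  ultimately show ?thesis by simp
qed

lemma GDERIV_LIMSEQ:
  fixes w :: "real^'n \<Rightarrow> real"
  assumes "GDERIV w x :> g"
  shows "(\<lambda>k. (w (x + (1 / real (Suc k)) *\<^sub>R e) - w x) * real (Suc k)) \<longlonglongrightarrow> g \<bullet> e"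
proof -
  have "((\<lambda>t. x + t *\<^sub>R e) has_derivative (\<lambda>t. t *\<^sub>R e)) (at 0)"
    by (auto intro!: derivative_eq_intros)
  from has_derivative_compose[OF this, of w "\<lambda>h. h \<bullet> g"] assms
  have "((\<lambda>t. w (x + t *\<^sub>R e)) has_derivative (\<lambda>t. t * (e \<bullet> g))) (at 0)"
    by (simp add: gderiv_def)
  then have "((\<lambda>t. w (x + t *\<^sub>R e)) has_real_derivative g \<bullet> e) (at 0)"
    by (simp add: has_field_derivative_def inner_commute mult.commute[of _ "g \<bullet> e"] mult_commute_abs)
  then have "((\<lambda>h. (w (x + h *\<^sub>R e) - w x) / h) \<longlongrightarrow> g \<bullet> e) (at 0)"
    by (simp add: DERIV_def)
  moreover have "filterlim (\<lambda>k. 1 / real (Suc k)) (at 0) sequentially"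
    using LIMSEQ_inverse_real_of_nat by (auto simp: filterlim_at inverse_eq_divide)
  ultimately have "(\<lambda>k. (w (x + (1 / real (Suc k)) *\<^sub>R e) - w x) / (1 / real (Suc k))) \<longlonglongrightarrow> g \<bullet> e"
    by (rule filterlim_compose)
  then show ?thesis by simp
qed

section \<open>Test functions and duality with L^1\<close>

lemma test_function_support_ball:
  assumes "test_function U \<phi> g"
  obtains R where "\<And>x. x \<notin> ball 0 R \<Longrightarrow> \<phi> x = 0"
proof -
  have "bounded (closure {x. \<phi> x \<noteq> 0})" using assms by (auto simp: test_function_def intro: compact_imp_bounded)
  then obtain R where "closure {x. \<phi> x \<noteq> 0} \<subseteq> ball 0 R" using bounded_subset_ballD by blast
  then show ?thesis using that[of R] closure_subset[of "{x. \<phi> x \<noteq> 0}"] by blast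
qed

lemma integral_partial_test_function:
  fixes \<phi> :: "real^'n \<Rightarrow> real"
  assumes t: "test_function U \<phi> g"
  shows "integrable lebesgue (\<lambda>x. g x $ j)" "(LINT x|lebesgue. g x $ j) = 0"
proof -
  obtain B where B: "\<And>x. norm (g x) \<le> B" by (rule test_function_bounded[OF t]) blast
  obtain R where R: "\<And>x. x \<notin> ball 0 R \<Longrightarrow> \<phi> x = 0" by (rule test_function_support_ball[OF t]) blast
  have "(\<lambda>k. (\<phi> (x + (1 / real (Suc k)) *\<^sub>R axis j 1) - \<phi> x) * real (Suc k)) \<longlonglongrightarrow> g x $ j" for x
    using GDERIV_LIMSEQ[of \<phi> x "g x" "axis j 1"] t by (simp add: test_function_def inner_axis)
  then have lim: "AE x in lebesgue. (\<lambda>k. (\<phi> (x + (1 / real (Suc k)) *\<^sub>R axis j 1) - \<phi> x) * real (Suc k)) \<longlonglongrightarrow> g x $ j"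
    by simp
  show "integrable lebesgue (\<lambda>x. g x $ j)" "(LINT x|lebesgue. g x $ j) = 0"
    using integral_directional_derivative_zero[OF test_function_lipschitz[OF t B] R lim] by auto
qed

lemma test_function_outside:
  assumes "test_function U \<phi> g" "x \<notin> U"
  shows "\<phi> x = 0" "g x = 0"
  using assms test_function_grad_zero[OF assms(1), of x] closure_subset[of "{x. \<phi> x \<noteq> 0}"]
  by (auto simp: test_function_def)

lemma test_function_integrable:
  fixes \<phi> :: "real^'n \<Rightarrow> real"
  assumes t: "test_function U \<phi> g"
  shows "integrable lebesgue \<phi>"
proof -
  obtain B where B: "\<And>x. \<bar>\<phi> x\<bar> \<le> B" by (rule test_function_bounded[OF t]) blast
  obtain R where R: "\<And>x. x \<notin> ball 0 R \<Longrightarrow> \<phi> x = 0" by (rule test_function_support_ball[OF t]) blast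
  have B0: "0 \<le> B" using B[of 0] by linarith
  show ?thesis
  proof (rule Bochner_Integration.integrable_bound)
    show "integrable lebesgue (\<lambda>y. indicator (ball 0 R) y * B)"
      by (intro integrable_mult_left integrable_real_indicator emeasure_ball_finite) auto
    show "AE x in lebesgue. norm (\<phi> x) \<le> norm (indicator (ball 0 R) x * B)"
      using R B B0 by (intro AE_I2) (auto simp: indicator_def)
  qed (rule test_function_measurable(3)[OF t])
qed

lemma test_function_mono: "test_function U \<phi> g \<Longrightarrow> U \<subseteq> V \<Longrightarrow> test_function V \<phi> g"
  by (auto simp: test_function_def)

text \<open>Prepares Stone-Weierstrass approximation by C^1 functions, which takes the place of
  mollification in the duality argument.\<close>

lemma C1_fun_real_polynomial_function:
  fixes p :: "real^'n \<Rightarrow> real"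
  assumes "real_polynomial_function p"
  shows "\<exists>g. C1_fun p g"
  using assms
proof (induction p rule: real_polynomial_function.induct)
  case (linear f)
  then interpret bounded_linear f .
  define b where "b = (\<Sum>i\<in>Basis. f i *\<^sub>R i)"
  have "f x = x \<bullet> b" for x
  proof -
    have "f x = f (\<Sum>i\<in>Basis. (x \<bullet> i) *\<^sub>R i)" by (simp add: euclidean_representation)
    also have "\<dots> = x \<bullet> b" by (simp add: sum scaleR b_def inner_sum_right mult.commute)
    finally show ?thesis .
  qed
  then have "f = (\<lambda>x. x \<bullet> b)" by auto
  then show ?case using C1_fun_inner[of b] by auto
next
  case (const c)
  then show ?case using C1_fun_const by blast
next
  case (add f g)
  then show ?case using C1_fun_add by blast
next
  case (mult f g)
  then show ?case using C1_fun_mult by blast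
qed

text \<open>The extremal multiplier sgn w is approximated by test functions: almost everywhere by
  continuous functions, which are clamped to [-1, 1], replaced by polynomials on the closed ball and
  cut off near its boundary. Dominated convergence carries the bound \<open>C\<close> to the
  limit.\<close>

lemma integral_abs_le_by_duality:
  fixes w :: "real^'n \<Rightarrow> real"
  assumes w: "set_integrable lebesgue (ball x r) w" and r: "r > 0"
    and dual: "\<And>\<phi> g. test_function (ball x r) \<phi> g \<Longrightarrow> (\<And>y. \<bar>\<phi> y\<bar> \<le> 1) \<Longrightarrow>
                  \<bar>LINT y:ball x r|lebesgue. w y * \<phi> y\<bar> \<le> C"
  shows "(LINT y:ball x r|lebesgue. \<bar>w y\<bar>) \<le> C"
proof -
  define w0 where "w0 y = indicator (ball x r) y *\<^sub>R w y" for y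
  have w0: "integrable lebesgue w0" using w by (simp add: w0_def[abs_def] set_integrable_def)
  have w0m: "w0 \<in> borel_measurable lebesgue" using w0 by auto
  have "(\<lambda>y. sgn (w0 y)) \<in> borel_measurable lebesgue"
    by (rule measurable_compose[OF w0m]) simp
  then have "(\<lambda>y. sgn (w0 y)) measurable_on UNIV"
    by (intro lebesgue_measurable_imp_measurable_on) (auto simp: lebesgue_on_UNIV_eq)
  then obtain N h where N: "negligible N" and hc: "\<And>k. continuous_on UNIV (h k)"
    and hl: "\<And>y. y \<notin> N \<Longrightarrow> (\<lambda>k. h k y) \<longlonglongrightarrow> sgn (w0 y)"
    unfolding measurable_on_def by auto
  define h1 where "h1 k y = max (-1) (min 1 (h k y))" for k y
  have "\<exists>q. real_polynomial_function q \<and> (\<forall>y\<in>cball x r. \<bar>h1 k y - q y\<bar> < 1 / real (Suc k))" for k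
  proof -
    have "continuous_on (cball x r) (h1 k)"
      unfolding h1_def by (intro continuous_intros continuous_on_subset[OF hc]) auto
    then show ?thesis
      by (rule Stone_Weierstrass_real_polynomial_function[OF compact_cball _, of x r "h1 k" "1 / real (Suc k)"]) auto
  qed
  then obtain q where q: "\<And>k. real_polynomial_function (q k)" "\<And>k y. y \<in> cball x r \<Longrightarrow> \<bar>h1 k y - q k y\<bar> < 1 / real (Suc k)"
    by metis
  have "\<exists>gq. \<forall>k. C1_fun (q k) (gq k)"
    using C1_fun_real_polynomial_function[OF q(1)] by (intro choice allI) 
  then obtain gq where gq: "\<And>k. C1_fun (q k) (gq k)" by blast
  \<comment> \<open>\<open>ct k\<close> is 0 where r^2 - |y - x|^2 \<le> 1 / (k + 1) and 1 where
    that difference is at least 2 / (k + 1): compact support for each \<open>k\<close>, exhausting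
    the open ball.\<close>
  define ct where "ct k y = smoothstep (real (Suc k) * (r\<^sup>2 - (norm (y - x))\<^sup>2) - 1)" for k y
  \<comment> \<open>Compensates the overshoot 1 / (k + 1) of the polynomial, so that the bound 1 on
    the test function holds exactly.\<close>
  define c where "c k = 1 / (1 + 1 / real (Suc k))" for k
  have c: "0 < c k" "c k * (1 + 1 / real (Suc k)) = 1" for k
  proof -
    have "0 < 1 + 1 / real (Suc k)" by (intro add_pos_nonneg) auto
    then show "0 < c k" "c k * (1 + 1 / real (Suc k)) = 1" by (simp_all add: c_def)
  qed
  have "\<exists>gct. C1_fun (ct k) gct" for k
    unfolding ct_def[abs_def]
    using C1_fun_smoothstep[OF C1_fun_diff[OF C1_fun_mult[OF C1_fun_const C1_fun_diff[OF C1_fun_const C1_fun_dist_sq]] C1_fun_const]]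
    by blast
  then obtain gct where gct: "\<And>k. C1_fun (ct k) (gct k)" by metis
  define \<phi> where "\<phi> k y = c k * (ct k y * q k y)" for k y
  have "\<exists>g. test_function (ball x r) (\<phi> k) g" for k
  proof -
    let ?K = "{y. 1 \<le> real (Suc k) * (r\<^sup>2 - (norm (y - x))\<^sup>2)}"
    have Kb: "norm (y - x) < r" if "y \<in> ?K" "r > 0" for y
    proof -
      have "0 < real (Suc k) * (r\<^sup>2 - (norm (y - x))\<^sup>2)" using that by auto
      then have "(norm (y - x))\<^sup>2 < r\<^sup>2" by (simp add: zero_less_mult_iff)
      then show ?thesis using that by (metis less_imp_le power2_less_imp_less)
    qed
    have "closed ?K" by (intro closed_Collect_le continuous_intros)
    moreover have sub: "?K \<subseteq> ball x r" using Kb[OF _ r] by (auto simp: dist_norm norm_minus_commute)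
    ultimately have K: "compact ?K" using bounded_subset[OF bounded_ball] by (auto simp: compact_eq_bounded_closed)
    have out: "\<phi> k y = 0" if "y \<notin> ?K" for y
      using that by (auto simp: \<phi>_def ct_def smoothstep_eq_0)
    show ?thesis
      using test_functionI[OF C1_fun_mult[OF C1_fun_const[of "c k"] C1_fun_mult[OF gct[of k] gq[of k]]] K sub]
        out unfolding \<phi>_def[abs_def] by blast
  qed
  then obtain g where t: "\<And>k. test_function (ball x r) (\<phi> k) (g k)" by metis
  have \<phi>1: "\<bar>\<phi> k y\<bar> \<le> 1" for k y
  proof (cases "y \<in> ball x r")
    case True
    have "\<bar>h1 k y\<bar> \<le> 1" by (auto simp: h1_def)
    then have "\<bar>q k y\<bar> \<le> 1 + 1 / real (Suc k)" using q(2)[of y k] True by (auto simp: less_imp_le)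
    moreover have "\<bar>ct k y\<bar> \<le> 1" using smoothstep_bounds by (auto simp: ct_def abs_le_iff intro: order_trans[of _ 0])
    ultimately have "\<bar>ct k y\<bar> * \<bar>q k y\<bar> \<le> 1 * (1 + 1 / real (Suc k))" by (intro mult_mono) auto
    then have "c k * (\<bar>ct k y\<bar> * \<bar>q k y\<bar>) \<le> c k * (1 + 1 / real (Suc k))" using c(1)[of k] by (intro mult_left_mono) auto
    then have "c k * (\<bar>ct k y\<bar> * \<bar>q k y\<bar>) \<le> 1" unfolding c(2) .
    then show ?thesis using c(1)[of k] by (simp add: \<phi>_def abs_mult)
  next
    case False
    then show ?thesis using test_function_outside[OF t] by simp
  qed
  have lim: "(\<lambda>k. LINT y|lebesgue. w0 y * \<phi> k y) \<longlonglongrightarrow> (LINT y|lebesgue. \<bar>w0 y\<bar>)"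
  proof (rule integral_dominated_convergence[where w="\<lambda>y. \<bar>w0 y\<bar>"])
    show "(\<lambda>y. w0 y * \<phi> k y) \<in> borel_measurable lebesgue" for k
      using w0 test_function_measurable(3)[OF t] by auto
    show "AE y in lebesgue. norm (w0 y * \<phi> k y) \<le> \<bar>w0 y\<bar>" for k
      using \<phi>1 by (intro AE_I2) (simp add: abs_mult mult_left_le)
    have "AE y in lebesgue. y \<notin> N" using N by (intro AE_not_in) (simp add: negligible_iff_null_sets)
    then show "AE y in lebesgue. (\<lambda>k. w0 y * \<phi> k y) \<longlonglongrightarrow> \<bar>w0 y\<bar>"
    proof eventually_elim
      case (elim y)
      show ?case
      proof (cases "y \<in> ball x r")
        case True
        then have dy: "norm (y - x) < r" by (simp add: dist_norm norm_minus_commute)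
        then have pos: "r\<^sup>2 - (norm (y - x))\<^sup>2 > 0" by (simp add: power_strict_mono)
        have inv: "(\<lambda>k. 1 / real (Suc k)) \<longlonglongrightarrow> 0" using LIMSEQ_inverse_real_of_nat by (simp add: inverse_eq_divide)
        have "(\<lambda>k. h1 k y) \<longlonglongrightarrow> max (-1) (min 1 (sgn (w0 y)))"
          unfolding h1_def by (intro tendsto_intros hl elim)
        then have L1: "(\<lambda>k. h1 k y) \<longlonglongrightarrow> sgn (w0 y)" by (simp add: sgn_if max_def min_def split: if_splits)
        have "(\<lambda>k. q k y - h1 k y) \<longlonglongrightarrow> 0"
          by (rule Lim_null_comparison[OF _ inv]) (use q(2)[of y] True in \<open>auto intro!: always_eventually simp: abs_minus_commute less_imp_le\<close>)
        from tendsto_add[OF this L1] have L2: "(\<lambda>k. q k y) \<longlonglongrightarrow> sgn (w0 y)" by simp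
        obtain n0 :: nat where n0: "2 / (r\<^sup>2 - (norm (y - x))\<^sup>2) < real n0" using reals_Archimedean2 by blast
        have "\<forall>\<^sub>F k in sequentially. ct k y = 1"
        proof (rule eventually_sequentiallyI[of n0])
          fix k assume "n0 \<le> k"
          then have "2 / (r\<^sup>2 - (norm (y - x))\<^sup>2) \<le> real (Suc k)" using n0 by simp
          then have "2 \<le> real (Suc k) * (r\<^sup>2 - (norm (y - x))\<^sup>2)" using pos by (simp only: divide_le_eq if_True)
          then show "ct k y = 1" unfolding ct_def by (intro smoothstep_eq_1) simp
        qed
        then have L3: "(\<lambda>k. ct k y) \<longlonglongrightarrow> 1" by (rule tendsto_eventually)
        have L4: "c \<longlonglongrightarrow> 1 / (1 + 0)" unfolding c_def[abs_def] by (intro tendsto_intros inv) simp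
        have "(\<lambda>k. w0 y * \<phi> k y) \<longlonglongrightarrow> w0 y * (1 / (1 + 0) * (1 * sgn (w0 y)))"
          unfolding \<phi>_def by (intro tendsto_intros L2 L3 L4)
        then show ?thesis by (simp add: abs_sgn)
      qed (simp add: w0_def)
    qed
  qed (use w0 in auto)
  have "(LINT y|lebesgue. w0 y * \<phi> k y) \<le> C" for k
    using dual[OF t \<phi>1, of k] by (simp add: w0_def set_lebesgue_integral_def abs_le_iff mult.assoc)
  then have "(LINT y|lebesgue. \<bar>w0 y\<bar>) \<le> C" by (intro LIMSEQ_le_const2[OF lim]) auto
  then show ?thesis by (simp add: w0_def set_lebesgue_integral_def abs_mult)
qed

text \<open>Subtracting an affine function of slope \<open>l\<close> subtracts \<open>l\<close> from
  the row of \<open>G\<close> and leaves the singular part alone, because the partial derivative of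
  the compactly supported product of \<open>P\<close> with the affine function integrates to
  zero.\<close>

lemma BV_affine_identity:
  fixes u :: "real^'n \<Rightarrow> real^'m"
  assumes BV: "has_BV_derivative U u G \<mu> \<sigma>" and ui: "set_integrable lebesgue U u"
    and t: "test_function U P h"
  shows "(LINT y:U|lebesgue. (u y $ i - (c + l \<bullet> (y - x))) * h y $ j) =
     - (LINT y:U|lebesgue. P y * (G y $ i $ j - l $ j)) - (LINT y|\<mu>. P y * \<sigma> y $ i $ j)"
proof -
  have Gi: "set_integrable lebesgue U (\<lambda>y. G y $ i $ j)"
  proof -
    have "set_integrable lebesgue U G" using BV by (simp add: has_BV_derivative_def)
    from set_integrable_nth[OF set_integrable_nth[OF this, of i], of j] show ?thesis .
  qed
  obtain B where B: "\<And>y. \<bar>P y\<bar> \<le> B" "\<And>y. norm (h y) \<le> B" by (rule test_function_bounded[OF t]) blast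
  have Bj: "\<bar>h y $ j\<bar> \<le> B" for y by (rule order_trans[OF component_le_norm_cart B(2)])
  have i1: "set_integrable lebesgue U (\<lambda>y. u y $ i * h y $ j)"
    by (rule set_integrable_bounded_mult(2)[OF set_integrable_nth[OF ui] test_function_measurable(4)[OF t] Bj])
  have i2: "set_integrable lebesgue U (\<lambda>y. P y * G y $ i $ j)"
    by (rule set_integrable_bounded_mult(1)[OF Gi test_function_measurable(3)[OF t] B(1)])
  have "C1_fun (\<lambda>y. (y \<bullet> l) + (c - x \<bullet> l)) (\<lambda>y. l + 0)" by (intro C1_fun_add C1_fun_inner C1_fun_const)
  then have aff: "C1_fun (\<lambda>y. c + l \<bullet> (y - x)) (\<lambda>y. l)" by (simp add: inner_diff_right inner_commute algebra_simps)
  have t2: "test_function U (\<lambda>y. P y * (c + l \<bullet> (y - x))) (\<lambda>y. P y *\<^sub>R l + (c + l \<bullet> (y - x)) *\<^sub>R h y)"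
    by (rule test_function_mult[OF t aff])
  have iP: "integrable lebesgue (\<lambda>y. P y * l $ j)" using test_function_integrable[OF t] by auto
  have "integrable lebesgue (\<lambda>y. (P y *\<^sub>R l + (c + l \<bullet> (y - x)) *\<^sub>R h y) $ j - P y * l $ j)"
    by (rule Bochner_Integration.integrable_diff[OF integral_partial_test_function(1)[OF t2] iP])
  then have iA: "integrable lebesgue (\<lambda>y. (c + l \<bullet> (y - x)) * h y $ j)" by simp
  have "0 = (LINT y|lebesgue. P y * l $ j + (c + l \<bullet> (y - x)) * h y $ j)"
    using integral_partial_test_function(2)[OF t2, of j] by simp
  also have "\<dots> = (LINT y|lebesgue. P y * l $ j) + (LINT y|lebesgue. (c + l \<bullet> (y - x)) * h y $ j)"
    by (rule Bochner_Integration.integral_add[OF iP iA])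
  finally have A: "(LINT y|lebesgue. (c + l \<bullet> (y - x)) * h y $ j) = - (LINT y|lebesgue. P y * l $ j)" by linarith
  have inU: "indicator U y *\<^sub>R (P y * z) = P y * z" "indicator U y *\<^sub>R (z * h y $ j) = z * h y $ j" for y z
    using test_function_outside[OF t, of y] by (cases "y \<in> U"; simp)+
  have "(LINT y:U|lebesgue. (u y $ i - (c + l \<bullet> (y - x))) * h y $ j)
      = (LINT y:U|lebesgue. u y $ i * h y $ j) - (LINT y|lebesgue. (c + l \<bullet> (y - x)) * h y $ j)"
    using i1 iA unfolding set_lebesgue_integral_def set_integrable_def inU
    by (subst Bochner_Integration.integral_diff[symmetric]) (auto simp: algebra_simps)
  also have "(LINT y:U|lebesgue. u y $ i * h y $ j) = - (LINT y:U|lebesgue. P y * G y $ i $ j) - (LINT y|\<mu>. P y * \<sigma> y $ i $ j)"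
    using BV t unfolding has_BV_derivative_def by blast
  also have "- (LINT y:U|lebesgue. P y * G y $ i $ j) - (LINT y|\<mu>. P y * \<sigma> y $ i $ j) - (LINT y|lebesgue. (c + l \<bullet> (y - x)) * h y $ j)
     = - ((LINT y:U|lebesgue. P y * G y $ i $ j) - (LINT y|lebesgue. P y * l $ j)) - (LINT y|\<mu>. P y * \<sigma> y $ i $ j)"
    unfolding A by simp
  also have "(LINT y:U|lebesgue. P y * G y $ i $ j) - (LINT y|lebesgue. P y * l $ j) = (LINT y:U|lebesgue. P y * (G y $ i $ j - l $ j))"
    using i2 iP unfolding set_lebesgue_integral_def set_integrable_def inU
    by (subst Bochner_Integration.integral_diff[symmetric]) (auto simp: algebra_simps)
  finally show ?thesis .
qed

lemma C1_fun_scale: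
  assumes "C1_fun \<phi> g"
  shows "C1_fun (\<lambda>y. \<phi> (x + s *\<^sub>R (y - x))) (\<lambda>y. s *\<^sub>R g (x + s *\<^sub>R (y - x)))"
  unfolding C1_fun_def
proof (intro conjI allI)
  fix y
  have "((\<lambda>y. x + s *\<^sub>R (y - x)) has_derivative (\<lambda>h. s *\<^sub>R h)) (at y)" by (auto intro!: derivative_eq_intros)
  from has_derivative_compose[OF this, of \<phi> "\<lambda>h. h \<bullet> g (x + s *\<^sub>R (y - x))"] assms
  show "GDERIV (\<lambda>y. \<phi> (x + s *\<^sub>R (y - x))) y :> s *\<^sub>R g (x + s *\<^sub>R (y - x))"
    by (simp add: C1_fun_def gderiv_def)
  show "continuous_on UNIV (\<lambda>y. s *\<^sub>R g (x + s *\<^sub>R (y - x)))"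
  proof -
    have gc: "continuous_on UNIV g" using assms by (simp add: C1_fun_def)
    have fc: "continuous_on UNIV (\<lambda>y. x + s *\<^sub>R (y - x))" by (intro continuous_intros)
    have "continuous_on UNIV (\<lambda>y. g (x + s *\<^sub>R (y - x)))"
      by (rule continuous_on_compose2[OF gc fc]) simp
    then show ?thesis by (intro continuous_intros)
  qed
qed

lemma test_function_scale:
  assumes t: "test_function (ball x r) \<phi> g" and s: "0 < s"
  shows "test_function (ball x (s * r)) (\<lambda>y. \<phi> (x + (1 / s) *\<^sub>R (y - x))) (\<lambda>y. (1 / s) *\<^sub>R g (x + (1 / s) *\<^sub>R (y - x)))"
proof (rule test_functionI)
  let ?K = "closure {x. \<phi> x \<noteq> 0}"
  let ?f = "\<lambda>z. x + s *\<^sub>R (z - x)"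
  show "C1_fun (\<lambda>y. \<phi> (x + (1 / s) *\<^sub>R (y - x))) (\<lambda>y. (1 / s) *\<^sub>R g (x + (1 / s) *\<^sub>R (y - x)))"
    using t by (intro C1_fun_scale) (simp add: test_function_iff)
  show "compact (?f ` ?K)"
    using t by (intro compact_continuous_image continuous_intros) (auto simp: test_function_def)
  show "?f ` ?K \<subseteq> ball x (s * r)"
    using t s by (auto simp: test_function_def dist_norm norm_minus_commute)
  fix y assume y: "y \<notin> ?f ` ?K"
  have "y = ?f (x + (1 / s) *\<^sub>R (y - x))" using s by simp
  then have "x + (1 / s) *\<^sub>R (y - x) \<notin> ?K" using y by blast
  then show "\<phi> (x + (1 / s) *\<^sub>R (y - x)) = 0" using closure_subset[of "{x. \<phi> x \<noteq> 0}"] by blast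
qed

lemma set_integrable_const_ball:
  fixes x :: "'a::euclidean_space" and c :: "'b::{banach, second_countable_topology}"
  shows "set_integrable lebesgue (ball x r) (\<lambda>_. c)"
  unfolding set_integrable_def
  by (intro integrable_scaleR_left integrable_real_indicator emeasure_ball_finite) auto

text \<open>One \<open>c * C\<close> stems from the absolutely continuous part, whose deviation from
  the constant matrix \<open>A\<close> is what counts, the other from the singular measure.\<close>

lemma BV_affine_test_bound:
  fixes u :: "real^'n \<Rightarrow> real^'m"
  assumes BV: "has_BV_derivative U u G \<mu> \<sigma>" and ui: "set_integrable lebesgue U u"
    and U: "open U" "ball x \<rho> \<subseteq> U"
    and Gb: "(LINT y:ball x \<rho>|lebesgue. norm (G y - A)) \<le> C"
    and \<mu>b: "measure \<mu> (cball x \<rho>) \<le> C"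
    and t: "test_function (ball x \<rho>) P h" and Pb: "\<And>y. \<bar>P y\<bar> \<le> c * indicator (ball x \<rho>) y" and c: "0 \<le> c"
  shows "\<bar>LINT y:U|lebesgue. (u y $ i - (b + A $ i \<bullet> (y - x))) * h y $ j\<bar> \<le> 2 * c * C"
proof -
  interpret \<mu>: finite_measure \<mu> using BV by (simp add: has_BV_derivative_def)
  have s\<mu>: "sets \<mu> = sets borel" using BV by (simp add: has_BV_derivative_def)
  have "set_integrable lebesgue U G" using BV by (simp add: has_BV_derivative_def)
  then have GB: "set_integrable lebesgue (ball x \<rho>) G"
    by (rule set_integrable_subset) (use U in auto)
  have tU: "test_function U P h" by (rule test_function_mono[OF t U(2)])
  have Pc: "\<bar>P y\<bar> \<le> c" for y using Pb[of y] c by (cases "y \<in> ball x \<rho>") (auto simp del: mem_ball)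
  have id: "(LINT y:U|lebesgue. (u y $ i - (b + A $ i \<bullet> (y - x))) * h y $ j) =
     - (LINT y:U|lebesgue. P y * (G y $ i $ j - A $ i $ j)) - (LINT y|\<mu>. P y * \<sigma> y $ i $ j)"
    by (rule BV_affine_identity[OF BV ui tU])
  have A1: "\<bar>LINT y:U|lebesgue. P y * (G y $ i $ j - A $ i $ j)\<bar> \<le> c * C"
  proof -
    have GA: "set_integrable lebesgue (ball x \<rho>) (\<lambda>y. G y - A)"
      by (rule set_integral_diff(1)[OF GB set_integrable_const_ball])
    have iGA: "integrable lebesgue (\<lambda>y. indicator (ball x \<rho>) y *\<^sub>R norm (G y - A))"
      using set_integrable_norm[OF GA] by (simp add: set_integrable_def)
    have GAij: "set_integrable lebesgue (ball x \<rho>) (\<lambda>y. G y $ i $ j - A $ i $ j)"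
      using set_integrable_nth[OF set_integrable_nth[OF GA, of i], of j] by simp
    have gij: "\<bar>G y $ i $ j - A $ i $ j\<bar> \<le> norm (G y - A)" for y
      using matrix_component_le_norm[of "G y - A" i j] by simp
    have eqU: "indicator U y *\<^sub>R (P y * z) = indicator (ball x \<rho>) y *\<^sub>R (P y * z)" for y z
      using test_function_outside[OF t, of y] U(2) by (cases "y \<in> ball x \<rho>") (auto simp: indicator_def)
    have "\<bar>LINT y:U|lebesgue. P y * (G y $ i $ j - A $ i $ j)\<bar> \<le> (LINT y|lebesgue. c * (indicator (ball x \<rho>) y *\<^sub>R norm (G y - A)))"
      unfolding set_lebesgue_integral_def eqU
    proof (rule integral_abs_bound_AE)
      show "integrable lebesgue (\<lambda>y. indicator (ball x \<rho>) y *\<^sub>R (P y * (G y $ i $ j - A $ i $ j)))"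
        using set_integrable_bounded_mult(1)[OF GAij test_function_measurable(3)[OF t] Pc] by (simp only: set_integrable_def)
      show "integrable lebesgue (\<lambda>y. c * (indicator (ball x \<rho>) y *\<^sub>R norm (G y - A)))"
        using iGA by (intro integrable_mult_right)
      have "\<bar>indicator (ball x \<rho>) y *\<^sub>R (P y * (G y $ i $ j - A $ i $ j))\<bar> \<le> c * (indicator (ball x \<rho>) y *\<^sub>R norm (G y - A))" for y
        using mult_mono[OF Pc[of y] gij[of y]] c by (simp add: abs_mult indicator_def)
      then show "AE y in lebesgue. \<bar>indicator (ball x \<rho>) y *\<^sub>R (P y * (G y $ i $ j - A $ i $ j))\<bar> \<le> c * (indicator (ball x \<rho>) y *\<^sub>R norm (G y - A))"
        by simp
    qed
    also have "\<dots> = c * (LINT y:ball x \<rho>|lebesgue. norm (G y - A))"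
      by (simp add: set_lebesgue_integral_def)
    also have "\<dots> \<le> c * C" using c by (intro mult_left_mono Gb)
    finally show ?thesis .
  qed
  have A2: "\<bar>LINT y|\<mu>. P y * \<sigma> y $ i $ j\<bar> \<le> c * C"
  proof -
    note si = BV_singular_integrable[OF BV test_function_measurable(1)[OF t] Pc, of i j]
    have "\<bar>LINT y|\<mu>. P y * \<sigma> y $ i $ j\<bar> \<le> (LINT y|\<mu>. c * indicator (cball x \<rho>) y)"
    proof (rule integral_abs_bound_AE[OF si(1)])
      show "integrable \<mu> (\<lambda>y. c * indicator (cball x \<rho>) y)"
        using s\<mu> by (intro integrable_mult_right integrable_real_indicator) (auto simp: less_top[symmetric])
      show "AE y in \<mu>. \<bar>P y * \<sigma> y $ i $ j\<bar> \<le> c * indicator (cball x \<rho>) y"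
        using si(2)
      proof eventually_elim
        case (elim y)
        have "c * indicator (ball x \<rho>) y \<le> c * (indicator (cball x \<rho>) y :: real)"
          using c by (intro mult_left_mono) (auto simp: indicator_def)
        then show ?case using elim Pb[of y] by linarith
      qed
    qed
    also have "\<dots> = c * measure \<mu> (cball x \<rho>)"
      using s\<mu> sets_eq_imp_space_eq[OF s\<mu>] by simp
    also have "\<dots> \<le> c * C" using c by (intro mult_left_mono \<mu>b)
    finally show ?thesis .
  qed
  show ?thesis unfolding id using A1 A2 by linarith
qed

text \<open>The test integral of \<open>v\<close> against the rescaled functions \<open>\<tau>\<^sup>-\<^sup>n \<phi>(x + (y - x)/\<tau>)\<close> has a derivative in
  \<open>\<tau>\<close> that is controlled by the total variation of \<open>v\<close>, since
  \<open>\<partial>\<^sub>\<tau> (\<tau>\<^sup>-\<^sup>n \<phi>(x + (y - x)/\<tau>)) = - div (\<tau>\<^sup>-\<^sup>n\<^sup>-\<^sup>1 (y - x) \<phi>(x + (y - x)/\<tau>))\<close>;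
  for \<open>\<tau> \<rightarrow> 0\<close> it tends to zero at a Lebesgue point.\<close>

lemma BV_rescaled_test_bound:
  fixes u :: "real^'n \<Rightarrow> real^'m" and r \<delta> :: real
  assumes BV: "has_BV_derivative U u G \<mu> \<sigma>" and ui: "set_integrable lebesgue U u"
    and U: "open U" "ball x r \<subseteq> U" and r: "0 < r"
    and Gb: "\<And>\<rho>. 0 < \<rho> \<Longrightarrow> \<rho> \<le> r \<Longrightarrow> (LINT y:ball x \<rho>|lebesgue. norm (G y - A)) \<le> \<delta> * \<rho> ^ CARD('n)"
    and \<mu>b: "\<And>\<rho>. 0 < \<rho> \<Longrightarrow> \<rho> \<le> r \<Longrightarrow> measure \<mu> (cball x \<rho>) \<le> \<delta> * \<rho> ^ CARD('n)"
    and lim: "((\<lambda>\<rho>. (LINT y:ball x \<rho>|lebesgue. norm (u y - a)) / \<rho> ^ CARD('n)) \<longlongrightarrow> 0) (at_right 0)"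
    and t: "test_function (ball x r) \<phi> g" and \<phi>1: "\<And>y. \<bar>\<phi> y\<bar> \<le> 1"
  shows "\<bar>LINT y:ball x r|lebesgue. (u y - a - A *v (y - x)) $ i * \<phi> y\<bar> \<le> 2 * CARD('n) * \<delta> * r ^ (CARD('n) + 1)"
proof -
  let ?n = "CARD('n)"
  interpret \<mu>: finite_measure \<mu> using BV by (simp add: has_BV_derivative_def)
  have s\<mu>: "sets \<mu> = sets borel" using BV by (simp add: has_BV_derivative_def)
  define v where "v y = u y $ i - (a $ i + A $ i \<bullet> (y - x))" for y
  have v: "(u y - a - A *v (y - x)) $ i = v y" for y
    by (simp add: v_def matrix_vector_mult_def inner_vec_def)
  have Bsets: "ball x \<rho> \<in> sets lebesgue" for \<rho> by auto
  have Bfin: "emeasure lebesgue (ball x \<rho>) < \<infinity>" for \<rho> by (rule emeasure_ball_finite)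
  have uB: "set_integrable lebesgue (ball x r) u"
    by (rule set_integrable_subset[OF ui]) (use U in auto)
  have GB: "set_integrable lebesgue (ball x r) G"
  proof -
    have "set_integrable lebesgue U G" using BV by (simp add: has_BV_derivative_def)
    then show ?thesis by (rule set_integrable_subset) (use U in auto)
  qed
  have affB: "set_integrable lebesgue (ball x r) (\<lambda>y. a $ i + A $ i \<bullet> (y - x))"
    unfolding set_integrable_def
  proof (rule Bochner_Integration.integrable_bound)
    show "integrable lebesgue (\<lambda>y. indicator (ball x r) y * (\<bar>a $ i\<bar> + norm (A $ i) * r))"
      using Bfin by (intro integrable_mult_left integrable_real_indicator) auto
    have "\<bar>a $ i + A $ i \<bullet> (y - x)\<bar> \<le> \<bar>a $ i\<bar> + norm (A $ i) * r" if "y \<in> ball x r" for y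
    proof -
      have "\<bar>A $ i \<bullet> (y - x)\<bar> \<le> norm (A $ i) * norm (y - x)" by (rule Cauchy_Schwarz_ineq2)
      also have "\<dots> \<le> norm (A $ i) * r" using that by (intro mult_left_mono) (auto simp: dist_norm norm_minus_commute)
      finally show ?thesis by linarith
    qed
    then show "AE y in lebesgue. norm (indicator (ball x r) y *\<^sub>R (a $ i + A $ i \<bullet> (y - x)))
        \<le> norm (indicator (ball x r) y * (\<bar>a $ i\<bar> + norm (A $ i) * r))"
      by (intro AE_I2) (auto simp: indicator_def intro: order_trans[OF _ abs_ge_self])
    show "(\<lambda>y. indicator (ball x r) y *\<^sub>R (a $ i + A $ i \<bullet> (y - x))) \<in> borel_measurable lebesgue"
    proof -
      have "(\<lambda>y. a $ i + A $ i \<bullet> (y - x)) \<in> borel_measurable borel"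
        by (intro borel_measurable_continuous_onI continuous_intros)
      then show ?thesis
        by (intro measurable_completion borel_measurable_scaleR borel_measurable_indicator) auto
    qed
  qed
  define f where "f y = indicator (ball x r) y *\<^sub>R v y" for y
  have f: "integrable lebesgue f"
    using set_integral_diff(1)[OF set_integrable_nth[OF uB] affB] by (simp add: f_def[abs_def] v_def set_integrable_def)
  obtain Bg where Bg0: "0 \<le> Bg" and Bg: "\<And>y. norm (g y) \<le> Bg" by (rule test_function_bounded[OF t]) blast
  have g0: "\<bar>(z - x) \<bullet> g z\<bar> \<le> r * Bg" for z
  proof (cases "z \<in> ball x r")
    case True
    have "\<bar>(z - x) \<bullet> g z\<bar> \<le> norm (z - x) * norm (g z)" by (rule Cauchy_Schwarz_ineq2)
    also have "\<dots> \<le> r * Bg" using True Bg[of z] r by (intro mult_mono) (auto simp: dist_norm norm_minus_commute)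
    finally show ?thesis .
  next
    case False
    then show ?thesis using test_function_outside[OF t False] Bg0 r by simp
  qed
  define Z where "Z s y = x + (1 / s) *\<^sub>R (y - x)" for s and y
  define k where "k s y = (1 / s) ^ ?n * \<phi> (Z s y)" for s and y
  define k' where "k' s y = - ((1 / s) ^ (?n + 1) * (real ?n * \<phi> (Z s y) + (Z s y - x) \<bullet> g (Z s y)))" for s and y
  obtain q where q: "?n = Suc q" using gr0_conv_Suc[of ?n] by auto
  have dk: "((\<lambda>s. k s y) has_real_derivative k' s y) (at s)" if s: "s > 0" for s y
  proof -
    have dinv: "((\<lambda>s. 1 / s) has_real_derivative - (1 / s) * (1 / s)) (at s)"
      using s by (auto intro!: derivative_eq_intros simp: power2_eq_square)
    have d1: "((\<lambda>s. (1 / s) ^ ?n) has_real_derivative - (real ?n * (1 / s) ^ (?n + 1))) (at s)"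
      unfolding q by (rule DERIV_cong[OF DERIV_power[OF dinv]]) (simp add: algebra_simps)
    have dZ: "((\<lambda>s. Z s y) has_derivative (\<lambda>h. (h * (- (1 / s) * (1 / s))) *\<^sub>R (y - x))) (at s)"
      unfolding Z_def
      by (rule has_derivative_eq_rhs[OF has_derivative_add[OF has_derivative_const[of x]
             has_derivative_scaleR_left[OF dinv[unfolded has_field_derivative_def], of "y - x"]]]) (simp add: mult.commute)
    have "(\<phi> has_derivative (\<lambda>h. h \<bullet> g (Z s y))) (at (Z s y))"
      using t by (simp add: test_function_def gderiv_def)
    note dd = has_derivative_compose[OF dZ this]
    have d2: "((\<lambda>s. \<phi> (Z s y)) has_real_derivative (- (1 / s) * (1 / s)) * ((y - x) \<bullet> g (Z s y))) (at s)"
      unfolding has_field_derivative_def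
      by (rule has_derivative_eq_rhs[OF dd]) (simp add: fun_eq_iff)
    have Zx: "Z s y - x = (1 / s) *\<^sub>R (y - x)" by (simp add: Z_def)
    show ?thesis
      unfolding k_def[abs_def]
      by (rule DERIV_cong[OF DERIV_mult[OF d1 d2]]) (simp add: k'_def Zx algebra_simps)
  qed
  have \<phi>m: "\<phi> \<in> borel_measurable borel" and gm: "g \<in> borel_measurable borel"
    using t test_function_measurable(1)[OF t] by (auto simp: test_function_def intro: borel_measurable_continuous_onI)
  have km: "k s \<in> borel_measurable lebesgue" "k' s \<in> borel_measurable lebesgue" for s
  proof -
    have Zm: "Z s \<in> borel_measurable borel" unfolding Z_def[abs_def] by (intro borel_measurable_continuous_onI continuous_intros)
    note [measurable] = Zm \<phi>m gm
    have "k s \<in> borel_measurable borel" "k' s \<in> borel_measurable borel" unfolding k_def[abs_def] k'_def[abs_def] by measurable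
    then show "k s \<in> borel_measurable lebesgue" "k' s \<in> borel_measurable lebesgue" by (auto intro: measurable_completion)
  qed
  define m where "m s = (LINT y|lebesgue. f y * k s y)" for s
  have dm: "(m has_real_derivative (LINT y|lebesgue. f y * k' s y)) (at s)" if s: "s > 0" for s
    unfolding m_def[abs_def]
  proof (rule DERIV_integral_parameter[OF f, where a="s / 2" and b="2 * s"
        and B="(2 / s) ^ (?n + 1) * (real ?n + r * Bg)" and C="(2 / s) ^ ?n"])
    show "s \<in> {s / 2<..<2 * s}" using s by auto
    fix q assume q: "q \<in> {s / 2<..<2 * s}"
    have qs: "q > 0" "1 / q \<le> 2 / s" using q s by (auto simp: field_simps)
    show "((\<lambda>s. k s y) has_real_derivative k' q y) (at q)" for y by (rule dk[OF qs(1)])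
    show "\<bar>k q y\<bar> \<le> (2 / s) ^ ?n" for y
    proof -
      have "(1 / q) ^ ?n * \<bar>\<phi> (Z q y)\<bar> \<le> (2 / s) ^ ?n * 1"
        using qs s \<phi>1 by (intro mult_mono power_mono) auto
      then show ?thesis using qs(1) by (simp add: k_def abs_mult)
    qed
    show "\<bar>k' q y\<bar> \<le> (2 / s) ^ (?n + 1) * (real ?n + r * Bg)" for y
    proof -
      have a1: "\<bar>real ?n * \<phi> (Z q y)\<bar> \<le> real ?n" using \<phi>1[of "Z q y"] by (simp add: abs_mult)
      have "\<bar>real ?n * \<phi> (Z q y) + (Z q y - x) \<bullet> g (Z q y)\<bar> \<le> real ?n + r * Bg"
        using abs_triangle_ineq[of "real ?n * \<phi> (Z q y)"] a1 g0[of "Z q y"] by (smt (verit))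
      then have "(1 / q) ^ (?n + 1) * \<bar>real ?n * \<phi> (Z q y) + (Z q y - x) \<bullet> g (Z q y)\<bar> \<le> (2 / s) ^ (?n + 1) * (real ?n + r * Bg)"
        using qs s by (intro mult_mono power_mono) auto
      then show ?thesis using qs(1) by (simp add: k'_def abs_mult)
    qed
    show "k q \<in> borel_measurable lebesgue" by (rule km)
  qed (rule km)
  have bound: "\<bar>LINT y|lebesgue. f y * k' s y\<bar> \<le> 2 * ?n * \<delta> * r ^ (?n + 1)" if s: "0 < s" "s < 1" for s
  proof -
    have sr: "0 < s * r" "s * r \<le> r" using s r by (auto simp: mult_le_cancel_right1)
    have subB: "ball x (s * r) \<subseteq> ball x r" using sr by (intro subset_ball)
    define \<psi> where "\<psi> y = \<phi> (Z s y)" for y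
    define h where "h y = (1 / s) *\<^sub>R g (Z s y)" for y
    have t1: "test_function (ball x (s * r)) \<psi> h"
      using test_function_scale[OF t s(1)] by (simp add: \<psi>_def[abs_def] h_def[abs_def] Z_def)
    \<comment> \<open>The components of the field s^(-n-1) (y - x) \<phi>(x + (y - x) / s).
      \<open>H j\<close> is the gradient of \<open>P j\<close>, so the sum of the
      \<open>H j y $ j\<close> is the divergence, equal to \<open>- k' s y\<close>.\<close>
    define P where "P j y = \<psi> y * ((1 / s) ^ (?n + 1) * (y $ j - x $ j))" for j y
    define H where "H j y = \<psi> y *\<^sub>R ((1 / s) ^ (?n + 1) *\<^sub>R axis j 1) + ((1 / s) ^ (?n + 1) * (y $ j - x $ j)) *\<^sub>R h y" for j and y :: "real^'n"
    have tP: "test_function (ball x (s * r)) (P j) (H j)" for j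
    proof -
      have "C1_fun (\<lambda>y. (1 / s) ^ (?n + 1) * (y $ j - x $ j)) (\<lambda>y. (1 / s) ^ (?n + 1) *\<^sub>R (axis j 1 - 0) + (y $ j - x $ j) *\<^sub>R 0)"
        by (intro C1_fun_mult C1_fun_const C1_fun_diff C1_fun_nth)
      then have "C1_fun (\<lambda>y. (1 / s) ^ (?n + 1) * (y $ j - x $ j)) (\<lambda>y. (1 / s) ^ (?n + 1) *\<^sub>R axis j 1)" by simp
      from test_function_mult[OF t1 this] show ?thesis by (simp add: P_def[abs_def] H_def[abs_def])
    qed
    have divH: "(\<Sum>j\<in>UNIV. H j y $ j) = - k' s y" for y
    proof -
      have "(\<Sum>j\<in>UNIV. H j y $ j) = (\<Sum>j\<in>(UNIV :: 'n set). \<psi> y * (1 / s) ^ (?n + 1)) + (\<Sum>j\<in>UNIV. (1 / s) ^ (?n + 1) * ((y - x) $ j * h y $ j))"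
        by (simp add: H_def sum.distrib mult.assoc)
      also have "(\<Sum>j\<in>UNIV. (1 / s) ^ (?n + 1) * ((y - x) $ j * h y $ j)) = (1 / s) ^ (?n + 1) * ((y - x) \<bullet> h y)"
        by (simp add: inner_vec_def sum_distrib_left)
      also have "(y - x) \<bullet> h y = (Z s y - x) \<bullet> g (Z s y)" by (simp add: h_def Z_def)
      finally show ?thesis by (simp add: k'_def \<psi>_def algebra_simps)
    qed
    have Pb: "\<bar>P j y\<bar> \<le> r * (1 / s) ^ ?n * indicator (ball x (s * r)) y" for j y
    proof (cases "y \<in> ball x (s * r)")
      case True
      have "\<bar>y $ j - x $ j\<bar> \<le> norm (y - x)" using component_le_norm_cart[of "y - x" j] by simp
      also have "\<dots> \<le> s * r" using True by (simp add: dist_norm norm_minus_commute)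
      finally have "\<bar>\<psi> y\<bar> * ((1 / s) ^ (?n + 1) * \<bar>y $ j - x $ j\<bar>) \<le> 1 * ((1 / s) ^ (?n + 1) * (s * r))"
        using s \<phi>1 by (intro mult_mono mult_left_mono) (auto simp: \<psi>_def)
      then show ?thesis using True s by (simp add: P_def abs_mult mult_ac)
    next
      case False
      then show ?thesis using test_function_outside[OF tP] by simp
    qed
    have tPU: "test_function U (P j) (H j)" for j
      by (rule test_function_mono[OF tP]) (use subB U in auto)
    have fH: "f y * H j y $ j = indicator U y *\<^sub>R ((u y $ i - (a $ i + A $ i \<bullet> (y - x))) * H j y $ j)" for j y
      using test_function_outside[OF tP[of j], of y] subB U(2)
      by (cases "y \<in> ball x (s * r)") (auto simp: f_def v_def indicator_def)
    have fHi: "integrable lebesgue (\<lambda>y. f y * H j y $ j)" for j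
    proof -
      obtain B where B: "\<And>y. norm (H j y) \<le> B" by (rule test_function_bounded[OF tP[of j]]) blast
      have Bj: "\<bar>H j y $ j\<bar> \<le> B" for y by (rule order_trans[OF component_le_norm_cart B])
      have "set_integrable lebesgue UNIV f" using f by (simp add: set_integrable_def)
      from set_integrable_bounded_mult(2)[OF this test_function_measurable(4)[OF tP] Bj]
      show ?thesis by (simp add: set_integrable_def)
    qed
    have each: "\<bar>LINT y|lebesgue. f y * H j y $ j\<bar> \<le> 2 * \<delta> * r ^ (?n + 1)" for j
    proof -
      \<comment> \<open>The field is of size r / s^n, and both parts of the derivative of the
        deviation are at most \<delta> (s r)^n on the ball of radius s r. The powers of
        \<open>s\<close> cancel, so the bound is uniform in the scale.\<close>
      have "\<bar>LINT y|lebesgue. f y * H j y $ j\<bar> \<le> 2 * (r * (1 / s) ^ ?n) * (\<delta> * (s * r) ^ ?n)"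
        unfolding fH set_lebesgue_integral_def[symmetric]
        by (rule BV_affine_test_bound[OF BV ui U(1) _ Gb[OF sr] \<mu>b[OF sr] tP Pb]) (use subB U r s in auto)
      also have "\<dots> = 2 * \<delta> * r ^ (?n + 1)" using s by (simp add: power_mult_distrib power_one_over)
      finally show ?thesis .
    qed
    have "(LINT y|lebesgue. f y * k' s y) = - (LINT y|lebesgue. (\<Sum>j\<in>UNIV. f y * H j y $ j))"
      unfolding Bochner_Integration.integral_minus[symmetric] sum_distrib_left[symmetric] divH by simp
    also have "\<dots> = - (\<Sum>j\<in>UNIV. LINT y|lebesgue. f y * H j y $ j)"
      by (subst Bochner_Integration.integral_sum) (use fHi in auto)
    finally have "\<bar>LINT y|lebesgue. f y * k' s y\<bar> \<le> (\<Sum>j\<in>UNIV. \<bar>LINT y|lebesgue. f y * H j y $ j\<bar>)"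
      by simp
    also have "\<dots> \<le> (\<Sum>j\<in>(UNIV :: 'n set). 2 * \<delta> * r ^ (?n + 1))" by (intro sum_mono each)
    finally show ?thesis by simp
  qed
  \<comment> \<open>Mean value theorem on [s, 1] with the uniform bound on the derivative; scale 0,
    where the kernel degenerates, is reached only as a limit.\<close>
  have step: "\<bar>m 1 - m s\<bar> \<le> 2 * ?n * \<delta> * r ^ (?n + 1)" if s: "0 < s" "s < 1" for s
  proof -
    obtain z where z: "s < z" "z < 1" "m 1 - m s = (1 - s) * (LINT y|lebesgue. f y * k' z y)"
      using MVT2[of s 1 m "\<lambda>z. LINT y|lebesgue. f y * k' z y"] dm s by fastforce
    have "\<bar>m 1 - m s\<bar> \<le> 1 * \<bar>LINT y|lebesgue. f y * k' z y\<bar>"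
      unfolding z(3) abs_mult using s by (intro mult_right_mono) auto
    also have "\<dots> \<le> 2 * ?n * \<delta> * r ^ (?n + 1)" using bound[of z] z s by simp
    finally show ?thesis .
  qed
  \<comment> \<open>At scale \<open>s\<close> the test integral is at most r^n times the normalised
    mean oscillation of \<open>u\<close> on the ball of radius s r, which tends to 0 at a Lebesgue
    point, plus a term of order \<open>s\<close> from the linear part.\<close>
  have m0: "(m \<longlongrightarrow> 0) (at_right 0)"
  proof (rule Lim_null_comparison)
    define V where "V = unit_ball_vol (real ?n)"
    have V0: "V \<ge> 0" by (simp add: V_def)
    show "\<forall>\<^sub>F s in at_right 0. norm (m s) \<le> r ^ ?n * ((LINT y:ball x (s * r)|lebesgue. norm (u y - a)) / (s * r) ^ ?n) + V * r ^ ?n * (norm (A $ i) * (s * r))"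
      unfolding eventually_at_right_field
    proof (intro exI[of _ 1] conjI allI impI)
      fix s :: real assume s: "0 < s" "s < 1"
      have sr: "0 < s * r" "s * r \<le> r" using s r by (auto simp: mult_le_cancel_right1)
      have subB: "ball x (s * r) \<subseteq> ball x r" using sr by (intro subset_ball)
      have t1: "test_function (ball x (s * r)) (\<lambda>y. \<phi> (Z s y)) (\<lambda>y. (1 / s) *\<^sub>R g (Z s y))"
        using test_function_scale[OF t s(1)] by (simp add: Z_def)
      have iu: "integrable lebesgue (\<lambda>y. indicator (ball x (s * r)) y *\<^sub>R norm (u y - a))"
      proof -
        have "set_integrable lebesgue (ball x (s * r)) (\<lambda>y. u y - a)"
          by (intro set_integral_diff(1) set_integrable_subset[OF uB] set_integrable_const_ball) (use subB in auto)
        then show ?thesis using integrable_norm by (fastforce simp: set_integrable_def)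
      qed
      have ii: "integrable lebesgue (\<lambda>y. indicator (ball x (s * r)) y * (norm (A $ i) * (s * r)))"
        using Bfin by (intro integrable_mult_left integrable_real_indicator) auto
      have "\<bar>m s\<bar> \<le> (LINT y|lebesgue. (1 / s) ^ ?n * (indicator (ball x (s * r)) y *\<^sub>R norm (u y - a) + indicator (ball x (s * r)) y * (norm (A $ i) * (s * r))))"
        unfolding m_def
      proof (rule integral_abs_bound_AE)
        have "\<bar>k s y\<bar> \<le> (1 / s) ^ ?n" for y
          using \<phi>1[of "Z s y"] s by (simp add: k_def abs_mult mult_left_le)
        moreover have "set_integrable lebesgue UNIV f" using f by (simp add: set_integrable_def)
        ultimately have "set_integrable lebesgue UNIV (\<lambda>y. f y * k s y)"
          by (intro set_integrable_bounded_mult(2)[where B="(1 / s) ^ ?n"] km)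
        then show "integrable lebesgue (\<lambda>y. f y * k s y)" by (simp add: set_integrable_def)
        show "integrable lebesgue (\<lambda>y. (1 / s) ^ ?n * (indicator (ball x (s * r)) y *\<^sub>R norm (u y - a) + indicator (ball x (s * r)) y * (norm (A $ i) * (s * r))))"
          by (intro integrable_mult_right Bochner_Integration.integrable_add iu ii)
        have "\<bar>f y * k s y\<bar> \<le> (1 / s) ^ ?n * (indicator (ball x (s * r)) y *\<^sub>R norm (u y - a) + indicator (ball x (s * r)) y * (norm (A $ i) * (s * r)))" for y
        proof (cases "y \<in> ball x (s * r)")
          case True
          have "\<bar>A $ i \<bullet> (y - x)\<bar> \<le> norm (A $ i) * norm (y - x)" by (rule Cauchy_Schwarz_ineq2)
          also have "\<dots> \<le> norm (A $ i) * (s * r)" using True by (intro mult_left_mono) (auto simp: dist_norm norm_minus_commute)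
          finally have "\<bar>v y\<bar> \<le> norm (u y - a) + norm (A $ i) * (s * r)"
            using component_le_norm_cart[of "u y - a" i] by (simp add: v_def)
          moreover have "\<bar>k s y\<bar> \<le> (1 / s) ^ ?n"
            using \<phi>1[of "Z s y"] s by (simp add: k_def abs_mult mult_left_le)
          ultimately have "\<bar>v y\<bar> * \<bar>k s y\<bar> \<le> (norm (u y - a) + norm (A $ i) * (s * r)) * (1 / s) ^ ?n"
            by (intro mult_mono) auto
          then show ?thesis using True subB by (auto simp: f_def abs_mult indicator_def mult.commute)
        next
          case False
          then show ?thesis using test_function_outside(1)[OF t1 False] by (simp add: k_def)
        qed
        then show "AE y in lebesgue. \<bar>f y * k s y\<bar> \<le> (1 / s) ^ ?n * (indicator (ball x (s * r)) y *\<^sub>R norm (u y - a) + indicator (ball x (s * r)) y * (norm (A $ i) * (s * r)))"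
          by simp
      qed
      also have "\<dots> = (1 / s) ^ ?n * ((LINT y:ball x (s * r)|lebesgue. norm (u y - a)) + measure lebesgue (ball x (s * r)) * (norm (A $ i) * (s * r)))"
        using iu ii by (simp add: set_lebesgue_integral_def)
      also have "\<dots> = r ^ ?n * ((LINT y:ball x (s * r)|lebesgue. norm (u y - a)) / (s * r) ^ ?n) + V * r ^ ?n * (norm (A $ i) * (s * r))"
        using s r by (simp add: content_ball V_def power_mult_distrib field_simps)
      finally show "norm (m s) \<le> r ^ ?n * ((LINT y:ball x (s * r)|lebesgue. norm (u y - a)) / (s * r) ^ ?n) + V * r ^ ?n * (norm (A $ i) * (s * r))"
        by simp
    qed simp
    have fl: "filterlim (\<lambda>s. s * r) (at_right 0) (at_right 0)"
      using r by (auto simp: filterlim_at eventually_at_right_field intro!: tendsto_eq_intros exI[of _ 1])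
    have l1: "((\<lambda>s. (LINT y:ball x (s * r)|lebesgue. norm (u y - a)) / (s * r) ^ ?n) \<longlongrightarrow> 0) (at_right 0)"
      by (rule filterlim_compose[OF lim fl])
    have l2: "((\<lambda>s. s * r) \<longlongrightarrow> 0) (at_right 0)" by (auto intro!: tendsto_eq_intros)
    have "((\<lambda>s. r ^ ?n * ((LINT y:ball x (s * r)|lebesgue. norm (u y - a)) / (s * r) ^ ?n) + V * r ^ ?n * (norm (A $ i) * (s * r))) \<longlongrightarrow> r ^ ?n * 0 + V * r ^ ?n * (norm (A $ i) * 0)) (at_right 0)"
      by (intro tendsto_intros l1 l2)
    then show "((\<lambda>s. r ^ ?n * ((LINT y:ball x (s * r)|lebesgue. norm (u y - a)) / (s * r) ^ ?n) + V * r ^ ?n * (norm (A $ i) * (s * r))) \<longlongrightarrow> 0) (at_right 0)"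
      by simp
  qed
  have "((\<lambda>s. \<bar>m 1 - m s\<bar>) \<longlongrightarrow> \<bar>m 1 - 0\<bar>) (at_right 0)" by (intro tendsto_intros m0)
  then have "\<bar>m 1 - 0\<bar> \<le> 2 * ?n * \<delta> * r ^ (?n + 1)"
    by (rule tendsto_upperbound) (use step in \<open>auto simp: eventually_at_right_field intro!: exI[of _ 1]\<close>)
  moreover have "m 1 = (LINT y:ball x r|lebesgue. v y * \<phi> y)"
    by (simp add: m_def f_def k_def Z_def set_lebesgue_integral_def mult.assoc)
  ultimately show ?thesis unfolding v by simp
qed

section \<open>Uniqueness of approximate limits and gradients\<close>

lemma continuous_set_integrable_ball:
  fixes f :: "'a::euclidean_space \<Rightarrow> 'b::{banach, second_countable_topology}"
  assumes "continuous_on UNIV f"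
  shows "set_integrable lebesgue (ball x r) f"
proof -
  have "integrable lborel (\<lambda>y. indicator (cball x r) y *\<^sub>R f y)"
    by (rule borel_integrable_compact[OF compact_cball continuous_on_subset[OF assms]]) simp
  then have "integrable lebesgue (\<lambda>y. indicator (cball x r) y *\<^sub>R f y)"
    by (subst integrable_completion) auto
  then have "set_integrable lebesgue (cball x r) f" by (simp add: set_integrable_def)
  then show ?thesis by (rule set_integrable_subset) auto
qed

lemma measure_lebesgue_ball_pos: "0 < r \<Longrightarrow> 0 < measure lebesgue (ball (x :: 'a::euclidean_space) r)"
  by simp

text \<open>For an \<open>h\<close> that is not integrable the integral is 0 by convention, and the
  bound is then exactly the assumption that \<open>e\<close> is nonnegative.\<close>

lemma set_integral_ball_upper:
  fixes h :: "'a::euclidean_space \<Rightarrow> real"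
  assumes "\<And>y. y \<in> ball x r \<Longrightarrow> h y \<le> e" "0 \<le> e"
  shows "(LINT y:ball x r|lebesgue. h y) \<le> e * measure lebesgue (ball x r)"
proof (cases "set_integrable lebesgue (ball x r) h")
  case True
  have "(LINT y:ball x r|lebesgue. h y) \<le> (LINT y:ball x r|lebesgue. e)"
    by (rule set_integral_mono[OF True set_integrable_const_ball]) (rule assms(1))
  also have "\<dots> = e * measure lebesgue (ball x r)"
    using emeasure_ball_finite[of x r] by (subst set_integral_const) auto
  finally show ?thesis .
next
  case False
  then show ?thesis using assms(2) by (simp add: set_lebesgue_integral_def set_integrable_def not_integrable_integral_eq)
qed

lemma set_integral_norm_nonneg: "0 \<le> (LINT y:A|M. norm (f y))" "0 \<le> r \<Longrightarrow> 0 \<le> (LINT y:A|M. norm (f y) / r)"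
  unfolding set_lebesgue_integral_def by (intro integral_nonneg_AE AE_I2; simp)+

text \<open>If \<open>T e\<close> were nonzero, |T (y - x)| would be at least a fixed multiple of
  \<open>r\<close> on a ball of radius c r around x + r e', that is, on a fixed proportion of
  \<open>ball x r\<close> at every scale, and the averages could not tend to zero.\<close>

lemma linear_average_zero:
  fixes T :: "'a::euclidean_space \<Rightarrow> 'b::real_normed_vector"
  assumes T: "bounded_linear T"
    and lim: "((\<lambda>r. (LINT y:ball x r|lebesgue. norm (T (y - x)) / r) / measure lebesgue (ball x r)) \<longlongrightarrow> 0) (at_right 0)"
  shows "T e = 0"
proof (rule ccontr)
  assume Te: "T e \<noteq> 0"
  interpret T: bounded_linear T by fact
  have e0: "e \<noteq> 0" using Te T.zero by auto
  obtain K where K: "0 < K" "\<And>x. norm (T x) \<le> norm x * K" using T.pos_bounded by auto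
  define e' where "e' = (1 / (2 * norm e)) *\<^sub>R e"
  have ne': "norm e' = 1 / 2" using e0 by (simp add: e'_def)
  define \<eta> where "\<eta> = norm (T e')"
  have \<eta>: "\<eta> > 0" using Te e0 by (simp add: \<eta>_def e'_def T.scaleR)
  \<comment> \<open>Since \<open>e'\<close> has norm 1/2, c \<le> 1/2 keeps the small ball inside
    \<open>ball x r\<close>; the other bound keeps the variation of \<open>T\<close> over it below
    half of |T (r e')|.\<close>
  define c where "c = min (1 / 2) (\<eta> / (2 * K))"
  have c: "0 < c" "c \<le> 1 / 2" "c * K \<le> \<eta> / 2" using \<eta> K(1) by (auto simp: c_def min_def field_simps)
  let ?n = "DIM('a)"
  have cont: "continuous_on UNIV (\<lambda>y. norm (T (y - x)) / r)" if "r > 0" for r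
    using that by (intro continuous_intros bounded_linear.continuous_on[OF T]) auto
  have low: "\<eta> / 2 * c ^ ?n \<le> (LINT y:ball x r|lebesgue. norm (T (y - x)) / r) / measure lebesgue (ball x r)" if r: "r > 0" for r
  proof -
    have sub: "ball (x + r *\<^sub>R e') (c * r) \<subseteq> ball x r"
    proof
      fix y assume "y \<in> ball (x + r *\<^sub>R e') (c * r)"
      then have "norm (y - (x + r *\<^sub>R e')) < c * r" by (simp add: dist_norm norm_minus_commute)
      moreover have "norm (y - x) \<le> norm (y - (x + r *\<^sub>R e')) + norm (r *\<^sub>R e')"
        using norm_triangle_ineq[of "y - (x + r *\<^sub>R e')" "r *\<^sub>R e'"] by simp
      moreover have "norm (r *\<^sub>R e') = r / 2" using r ne' by simp
      moreover have "c * r \<le> 1 / 2 * r" using c r by (intro mult_right_mono) auto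
      ultimately show "y \<in> ball x r" by (simp add: dist_norm norm_minus_commute)
    qed
    have i1: "set_integrable lebesgue (ball x r) (\<lambda>y. norm (T (y - x)) / r)"
      by (rule continuous_set_integrable_ball[OF cont[OF r]])
    have "\<eta> / 2 * measure lebesgue (ball (x + r *\<^sub>R e') (c * r)) = (LINT y:ball (x + r *\<^sub>R e') (c * r)|lebesgue. \<eta> / 2)"
      using emeasure_ball_finite[of "x + r *\<^sub>R e'" "c * r"] by (subst set_integral_const) auto
    also have "\<dots> \<le> (LINT y|lebesgue. indicator (ball x r) y *\<^sub>R (norm (T (y - x)) / r))"
      unfolding set_lebesgue_integral_def
    proof (rule integral_mono)
      show "integrable lebesgue (\<lambda>y. indicator (ball (x + r *\<^sub>R e') (c * r)) y *\<^sub>R (\<eta> / 2))"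
        using set_integrable_const_ball[of "x + r *\<^sub>R e'" "c * r" "\<eta> / 2"] by (simp add: set_integrable_def)
      show "integrable lebesgue (\<lambda>y. indicator (ball x r) y *\<^sub>R (norm (T (y - x)) / r))"
        using i1 by (simp add: set_integrable_def)
      fix y
      show "indicator (ball (x + r *\<^sub>R e') (c * r)) y *\<^sub>R (\<eta> / 2) \<le> indicator (ball x r) y *\<^sub>R (norm (T (y - x)) / r)"
      proof (cases "y \<in> ball (x + r *\<^sub>R e') (c * r)")
        case True
        define z where "z = y - (x + r *\<^sub>R e')"
        have z: "norm z \<le> c * r" using True by (simp add: z_def dist_norm norm_minus_commute)
        have "T (y - x) = r *\<^sub>R T e' + T z" by (simp add: z_def T.diff T.add T.scaleR)
        then have "norm (T (y - x)) \<ge> norm (r *\<^sub>R T e') - norm (T z)"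
          using norm_triangle_ineq4[of "r *\<^sub>R T e' + T z" "T z"] by simp
        moreover have "norm (T z) \<le> c * r * K" using K(2)[of z] mult_right_mono[OF z, of K] K(1) by linarith
        moreover have "c * r * K \<le> \<eta> / 2 * r" using mult_right_mono[OF c(3), of r] r by (simp add: mult_ac)
        moreover have "norm (r *\<^sub>R T e') = r * \<eta>" using r by (simp add: \<eta>_def)
        ultimately have "\<eta> / 2 * r \<le> norm (T (y - x))" by (simp add: mult.commute)
        then have "\<eta> / 2 \<le> norm (T (y - x)) / r" using r by (simp add: field_simps)
        then show ?thesis using True sub by (auto simp: indicator_def)
      next
        case False
        then show ?thesis using r by simp
      qed
    qed
    finally have "\<eta> / 2 * measure lebesgue (ball (x + r *\<^sub>R e') (c * r)) \<le> (LINT y:ball x r|lebesgue. norm (T (y - x)) / r)"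
      by (simp only: set_lebesgue_integral_def)
    moreover have "measure lebesgue (ball (x + r *\<^sub>R e') (c * r)) = c ^ ?n * measure lebesgue (ball x r)"
      using r c by (simp add: content_ball power_mult_distrib)
    moreover have "measure lebesgue (ball x r) > 0" using r by simp
    ultimately show ?thesis by (simp add: le_divide_eq mult_ac)
  qed
  have "\<eta> / 2 * c ^ ?n \<le> 0"
    by (rule tendsto_lowerbound[OF lim]) (use low in \<open>auto simp: eventually_at_right_field intro!: exI[of _ 1]\<close>)
  moreover have "0 < \<eta> / 2 * c ^ ?n" using \<eta> c by simp
  ultimately show False by linarith
qed

lemma matrix_vector_bounded_linear: "bounded_linear (\<lambda>h. (G :: real^'n^'m) *v h)"
  by (simp add: linear_conv_bounded_linear[symmetric] matrix_vector_mul_linear)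

lemma eventually_at_right_0I: "0 < b \<Longrightarrow> (\<And>r. 0 < r \<Longrightarrow> r < b \<Longrightarrow> P r) \<Longrightarrow> \<forall>\<^sub>F r in at_right (0::real). P r"
  by (auto simp: eventually_at_right_field)

text \<open>Integrability near \<open>x\<close> is essential here: the Bochner integral of a
  non-integrable function is 0 by convention, so that otherwise every \<open>a\<close> could pass
  for an approximate limit.\<close>

lemma approx_limit_unique:
  fixes u :: "real^'n \<Rightarrow> real^'m"
  assumes u: "set_integrable lebesgue (ball x R) u" and R: "R > 0"
    and a: "has_approx_limit u x a" and b: "has_approx_limit u x b"
  shows "a = b"
proof -
  have "((\<lambda>r. (LINT y:ball x r|lebesgue. norm (u y - a)) / measure lebesgue (ball x r)
      + (LINT y:ball x r|lebesgue. norm (u y - b)) / measure lebesgue (ball x r)) \<longlongrightarrow> 0 + 0) (at_right 0)"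
    using a b unfolding has_approx_limit_def by (rule tendsto_add)
  moreover have "\<forall>\<^sub>F r in at_right 0. norm (a - b) \<le> (LINT y:ball x r|lebesgue. norm (u y - a)) / measure lebesgue (ball x r)
      + (LINT y:ball x r|lebesgue. norm (u y - b)) / measure lebesgue (ball x r)"
  proof (rule eventually_at_right_0I[OF R])
    fix r :: real assume r: "0 < r" "r < R"
    have ur: "set_integrable lebesgue (ball x r) u"
      by (rule set_integrable_subset[OF u]) (use r in auto)
    have i: "set_integrable lebesgue (ball x r) (\<lambda>y. norm (u y - c))" for c
      by (rule set_integrable_norm[OF set_integral_diff(1)[OF ur set_integrable_const_ball]])
    have "norm (a - b) * measure lebesgue (ball x r) = (LINT y:ball x r|lebesgue. norm (a - b))"
      using emeasure_ball_finite[of x r] by (subst set_integral_const) auto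
    also have "\<dots> \<le> (LINT y:ball x r|lebesgue. norm (u y - a) + norm (u y - b))"
    proof (rule set_integral_mono[OF set_integrable_const_ball set_integral_add(1)[OF i i]])
      show "norm (a - b) \<le> norm (u y - a) + norm (u y - b)" for y
        using norm_triangle_ineq4[of "u y - b" "u y - a"] by simp
    qed
    also have "\<dots> = (LINT y:ball x r|lebesgue. norm (u y - a)) + (LINT y:ball x r|lebesgue. norm (u y - b))"
      by (rule set_integral_add(2)[OF i i])
    finally show "norm (a - b) \<le> (LINT y:ball x r|lebesgue. norm (u y - a)) / measure lebesgue (ball x r)
      + (LINT y:ball x r|lebesgue. norm (u y - b)) / measure lebesgue (ball x r)"
      using r by (simp add: add_divide_distrib[symmetric] le_divide_eq)
  qed
  ultimately have "norm (a - b) \<le> 0 + 0" by (rule tendsto_lowerbound) simp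
  then show ?thesis by simp
qed

text \<open>\<open>approx_gradient\<close> is a definite description, so only uniqueness turns a
  matrix found by analysis into its value. The means of |(G - H) (y - x)| / r tend to zero, and a
  linear map with this property vanishes.\<close>

lemma approx_gradient_unique:
  fixes u :: "real^'n \<Rightarrow> real^'m"
  assumes u: "set_integrable lebesgue (ball x R) u" and R: "R > 0"
    and G: "has_approx_gradient u x G" and H: "has_approx_gradient u x H"
  shows "G = H"
proof -
  define F where "F a G r = (LINT y:ball x r|lebesgue. norm (u y - a - G *v (y - x)) / r) / measure lebesgue (ball x r)" for a and G :: "real^'n^'m" and r
  obtain a where a: "has_approx_limit u x a" and la: "(F a G \<longlongrightarrow> 0) (at_right 0)"
    using G unfolding has_approx_gradient_def F_def[abs_def] by blast
  obtain b where b: "has_approx_limit u x b" and lb: "(F b H \<longlongrightarrow> 0) (at_right 0)"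
    using H unfolding has_approx_gradient_def F_def[abs_def] by blast
  have ab: "b = a" by (rule approx_limit_unique[OF u R b a])
  have lb: "(F a H \<longlongrightarrow> 0) (at_right 0)" using lb unfolding ab .
  have lin: "bounded_linear (\<lambda>h. G *v h - H *v h)"
    by (intro bounded_linear_sub matrix_vector_bounded_linear)
  have "G *v e - H *v e = 0" for e
  proof (rule linear_average_zero[OF lin, of x])
    show "((\<lambda>r. (LINT y:ball x r|lebesgue. norm (G *v (y - x) - H *v (y - x)) / r) / measure lebesgue (ball x r)) \<longlongrightarrow> 0) (at_right 0)"
    proof (rule Lim_null_comparison)
      show "((\<lambda>r. F a G r + F a H r) \<longlongrightarrow> 0) (at_right 0)" using tendsto_add[OF la lb] by simp
      show "\<forall>\<^sub>F r in at_right 0. norm ((LINT y:ball x r|lebesgue. norm (G *v (y - x) - H *v (y - x)) / r) / measure lebesgue (ball x r)) \<le> F a G r + F a H r"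
      proof (rule eventually_at_right_0I[OF R])
        fix r :: real assume r: "0 < r" "r < R"
        have ur: "set_integrable lebesgue (ball x r) u"
          by (rule set_integrable_subset[OF u]) (use r in auto)
        have cM: "continuous_on UNIV (\<lambda>y. M *v (y - x))" for M :: "real^'n^'m"
          by (intro bounded_linear.continuous_on[OF matrix_vector_bounded_linear] continuous_intros)
        have i: "set_integrable lebesgue (ball x r) (\<lambda>y. norm (u y - a - M *v (y - x)) / r)" for M :: "real^'n^'m"
          by (intro set_integrable_divide set_integrable_norm set_integral_diff(1) ur set_integrable_const_ball
                continuous_set_integrable_ball cM)
        have ii: "set_integrable lebesgue (ball x r) (\<lambda>y. norm (G *v (y - x) - H *v (y - x)) / r)"
          by (intro set_integrable_divide set_integrable_norm set_integral_diff(1)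
                continuous_set_integrable_ball cM)
        have "(LINT y:ball x r|lebesgue. norm (G *v (y - x) - H *v (y - x)) / r)
            \<le> (LINT y:ball x r|lebesgue. norm (u y - a - G *v (y - x)) / r + norm (u y - a - H *v (y - x)) / r)"
        proof (rule set_integral_mono[OF ii set_integral_add(1)[OF i i]])
          fix y
          have "norm (G *v (y - x) - H *v (y - x)) \<le> norm (u y - a - G *v (y - x)) + norm (u y - a - H *v (y - x))"
            using norm_triangle_ineq4[of "u y - a - H *v (y - x)" "u y - a - G *v (y - x)"] by simp
          then show "norm (G *v (y - x) - H *v (y - x)) / r \<le> norm (u y - a - G *v (y - x)) / r + norm (u y - a - H *v (y - x)) / r"
            using r by (simp add: add_divide_distrib[symmetric] divide_right_mono)
        qed
        also have "\<dots> = (LINT y:ball x r|lebesgue. norm (u y - a - G *v (y - x)) / r) + (LINT y:ball x r|lebesgue. norm (u y - a - H *v (y - x)) / r)"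
          by (rule set_integral_add(2)[OF i i])
        finally have "(LINT y:ball x r|lebesgue. norm (G *v (y - x) - H *v (y - x)) / r) / measure lebesgue (ball x r) \<le> F a G r + F a H r"
          unfolding F_def add_divide_distrib[symmetric] by (intro divide_right_mono) auto
        moreover have "0 \<le> (LINT y:ball x r|lebesgue. norm (G *v (y - x) - H *v (y - x)) / r) / measure lebesgue (ball x r)"
          using r by (intro divide_nonneg_nonneg set_integral_norm_nonneg) auto
        ultimately show "norm ((LINT y:ball x r|lebesgue. norm (G *v (y - x) - H *v (y - x)) / r) / measure lebesgue (ball x r)) \<le> F a G r + F a H r"
          by (simp only: real_norm_def abs_of_nonneg)
      qed
    qed
  qed
  then show ?thesis by (simp add: matrix_eq)
qed

lemma approx_gradient_eqI:
  fixes u :: "real^'n \<Rightarrow> real^'m"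
  assumes "set_integrable lebesgue (ball x R) u" "R > 0" "has_approx_gradient u x G"
  shows "approx_gradient u x = G"
  unfolding approx_gradient_def
proof (rule the_equality)
  show "has_approx_gradient u x G" by fact
  show "H = G" if "has_approx_gradient u x H" for H
    by (rule approx_gradient_unique[OF assms(1,2) that assms(3)])
qed

text \<open>Write \<open>u = a + G (y - x) + R\<close>. If \<open>|u| = 1\<close> then \<open>a \<bullet> (u - a)\<close> is quadratic in \<open>u - a\<close>, and if \<open>u = 0\<close> then
  \<open>R\<close> is of order one. Hence \<open>|a \<bullet> G (y - x)| \<le> C (r\<^sup>2 + |R|)\<close> on the ball of radius \<open>r\<close>, and the mean of the
  right-hand side is \<open>o(r)\<close>, whereas that of the left-hand side is linear in \<open>r\<close>.\<close>

lemma approx_gradient_sphere_tangential: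
  fixes u :: "real^'n \<Rightarrow> real^'m"
  assumes u: "set_integrable lebesgue (ball x R) u" and R: "R > 0"
    and sph: "AE y in lebesgue. y \<in> ball x R \<longrightarrow> norm (u y) = 1 \<or> u y = 0"
    and a: "has_approx_limit u x a" "norm a = 1" and G: "has_approx_gradient u x G"
  shows "a \<bullet> (G *v e) = 0"
proof -
  define Rm where "Rm y = u y - a - G *v (y - x)" for y
  define F where "F r = (LINT y:ball x r|lebesgue. norm (Rm y) / r) / measure lebesgue (ball x r)" for r
  have la: "(F \<longlongrightarrow> 0) (at_right 0)"
  proof -
    obtain b where b: "has_approx_limit u x b"
      and lb: "((\<lambda>r. (LINT y:ball x r|lebesgue. norm (u y - b - G *v (y - x)) / r) / measure lebesgue (ball x r)) \<longlongrightarrow> 0) (at_right 0)"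
      using G unfolding has_approx_gradient_def by blast
    have "b = a" by (rule approx_limit_unique[OF u R b a(1)])
    then show ?thesis using lb by (simp add: F_def[abs_def] Rm_def)
  qed
  interpret G: bounded_linear "\<lambda>h. G *v h" by (rule matrix_vector_bounded_linear)
  obtain K where K: "0 < K" "\<And>h. norm (G *v h) \<le> norm h * K" using G.pos_bounded by auto
  have lin: "bounded_linear (\<lambda>h. a \<bullet> (G *v h))"
    by (rule bounded_linear_compose[OF bounded_linear_inner_right matrix_vector_bounded_linear])
  have pt: "\<bar>a \<bullet> (G *v (y - x))\<bar> \<le> K\<^sup>2 * r\<^sup>2 + (3 + K) * norm (Rm y)"
    if r: "0 < r" "r \<le> 1" and y: "y \<in> ball x r" and s: "norm (u y) = 1 \<or> u y = 0" for r y
  proof -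
    let ?\<rho> = "norm (Rm y)"
    have yx: "norm (y - x) \<le> r" using y by (simp add: dist_norm norm_minus_commute)
    have Gy: "norm (G *v (y - x)) \<le> K * r" using order_trans[OF K(2)[of "y - x"] mult_right_mono[OF yx, of K]] K(1) by (simp add: mult.commute)
    have aR: "\<bar>a \<bullet> Rm y\<bar> \<le> ?\<rho>" using Cauchy_Schwarz_ineq2[of a "Rm y"] a(2) by simp
    have T: "a \<bullet> (G *v (y - x)) = a \<bullet> (u y - a) - a \<bullet> Rm y" by (simp add: Rm_def inner_diff_right)
    have Kr: "K * r \<le> K" using K r by simp
    have rho0: "0 \<le> ?\<rho>" by simp
    from s show ?thesis
    proof
      assume s: "norm (u y) = 1"
      have "u y - a = Rm y + G *v (y - x)" by (simp add: Rm_def)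
      then have ua: "norm (u y - a) \<le> ?\<rho> + K * r" using norm_triangle_ineq[of "Rm y" "G *v (y - x)"] Gy by simp
      have "norm (u y - a) \<le> 2" using norm_triangle_ineq4[of "u y" a] s a(2) by simp
      \<comment> \<open>The a priori bound makes the quadratic term linear in the remainder:
        \<rho>^2 \<le> (2 + K) \<rho>.\<close>
      then have rho2: "?\<rho> \<le> 2 + K"
        using norm_triangle_ineq4[of "u y - a" "G *v (y - x)"] Gy Kr by (simp add: Rm_def)
      have "(norm (u y - a))\<^sup>2 = (norm (u y))\<^sup>2 - 2 * (a \<bullet> u y) + (norm a)\<^sup>2"
        by (simp add: power2_norm_eq_inner inner_diff_left inner_diff_right inner_commute)
      moreover have "a \<bullet> a = 1" using a(2) by (simp add: power2_norm_eq_inner[symmetric])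
      ultimately have "a \<bullet> (u y - a) = - ((norm (u y - a))\<^sup>2 / 2)" using s a(2) by (simp add: inner_diff_right field_simps)
      moreover have "(norm (u y - a))\<^sup>2 \<le> (?\<rho> + K * r)\<^sup>2" using ua by (intro power_mono) auto
      moreover have "(?\<rho> + K * r)\<^sup>2 \<le> 2 * ?\<rho>\<^sup>2 + 2 * (K\<^sup>2 * r\<^sup>2)"
        using sum_squares_bound[of ?\<rho> "K * r"] by (simp add: power2_sum power_mult_distrib)
      moreover have "?\<rho>\<^sup>2 \<le> (2 + K) * ?\<rho>" using mult_right_mono[OF rho2 rho0] by (simp add: power2_eq_square)
      moreover have "(3 + K) * ?\<rho> = (2 + K) * ?\<rho> + ?\<rho>" by (simp add: algebra_simps)
      ultimately show ?thesis unfolding T using aR zero_le_power2[of "norm (u y - a)"] by linarith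
    next
      assume s: "u y = 0"
      have "a \<bullet> a = 1" using a(2) by (simp add: power2_norm_eq_inner[symmetric])
      then have T1: "a \<bullet> (G *v (y - x)) = - 1 - a \<bullet> Rm y" unfolding T s by (simp add: inner_diff_right)
      have T2: "\<bar>a \<bullet> (G *v (y - x))\<bar> \<le> K * r" using Cauchy_Schwarz_ineq2[of a "G *v (y - x)"] a(2) Gy by simp
      \<comment> \<open>Multiplied by K r, this bounds the linear term K r by a quadratic term and a
        multiple of the remainder.\<close>
      have one: "1 \<le> ?\<rho> + K * r" using T1 T2 aR by linarith
      have "K * r * 1 \<le> K * r * (?\<rho> + K * r)" using one K r by (intro mult_left_mono) auto
      moreover have "K * r * ?\<rho> \<le> K * ?\<rho>" using Kr by (intro mult_right_mono) auto
      moreover have "K * r * (?\<rho> + K * r) = K * r * ?\<rho> + K\<^sup>2 * r\<^sup>2" by (simp add: algebra_simps power2_eq_square)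
      moreover have "K * ?\<rho> \<le> (3 + K) * ?\<rho>" by (intro mult_right_mono) auto
      ultimately show ?thesis using T2 by linarith
    qed
  qed
  show ?thesis
  proof (rule linear_average_zero[OF lin, of x])
    show "((\<lambda>r. (LINT y:ball x r|lebesgue. norm (a \<bullet> (G *v (y - x))) / r) / measure lebesgue (ball x r)) \<longlongrightarrow> 0) (at_right 0)"
    proof (rule Lim_null_comparison)
      have "((\<lambda>r. K\<^sup>2 * r + (3 + K) * F r) \<longlongrightarrow> K\<^sup>2 * 0 + (3 + K) * 0) (at_right 0)"
        by (intro tendsto_intros la)
      then show "((\<lambda>r. K\<^sup>2 * r + (3 + K) * F r) \<longlongrightarrow> 0) (at_right 0)" by simp
      have R1: "0 < min 1 R" using R by simp
      show "\<forall>\<^sub>F r in at_right 0. norm ((LINT y:ball x r|lebesgue. norm (a \<bullet> (G *v (y - x))) / r) / measure lebesgue (ball x r)) \<le> K\<^sup>2 * r + (3 + K) * F r"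
      proof (rule eventually_at_right_0I[OF R1])
        fix r :: real assume r: "0 < r" "r < min 1 R"
        have ur: "set_integrable lebesgue (ball x r) u"
          by (rule set_integrable_subset[OF u]) (use r in auto)
        have cM: "continuous_on UNIV (\<lambda>y. G *v (y - x))"
          by (intro bounded_linear.continuous_on[OF matrix_vector_bounded_linear] continuous_intros)
        have i: "set_integrable lebesgue (ball x r) (\<lambda>y. norm (Rm y) / r)"
          unfolding Rm_def
          by (intro set_integrable_divide set_integrable_norm set_integral_diff(1) ur set_integrable_const_ball
                continuous_set_integrable_ball cM)
        have i3: "set_integrable lebesgue (ball x r) (\<lambda>y. (3 + K) * (norm (Rm y) / r))"
          by (intro set_integrable_mult_right impI i)
        have ii: "set_integrable lebesgue (ball x r) (\<lambda>y. norm (a \<bullet> (G *v (y - x))) / r)"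
          using cM r by (intro continuous_set_integrable_ball continuous_intros) auto
        have "(LINT y:ball x r|lebesgue. norm (a \<bullet> (G *v (y - x))) / r)
            \<le> (LINT y:ball x r|lebesgue. K\<^sup>2 * r + (3 + K) * (norm (Rm y) / r))"
        proof (rule set_integral_mono_AE[OF ii set_integral_add(1)[OF set_integrable_const_ball i3]])
          show "AE y \<in> ball x r in lebesgue. norm (a \<bullet> (G *v (y - x))) / r \<le> K\<^sup>2 * r + (3 + K) * (norm (Rm y) / r)"
            using sph
          proof eventually_elim
            case (elim y)
            show ?case
            proof
              assume y: "y \<in> ball x r"
              then have "norm (u y) = 1 \<or> u y = 0" using elim r by auto
              from pt[OF r(1) _ y this] r
              have "\<bar>a \<bullet> (G *v (y - x))\<bar> / r \<le> (K\<^sup>2 * r\<^sup>2 + (3 + K) * norm (Rm y)) / r"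
                by (intro divide_right_mono) auto
              also have "\<dots> = K\<^sup>2 * r + (3 + K) * (norm (Rm y) / r)"
                using r by (simp add: add_divide_distrib power2_eq_square)
              finally show "norm (a \<bullet> (G *v (y - x))) / r \<le> K\<^sup>2 * r + (3 + K) * (norm (Rm y) / r)" by simp
            qed
          qed
        qed
        also have "\<dots> = (K\<^sup>2 * r) * measure lebesgue (ball x r) + (3 + K) * (LINT y:ball x r|lebesgue. norm (Rm y) / r)"
          using emeasure_ball_finite[of x r]
          by (subst set_integral_add(2)[OF set_integrable_const_ball i3], subst set_integral_const) auto
        finally have "(LINT y:ball x r|lebesgue. norm (a \<bullet> (G *v (y - x))) / r) / measure lebesgue (ball x r)
           \<le> ((K\<^sup>2 * r) * measure lebesgue (ball x r) + (3 + K) * (LINT y:ball x r|lebesgue. norm (Rm y) / r)) / measure lebesgue (ball x r)"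
          by (intro divide_right_mono) auto
        also have "\<dots> = K\<^sup>2 * r + (3 + K) * F r"
        proof -
          have "measure lebesgue (ball x r) \<noteq> 0" using measure_lebesgue_ball_pos[OF r(1), of x] by linarith
          then show ?thesis by (simp add: F_def add_divide_distrib)
        qed
        finally have "(LINT y:ball x r|lebesgue. norm (a \<bullet> (G *v (y - x))) / r) / measure lebesgue (ball x r) \<le> K\<^sup>2 * r + (3 + K) * F r" .
        moreover have "0 \<le> (LINT y:ball x r|lebesgue. norm (a \<bullet> (G *v (y - x))) / r) / measure lebesgue (ball x r)"
          using r by (intro divide_nonneg_nonneg set_integral_norm_nonneg) auto
        ultimately show "norm ((LINT y:ball x r|lebesgue. norm (a \<bullet> (G *v (y - x))) / r) / measure lebesgue (ball x r)) \<le> K\<^sup>2 * r + (3 + K) * F r"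
          by (simp only: real_norm_def abs_of_nonneg)
      qed
    qed
  qed
qed

text \<open>The Calderon-Zygmund theorem on approximate differentiability, in L^1 form. Almost every
  point is a Lebesgue point of \<open>u\<close> and of \<open>G\<close> and a point of density zero
  for the singular measure; there the rescaled test bound, passed through duality, makes the mean
  deviation from the affine map of order \<delta> r.\<close>

theorem BV_approx_gradient:
  fixes u :: "real^'n \<Rightarrow> real^'m"
  assumes BV: "has_BV_derivative U u G \<mu> \<sigma>" and ui: "set_integrable lebesgue U u" and U: "open U"
  shows "AE x in lebesgue. x \<in> U \<longrightarrow> has_approx_limit u x (u x) \<and> has_approx_gradient u x (G x) \<and> approx_gradient u x = G x"
proof -
  let ?n = "CARD('n)"
  interpret \<mu>: finite_measure \<mu> using BV by (simp add: has_BV_derivative_def)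
  have s\<mu>: "sets \<mu> = sets borel" using BV by (simp add: has_BV_derivative_def)
  obtain N where N: "N \<in> null_sets lborel" "AE x in \<mu>. x \<in> N"
    using BV unfolding has_BV_derivative_def by blast
  have Nb: "- N \<in> sets borel" using N(1) by auto
  have N0: "emeasure \<mu> (- N) = 0"
  proof -
    have "- N \<in> null_sets \<mu>"
      by (rule AE_iff_null_sets[THEN iffD2]) (use Nb s\<mu> N(2) in auto)
    then show ?thesis by auto
  qed
  have A1: "AE x in lebesgue. x \<in> - N \<longrightarrow> ((\<lambda>r. measure \<mu> (cball x r) / r ^ ?n) \<longlongrightarrow> 0) (at_right 0)"
    using measure_cball_density_zero[OF s\<mu> \<mu>.finite_measure_axioms Nb N0] by simp
  have A2: "AE x in lebesgue. x \<notin> N"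
    by (rule AE_not_in) (use N(1) in \<open>auto intro: null_sets_completionI\<close>)
  \<comment> \<open>Extension by zero, because the differentiation lemma is about functions
    integrable on the whole space; on small balls inside \<open>U\<close> nothing changes.\<close>
  define u0 where "u0 y = indicator U y *\<^sub>R u y" for y
  define G0 where "G0 y = indicator U y *\<^sub>R G y" for y
  have u0: "integrable lebesgue u0" using ui by (simp add: u0_def[abs_def] set_integrable_def)
  have "set_integrable lebesgue U G" using BV by (simp add: has_BV_derivative_def)
  then have G0: "integrable lebesgue G0" by (simp add: G0_def[abs_def] set_integrable_def)
  have A3: "AE x in lebesgue. ((\<lambda>r. (LINT y:ball x r|lebesgue. norm (u0 y - u0 x)) / r ^ ?n) \<longlongrightarrow> 0) (at_right 0)"
    using lebesgue_differentiation[OF u0] by simp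
  have A4: "AE x in lebesgue. ((\<lambda>r. (LINT y:ball x r|lebesgue. norm (G0 y - G0 x)) / r ^ ?n) \<longlongrightarrow> 0) (at_right 0)"
    using lebesgue_differentiation[OF G0] by simp
  show ?thesis
    using A1 A2 A3 A4
  proof eventually_elim
    case (elim x)
    show ?case
    proof
      assume x: "x \<in> U"
      obtain R where R: "R > 0" "ball x R \<subseteq> U" using U x open_contains_ball by blast
      have set_cong: "(LINT y:ball x r|lebesgue. f y) = (LINT y:ball x r|lebesgue. g y)"
        if "r < R" "\<And>y. y \<in> U \<Longrightarrow> f y = g y" for r and f g :: "real^'n \<Rightarrow> real"
      proof -
        have "ball x r \<subseteq> U" using R(2) subset_ball[of r R x] that(1) by auto
        then show ?thesis unfolding set_lebesgue_integral_def
          by (intro Bochner_Integration.integral_cong) (use that(2) in \<open>auto simp: indicator_def\<close>)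
      qed
      define V where "V = unit_ball_vol (real ?n)"
      have V: "V > 0" by (simp add: V_def)
      have mb: "measure lebesgue (ball x r) = V * r ^ ?n" if "r > 0" for r
        using that by (simp add: content_ball V_def)
      have lu: "((\<lambda>r. (LINT y:ball x r|lebesgue. norm (u y - u x)) / r ^ ?n) \<longlongrightarrow> 0) (at_right 0)"
      proof (rule Lim_transform_eventually[OF elim(3)])
        show "\<forall>\<^sub>F r in at_right 0. (LINT y:ball x r|lebesgue. norm (u0 y - u0 x)) / r ^ ?n = (LINT y:ball x r|lebesgue. norm (u y - u x)) / r ^ ?n"
          by (rule eventually_at_right_0I[OF R(1)]) (auto simp: u0_def x intro!: arg_cong2[where f="(/)"] set_cong)
      qed
      have lG: "((\<lambda>r. (LINT y:ball x r|lebesgue. norm (G y - G x)) / r ^ ?n) \<longlongrightarrow> 0) (at_right 0)"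
      proof (rule Lim_transform_eventually[OF elim(4)])
        show "\<forall>\<^sub>F r in at_right 0. (LINT y:ball x r|lebesgue. norm (G0 y - G0 x)) / r ^ ?n = (LINT y:ball x r|lebesgue. norm (G y - G x)) / r ^ ?n"
          by (rule eventually_at_right_0I[OF R(1)]) (auto simp: G0_def x intro!: arg_cong2[where f="(/)"] set_cong)
      qed
      have l\<mu>: "((\<lambda>r. measure \<mu> (cball x r) / r ^ ?n) \<longlongrightarrow> 0) (at_right 0)"
        using elim(1,2) by simp
      have hl: "has_approx_limit u x (u x)"
        unfolding has_approx_limit_def
      proof (rule Lim_transform_eventually)
        show "((\<lambda>r. (LINT y:ball x r|lebesgue. norm (u y - u x)) / r ^ ?n / V) \<longlongrightarrow> 0) (at_right 0)"
          using tendsto_divide[OF lu tendsto_const[of V]] V by simp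
        show "\<forall>\<^sub>F r in at_right 0. (LINT y:ball x r|lebesgue. norm (u y - u x)) / r ^ ?n / V = (LINT y:ball x r|lebesgue. norm (u y - u x)) / measure lebesgue (ball x r)"
          by (rule eventually_at_right_0I[OF R(1)]) (simp only: mb divide_divide_eq_left mult.commute)
      qed
      have "((\<lambda>r. (LINT y:ball x r|lebesgue. norm (u y - u x - G x *v (y - x)) / r) / measure lebesgue (ball x r)) \<longlongrightarrow> 0) (at_right 0)"
      proof (rule tendstoI)
        fix e :: real assume e: "e > 0"
        define K where "K = CARD('m) * (2 * CARD('n))"
        have K: "real K > 0" by (simp add: K_def)
        \<comment> \<open>Summing 2 n \<delta> r^(n+1) over the components gives K \<delta> r^(n+1);
          division by \<open>r\<close> and by the volume V r^n leaves e / 2.\<close>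
        define \<delta> where "\<delta> = e * V / (2 * K)"
        have \<delta>: "\<delta> > 0" using e V K by (simp add: \<delta>_def)
        have "\<forall>\<^sub>F r in at_right 0. (LINT y:ball x r|lebesgue. norm (G y - G x)) / r ^ ?n < \<delta>"
          by (rule order_tendstoD(2)[OF lG \<delta>])
        moreover have "\<forall>\<^sub>F r in at_right 0. measure \<mu> (cball x r) / r ^ ?n < \<delta>"
          by (rule order_tendstoD(2)[OF l\<mu> \<delta>])
        ultimately have "\<forall>\<^sub>F r in at_right 0. (LINT y:ball x r|lebesgue. norm (G y - G x)) / r ^ ?n < \<delta> \<and> measure \<mu> (cball x r) / r ^ ?n < \<delta>"
          by (rule eventually_conj)
        then obtain b where b: "b > 0" "\<And>r. 0 < r \<Longrightarrow> r < b \<Longrightarrow> (LINT y:ball x r|lebesgue. norm (G y - G x)) / r ^ ?n < \<delta> \<and> measure \<mu> (cball x r) / r ^ ?n < \<delta>"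
          unfolding eventually_at_right_field by blast
        have bR: "0 < min b R" using b R by simp
        show "\<forall>\<^sub>F r in at_right 0. dist ((LINT y:ball x r|lebesgue. norm (u y - u x - G x *v (y - x)) / r) / measure lebesgue (ball x r)) 0 < e"
        proof (rule eventually_at_right_0I[OF bR])
          fix r :: real assume r: "0 < r" "r < min b R"
          have sub: "ball x r \<subseteq> U" using R(2) subset_ball[of r R x] r by auto
          have Gb: "(LINT y:ball x \<rho>|lebesgue. norm (G y - G x)) \<le> \<delta> * \<rho> ^ ?n" if "0 < \<rho>" "\<rho> \<le> r" for \<rho>
            using b(2)[of \<rho>] that r by (simp add: divide_less_eq)
          have \<mu>b: "measure \<mu> (cball x \<rho>) \<le> \<delta> * \<rho> ^ ?n" if "0 < \<rho>" "\<rho> \<le> r" for \<rho>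
            using b(2)[of \<rho>] that r by (simp add: divide_less_eq)
          have uB: "set_integrable lebesgue (ball x r) u"
            by (rule set_integrable_subset[OF ui]) (use U sub in auto)
          have cM: "continuous_on UNIV (\<lambda>y. G x *v (y - x))"
            by (intro bounded_linear.continuous_on[OF matrix_vector_bounded_linear] continuous_intros)
          have iv: "set_integrable lebesgue (ball x r) (\<lambda>y. u y - u x - G x *v (y - x))"
            by (intro set_integral_diff(1) uB set_integrable_const_ball continuous_set_integrable_ball cM)
          have ivi: "set_integrable lebesgue (ball x r) (\<lambda>y. (u y - u x - G x *v (y - x)) $ i)" for i
            by (rule set_integrable_nth[OF iv])
          have iva: "set_integrable lebesgue (ball x r) (\<lambda>y. \<bar>(u y - u x - G x *v (y - x)) $ i\<bar>)" for i
            using set_integrable_norm[OF ivi[of i]] by simp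
          have comp: "(LINT y:ball x r|lebesgue. \<bar>(u y - u x - G x *v (y - x)) $ i\<bar>) \<le> 2 * ?n * \<delta> * r ^ (?n + 1)" for i
            by (rule integral_abs_le_by_duality[OF ivi r(1)])
               (rule BV_rescaled_test_bound[OF BV ui U sub r(1) Gb \<mu>b lu])
          have isum: "set_integrable lebesgue (ball x r) (\<lambda>y. \<Sum>i\<in>UNIV. \<bar>(u y - u x - G x *v (y - x)) $ i\<bar>)"
            unfolding set_integrable_def scaleR_sum_right
            by (rule Bochner_Integration.integrable_sum) (use iva in \<open>simp only: set_integrable_def\<close>)
          have "(LINT y:ball x r|lebesgue. norm (u y - u x - G x *v (y - x)) / r) = (LINT y:ball x r|lebesgue. norm (u y - u x - G x *v (y - x))) / r"
            by simp
          also have "(LINT y:ball x r|lebesgue. norm (u y - u x - G x *v (y - x))) \<le> (LINT y:ball x r|lebesgue. (\<Sum>i\<in>UNIV. \<bar>(u y - u x - G x *v (y - x)) $ i\<bar>))"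
            by (rule set_integral_mono[OF set_integrable_norm[OF iv] isum]) (rule norm_le_l1_cart)
          also have "\<dots> = (\<Sum>i\<in>UNIV. LINT y:ball x r|lebesgue. \<bar>(u y - u x - G x *v (y - x)) $ i\<bar>)"
            unfolding set_lebesgue_integral_def scaleR_sum_right
            by (rule Bochner_Integration.integral_sum) (use iva in \<open>simp add: set_integrable_def\<close>)
          also have "\<dots> \<le> (\<Sum>i\<in>(UNIV::'m set). 2 * ?n * \<delta> * r ^ (?n + 1))" by (intro sum_mono comp)
          also have "\<dots> = K * \<delta> * r ^ (?n + 1)" by (simp add: K_def)
          finally have "(LINT y:ball x r|lebesgue. norm (u y - u x - G x *v (y - x)) / r) \<le> K * \<delta> * r ^ (?n + 1) / r"
            using r by (simp add: divide_right_mono)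
          also have "\<dots> = K * \<delta> * r ^ ?n" using r by simp
          also have "\<dots> = e / 2 * measure lebesgue (ball x r)" unfolding mb[OF r(1)] \<delta>_def using K by simp
          finally have "(LINT y:ball x r|lebesgue. norm (u y - u x - G x *v (y - x)) / r) / measure lebesgue (ball x r) \<le> e / 2"
            using measure_lebesgue_ball_pos[OF r(1), of x] by (simp only: divide_le_eq if_True)
          moreover have "0 \<le> (LINT y:ball x r|lebesgue. norm (u y - u x - G x *v (y - x)) / r) / measure lebesgue (ball x r)"
            using r by (intro divide_nonneg_nonneg set_integral_norm_nonneg) auto
          ultimately show "dist ((LINT y:ball x r|lebesgue. norm (u y - u x - G x *v (y - x)) / r) / measure lebesgue (ball x r)) 0 < e"
            using e by (simp only: dist_real_def diff_0_right abs_of_nonneg)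
        qed
      qed
      with hl have hg: "has_approx_gradient u x (G x)" unfolding has_approx_gradient_def by blast
      have uR: "set_integrable lebesgue (ball x R) u"
        by (rule set_integrable_subset[OF ui]) (use U R in auto)
      show "has_approx_limit u x (u x) \<and> has_approx_gradient u x (G x) \<and> approx_gradient u x = G x"
        using hl hg approx_gradient_eqI[OF uR R(1) hg] by blast
    qed
  qed
qed

section \<open>Continuous, differentiable and Lipschitz maps\<close>

lemma continuous_has_approx_limit:
  fixes u :: "real^'n \<Rightarrow> real^'m"
  assumes "isCont u x"
  shows "has_approx_limit u x (u x)"
  unfolding has_approx_limit_def
proof (rule tendstoI)
  fix e :: real assume e: "e > 0"
  then obtain d where d: "d > 0" "\<And>y. dist y x < d \<Longrightarrow> dist (u y) (u x) < e / 2"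
    using assms unfolding continuous_at_eps_delta by (metis half_gt_zero)
  show "\<forall>\<^sub>F r in at_right 0. dist ((LINT y:ball x r|lebesgue. norm (u y - u x)) / measure lebesgue (ball x r)) 0 < e"
  proof (rule eventually_at_right_0I[OF d(1)])
    fix r :: real assume r: "0 < r" "r < d"
    have "(LINT y:ball x r|lebesgue. norm (u y - u x)) \<le> e / 2 * measure lebesgue (ball x r)"
    proof (rule set_integral_ball_upper)
      fix y assume "y \<in> ball x r"
      then have "dist (u y) (u x) < e / 2" using r by (intro d(2)) (simp add: dist_commute)
      then show "norm (u y - u x) \<le> e / 2" by (simp add: dist_norm)
    qed (use e in simp)
    then have "(LINT y:ball x r|lebesgue. norm (u y - u x)) / measure lebesgue (ball x r) \<le> e / 2"
      using measure_lebesgue_ball_pos[OF r(1), of x] by (simp only: divide_le_eq if_True)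
    moreover have "0 \<le> (LINT y:ball x r|lebesgue. norm (u y - u x)) / measure lebesgue (ball x r)"
      using r by (intro divide_nonneg_nonneg set_integral_norm_nonneg) auto
    ultimately show "dist ((LINT y:ball x r|lebesgue. norm (u y - u x)) / measure lebesgue (ball x r)) 0 < e"
      using e by (simp only: dist_real_def diff_0_right abs_of_nonneg)
  qed
qed

lemma has_derivative_has_approx_gradient:
  fixes u :: "real^'n \<Rightarrow> real^'m"
  assumes d: "(u has_derivative (\<lambda>h. G *v h)) (at x)"
  shows "has_approx_gradient u x G"
  unfolding has_approx_gradient_def
proof (intro exI conjI)
  show "has_approx_limit u x (u x)"
    by (rule continuous_has_approx_limit[OF has_derivative_continuous[OF d]])
  show "((\<lambda>r. (LINT y:ball x r|lebesgue. norm (u y - u x - G *v (y - x)) / r) / measure lebesgue (ball x r)) \<longlongrightarrow> 0) (at_right 0)"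
  proof (rule tendstoI)
    fix e :: real assume e: "e > 0"
    have "\<forall>e>0. \<exists>d>0. \<forall>y. norm (y - x) < d \<longrightarrow> norm (u y - u x - G *v (y - x)) \<le> e * norm (y - x)"
      using d unfolding has_derivative_at_alt by blast
    then obtain b where b: "b > 0" "\<And>y. norm (y - x) < b \<Longrightarrow> norm (u y - u x - G *v (y - x)) \<le> e / 2 * norm (y - x)"
      using half_gt_zero[OF e] by blast
    show "\<forall>\<^sub>F r in at_right 0. dist ((LINT y:ball x r|lebesgue. norm (u y - u x - G *v (y - x)) / r) / measure lebesgue (ball x r)) 0 < e"
    proof (rule eventually_at_right_0I[OF b(1)])
      fix r :: real assume r: "0 < r" "r < b"
      have "(LINT y:ball x r|lebesgue. norm (u y - u x - G *v (y - x)) / r) \<le> e / 2 * measure lebesgue (ball x r)"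
      proof (rule set_integral_ball_upper)
        fix y assume "y \<in> ball x r"
        then have y: "norm (y - x) < r" by (simp add: dist_norm norm_minus_commute)
        have "norm (u y - u x - G *v (y - x)) \<le> e / 2 * norm (y - x)" using y r by (intro b(2)) simp
        also have "\<dots> \<le> e / 2 * r" using y e by (intro mult_left_mono) auto
        finally show "norm (u y - u x - G *v (y - x)) / r \<le> e / 2" using r by (simp only: divide_le_eq if_True)
      qed (use e in simp)
      then have "(LINT y:ball x r|lebesgue. norm (u y - u x - G *v (y - x)) / r) / measure lebesgue (ball x r) \<le> e / 2"
        using measure_lebesgue_ball_pos[OF r(1), of x] by (simp only: divide_le_eq if_True)
      moreover have "0 \<le> (LINT y:ball x r|lebesgue. norm (u y - u x - G *v (y - x)) / r) / measure lebesgue (ball x r)"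
        using r by (intro divide_nonneg_nonneg set_integral_norm_nonneg) auto
      ultimately show "dist ((LINT y:ball x r|lebesgue. norm (u y - u x - G *v (y - x)) / r) / measure lebesgue (ball x r)) 0 < e"
        using e by (simp only: dist_real_def diff_0_right abs_of_nonneg)
    qed
  qed
qed

lemma hausdorff_measure_empty [simp]: "hausdorff_measure k ({} :: 'a::metric_space set) = 0"
proof -
  have "hausdorff_premeasure k \<delta> ({} :: 'a set) = 0" if "\<delta> > 0" for \<delta>
  proof -
    let ?C = "(\<lambda>i. {}) :: nat \<Rightarrow> 'a set"
    have "hausdorff_premeasure k \<delta> ({} :: 'a set) \<le> 0"
      unfolding hausdorff_premeasure_def by (rule INF_lower2[where i="?C"]) (use that in \<open>auto simp: diameter_empty\<close>)
    then show ?thesis by simp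
  qed
  then show ?thesis unfolding hausdorff_measure_def
    by (intro antisym SUP_least) auto
qed

text \<open>Serves the candidate and its extension, whose kinks at the plates go into the null set
  \<open>N\<close>. Continuity makes the discontinuity set empty, and the singular part can be taken
  to be the null measure.\<close>

lemma lipschitz_SBV2:
  fixes u :: "real^'n \<Rightarrow> real^'m"
  assumes lip: "\<And>x y. norm (u x - u y) \<le> L * norm (x - y)" and bd: "\<And>x. norm (u x) \<le> M"
    and N: "N \<in> null_sets lebesgue" and D: "\<And>x. x \<notin> N \<Longrightarrow> (u has_derivative (\<lambda>h. G x *v h)) (at x)"
    and V: "open V" "bounded V"
  shows "u \<in> SBV2 V"
proof -
  have L0: "0 \<le> L"
    using order_trans[OF norm_ge_zero lip[of "axis undefined 1" 0]] by simp
  have M0: "0 \<le> M" using bd[of 0] norm_ge_zero order_trans by blast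
  have cont: "isCont u x" for x
  proof -
    have "((\<lambda>y. u y - u x) \<longlongrightarrow> 0) (at x)"
    proof (rule Lim_null_comparison)
      show "\<forall>\<^sub>F y in at x. norm (u y - u x) \<le> L * norm (y - x)" using lip by simp
      show "((\<lambda>y. L * norm (y - x)) \<longlongrightarrow> 0) (at x)"
        by (rule tendsto_eq_rhs, (rule tendsto_intros)+) simp
    qed
    then show ?thesis by (simp add: isCont_def LIM_zero_iff)
  qed
  then have cu: "continuous_on UNIV u" by (simp add: continuous_at_imp_continuous_on)
  have um: "u \<in> borel_measurable lebesgue"
    by (intro measurable_completion) (simp add: borel_measurable_continuous_onI[OF cu])
  have disc: "approx_discont_set V u = {}"
    unfolding approx_discont_set_def using continuous_has_approx_limit[OF cont] by blast
  have Vl: "V \<in> lmeasurable" using V by (intro bounded_set_imp_lmeasurable) auto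
  have Vfin: "emeasure lebesgue V < \<infinity>" "V \<in> sets lebesgue" using Vl by (auto simp: fmeasurable_def)
  have bint: "set_integrable lebesgue V f"
    if "f \<in> borel_measurable lebesgue" "AE x in lebesgue. norm (f x) \<le> B" for f :: "real^'n \<Rightarrow> 'z::{banach, second_countable_topology}" and B :: real
    unfolding set_integrable_def
  proof (rule Bochner_Integration.integrable_bound)
    show "integrable lebesgue (\<lambda>x. indicator V x * \<bar>B\<bar>)"
      using Vfin by (intro integrable_mult_left integrable_real_indicator) auto
    show "(\<lambda>x. indicator V x *\<^sub>R f x) \<in> borel_measurable lebesgue"
      using Vfin that(1) by (intro borel_measurable_scaleR borel_measurable_indicator) auto
    show "AE x in lebesgue. norm (indicator V x *\<^sub>R f x) \<le> norm (indicator V x * \<bar>B\<bar>)"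
      using that(2) by eventually_elim (auto simp: indicator_def)
  qed
  have gd: "GDERIV (\<lambda>x. u x $ i) x :> G x $ i" if "x \<notin> N" for x i
  proof -
    have "((\<lambda>x. u x $ i) has_derivative (\<lambda>h. (G x *v h) $ i)) (at x)"
      by (rule bounded_linear.has_derivative[OF bounded_linear_vec_nth D[OF that]])
    then show ?thesis
      unfolding gderiv_def by (simp add: matrix_vector_mult_def inner_vec_def mult.commute)
  qed
  have aeN: "AE x in lebesgue. x \<notin> N" by (rule AE_not_in[OF N])
  have ulip: "\<bar>u x $ i - u y $ i\<bar> \<le> L * dist x y" for x y i
    using component_le_norm_cart[of "u x - u y" i] lip[of x y] by (simp add: dist_norm)
  have ubd: "\<bar>u x $ i\<bar> \<le> M" for x i using component_le_norm_cart[of "u x" i] bd[of x] by linarith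
  \<comment> \<open>\<open>G\<close> is given only pointwise off \<open>N\<close>; its measurability
    and its bound are inherited from these difference quotients.\<close>
  define F where "F i j k x = (u (x + (1 / real (Suc k)) *\<^sub>R axis j 1) $ i - u x $ i) * real (Suc k)" for i j k x
  have Flim: "(\<lambda>k. F i j k x) \<longlonglongrightarrow> G x $ i $ j" if "x \<notin> N" for x i j
    unfolding F_def using GDERIV_LIMSEQ[OF gd[OF that], of "axis j 1" i] by (simp add: inner_axis)
  have Fm: "F i j k \<in> borel_measurable lebesgue" for i j k
  proof -
    have "continuous_on UNIV (\<lambda>x. u (x + (1 / real (Suc k)) *\<^sub>R axis j 1))"
      by (rule continuous_on_compose2[OF cu]) (intro continuous_intros, simp)
    then have "continuous_on UNIV (F i j k)" unfolding F_def using cu by (intro continuous_intros)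
    then show ?thesis by (intro measurable_completion) (simp add: borel_measurable_continuous_onI)
  qed
  have Gm1: "(\<lambda>x. G x $ i $ j) \<in> borel_measurable lebesgue" for i j
    by (rule AE_LIMSEQ_measurable_lebesgue[where F="F i j", OF Fm]) (use aeN in \<open>eventually_elim, simp add: Flim\<close>)
  have Gm: "G \<in> borel_measurable lebesgue"
    unfolding borel_measurable_euclidean_space[of G]
  proof
    fix b :: "real^'n^'m" assume "b \<in> Basis"
    then obtain i c where c: "b = axis i c" "c \<in> Basis" by (auto simp: Basis_vec_def)
    then obtain j where "c = axis j 1" by (auto simp: Basis_vec_def)
    then have "G x \<bullet> b = G x $ i $ j" for x using c by (simp add: inner_axis)
    then show "(\<lambda>x. G x \<bullet> b) \<in> borel_measurable lebesgue" using Gm1 by simp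
  qed
  have Gb1: "\<bar>G x $ i $ j\<bar> \<le> L" if "x \<notin> N" for x i j
  proof (rule LIMSEQ_le_const2[OF tendsto_rabs[OF Flim[OF that]]])
    have "\<bar>F i j k x\<bar> \<le> L" for k
    proof -
      have "\<bar>u (x + (1 / real (Suc k)) *\<^sub>R axis j 1) $ i - u x $ i\<bar> \<le> L * (1 / real (Suc k))"
        using ulip[of "x + (1 / real (Suc k)) *\<^sub>R axis j 1" i x] by (simp add: dist_norm)
      then have "\<bar>u (x + (1 / real (Suc k)) *\<^sub>R axis j 1) $ i - u x $ i\<bar> * real (Suc k) \<le> L * (1 / real (Suc k)) * real (Suc k)"
        by (rule mult_right_mono) simp
      then show ?thesis by (simp add: F_def abs_mult)
    qed
    then show "\<exists>N. \<forall>k\<ge>N. \<bar>F i j k x\<bar> \<le> L" by blast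
  qed
  have Gb: "norm (G x) \<le> CARD('m) * (CARD('n) * L)" if "x \<notin> N" for x
  proof -
    have "norm (G x $ i) \<le> CARD('n) * L" for i
    proof -
      have "norm (G x $ i) \<le> (\<Sum>j\<in>UNIV. \<bar>G x $ i $ j\<bar>)" by (rule norm_le_l1_cart)
      also have "\<dots> \<le> (\<Sum>j\<in>(UNIV::'n set). L)" by (intro sum_mono Gb1 that)
      finally show ?thesis by simp
    qed
    moreover have "norm (G x) \<le> (\<Sum>i\<in>UNIV. norm (G x $ i))"
      unfolding norm_vec_def by (rule L2_set_le_sum) simp
    ultimately have "norm (G x) \<le> (\<Sum>i\<in>(UNIV::'m set). CARD('n) * L)"
      by (meson order_trans sum_mono)
    then show ?thesis by simp
  qed
  have GbAE: "AE x in lebesgue. norm (G x) \<le> CARD('m) * (CARD('n) * L)"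
    using aeN by eventually_elim (rule Gb)
  have ui: "set_integrable lebesgue V u" by (rule bint[OF um]) (use bd in auto)
  have Gi: "set_integrable lebesgue V G" by (rule bint[OF Gm GbAE])
  have ident: "(LINT x:V|lebesgue. u x $ i * g x $ j) = - (LINT x:V|lebesgue. \<phi> x * G x $ i $ j)"
    if t: "test_function V \<phi> g" for \<phi> g i j
  proof -
    obtain B where B: "\<And>x. \<bar>\<phi> x\<bar> \<le> B" "\<And>x. norm (g x) \<le> B" by (rule test_function_bounded[OF t]) blast
    obtain R where R: "\<And>x. x \<notin> ball 0 R \<Longrightarrow> \<phi> x = 0" by (rule test_function_support_ball[OF t]) blast
    have B0: "0 \<le> B" using B(1)[of 0] by linarith
    have Bj: "\<bar>g x $ j\<bar> \<le> B" for x by (rule order_trans[OF component_le_norm_cart B(2)])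
    define w where "w x = u x $ i * \<phi> x" for x
    have wlip: "\<bar>w x - w y\<bar> \<le> (B * L + M * B) * dist x y" for x y
    proof -
      have "w x - w y = \<phi> x * (u x $ i - u y $ i) + u y $ i * (\<phi> x - \<phi> y)" by (simp add: w_def algebra_simps)
      also have "\<bar>\<dots>\<bar> \<le> \<bar>\<phi> x\<bar> * \<bar>u x $ i - u y $ i\<bar> + \<bar>u y $ i\<bar> * \<bar>\<phi> x - \<phi> y\<bar>"
        by (metis abs_mult abs_triangle_ineq)
      also have "\<dots> \<le> B * (L * dist x y) + M * (B * dist x y)"
        using B ulip ubd B0 M0 test_function_lipschitz[OF t B(2)] by (intro add_mono mult_mono) auto
      finally show ?thesis by (simp add: algebra_simps)
    qed
    have w0: "x \<notin> ball 0 R \<Longrightarrow> w x = 0" for x using R by (simp add: w_def)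
    have lim: "AE x in lebesgue. (\<lambda>k. (w (x + (1 / real (Suc k)) *\<^sub>R axis j 1) - w x) * real (Suc k)) \<longlonglongrightarrow> u x $ i * g x $ j + \<phi> x * G x $ i $ j"
      using aeN
    proof eventually_elim
      case (elim x)
      have "GDERIV \<phi> x :> g x" using t by (simp add: test_function_def)
      from GDERIV_LIMSEQ[OF GDERIV_mult[OF gd[OF elim, of i] this], of "axis j 1"]
      show ?case by (simp add: w_def inner_axis)
    qed
    have z: "(LINT x|lebesgue. u x $ i * g x $ j + \<phi> x * G x $ i $ j) = 0"
      by (rule integral_directional_derivative_zero(2)[OF wlip w0 lim])
    have i1: "set_integrable lebesgue V (\<lambda>x. u x $ i * g x $ j)"
      by (rule set_integrable_bounded_mult(2)[OF set_integrable_nth[OF ui] test_function_measurable(4)[OF t] Bj])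
    have i2: "set_integrable lebesgue V (\<lambda>x. \<phi> x * G x $ i $ j)"
      by (rule set_integrable_bounded_mult(1)[OF set_integrable_nth[OF set_integrable_nth[OF Gi]] test_function_measurable(3)[OF t] B(1)])
    have "(LINT x:V|lebesgue. u x $ i * g x $ j) + (LINT x:V|lebesgue. \<phi> x * G x $ i $ j)
       = (LINT x:V|lebesgue. u x $ i * g x $ j + \<phi> x * G x $ i $ j)"
      by (rule set_integral_add(2)[OF i1 i2, symmetric])
    also have "\<dots> = (LINT x|lebesgue. u x $ i * g x $ j + \<phi> x * G x $ i $ j)"
      unfolding set_lebesgue_integral_def
      by (intro Bochner_Integration.integral_cong) (use test_function_outside[OF t] in \<open>auto simp: indicator_def\<close>)
    finally show ?thesis using z by simp
  qed
  \<comment> \<open>Under the null measure every almost everywhere statement holds, even |\<sigma>|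
    = 1 for \<sigma> = 0.\<close>
  define \<mu> :: "(real^'n) measure" where "\<mu> = null_measure borel"
  have AE\<mu>: "AE x in \<mu>. P x" for P
    by (rule AE_I[where N=UNIV]) (auto simp: \<mu>_def)
  have BV: "has_BV_derivative V u G \<mu> (\<lambda>_. 0)"
    unfolding has_BV_derivative_def
  proof (intro conjI allI impI)
    show "finite_measure \<mu>" by (rule finite_measureI) (simp add: \<mu>_def)
    show "\<exists>N\<in>null_sets lborel. AE x in \<mu>. x \<in> N" using AE\<mu> by (intro bexI[of _ "{}"]) auto
    show "(LINT x:V|lebesgue. u x $ i * g x $ j) = - (LINT x:V|lebesgue. \<phi> x * G x $ i $ j) - (LINT x|\<mu>. \<phi> x * (0 :: real^'n^'m) $ i $ j)"
      if "test_function V \<phi> g" for \<phi> g i j using ident[OF that] by simp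
  qed (use Gi AE\<mu> in \<open>auto simp: \<mu>_def\<close>)
  have inBV: "u \<in> BV V" unfolding BV_def using ui BV by blast
  have inSBV: "u \<in> SBV V" unfolding SBV_def using inBV BV AE\<mu> by blast
  have ag: "approx_gradient u x = G x" if "x \<notin> N" for x
    by (rule approx_gradient_eqI[OF continuous_set_integrable_ball[OF cu] zero_less_one has_derivative_has_approx_gradient[OF D[OF that]]])
  have agAE: "AE x in lebesgue. G x = approx_gradient u x" using aeN by eventually_elim (simp add: ag)
  have agm: "approx_gradient u \<in> borel_measurable lebesgue" by (rule borel_measurable_AE[OF Gm agAE])
  show ?thesis
    unfolding SBV2_def
  proof (intro CollectI conjI inSBV)
    show "set_borel_measurable lebesgue V (approx_gradient u)"
      unfolding set_borel_measurable_def using Vfin agm by (intro borel_measurable_scaleR borel_measurable_indicator) auto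
    show "set_integrable lebesgue V (\<lambda>x. (norm (approx_gradient u x))\<^sup>2)"
    proof (rule bint)
      show "(\<lambda>x. (norm (approx_gradient u x))\<^sup>2) \<in> borel_measurable lebesgue"
        by (rule measurable_compose[OF agm]) simp
      show "AE x in lebesgue. norm ((norm (approx_gradient u x))\<^sup>2) \<le> (CARD('m) * (CARD('n) * L))\<^sup>2"
        using GbAE agAE
      proof eventually_elim
        case (elim x)
        then have "norm (approx_gradient u x) \<le> CARD('m) * (CARD('n) * L)" by simp
        then show ?case by (simp only: real_norm_def abs_of_nonneg zero_le_power2) (rule power_mono, simp_all)
      qed
    qed
    show "hausdorff_measure (CARD('n) - 1) (approx_discont_set V u) < \<infinity>" by (simp add: disc)
  qed
qed

section \<open>The profile\<close>

lemma profile_integrand: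
  fixes t D :: real
  assumes "t\<^sup>2 < D"
  shows "0 < D - t\<^sup>2 * (cos u)\<^sup>2" "D - t\<^sup>2 \<le> D - t\<^sup>2 * (cos u)\<^sup>2" "D - t\<^sup>2 * (cos u)\<^sup>2 \<le> D"
proof -
  have "(cos u)\<^sup>2 \<le> 1" by (simp add: abs_square_le_1)
  then have "t\<^sup>2 * (cos u)\<^sup>2 \<le> t\<^sup>2" by (simp add: mult_left_le)
  then show "0 < D - t\<^sup>2 * (cos u)\<^sup>2" "D - t\<^sup>2 \<le> D - t\<^sup>2 * (cos u)\<^sup>2" "D - t\<^sup>2 * (cos u)\<^sup>2 \<le> D"
    using assms by auto
qed

text \<open>An antiderivative on the whole line rather than on [0, pi/2]: its inverse is then a
  profile with two-sided derivatives at the plates and with values beyond them.\<close>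

lemma profile_antiderivative:
  fixes t D :: real
  assumes D: "t\<^sup>2 < D"
  obtains T where "T 0 = 0" "\<And>x. (T has_real_derivative 1 / sqrt (D - t\<^sup>2 * (cos x)\<^sup>2)) (at x)"
    "\<And>x. 0 \<le> x \<Longrightarrow> integral {0..x} (\<lambda>u. 1 / sqrt (D - t\<^sup>2 * (cos u)\<^sup>2)) = T x"
proof -
  let ?f = "\<lambda>u. 1 / sqrt (D - t\<^sup>2 * (cos u)\<^sup>2)"
  have "sqrt (D - t\<^sup>2 * (cos x)\<^sup>2) \<noteq> 0" for x
    using profile_integrand(1)[OF D, of x] by simp
  then have c: "isCont ?f x" for x
    by (intro continuous_intros) auto
  have "\<exists>F. \<forall>x::real. - \<infinity> < ereal x \<longrightarrow> ereal x < \<infinity> \<longrightarrow> (F has_vector_derivative ?f x) (at x)"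
    by (rule einterval_antiderivative) (auto intro: c)
  then obtain F where F: "\<And>x. (F has_vector_derivative ?f x) (at x)" by auto
  show ?thesis
  proof (rule that[of "\<lambda>x. F x - F 0"])
    show "F 0 - F 0 = 0" by simp
    show d: "((\<lambda>x. F x - F 0) has_real_derivative ?f x) (at x)" for x
      using F[of x] by (auto intro!: derivative_eq_intros simp: has_real_derivative_iff_has_vector_derivative[symmetric])
    show "integral {0..x} ?f = F x - F 0" if "0 \<le> x" for x
      by (rule integral_unique[OF fundamental_theorem_of_calculus[OF that]])
         (rule has_vector_derivative_at_within[OF F])
  qed
qed

text \<open>The height over which the angle turns from 0 to pi/2 for the parameter \<open>D\<close>;
  the condition at z = 1 says that it equals 1.\<close>

definition profile_period :: "real \<Rightarrow> real \<Rightarrow> real" where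
  "profile_period t D = integral {0..pi/2} (\<lambda>u. 1 / sqrt (D - t\<^sup>2 * (cos u)\<^sup>2))"

text \<open>The integrand decreases strictly in \<open>D\<close>. This determines \<open>D\<close>,
  and thereby the profile, uniquely.\<close>

lemma profile_period_strict_antimono:
  assumes "0 < t" "t\<^sup>2 < D" "D < D'"
  shows "profile_period t D' < profile_period t D"
proof -
  have D': "t\<^sup>2 < D'" using assms by simp
  obtain T where T: "T 0 = 0" "\<And>x. (T has_real_derivative 1 / sqrt (D - t\<^sup>2 * (cos x)\<^sup>2)) (at x)"
    "\<And>x. 0 \<le> x \<Longrightarrow> integral {0..x} (\<lambda>u. 1 / sqrt (D - t\<^sup>2 * (cos u)\<^sup>2)) = T x"
    by (rule profile_antiderivative[OF assms(2)]) (rule that)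
  obtain T' where T': "T' 0 = 0" "\<And>x. (T' has_real_derivative 1 / sqrt (D' - t\<^sup>2 * (cos x)\<^sup>2)) (at x)"
    "\<And>x. 0 \<le> x \<Longrightarrow> integral {0..x} (\<lambda>u. 1 / sqrt (D' - t\<^sup>2 * (cos u)\<^sup>2)) = T' x"
    by (rule profile_antiderivative[OF D']) (rule that)
  have "T 0 - T' 0 < T (pi / 2) - T' (pi / 2)"
  proof (rule DERIV_pos_imp_increasing[of 0 "pi / 2" "\<lambda>x. T x - T' x"])
    fix x
    have "0 < D - t\<^sup>2 * (cos x)\<^sup>2" by (rule profile_integrand(1)[OF assms(2)])
    then have "1 / sqrt (D' - t\<^sup>2 * (cos x)\<^sup>2) < 1 / sqrt (D - t\<^sup>2 * (cos x)\<^sup>2)"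
      using assms(3) by (intro divide_strict_left_mono) auto
    then show "\<exists>y. ((\<lambda>x. T x - T' x) has_real_derivative y) (at x) \<and> 0 < y"
      using DERIV_diff[OF T(2)[of x] T'(2)[of x]] by (intro exI conjI) auto
  qed simp
  then show ?thesis using T(1,3) T'(1,3) by (simp add: profile_period_def)
qed

text \<open>Intermediate value theorem between pi^2/4, where the root is at most pi/2 and the period
  at least 1, and t^2 + pi^2/4, where the root is at least pi/2 and the period at most 1. The upper
  end is recorded because it bounds the Lagrange multiplier in the calibration.\<close>

lemma profile_period_solution:
  assumes t: "0 < t" "t < 1 / 4"
  obtains D where "t\<^sup>2 < D" "D \<le> t\<^sup>2 + pi\<^sup>2 / 4" "profile_period t D = 1"
proof -
  have t2: "t\<^sup>2 < 1 / 16" using power_strict_mono[of t "1/4" 2] t by (simp add: power2_eq_square)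
  have pi2: "9 / 4 \<le> pi\<^sup>2 / 4" using power_mono[of 3 pi 2] pi_gt3 by simp
  let ?a = "pi\<^sup>2 / 4" and ?b = "t\<^sup>2 + pi\<^sup>2 / 4"
  have a: "t\<^sup>2 < ?a" "t\<^sup>2 < ?b" using t2 pi2 by auto
  have sq: "sqrt ?a = pi / 2" by (simp add: real_sqrt_divide)
  have int: "(\<lambda>u. 1 / sqrt (D - t\<^sup>2 * (cos u)\<^sup>2)) integrable_on {0..pi/2}" if "t\<^sup>2 < D" for D
  proof (rule integrable_continuous_real)
    have "sqrt (D - t\<^sup>2 * (cos x)\<^sup>2) \<noteq> 0" for x
      using profile_integrand(1)[OF that, of x] by simp
    then show "continuous_on {0..pi/2} (\<lambda>u. 1 / sqrt (D - t\<^sup>2 * (cos u)\<^sup>2))"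
      by (intro continuous_intros) auto
  qed
  have c1: "integral {0..pi/2} (\<lambda>u. 2 / pi) = 1" by simp
  have lo: "integral {0..pi/2} (\<lambda>u. 2 / pi) \<le> profile_period t ?a"
    unfolding profile_period_def
  proof (rule integral_le[OF _ int[OF a(1)]])
    fix u :: real
    have "sqrt (?a - t\<^sup>2 * (cos u)\<^sup>2) \<le> pi / 2" "0 < sqrt (?a - t\<^sup>2 * (cos u)\<^sup>2)"
      using profile_integrand[OF a(1), of u] real_sqrt_le_mono[of "?a - t\<^sup>2 * (cos u)\<^sup>2" ?a] sq by auto
    then have "1 / (pi / 2) \<le> 1 / sqrt (?a - t\<^sup>2 * (cos u)\<^sup>2)" by (intro divide_left_mono) auto
    then show "2 / pi \<le> 1 / sqrt (?a - t\<^sup>2 * (cos u)\<^sup>2)" by simp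
  qed (rule integrable_const_ivl)
  have hi: "profile_period t ?b \<le> integral {0..pi/2} (\<lambda>u. 2 / pi)"
    unfolding profile_period_def
  proof (rule integral_le[OF int[OF a(2)]])
    fix u :: real
    have "pi / 2 \<le> sqrt (?b - t\<^sup>2 * (cos u)\<^sup>2)"
      using profile_integrand(2)[OF a(2), of u] real_sqrt_le_mono[of ?a "?b - t\<^sup>2 * (cos u)\<^sup>2"] sq by auto
    moreover have "0 < sqrt (?b - t\<^sup>2 * (cos u)\<^sup>2)"
      using profile_integrand(1)[OF a(2), of u] by simp
    ultimately have "1 / sqrt (?b - t\<^sup>2 * (cos u)\<^sup>2) \<le> 1 / (pi / 2)"
      by (intro divide_left_mono mult_pos_pos) simp_all
    then show "1 / sqrt (?b - t\<^sup>2 * (cos u)\<^sup>2) \<le> 2 / pi" by simp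
  qed (rule integrable_const_ivl)
  have cont: "continuous_on {?a..?b} (profile_period t)"
  proof -
    have nz: "sqrt (D - t\<^sup>2 * (cos x)\<^sup>2) \<noteq> 0" if "D \<in> {?a..?b}" for D x
    proof -
      have "t\<^sup>2 < D" using that a(1) by auto
      from profile_integrand(1)[OF this, of x] show ?thesis by simp
    qed
    have "continuous_on ({?a..?b} \<times> cbox 0 (pi/2)) (\<lambda>(D, u). 1 / sqrt (D - t\<^sup>2 * (cos u)\<^sup>2))"
      unfolding case_prod_beta using nz by (intro continuous_intros) auto
    from integral_continuous_on_param[OF this] show ?thesis
      by (simp add: profile_period_def[abs_def])
  qed
  obtain D where D: "?a \<le> D" "D \<le> ?b" "profile_period t D = 1"
    using IVT2'[of "profile_period t" ?b 1 ?a] lo hi cont unfolding c1 by auto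
  show ?thesis by (rule that[of D]) (use D a in auto)
qed

text \<open>The profile is the inverse of the antiderivative \<open>T\<close>. For another solution,
  \<open>D\<close> is fixed by the strict monotonicity of the period, and the angle by injectivity
  of \<open>T\<close>.\<close>

lemma profile_exists:
  assumes t: "0 < t" "t < 1 / 4"
  obtains D \<theta> where "t\<^sup>2 < D" "D \<le> t\<^sup>2 + pi\<^sup>2 / 4" "is_profile t D \<theta>"
    "\<And>D' \<theta>'. is_profile t D' \<theta>' \<Longrightarrow> D' = D \<and> (\<forall>z\<in>{0..1}. \<theta>' z = \<theta> z)"
    "\<theta> 0 = 0" "\<theta> 1 = pi / 2"
    "\<And>z. (\<theta> has_real_derivative sqrt (D - t\<^sup>2 * (cos (\<theta> z))\<^sup>2)) (at z)"
proof -
  obtain D where D: "t\<^sup>2 < D" "D \<le> t\<^sup>2 + pi\<^sup>2 / 4" "profile_period t D = 1"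
    by (rule profile_period_solution[OF t]) (rule that)
  let ?f = "\<lambda>u. 1 / sqrt (D - t\<^sup>2 * (cos u)\<^sup>2)"
  obtain T where T: "T 0 = 0" "\<And>x. (T has_real_derivative ?f x) (at x)"
    "\<And>x. 0 \<le> x \<Longrightarrow> integral {0..x} ?f = T x"
    by (rule profile_antiderivative[OF D(1)]) (rule that)
  have fpos: "0 < ?f x" for x using profile_integrand(1)[OF D(1), of x] by simp
  have mono: "T x < T y" if "x < y" for x y
    by (rule DERIV_pos_imp_increasing[OF that]) (use T(2) fpos in blast)
  have inj: "x = y" if "T x = T y" for x y
    using mono[of x y] mono[of y x] that by (cases x y rule: linorder_cases) auto
  have D0: "0 < D" using D(1) zero_le_power2[of t] by linarith
  then have Dpos: "0 < sqrt D" by simp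
  have flow: "1 / sqrt D \<le> ?f x" for x
    using profile_integrand[OF D(1), of x] D0
    by (intro divide_left_mono real_sqrt_le_mono mult_pos_pos real_sqrt_gt_zero) simp_all
  have grow: "T y - T x \<ge> (y - x) / sqrt D" if xy: "x \<le> y" for x y
  proof -
    have d: "((\<lambda>x. T x - x / sqrt D) has_real_derivative ?f x - 1 / sqrt D) (at x)" for x
      by (intro DERIV_diff T(2) DERIV_cdivide DERIV_ident)
    have "0 \<le> ?f x - 1 / sqrt D" for x using flow[of x] by simp
    then have "T x - x / sqrt D \<le> T y - y / sqrt D"
      by (intro DERIV_nonneg_imp_nondecreasing[OF xy]) (use d in blast)
    then show ?thesis by (simp add: diff_divide_distrib)
  qed
  have contT: "continuous_on A T" for A
    by (intro continuous_at_imp_continuous_on ballI DERIV_isCont[OF T(2)])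
  have surj: "\<exists>x. T x = z" for z
  proof -
    have "T (\<bar>z\<bar> * sqrt D) \<ge> \<bar>z\<bar>" using grow[of 0 "\<bar>z\<bar> * sqrt D"] T(1) Dpos by simp
    moreover have "T (- (\<bar>z\<bar> * sqrt D)) \<le> - \<bar>z\<bar>" using grow[of "- (\<bar>z\<bar> * sqrt D)" 0] T(1) Dpos by simp
    ultimately have "T (- (\<bar>z\<bar> * sqrt D)) \<le> z" "z \<le> T (\<bar>z\<bar> * sqrt D)" by linarith+
    moreover have "- (\<bar>z\<bar> * sqrt D) \<le> \<bar>z\<bar> * sqrt D" using mult_nonneg_nonneg[of "\<bar>z\<bar>" "sqrt D"] Dpos by linarith
    ultimately show ?thesis
      using IVT'[of T "- (\<bar>z\<bar> * sqrt D)" z "\<bar>z\<bar> * sqrt D", OF _ _ _ contT] by blast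
  qed
  define \<theta> where "\<theta> z = (THE x. T x = z)" for z
  have T\<theta>: "T (\<theta> z) = z" for z
    unfolding \<theta>_def by (rule theI') (use surj inj in blast)
  have \<theta>T: "\<theta> (T x) = x" for x by (rule inj) (rule T\<theta>)
  have \<theta>mono: "\<theta> x \<le> \<theta> y" if "x \<le> y" for x y
    using mono[of "\<theta> y" "\<theta> x"] that by (simp add: T\<theta>) (meson not_le)
  have \<theta>0: "\<theta> 0 = 0" using \<theta>T[of 0] T(1) by simp
  have Tpi: "T (pi / 2) = 1" using D(3) T(3)[of "pi / 2"] by (simp add: profile_period_def)
  have \<theta>1: "\<theta> 1 = pi / 2" using \<theta>T[of "pi / 2"] Tpi by simp
  have \<theta>cont: "isCont \<theta> z" for z
  proof -
    have L: "\<theta> b - \<theta> a \<le> sqrt D * (b - a)" if "a \<le> b" for a b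
      using grow[OF \<theta>mono[OF that]] Dpos by (simp add: T\<theta> divide_le_eq mult.commute)
    have "\<bar>\<theta> y - \<theta> z\<bar> \<le> sqrt D * \<bar>y - z\<bar>" for y
      by (cases "y \<le> z") (use L[of y z] L[of z y] \<theta>mono[of y z] \<theta>mono[of z y] in auto)
    then have "\<forall>\<^sub>F y in at z. norm (\<theta> y - \<theta> z) \<le> sqrt D * \<bar>y - z\<bar>" by simp
    moreover have "((\<lambda>y. sqrt D * \<bar>y - z\<bar>) \<longlongrightarrow> sqrt D * \<bar>z - z\<bar>) (at z)" by (intro tendsto_intros)
    then have "((\<lambda>y. sqrt D * \<bar>y - z\<bar>) \<longlongrightarrow> 0) (at z)" by simp
    ultimately have "((\<lambda>y. \<theta> y - \<theta> z) \<longlongrightarrow> 0) (at z)" by (rule Lim_null_comparison)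
    then show ?thesis by (simp add: isCont_def LIM_zero_iff)
  qed
  have d\<theta>: "(\<theta> has_real_derivative sqrt (D - t\<^sup>2 * (cos (\<theta> z))\<^sup>2)) (at z)" for z
  proof -
    have "(\<theta> has_real_derivative inverse (?f (\<theta> z))) (at z)"
      by (rule DERIV_inverse_function[where f=T and a="z - 1" and b="z + 1"])
         (use T(2) fpos[of "\<theta> z"] \<theta>cont T\<theta> in auto)
    then show ?thesis by simp
  qed
  have prof: "is_profile t D \<theta>"
    unfolding is_profile_def
  proof (intro conjI ballI)
    show "\<theta> \<in> {0..1} \<rightarrow> {0..pi / 2}" using \<theta>mono[of 0] \<theta>mono[of _ 1] by (auto simp: \<theta>0 \<theta>1)
    show "integral {0..\<theta> z} ?f = z" if "z \<in> {0..1}" for z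
      using T(3)[of "\<theta> z"] \<theta>mono[of 0 z] that by (simp add: T\<theta> \<theta>0)
  qed (use D \<theta>1 in auto)
  have uniq: "D' = D \<and> (\<forall>z\<in>{0..1}. \<theta>' z = \<theta> z)" if p: "is_profile t D' \<theta>'" for D' \<theta>'
  proof -
    have D': "t\<^sup>2 < D'" using p by (simp add: is_profile_def)
    have "\<forall>z\<in>{0..1}. integral {0..\<theta>' z} (\<lambda>u. 1 / sqrt (D' - t\<^sup>2 * (cos u)\<^sup>2)) = z" and "\<theta>' 1 = pi / 2"
      using p unfolding is_profile_def by blast+
    from this(1)[rule_format, of 1] this(2) have p1: "profile_period t D' = 1"
      by (simp add: profile_period_def)
    have DD: "D' = D"
      using profile_period_strict_antimono[OF t(1) D', of D] profile_period_strict_antimono[OF t(1) D(1), of D'] p1 D(3)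
      by (cases D D' rule: linorder_cases) auto
    moreover have "\<theta>' z = \<theta> z" if z: "z \<in> {0..1}" for z
    proof -
      have "0 \<le> \<theta>' z" "integral {0..\<theta>' z} ?f = z" using p z unfolding is_profile_def DD by auto
      then have "T (\<theta>' z) = z" using T(3) by simp
      then show ?thesis using \<theta>T by metis
    qed
    ultimately show ?thesis by blast
  qed
  show ?thesis by (rule that[OF D(1,2) prof uniq \<theta>0 \<theta>1 d\<theta>])
qed

text \<open>The algebra generated by \<open>S\<close>. Once it contains the derivatives of the
  generators it is closed under differentiation, which yields derivatives of every order without a
  formula for any of them.\<close>

inductive_set derivative_algebra :: "(real \<Rightarrow> real) set \<Rightarrow> (real \<Rightarrow> real) set" for S where
  base: "f \<in> S \<Longrightarrow> f \<in> derivative_algebra S"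
| const: "(\<lambda>_. c) \<in> derivative_algebra S"
| add: "f \<in> derivative_algebra S \<Longrightarrow> g \<in> derivative_algebra S \<Longrightarrow> (\<lambda>z. f z + g z) \<in> derivative_algebra S"
| mult: "f \<in> derivative_algebra S \<Longrightarrow> g \<in> derivative_algebra S \<Longrightarrow> (\<lambda>z. f z * g z) \<in> derivative_algebra S"

lemma derivative_algebra_closed:
  assumes S: "\<And>f. f \<in> S \<Longrightarrow> \<exists>f'\<in>derivative_algebra S. \<forall>z. (f has_real_derivative f' z) (at z)"
    and f: "f \<in> derivative_algebra S"
  shows "\<exists>f'\<in>derivative_algebra S. \<forall>z. (f has_real_derivative f' z) (at z)"
  using f
proof induction
  case (base f)
  then show ?case by (rule S)
next
  case (const c)
  show ?case by (rule bexI[OF _ derivative_algebra.const[of 0]]) simp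
next
  case (add f g)
  then obtain f' g' where "f' \<in> derivative_algebra S" "g' \<in> derivative_algebra S"
    "\<And>z. (f has_real_derivative f' z) (at z)" "\<And>z. (g has_real_derivative g' z) (at z)" by blast
  then show ?case by (intro bexI[OF _ derivative_algebra.add[of f' S g']] allI DERIV_add)
next
  case (mult f g)
  then obtain f' g' where fg: "f' \<in> derivative_algebra S" "g' \<in> derivative_algebra S"
    "\<And>z. (f has_real_derivative f' z) (at z)" "\<And>z. (g has_real_derivative g' z) (at z)" by blast
  show ?case
    by (rule bexI[OF _ derivative_algebra.add[OF derivative_algebra.mult[OF fg(1) mult.hyps(2)] derivative_algebra.mult[OF fg(2) mult.hyps(1)]]])
       (auto intro: DERIV_mult fg)
qed

lemma derivative_algebra_smooth:
  assumes S: "\<And>f. f \<in> S \<Longrightarrow> \<exists>f'\<in>derivative_algebra S. \<forall>z. (f has_real_derivative f' z) (at z)"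
    and f: "f \<in> derivative_algebra S"
  shows "\<exists>F :: nat \<Rightarrow> real \<Rightarrow> real. F 0 = f \<and> (\<forall>k z. (F k has_real_derivative F (Suc k) z) (at z))"
proof -
  have "\<exists>F. \<forall>k. (F k \<in> derivative_algebra S \<and> (k = 0 \<longrightarrow> F k = f)) \<and> (\<forall>z. (F k has_real_derivative F (Suc k) z) (at z))"
    by (rule dependent_nat_choice) (use f derivative_algebra_closed[OF S] in auto)
  then show ?thesis by blast
qed

lemma vector3_eq_axis: "(vector [a, b, c] :: real^3) = a *\<^sub>R axis 1 1 + b *\<^sub>R axis 2 1 + c *\<^sub>R axis 3 1"
  by (simp add: vec_eq_iff forall_3 axis_def)

lemma smooth_on_vector3:
  assumes "\<exists>F :: nat \<Rightarrow> real \<Rightarrow> real. F 0 = f \<and> (\<forall>k z. (F k has_real_derivative F (Suc k) z) (at z))"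
    and "\<exists>F :: nat \<Rightarrow> real \<Rightarrow> real. F 0 = g \<and> (\<forall>k z. (F k has_real_derivative F (Suc k) z) (at z))"
    and "\<exists>F :: nat \<Rightarrow> real \<Rightarrow> real. F 0 = h \<and> (\<forall>k z. (F k has_real_derivative F (Suc k) z) (at z))"
  shows "smooth_on S (\<lambda>z. vector [f z, g z, h z] :: real^3)"
proof -
  obtain F where F: "F 0 = f" "\<And>k z. (F k has_real_derivative F (Suc k) z) (at z)" using assms(1) by blast
  obtain G where G: "G 0 = g" "\<And>k z. (G k has_real_derivative G (Suc k) z) (at z)" using assms(2) by blast
  obtain H where H: "H 0 = h" "\<And>k z. (H k has_real_derivative H (Suc k) z) (at z)" using assms(3) by blast
  have c: "((\<lambda>z. q z *\<^sub>R v) has_vector_derivative q' *\<^sub>R v) (at z within S)"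
    if "(q has_real_derivative q') (at z)" for q q' z and v :: "real^3"
    using has_vector_derivative_scaleR[OF has_field_derivative_at_within[OF that] has_vector_derivative_const[of v]] by simp
  show ?thesis
    unfolding smooth_on_def
  proof (intro exI[of _ "\<lambda>k z. vector [F k z, G k z, H k z] :: real^3"] conjI allI ballI)
    show "(\<lambda>z. vector [F 0 z, G 0 z, H 0 z]) = (\<lambda>z. vector [f z, g z, h z] :: real^3)"
      by (simp add: F G H)
    fix k z
    show "((\<lambda>z. vector [F k z, G k z, H k z] :: real^3) has_vector_derivative vector [F (Suc k) z, G (Suc k) z, H (Suc k) z]) (at z within S)"
      unfolding vector3_eq_axis
      by (intro has_vector_derivative_add c F(2) G(2) H(2))
  qed
qed

section \<open>The calibration\<close>

definition chiral_density :: "real \<Rightarrow> real^3 \<Rightarrow> real^3^3 \<Rightarrow> real" where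
  "chiral_density t n G = (norm G)\<^sup>2 + 2 * t * (n \<bullet> curl_of G) + t\<^sup>2 * (norm n)\<^sup>2"

lemma norm_sq_vec3: "(norm (v :: real^3))\<^sup>2 = (v$1)\<^sup>2 + (v$2)\<^sup>2 + (v$3)\<^sup>2"
  unfolding power2_norm_eq_inner by (simp add: inner_vec_def sum_3 power2_eq_square)

lemma norm_sq_mat3: "(norm (G :: real^3^3))\<^sup>2 =
    (G$1$1)\<^sup>2 + (G$1$2)\<^sup>2 + (G$1$3)\<^sup>2 + (G$2$1)\<^sup>2 + (G$2$2)\<^sup>2 + (G$2$3)\<^sup>2 + (G$3$1)\<^sup>2 + (G$3$2)\<^sup>2 + (G$3$3)\<^sup>2"
  unfolding power2_norm_eq_inner by (simp add: inner_vec_def sum_3 power2_eq_square)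

lemma chiral_density_components:
  "chiral_density t n G =
    (G$1$1)\<^sup>2 + (G$1$2)\<^sup>2 + (G$1$3)\<^sup>2 + (G$2$1)\<^sup>2 + (G$2$2)\<^sup>2 + (G$2$3)\<^sup>2 + (G$3$1)\<^sup>2 + (G$3$2)\<^sup>2 + (G$3$3)\<^sup>2
    + 2 * t * (n$1 * (G$3$2 - G$2$3) + n$2 * (G$1$3 - G$3$1) + n$3 * (G$2$1 - G$1$2))
    + t\<^sup>2 * ((n$1)\<^sup>2 + (n$2)\<^sup>2 + (n$3)\<^sup>2)"
  unfolding chiral_density_def norm_sq_vec3 norm_sq_mat3 curl_of_def by (simp add: inner_vec_def sum_3)

text \<open>Completing squares. Here \<open>N\<close> stands for the value of the candidate and \<open>p\<close> for its derivative,
  and \<open>w = n - N\<close>; the last bracket vanishes by the choice of \<open>L\<close>.\<close>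

lemma calibration_square_identity:
  fixes t a a' L :: real
  shows "g11\<^sup>2 + g12\<^sup>2 + g13\<^sup>2 + g21\<^sup>2 + g22\<^sup>2 + g23\<^sup>2 + g31\<^sup>2 + g32\<^sup>2 + g33\<^sup>2
    + 2 * t * (n1 * (g32 - g23) + n2 * (g13 - g31) + n3 * (g21 - g12))
    + t\<^sup>2 * (n1\<^sup>2 + n2\<^sup>2 + n3\<^sup>2)
    - ((2 * t * N3) * g21 + (- 2 * t * N2) * g31 + (- 2 * t * N3) * g12 + (2 * t * N1) * g32
       + (2 * p1 + 2 * t * N2 - 2 * a * N1) * g13 + (2 * p2 - 2 * t * N1 - 2 * a * N2) * g23 + (2 * p3 - 2 * a * N3) * g33
       + (2 * (t\<^sup>2 - L - a') * N1 - 2 * t * p2 - 2 * a * p1) * n1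
       + (2 * (t\<^sup>2 - L - a') * N2 + 2 * t * p1 - 2 * a * p2) * n2
       + (2 * (t\<^sup>2 - L - a') * N3 - 2 * a * p3) * n3 + L + 2 * a')
   = g11\<^sup>2 + (g21 + t * (n3 - N3))\<^sup>2 + (g31 - t * (n2 - N2))\<^sup>2
     + (g12 - t * (n3 - N3))\<^sup>2 + g22\<^sup>2 + (g32 + t * (n1 - N1))\<^sup>2
     + (g13 - p1 + t * (n2 - N2) - a * (n1 - N1))\<^sup>2 + (g23 - p2 - t * (n1 - N1) - a * (n2 - N2))\<^sup>2
     + (g33 - p3 - a * (n3 - N3))\<^sup>2
     + (- a' - a\<^sup>2 - L - t\<^sup>2) * ((n1 - N1)\<^sup>2 + (n2 - N2)\<^sup>2 + (n3 - N3)\<^sup>2)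
     + 2 * a * (n1 * g13 + n2 * g23 + n3 * g33) + 2 * a * (N1 * p1 + N2 * p2 + N3 * p3)
     + (L + a' - t\<^sup>2) * (N1\<^sup>2 + N2\<^sup>2 + N3\<^sup>2 - 1) + (L + a') * (n1\<^sup>2 + n2\<^sup>2 + n3\<^sup>2 - 1)
     + (L - t\<^sup>2 - (p1\<^sup>2 + p2\<^sup>2 + p3\<^sup>2) - 2 * t * (p1 * N2 - p2 * N1))"
  by algebra

text \<open>The facts supplied by the existence of the profile. The differential equation holds on
  the whole line, so the calibration continues past the plates, where the test functions also
  live.\<close>

locale director_profile =
  fixes t D :: real and \<theta> :: "real \<Rightarrow> real"
  assumes t: "0 < t" "t < 1 / 4" and D: "t\<^sup>2 < D" "D \<le> t\<^sup>2 + pi\<^sup>2 / 4"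
    and theta_0: "\<theta> 0 = 0" and theta_1: "\<theta> 1 = pi / 2"
    and DERIV_theta: "\<And>z. (\<theta> has_real_derivative sqrt (D - t\<^sup>2 * (cos (\<theta> z))\<^sup>2)) (at z)"
begin

definition speed :: "real \<Rightarrow> real" where "speed z = sqrt (D - t\<^sup>2 * (cos (\<theta> z))\<^sup>2)"

text \<open>The Lagrange multiplier \<Lambda> of |n| = 1 at the candidate \<open>N\<close>, as it
  appears in the Euler-Lagrange equation N'' = 2 t (e3 \<times> N') + (t^2 - \<Lambda>) N.\<close>

definition multiplier :: "real \<Rightarrow> real" where "multiplier z = (speed z)\<^sup>2 + t\<^sup>2 * (sin (\<theta> z))\<^sup>2"

definition N1 :: "real \<Rightarrow> real" where "N1 z = cos (\<theta> z) * cos (t * z)"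
definition N2 :: "real \<Rightarrow> real" where "N2 z = cos (\<theta> z) * sin (t * z)"
definition N3 :: "real \<Rightarrow> real" where "N3 z = sin (\<theta> z)"

definition P1 :: "real \<Rightarrow> real" where "P1 z = - (sin (\<theta> z) * speed z * cos (t * z)) - t * (cos (\<theta> z) * sin (t * z))"
definition P2 :: "real \<Rightarrow> real" where "P2 z = - (sin (\<theta> z) * speed z * sin (t * z)) + t * (cos (\<theta> z) * cos (t * z))"
definition P3 :: "real \<Rightarrow> real" where "P3 z = cos (\<theta> z) * speed z"

text \<open>An odd polynomial about \<open>1/2\<close> with \<open>- a' - a\<^sup>2 \<ge> 3\<close> on \<open>[0, 1]\<close>; since \<open>3\<close> lies between
  \<open>\<pi>\<^sup>2/4\<close> and \<open>\<pi>\<^sup>2\<close>, this expresses the Poincare inequality on the unit interval with room to spare.\<close>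

definition riccati :: "real \<Rightarrow> real" where "riccati z = - (3 * (z - 1/2) + 12 * (z - 1/2)^3)"
definition riccati' :: "real \<Rightarrow> real" where "riccati' z = - (3 + 36 * (z - 1/2)\<^sup>2)"

text \<open>The third column is \<open>2 N' + 2 t (N \<times> e\<^sub>3) - 2 a N\<close> and the others are \<open>2 t (N \<times> e\<^sub>j)\<close>. In \<open>calib'\<close>
  the second derivative is eliminated with the Euler-Lagrange equation of the profile.\<close>

definition calib :: "real \<Rightarrow> real^3^3" where
  "calib z = vector [
     vector [0, - 2 * t * N3 z, 2 * P1 z + 2 * t * N2 z - 2 * riccati z * N1 z],
     vector [2 * t * N3 z, 0, 2 * P2 z - 2 * t * N1 z - 2 * riccati z * N2 z],
     vector [- 2 * t * N2 z, 2 * t * N1 z, 2 * P3 z - 2 * riccati z * N3 z]]"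

definition calib' :: "real \<Rightarrow> real^3^3" where
  "calib' z = vector [
     vector [0, - 2 * t * P3 z, 2 * (t\<^sup>2 - multiplier z - riccati' z) * N1 z - 2 * t * P2 z - 2 * riccati z * P1 z],
     vector [2 * t * P3 z, 0, 2 * (t\<^sup>2 - multiplier z - riccati' z) * N2 z + 2 * t * P1 z - 2 * riccati z * P2 z],
     vector [- 2 * t * P2 z, 2 * t * P1 z, 2 * (t\<^sup>2 - multiplier z - riccati' z) * N3 z - 2 * riccati z * P3 z]]"

definition calib_offset :: "real \<Rightarrow> real" where "calib_offset z = multiplier z + 2 * riccati' z"

text \<open>Up to the offset this is the divergence of the field whose j-th component is the sum
  over \<open>i\<close> of \<open>calib z $ i $ j * n $ i\<close>: the matrix depends on the height
  only, so just its third column is differentiated.\<close>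

definition calib_integrand :: "real \<Rightarrow> real^3 \<Rightarrow> real^3^3 \<Rightarrow> real" where
  "calib_integrand z n G = (\<Sum>i\<in>UNIV. \<Sum>j\<in>UNIV. calib z $ i $ j * G $ i $ j) + (\<Sum>i\<in>UNIV. calib' z $ i $ 3 * n $ i) + calib_offset z"

definition director_deriv :: "real \<Rightarrow> real^3" where "director_deriv z = vector [P1 z, P2 z, P3 z]"

section \<open>Differential equations of the profile and of the calibration\<close>

lemma director_eq: "director t \<theta> z = vector [N1 z, N2 z, N3 z]"
  by (simp add: director_def N1_def N2_def N3_def)

lemma speed_sq: "(speed z)\<^sup>2 = D - t\<^sup>2 * (cos (\<theta> z))\<^sup>2"
  using profile_integrand(1)[OF D(1), of "\<theta> z"] by (simp add: speed_def)

lemma speed_pos: "0 < speed z"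
  using profile_integrand(1)[OF D(1), of "\<theta> z"] by (simp add: speed_def)

lemma sin_sq: "(sin x)\<^sup>2 = 1 - (cos x)\<^sup>2" for x :: real
  by (simp add: sin_squared_eq)

lemma t_sq: "t\<^sup>2 < 1 / 16"
  using power_strict_mono[of t "1/4" 2] t by (simp add: power2_eq_square)

lemma pi_sq: "pi\<^sup>2 \<le> 987 / 100"
proof -
  have "pi \<le> 31416 / 10000" using pi_approx by simp
  then have "pi\<^sup>2 \<le> (31416 / 10000)\<^sup>2" by (intro power_mono) auto
  then show ?thesis by (simp add: power2_eq_square)
qed

text \<open>The last item is the pendulum equation \<theta>'' = t^2 sin \<theta> cos \<theta>,
  obtained from the first integral that defines \<open>speed\<close>; the root is differentiable
  because t^2 < D keeps the radicand positive.\<close>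

lemma DERIV_angles:
  "((\<lambda>z. cos (\<theta> z)) has_real_derivative - (sin (\<theta> z) * speed z)) (at z)"
  "((\<lambda>z. sin (\<theta> z)) has_real_derivative cos (\<theta> z) * speed z) (at z)"
  "((\<lambda>z. cos (t * z)) has_real_derivative - (t * sin (t * z))) (at z)"
  "((\<lambda>z. sin (t * z)) has_real_derivative t * cos (t * z)) (at z)"
  "(speed has_real_derivative t\<^sup>2 * cos (\<theta> z) * sin (\<theta> z)) (at z)"
proof -
  have d: "(\<theta> has_real_derivative speed z) (at z)" using DERIV_theta[of z] by (simp add: speed_def)
  show c: "((\<lambda>z. cos (\<theta> z)) has_real_derivative - (sin (\<theta> z) * speed z)) (at z)"
    using DERIV_chain2[OF DERIV_cos d] by simp
  show "((\<lambda>z. sin (\<theta> z)) has_real_derivative cos (\<theta> z) * speed z) (at z)"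
    using DERIV_chain2[OF DERIV_sin d] by simp
  have tz: "((\<lambda>z. t * z) has_real_derivative t) (at z)" using DERIV_cmult[OF DERIV_ident, of t] by simp
  show "((\<lambda>z. cos (t * z)) has_real_derivative - (t * sin (t * z))) (at z)"
    using DERIV_chain2[OF DERIV_cos tz] by (simp add: mult.commute)
  show "((\<lambda>z. sin (t * z)) has_real_derivative t * cos (t * z)) (at z)"
    using DERIV_chain2[OF DERIV_sin tz] by (simp add: mult.commute)
  have pos: "0 < D - t\<^sup>2 * (cos (\<theta> z))\<^sup>2" by (rule profile_integrand(1)[OF D(1)])
  have "((\<lambda>z. D - t\<^sup>2 * (cos (\<theta> z) * cos (\<theta> z))) has_real_derivative
      0 - t\<^sup>2 * (- (sin (\<theta> z) * speed z) * cos (\<theta> z) + - (sin (\<theta> z) * speed z) * cos (\<theta> z))) (at z)"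
    by (intro DERIV_diff DERIV_const DERIV_cmult DERIV_mult c)
  then have "((\<lambda>z. D - t\<^sup>2 * (cos (\<theta> z))\<^sup>2) has_real_derivative 2 * t\<^sup>2 * sin (\<theta> z) * cos (\<theta> z) * speed z) (at z)"
    by (simp add: power2_eq_square algebra_simps)
  from DERIV_chain2[OF DERIV_real_sqrt[OF pos] this]
  have "((\<lambda>z. sqrt (D - t\<^sup>2 * (cos (\<theta> z))\<^sup>2)) has_real_derivative
     inverse (speed z) / 2 * (2 * t\<^sup>2 * sin (\<theta> z) * cos (\<theta> z) * speed z)) (at z)"
    by (simp add: speed_def)
  then have d1: "((\<lambda>z. sqrt (D - t\<^sup>2 * (cos (\<theta> z))\<^sup>2)) has_real_derivative
     inverse (speed z) / 2 * (2 * t\<^sup>2 * sin (\<theta> z) * cos (\<theta> z) * speed z)) (at z)" .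
  have e1: "inverse (speed z) / 2 * (2 * t\<^sup>2 * sin (\<theta> z) * cos (\<theta> z) * speed z) = t\<^sup>2 * cos (\<theta> z) * sin (\<theta> z)"
    using speed_pos[of z] by (simp add: field_simps)
  have omf: "(\<lambda>z. sqrt (D - t\<^sup>2 * (cos (\<theta> z))\<^sup>2)) = speed" by (rule ext) (simp add: speed_def)
  show "(speed has_real_derivative t\<^sup>2 * cos (\<theta> z) * sin (\<theta> z)) (at z)"
    by (rule DERIV_cong[OF d1[unfolded omf] e1])
qed

lemma DERIV_N:
  "(N1 has_real_derivative P1 z) (at z)" "(N2 has_real_derivative P2 z) (at z)" "(N3 has_real_derivative P3 z) (at z)"
proof -
  show "(N1 has_real_derivative P1 z) (at z)"
    unfolding N1_def[abs_def]
    by (rule DERIV_cong[OF DERIV_mult[OF DERIV_angles(1) DERIV_angles(3)]]) (simp add: P1_def)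
  show "(N2 has_real_derivative P2 z) (at z)"
    unfolding N2_def[abs_def]
    by (rule DERIV_cong[OF DERIV_mult[OF DERIV_angles(1) DERIV_angles(4)]]) (simp add: P2_def)
  show "(N3 has_real_derivative P3 z) (at z)"
    unfolding N3_def[abs_def]
    by (rule DERIV_cong[OF DERIV_angles(2)]) (simp add: P3_def)
qed

text \<open>The Euler-Lagrange system in components. After differentiation by the product rule it is
  a polynomial identity modulo sin^2 + cos^2 = 1 at the angle \<open>\<theta> z\<close>.\<close>

lemma DERIV_P:
  "(P1 has_real_derivative (t\<^sup>2 - multiplier z) * N1 z - 2 * t * P2 z) (at z)"
  "(P2 has_real_derivative (t\<^sup>2 - multiplier z) * N2 z + 2 * t * P1 z) (at z)"
  "(P3 has_real_derivative (t\<^sup>2 - multiplier z) * N3 z) (at z)"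
proof -
  let ?c = "cos (\<theta> z)" and ?s = "sin (\<theta> z)" and ?C = "cos (t * z)" and ?S = "sin (t * z)" and ?w = "speed z"
  have so: "((\<lambda>z. sin (\<theta> z) * speed z) has_real_derivative (?c * ?w) * ?w + (t\<^sup>2 * ?c * ?s) * ?s) (at z)"
    by (rule DERIV_mult[OF DERIV_angles(2) DERIV_angles(5)])
  have s2: "?s\<^sup>2 = 1 - ?c\<^sup>2" by (rule sin_sq)
  have "(P1 has_real_derivative - (((?c * ?w) * ?w + (t\<^sup>2 * ?c * ?s) * ?s) * ?C + - (t * ?S) * (?s * ?w))
      - t * (- (?s * ?w) * ?S + (t * ?C) * ?c)) (at z)"
    unfolding P1_def[abs_def] by (intro DERIV_diff DERIV_minus DERIV_cmult DERIV_mult so DERIV_angles)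
  moreover have "- (((?c * ?w) * ?w + (t\<^sup>2 * ?c * ?s) * ?s) * ?C + - (t * ?S) * (?s * ?w))
      - t * (- (?s * ?w) * ?S + (t * ?C) * ?c) = (t\<^sup>2 - multiplier z) * N1 z - 2 * t * P2 z"
    unfolding multiplier_def N1_def P2_def using s2 by algebra
  ultimately show "(P1 has_real_derivative (t\<^sup>2 - multiplier z) * N1 z - 2 * t * P2 z) (at z)" by simp
  have "(P2 has_real_derivative - (((?c * ?w) * ?w + (t\<^sup>2 * ?c * ?s) * ?s) * ?S + (t * ?C) * (?s * ?w))
      + t * (- (?s * ?w) * ?C + - (t * ?S) * ?c)) (at z)"
    unfolding P2_def[abs_def] by (intro DERIV_add DERIV_minus DERIV_cmult DERIV_mult so DERIV_angles)
  moreover have "- (((?c * ?w) * ?w + (t\<^sup>2 * ?c * ?s) * ?s) * ?S + (t * ?C) * (?s * ?w))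
      + t * (- (?s * ?w) * ?C + - (t * ?S) * ?c) = (t\<^sup>2 - multiplier z) * N2 z + 2 * t * P1 z"
    unfolding multiplier_def N2_def P1_def using s2 by algebra
  ultimately show "(P2 has_real_derivative (t\<^sup>2 - multiplier z) * N2 z + 2 * t * P1 z) (at z)" by simp
  have "(P3 has_real_derivative - (?s * ?w) * ?w + (t\<^sup>2 * ?c * ?s) * ?c) (at z)"
    unfolding P3_def[abs_def] by (intro DERIV_mult DERIV_angles)
  moreover have "- (?s * ?w) * ?w + (t\<^sup>2 * ?c * ?s) * ?c = (t\<^sup>2 - multiplier z) * N3 z"
    unfolding multiplier_def N3_def using s2 by algebra
  ultimately show "(P3 has_real_derivative (t\<^sup>2 - multiplier z) * N3 z) (at z)" by simp
qed

lemma DERIV_riccati: "(riccati has_real_derivative riccati' z) (at z)"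
  unfolding riccati_def[abs_def] riccati'_def
  by (auto intro!: derivative_eq_intros simp: power2_eq_square)

lemma DERIV_calib: "((\<lambda>z. calib z $ i $ j) has_real_derivative calib' z $ i $ j) (at z)"
proof -
  have e: "((\<lambda>z. 2 * t * f z) has_real_derivative 2 * t * f') (at z)" if "(f has_real_derivative f') (at z)" for f f'
    using DERIV_cmult[OF that] .
  have e': "((\<lambda>z. - 2 * t * f z) has_real_derivative - 2 * t * f') (at z)" if "(f has_real_derivative f') (at z)" for f f'
    using DERIV_cmult[OF that] .
  have r: "((\<lambda>z. 2 * riccati z * f z) has_real_derivative 2 * riccati' z * f z + f' * (2 * riccati z)) (at z)" if "(f has_real_derivative f') (at z)" for f f'
    by (rule DERIV_mult[OF DERIV_cmult[OF DERIV_riccati] that])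
  have "((\<lambda>z. 2 * P1 z + 2 * t * N2 z - 2 * riccati z * N1 z) has_real_derivative
      2 * ((t\<^sup>2 - multiplier z) * N1 z - 2 * t * P2 z) + 2 * t * P2 z - (2 * riccati' z * N1 z + P1 z * (2 * riccati z))) (at z)"
    by (intro DERIV_diff DERIV_add e r DERIV_cmult[OF DERIV_P(1)] DERIV_N)
  then have 13: "((\<lambda>z. 2 * P1 z + 2 * t * N2 z - 2 * riccati z * N1 z) has_real_derivative
      2 * (t\<^sup>2 - multiplier z - riccati' z) * N1 z - 2 * t * P2 z - 2 * riccati z * P1 z) (at z)"
    by (rule DERIV_cong) (simp add: algebra_simps)
  have "((\<lambda>z. 2 * P2 z - 2 * t * N1 z - 2 * riccati z * N2 z) has_real_derivative
      2 * ((t\<^sup>2 - multiplier z) * N2 z + 2 * t * P1 z) - 2 * t * P1 z - (2 * riccati' z * N2 z + P2 z * (2 * riccati z))) (at z)"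
    by (intro DERIV_diff DERIV_add e r DERIV_cmult[OF DERIV_P(2)] DERIV_N)
  then have 23: "((\<lambda>z. 2 * P2 z - 2 * t * N1 z - 2 * riccati z * N2 z) has_real_derivative
      2 * (t\<^sup>2 - multiplier z - riccati' z) * N2 z + 2 * t * P1 z - 2 * riccati z * P2 z) (at z)"
    by (rule DERIV_cong) (simp add: algebra_simps)
  have "((\<lambda>z. 2 * P3 z - 2 * riccati z * N3 z) has_real_derivative
      2 * ((t\<^sup>2 - multiplier z) * N3 z) - (2 * riccati' z * N3 z + P3 z * (2 * riccati z))) (at z)"
    by (intro DERIV_diff r DERIV_cmult[OF DERIV_P(3)] DERIV_N)
  then have 33: "((\<lambda>z. 2 * P3 z - 2 * riccati z * N3 z) has_real_derivative
      2 * (t\<^sup>2 - multiplier z - riccati' z) * N3 z - 2 * riccati z * P3 z) (at z)"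
    by (rule DERIV_cong) (simp add: algebra_simps)
  have "\<forall>i j. ((\<lambda>z. calib z $ i $ j) has_real_derivative calib' z $ i $ j) (at z)"
    unfolding forall_3 calib_def calib'_def vector_3
    by (intro conjI DERIV_const e e' DERIV_N 13 23 33)
  then show ?thesis by blast
qed

lemma continuous_profile: "continuous_on A speed" "continuous_on A N1" "continuous_on A N2" "continuous_on A N3"
  "continuous_on A P1" "continuous_on A P2" "continuous_on A P3" "continuous_on A riccati" "continuous_on A riccati'" "continuous_on A multiplier"
proof -
  show "continuous_on A speed" by (intro continuous_at_imp_continuous_on ballI DERIV_isCont[OF DERIV_angles(5)])
  moreover have "continuous_on A \<theta>" by (intro continuous_at_imp_continuous_on ballI DERIV_isCont[OF DERIV_theta])
  ultimately show "continuous_on A multiplier" unfolding multiplier_def[abs_def] by (intro continuous_intros)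
  show "continuous_on A N1" "continuous_on A N2" "continuous_on A N3"
    by (intro continuous_at_imp_continuous_on ballI DERIV_isCont[OF DERIV_N(1)] DERIV_isCont[OF DERIV_N(2)] DERIV_isCont[OF DERIV_N(3)])+
  show "continuous_on A P1" "continuous_on A P2" "continuous_on A P3"
    by (intro continuous_at_imp_continuous_on ballI DERIV_isCont[OF DERIV_P(1)] DERIV_isCont[OF DERIV_P(2)] DERIV_isCont[OF DERIV_P(3)])+
  show "continuous_on A riccati" "continuous_on A riccati'"
    unfolding riccati_def[abs_def] riccati'_def[abs_def] by (intro continuous_intros)+
qed

lemma continuous_calib': "continuous_on A (\<lambda>z. calib' z $ i $ j)"
proof -
  have "\<forall>i j. continuous_on A (\<lambda>z. calib' z $ i $ j)"
    unfolding forall_3 calib'_def vector_3 by (intro conjI continuous_intros continuous_profile)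
  then show ?thesis by blast
qed

lemma continuous_calib_offset: "continuous_on A calib_offset"
  unfolding calib_offset_def[abs_def] by (intro continuous_intros continuous_profile)

section \<open>Algebraic identities and the pointwise comparison\<close>

lemma N_norm: "(N1 z)\<^sup>2 + (N2 z)\<^sup>2 + (N3 z)\<^sup>2 = 1"
proof -
  have "(cos (\<theta> z))\<^sup>2 + (sin (\<theta> z))\<^sup>2 = 1" "(cos (t * z))\<^sup>2 + (sin (t * z))\<^sup>2 = 1" by simp_all
  then show ?thesis unfolding N1_def N2_def N3_def by algebra
qed

lemma N_P: "N1 z * P1 z + N2 z * P2 z + N3 z * P3 z = 0"
proof -
  have "(cos (t * z))\<^sup>2 + (sin (t * z))\<^sup>2 = 1" by simp
  then show ?thesis unfolding N1_def N2_def N3_def P1_def P2_def P3_def by algebra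
qed

lemma P_norm: "(P1 z)\<^sup>2 + (P2 z)\<^sup>2 + (P3 z)\<^sup>2 = (speed z)\<^sup>2 + t\<^sup>2 * (cos (\<theta> z))\<^sup>2"
proof -
  have "(cos (\<theta> z))\<^sup>2 + (sin (\<theta> z))\<^sup>2 = 1" "(cos (t * z))\<^sup>2 + (sin (t * z))\<^sup>2 = 1" by simp_all
  then show ?thesis unfolding P1_def P2_def P3_def by algebra
qed

lemma P_cross: "P1 z * N2 z - P2 z * N1 z = - t * (cos (\<theta> z))\<^sup>2"
proof -
  have "(cos (t * z))\<^sup>2 + (sin (t * z))\<^sup>2 = 1" by simp
  then show ?thesis unfolding P1_def P2_def N1_def N2_def by algebra
qed

lemma multiplier_eq: "multiplier z - t\<^sup>2 - ((P1 z)\<^sup>2 + (P2 z)\<^sup>2 + (P3 z)\<^sup>2) - 2 * t * (P1 z * N2 z - P2 z * N1 z) = 0"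
  unfolding P_norm P_cross multiplier_def using sin_sq[of "\<theta> z"] by algebra

lemma multiplier_le: "multiplier z \<le> D + t\<^sup>2"
proof -
  have "multiplier z = D + t\<^sup>2 - 2 * (t\<^sup>2 * (cos (\<theta> z))\<^sup>2)"
    unfolding multiplier_def speed_sq sin_sq by (simp add: algebra_simps)
  then show ?thesis by simp
qed

text \<open>With s = (z - 1/2)^2 the excess over 3 is 9 s (1 - 4 s) (3 + 4 s), which vanishes at the
  midpoint and at both ends. For a = -(3 x + c x^3) with x = z - 1/2, the value of - a' - a^2 at the
  ends is 3 - (c - 12)^2 / 64, so 12 is the only cubic coefficient that works.\<close>

lemma riccati_ineq:
  assumes "z \<in> {0..1}"
  shows "3 \<le> - riccati' z - (riccati z)\<^sup>2"
proof -
  define s where "s = (z - 1/2)\<^sup>2"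
  have "\<bar>z - 1/2\<bar> \<le> 1/2" unfolding abs_le_iff using assms by auto
  then have s: "0 \<le> s" "s \<le> 1 / 4" using power_mono[of "\<bar>z - 1/2\<bar>" "1/2" 2] by (auto simp: s_def power2_eq_square)
  have "(riccati z)\<^sup>2 = s * (3 + 12 * s)\<^sup>2" unfolding riccati_def s_def by (simp add: power2_eq_square power3_eq_cube algebra_simps)
  then have "- riccati' z - (riccati z)\<^sup>2 = 3 + 9 * s * (1 - 4 * s) * (3 + 4 * s)"
    unfolding riccati'_def s_def[symmetric] by (simp add: power2_eq_square algebra_simps)
  moreover have "0 \<le> 9 * s * (1 - 4 * s) * (3 + 4 * s)" using s by (intro mult_nonneg_nonneg) auto
  ultimately show ?thesis by linarith
qed

lemma calib_integrand_components:
  "calib_integrand z n G = (2 * t * N3 z) * G$2$1 + (- 2 * t * N2 z) * G$3$1 + (- 2 * t * N3 z) * G$1$2 + (2 * t * N1 z) * G$3$2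
       + (2 * P1 z + 2 * t * N2 z - 2 * riccati z * N1 z) * G$1$3 + (2 * P2 z - 2 * t * N1 z - 2 * riccati z * N2 z) * G$2$3 + (2 * P3 z - 2 * riccati z * N3 z) * G$3$3
       + (2 * (t\<^sup>2 - multiplier z - riccati' z) * N1 z - 2 * t * P2 z - 2 * riccati z * P1 z) * n$1
       + (2 * (t\<^sup>2 - multiplier z - riccati' z) * N2 z + 2 * t * P1 z - 2 * riccati z * P2 z) * n$2
       + (2 * (t\<^sup>2 - multiplier z - riccati' z) * N3 z - 2 * riccati z * P3 z) * n$3 + multiplier z + 2 * riccati' z"
  unfolding calib_integrand_def sum_3 calib_def calib'_def vector_3 calib_offset_def by simp

text \<open>On the sphere the square identity leaves nonnegative terms only: the constraint and the
  tangency of the third column of \<open>G\<close> remove the others. At n = 0 the squares are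
  completed in \<open>G\<close> alone, leaving 2 (- a' - a^2 - \<Lambda>) + a^2 - t^2, which beats
  3/10; the distance from 0 to the unit vector N is 1.\<close>

lemma chiral_density_ge_calib:
  assumes z: "z \<in> {0..1}" and n: "norm n = 1 \<and> n$1 * G$1$3 + n$2 * G$2$3 + n$3 * G$3$3 = 0 \<or> n = 0"
  shows "calib_integrand z n G + 3 / 10 * (norm (n - director t \<theta> z))\<^sup>2 \<le> chiral_density t n G"
proof -
  note id = calibration_square_identity[of "G$1$1" "G$1$2" "G$1$3" "G$2$1" "G$2$2" "G$2$3" "G$3$1" "G$3$2" "G$3$3"
      t "n$1" "n$2" "n$3" "N3 z" "N2 z" "N1 z" "P1 z" "riccati z" "P2 z" "P3 z" "multiplier z" "riccati' z"]
  \<comment> \<open>\<Lambda> \<le> D + t^2 \<le> pi^2 / 4 + 2 t^2, with t < 1/4 and pi^2 \<le>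
    9.87.\<close>
  have L: "multiplier z \<le> 2.6" using multiplier_le[of z] D t_sq pi_sq by linarith
  have R: "3 \<le> - riccati' z - (riccati z)\<^sup>2" by (rule riccati_ineq[OF z])
  have nN: "(norm (n - director t \<theta> z))\<^sup>2 = (n$1 - N1 z)\<^sup>2 + (n$2 - N2 z)\<^sup>2 + (n$3 - N3 z)\<^sup>2"
    unfolding norm_sq_vec3 director_eq by simp
  from n show ?thesis
  proof
    assume n: "norm n = 1 \<and> n$1 * G$1$3 + n$2 * G$2$3 + n$3 * G$3$3 = 0"
    then have n1: "(n$1)\<^sup>2 + (n$2)\<^sup>2 + (n$3)\<^sup>2 - 1 = 0" using norm_sq_vec3[of n] by simp
    have N1: "(N1 z)\<^sup>2 + (N2 z)\<^sup>2 + (N3 z)\<^sup>2 - 1 = 0" using N_norm[of z] by simp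
    have "3 / 10 * (norm (n - director t \<theta> z))\<^sup>2 \<le> (- riccati' z - (riccati z)\<^sup>2 - multiplier z - t\<^sup>2) * (norm (n - director t \<theta> z))\<^sup>2"
      using L R t_sq by (intro mult_right_mono) auto
    moreover have "chiral_density t n G - calib_integrand z n G \<ge> (- riccati' z - (riccati z)\<^sup>2 - multiplier z - t\<^sup>2) * (norm (n - director t \<theta> z))\<^sup>2"
      unfolding chiral_density_components calib_integrand_components id nN
      unfolding n1 N1 N_P multiplier_eq conjunct2[OF n] by simp
    ultimately show ?thesis by linarith
  next
    assume n0: "n = 0"
    have nn: "(norm (n - director t \<theta> z))\<^sup>2 = 1" unfolding nN using N_norm[of z] by (simp add: n0)
    have N1: "(N1 z)\<^sup>2 + (N2 z)\<^sup>2 + (N3 z)\<^sup>2 - 1 = 0" using N_norm[of z] by simp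
    have sq: "x\<^sup>2 - c * x \<ge> - (c\<^sup>2 / 4)" for x c :: real
      using zero_le_power2[of "x - c / 2"] by (simp add: power2_diff power_divide algebra_simps)
    have "chiral_density t n G - calib_integrand z n G =
       (G$1$1)\<^sup>2 + (G$2$2)\<^sup>2 + ((G$2$1)\<^sup>2 - (2 * t * N3 z) * G$2$1) + ((G$3$1)\<^sup>2 - (- 2 * t * N2 z) * G$3$1)
       + ((G$1$2)\<^sup>2 - (- 2 * t * N3 z) * G$1$2) + ((G$3$2)\<^sup>2 - (2 * t * N1 z) * G$3$2)
       + ((G$1$3)\<^sup>2 - (2 * P1 z + 2 * t * N2 z - 2 * riccati z * N1 z) * G$1$3)
       + ((G$2$3)\<^sup>2 - (2 * P2 z - 2 * t * N1 z - 2 * riccati z * N2 z) * G$2$3)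
       + ((G$3$3)\<^sup>2 - (2 * P3 z - 2 * riccati z * N3 z) * G$3$3) - multiplier z - 2 * riccati' z"
      unfolding chiral_density_components calib_integrand_components n0 by simp
    also have "\<dots> \<ge> 0 + 0 - ((2 * t * N3 z)\<^sup>2 / 4) - ((- 2 * t * N2 z)\<^sup>2 / 4) - ((- 2 * t * N3 z)\<^sup>2 / 4) - ((2 * t * N1 z)\<^sup>2 / 4)
        - ((2 * P1 z + 2 * t * N2 z - 2 * riccati z * N1 z)\<^sup>2 / 4) - ((2 * P2 z - 2 * t * N1 z - 2 * riccati z * N2 z)\<^sup>2 / 4)
        - ((2 * P3 z - 2 * riccati z * N3 z)\<^sup>2 / 4) - multiplier z - 2 * riccati' z"
      (is "_ \<ge> ?low")
      using sq[where x="G$2$1" and c="2 * t * N3 z"] sq[where x="G$3$1" and c="- 2 * t * N2 z"] sq[where x="G$1$2" and c="- 2 * t * N3 z"] sq[where x="G$3$2" and c="2 * t * N1 z"]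
        sq[where x="G$1$3" and c="2 * P1 z + 2 * t * N2 z - 2 * riccati z * N1 z"] sq[where x="G$2$3" and c="2 * P2 z - 2 * t * N1 z - 2 * riccati z * N2 z"]
        sq[where x="G$3$3" and c="2 * P3 z - 2 * riccati z * N3 z"] zero_le_power2[of "G$1$1"] zero_le_power2[of "G$2$2"]
      by linarith
    also have "?low = - t\<^sup>2 - (riccati z)\<^sup>2 - 2 * multiplier z - 2 * riccati' z
        - (2 * t\<^sup>2 + (riccati z)\<^sup>2) * ((N1 z)\<^sup>2 + (N2 z)\<^sup>2 + (N3 z)\<^sup>2 - 1) + 2 * riccati z * (N1 z * P1 z + N2 z * P2 z + N3 z * P3 z)
        + (multiplier z - t\<^sup>2 - ((P1 z)\<^sup>2 + (P2 z)\<^sup>2 + (P3 z)\<^sup>2) - 2 * t * (P1 z * N2 z - P2 z * N1 z))"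
      by (simp add: power2_eq_square field_simps)
    also have "\<dots> = - t\<^sup>2 - (riccati z)\<^sup>2 - 2 * multiplier z - 2 * riccati' z" unfolding N1 N_P multiplier_eq by simp
    finally show ?thesis unfolding nn using L R t_sq zero_le_power2[of "riccati z"] by linarith
  qed
qed

text \<open>Every square in the identity vanishes at the candidate with its own gradient: the
  calibration is sharp there at each height.\<close>

lemma chiral_density_eq_calib:
  assumes G: "G = vector [vector [0, 0, P1 z], vector [0, 0, P2 z], vector [0, 0, P3 z]]"
  shows "chiral_density t (director t \<theta> z) G = calib_integrand z (director t \<theta> z) G"
proof -
  note id = calibration_square_identity[of 0 0 "P1 z" 0 0 "P2 z" 0 0 "P3 z"
      t "N1 z" "N2 z" "N3 z" "N3 z" "N2 z" "N1 z" "P1 z" "riccati z" "P2 z" "P3 z" "multiplier z" "riccati' z"]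
  have N1: "(N1 z)\<^sup>2 + (N2 z)\<^sup>2 + (N3 z)\<^sup>2 - 1 = 0" using N_norm[of z] by simp
  have "chiral_density t (director t \<theta> z) G - calib_integrand z (director t \<theta> z) G = 0"
    unfolding chiral_density_components calib_integrand_components director_eq G vector_3 id
    unfolding N1 N_P multiplier_eq by simp
  then show ?thesis by simp
qed

section \<open>Boundary values, bounds and smoothness of the director\<close>

lemma director_ends: "director t \<theta> 0 = e1" "director t \<theta> 1 = e3"
  by (simp_all add: director_def theta_0 theta_1 vec_eq_iff forall_3 axis_def)

lemma norm_director: "norm (director t \<theta> z) = 1"
  using norm_sq_vec3[of "director t \<theta> z"] N_norm[of z]
  by (simp add: director_eq power2_eq_1_iff) (metis norm_ge_zero one_neq_neg_one zero_le_one le_minus_one_simps(3))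

lemma norm_director_deriv: "norm (director_deriv z) \<le> 2"
proof (rule power2_le_imp_le)
  have "(norm (director_deriv z))\<^sup>2 = D"
    using P_norm[of z] unfolding norm_sq_vec3 director_deriv_def speed_sq by simp
  then show "(norm (director_deriv z))\<^sup>2 \<le> 2\<^sup>2" using D t_sq pi_sq by simp
qed simp

lemma director_has_vector_derivative: "(director t \<theta> has_vector_derivative director_deriv z) (at z)"
proof -
  have c: "((\<lambda>z. q z *\<^sub>R v) has_vector_derivative q' *\<^sub>R v) (at z)"
    if "(q has_real_derivative q') (at z)" for q q' and v :: "real^3"
    using has_vector_derivative_scaleR[OF that has_vector_derivative_const[of v]] by simp
  show ?thesis
    unfolding director_eq[abs_def] director_deriv_def vector3_eq_axis
    by (intro has_vector_derivative_add c DERIV_N)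
qed

text \<open>The interval is [-1, 2], which contains the heights where the test functions live. There
  |a| \<le> 3 * 3/2 + 12 * 27/8 = 45, and an entry is at most 2 * 2 + 2/4 + 2 * 45 < 100.\<close>

lemma calib_bound:
  assumes z: "\<bar>z - 1/2\<bar> \<le> 3/2"
  shows "\<bar>calib z $ i $ j\<bar> \<le> 100"
proof -
  have Nb: "\<bar>N1 z\<bar> \<le> 1" "\<bar>N2 z\<bar> \<le> 1" "\<bar>N3 z\<bar> \<le> 1"
    using component_le_norm_cart[of "director t \<theta> z" 1] component_le_norm_cart[of "director t \<theta> z" 2]
      component_le_norm_cart[of "director t \<theta> z" 3] norm_director[of z] by (simp_all add: director_eq)
  have Pb: "\<bar>P1 z\<bar> \<le> 2" "\<bar>P2 z\<bar> \<le> 2" "\<bar>P3 z\<bar> \<le> 2"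
    using order_trans[OF component_le_norm_cart norm_director_deriv, of z 1] order_trans[OF component_le_norm_cart norm_director_deriv, of z 2]
      order_trans[OF component_le_norm_cart norm_director_deriv, of z 3] by (simp_all add: director_deriv_def)
  have rb: "\<bar>riccati z\<bar> \<le> 45"
  proof -
    define y where "y = \<bar>z - 1/2\<bar>"
    have y: "0 \<le> y" "y \<le> 3/2" using z by (simp_all add: y_def)
    then have "y^3 \<le> (3/2)^3" by (intro power_mono)
    then have y3: "y^3 \<le> 27 / 8" by (simp add: power3_eq_cube)
    have "\<bar>3 * x + 12 * x^3\<bar> \<le> 3 * \<bar>x\<bar> + 12 * \<bar>x\<bar>^3" for x :: real
      using abs_triangle_ineq[of "3 * x" "12 * x^3"] by (simp add: abs_mult power_abs)
    from this[of "z - 1/2"] have "\<bar>riccati z\<bar> \<le> 3 * y + 12 * y^3"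
      by (simp only: riccati_def abs_minus_cancel y_def)
    also have "\<dots> \<le> 45" using y y3 by linarith
    finally show ?thesis .
  qed
  have tN: "\<bar>t * f\<bar> \<le> 1 / 4" if "\<bar>f\<bar> \<le> 1" for f
    using mult_mono[of t "1/4" "\<bar>f\<bar>" 1] t that by (simp add: abs_mult)
  have rN: "\<bar>riccati z * f\<bar> \<le> 45" if "\<bar>f\<bar> \<le> 1" for f
    using mult_mono[OF rb that] by (simp add: abs_mult)
  have c1: "\<bar>2 * t * f\<bar> \<le> 100" "\<bar>- 2 * t * f\<bar> \<le> 100" if "\<bar>f\<bar> \<le> 1" for f
  proof -
    have e: "2 * t * f = 2 * (t * f)" "- 2 * t * f = - (2 * (t * f))" by simp_all
    show "\<bar>2 * t * f\<bar> \<le> 100" "\<bar>- 2 * t * f\<bar> \<le> 100" unfolding e using tN[OF that] by linarith+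
  qed
  have c2: "\<bar>2 * p + 2 * t * f - 2 * riccati z * g\<bar> \<le> 100" "\<bar>2 * p - 2 * t * f - 2 * riccati z * g\<bar> \<le> 100"
    "\<bar>2 * p - 2 * riccati z * g\<bar> \<le> 100"
    if "\<bar>p\<bar> \<le> 2" "\<bar>f\<bar> \<le> 1" "\<bar>g\<bar> \<le> 1" for p f g
  proof -
    have e: "2 * t * f = 2 * (t * f)" "2 * riccati z * g = 2 * (riccati z * g)" by simp_all
    show "\<bar>2 * p + 2 * t * f - 2 * riccati z * g\<bar> \<le> 100" "\<bar>2 * p - 2 * t * f - 2 * riccati z * g\<bar> \<le> 100"
      "\<bar>2 * p - 2 * riccati z * g\<bar> \<le> 100"
      unfolding e using that(1) tN[OF that(2)] rN[OF that(3)] by linarith+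
  qed
  have "\<forall>i j. \<bar>calib z $ i $ j\<bar> \<le> 100"
    unfolding forall_3 calib_def vector_3
    by (intro conjI c1 Nb c2(1)[OF Pb(1) Nb(2) Nb(1)] c2(2)[OF Pb(2) Nb(1) Nb(2)] c2(3)[OF Pb(3) Nb(3) Nb(3)]) simp_all
  then show ?thesis by blast
qed

text \<open>Including \<open>speed\<close> among the generators closes the system: its derivative is
  \<open>t\<^sup>2 * cos (\<theta> z) * sin (\<theta> z)\<close>, again a product of generators, so
  no new square root ever appears.\<close>

lemma director_smooth_on: "smooth_on S (director t \<theta>)"
proof -
  let ?B = "{\<lambda>z. cos (\<theta> z), \<lambda>z. sin (\<theta> z), \<lambda>z. cos (t * z), \<lambda>z. sin (t * z), speed}"
  have b: "f \<in> derivative_algebra ?B" if "f \<in> ?B" for f using that by (rule derivative_algebra.base)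
  have S: "\<exists>f'\<in>derivative_algebra ?B. \<forall>z. (f has_real_derivative f' z) (at z)" if "f \<in> ?B" for f
  proof -
    note m = derivative_algebra.mult and k = derivative_algebra.const
    have 1: "(\<lambda>z. (- 1) * (sin (\<theta> z) * speed z)) \<in> derivative_algebra ?B" by (intro m k b) auto
    have 2: "(\<lambda>z. cos (\<theta> z) * speed z) \<in> derivative_algebra ?B" by (intro m b) auto
    have 3: "(\<lambda>z. (- t) * sin (t * z)) \<in> derivative_algebra ?B" by (intro m k b) auto
    have 4: "(\<lambda>z. t * cos (t * z)) \<in> derivative_algebra ?B" by (intro m k b) auto
    have 5: "(\<lambda>z. t\<^sup>2 * cos (\<theta> z) * sin (\<theta> z)) \<in> derivative_algebra ?B" by (intro m k b) auto
    show ?thesis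
      using that DERIV_angles bexI[OF _ 1] bexI[OF _ 2] bexI[OF _ 3] bexI[OF _ 4] bexI[OF _ 5] by auto
  qed
  have d: "director t \<theta> = (\<lambda>z. vector [N1 z, N2 z, N3 z])" by (rule ext) (rule director_eq)
  have 1: "N1 \<in> derivative_algebra ?B" unfolding N1_def[abs_def] by (intro derivative_algebra.mult b) simp_all
  have 2: "N2 \<in> derivative_algebra ?B" unfolding N2_def[abs_def] by (intro derivative_algebra.mult b) simp_all
  have 3: "N3 \<in> derivative_algebra ?B" unfolding N3_def[abs_def] by (intro b) simp
  show ?thesis
    unfolding d
    by (intro smooth_on_vector3 derivative_algebra_smooth[OF S] 1 2 3)
qed

end

section \<open>Periodic extension\<close>

text \<open>Each covering set is put into an open ball centred at one of its points, with radius its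
  diameter \<open>d\<close> plus a tiny \<open>e i\<close>. The premeasure weighs the set by pi/4
  d^2, while r^2 \<le> 2 d^2 + 2 e^2; since 2 * 4/pi < 3, the factor is 3.\<close>

lemma small_ball_cover_hausdorff:
  fixes S :: "(real^3) set"
  assumes fin: "hausdorff_measure 2 S < \<infinity>" and \<delta>: "\<delta> > 0" and \<eta>: "\<eta> > 0"
  shows "\<exists>c r. small_ball_cover S (3 * enn2real (hausdorff_measure 2 S) + \<eta>) \<delta> c r"
proof -
  define H where "H = enn2real (hausdorff_measure 2 S)"
  have H: "hausdorff_measure 2 S = ennreal H" "0 \<le> H" using fin by (simp_all add: H_def ennreal_enn2real_if)
  \<comment> \<open>Three times this is \<eta> / 2. The other half of the slack pays for the radii
    \<open>e i\<close>, whose squares sum to at most 2 s^2 \<le> \<eta> / 4.\<close>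
  define \<eta>' where "\<eta>' = \<eta> / 6"
  have \<eta>': "\<eta>' > 0" using \<eta> by (simp add: \<eta>'_def)
  define f where "f C i = (if C i = {} then 0 else unit_ball_vol (real 2) * (diameter (C i) / 2) ^ 2)" for C :: "nat \<Rightarrow> (real^3) set" and i
  have "hausdorff_premeasure 2 (\<delta> / 2) S \<le> hausdorff_measure 2 S"
    unfolding hausdorff_measure_def using \<delta> by (intro SUP_upper) simp
  also have "\<dots> < ennreal (H + \<eta>')" using H \<eta>' by (simp add: ennreal_lessI)
  finally obtain C :: "nat \<Rightarrow> (real^3) set" where
    C: "S \<subseteq> (\<Union>i. C i)" "\<forall>i. bounded (C i) \<and> diameter (C i) < \<delta> / 2" and Cs: "(\<Sum>i. ennreal (f C i)) < ennreal (H + \<eta>')"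
    unfolding hausdorff_premeasure_def INF_less_iff f_def by blast
  have f0: "0 \<le> f C i" for i by (simp add: f_def)
  have fs: "(\<Sum>i<N. f C i) \<le> H + \<eta>'" for N
  proof -
    have "ennreal (\<Sum>i<N. f C i) = (\<Sum>i<N. ennreal (f C i))" using f0 by (simp add: sum_ennreal)
    also have "\<dots> \<le> (\<Sum>i. ennreal (f C i))" by (rule sum_le_suminf) auto
    also have "\<dots> \<le> ennreal (H + \<eta>')" using Cs by simp
    finally show ?thesis using H \<eta>' by (simp add: ennreal_le_iff del: ennreal_plus)
  qed
  define s where "s = min (\<delta> / 4) (sqrt (\<eta> / 8))"
  have s: "0 < s" "s \<le> \<delta> / 4" using \<delta> \<eta> by (auto simp: s_def)
  have s2: "s\<^sup>2 \<le> \<eta> / 8"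
  proof -
    have "s\<^sup>2 \<le> (sqrt (\<eta> / 8))\<^sup>2" using s by (intro power_mono) (auto simp: s_def)
    then show ?thesis using \<eta> by simp
  qed
  define e where "e i = s * (1 / 2) ^ i" for i :: nat
  have e: "0 < e i" "e i \<le> s" for i using s by (auto simp: e_def mult_left_le power_le_one)
  define d where "d i = (if C i = {} then 0 else diameter (C i))" for i
  have d: "0 \<le> d i" "d i < \<delta> / 2" for i using C(2) \<delta> by (auto simp: d_def diameter_ge_0)
  define r where "r i = d i + e i" for i
  \<comment> \<open>For an empty covering set the centre is arbitrary and the radius is just
    \<open>e i\<close>.\<close>
  define c where "c i = (SOME x. x \<in> C i)" for i
  have sub: "C i \<subseteq> ball (c i) (r i)" for i
  proof
    fix x assume x: "x \<in> C i"
    then have "c i \<in> C i" unfolding c_def by (rule someI)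
    then have "dist (c i) x \<le> d i" using x C(2) diameter_bounded_bound[of "C i" "c i" x] by (auto simp: d_def)
    then show "x \<in> ball (c i) (r i)" using e(1)[of i] by (simp add: r_def)
  qed
  have fd: "f C i = pi / 4 * (d i)\<^sup>2" for i
    by (simp add: f_def d_def unit_ball_vol_2 power2_eq_square)
  have sum_e: "(\<Sum>i<N. (e i)\<^sup>2) \<le> 2 * s\<^sup>2" for N
  proof -
    have "(\<Sum>i<N. (e i)\<^sup>2) = s\<^sup>2 * (\<Sum>i<N. (1 / 4) ^ i)"
      by (simp add: e_def power_mult_distrib sum_distrib_left power_one_over power2_eq_square flip: power_mult_distrib)
    also have "(\<Sum>i<N. (1 / 4 :: real) ^ i) \<le> 2"
      by (subst sum_gp_strict) (simp add: field_simps)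
    then have "s\<^sup>2 * (\<Sum>i<N. (1 / 4) ^ i) \<le> s\<^sup>2 * 2" by (intro mult_left_mono) auto
    finally show ?thesis by simp
  qed
  have "small_ball_cover S (3 * H + \<eta>) \<delta> c r"
    unfolding small_ball_cover_def
  proof (intro conjI allI)
    show "0 < r k" "r k < \<delta>" for k using d[of k] e[of k] s by (auto simp: r_def)
    show "S \<subseteq> (\<Union>k. ball (c k) (r k))" using C(1) sub by blast
    fix N
    have "(\<Sum>k<N. (r k)\<^sup>2) \<le> (\<Sum>k<N. 2 * (d k)\<^sup>2 + 2 * (e k)\<^sup>2)"
    proof (rule sum_mono)
      fix k
      show "(r k)\<^sup>2 \<le> 2 * (d k)\<^sup>2 + 2 * (e k)\<^sup>2"
        using sum_squares_bound[of "d k" "e k"] by (simp add: r_def power2_sum)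
    qed
    also have "\<dots> = 2 * (\<Sum>k<N. (d k)\<^sup>2) + 2 * (\<Sum>k<N. (e k)\<^sup>2)" by (simp add: sum.distrib sum_distrib_left)
    also have "2 * (\<Sum>k<N. (d k)\<^sup>2) \<le> 3 * (H + \<eta>')"
    proof -
      have "pi / 4 * (\<Sum>k<N. (d k)\<^sup>2) \<le> H + \<eta>'" using fs[of N] by (simp add: fd sum_distrib_left)
      moreover have "3 / 4 * (\<Sum>k<N. (d k)\<^sup>2) \<le> pi / 4 * (\<Sum>k<N. (d k)\<^sup>2)"
        using pi_gt3 by (intro mult_right_mono sum_nonneg) auto
      moreover have "0 \<le> H + \<eta>'" using H \<eta>' by simp
      ultimately have "3 / 4 * (\<Sum>k<N. (d k)\<^sup>2) \<le> H + \<eta>'" "0 \<le> H + \<eta>'"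
        by (blast intro: order_trans)+
      moreover have "2 * X \<le> 3 * Y" if "3 / 4 * X \<le> Y" "0 \<le> Y" for X Y :: real using that by linarith
      ultimately show ?thesis by blast
    qed
    also have "2 * (\<Sum>k<N. (e k)\<^sup>2) \<le> \<eta> / 2" using sum_e[of N] s2 by linarith
    finally show "(\<Sum>k<N. (r k)\<^sup>2) \<le> 3 * H + \<eta>" by (simp add: \<eta>'_def)
  qed
  then show ?thesis unfolding H_def by blast
qed

text \<open>The index \<open>i\<close> encodes ball \<open>i div m\<close> and translate
  \<open>i mod m\<close>, so a single sequence runs through all copies, and the indices below N * m
  use each ball with index below N exactly m times.\<close>

lemma small_ball_cover_translates:
  fixes S T :: "(real^'n) set" and v :: "nat \<Rightarrow> real^'n"
  assumes c: "small_ball_cover S h \<delta> c r" and m: "m > 0" and T: "T \<subseteq> (\<Union>k<m. (\<lambda>x. x + v k) ` S)"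
  shows "small_ball_cover T (real m * h) \<delta> (\<lambda>i. c (i div m) + v (i mod m)) (\<lambda>i. r (i div m))"
  unfolding small_ball_cover_def
proof (intro conjI allI)
  have r: "\<And>k. 0 < r k" "\<And>k. r k < \<delta>" and S: "S \<subseteq> (\<Union>k. ball (c k) (r k))"
    and sumr: "\<And>N. (\<Sum>k<N. (r k)\<^sup>2) \<le> h"
    using c by (simp_all add: small_ball_cover_def)
  show "0 < r (k div m)" "r (k div m) < \<delta>" for k by (rule r)+
  show "T \<subseteq> (\<Union>i. ball (c (i div m) + v (i mod m)) (r (i div m)))"
  proof
    fix y assume "y \<in> T"
    then obtain k x where k: "k < m" "x \<in> S" "y = x + v k" using T by blast
    then obtain j where j: "x \<in> ball (c j) (r j)" using S by blast
    have "(j * m + k) div m = j" "(j * m + k) mod m = k" using k m by auto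
    then have "y \<in> ball (c ((j * m + k) div m) + v ((j * m + k) mod m)) (r ((j * m + k) div m))"
      using j k by (simp add: dist_norm)
    then show "y \<in> (\<Union>i. ball (c (i div m) + v (i mod m)) (r (i div m)))" by blast
  qed
  fix N
  have "(\<Sum>i<N. (r (i div m))\<^sup>2) \<le> (\<Sum>i<N * m. (r (i div m))\<^sup>2)"
    using m by (intro sum_mono2) auto
  also have "\<dots> = (\<Sum>j<N. \<Sum>i\<in>{j * m..<j * m + m}. (r (i div m))\<^sup>2)"
    by (rule sum.nat_group[symmetric])
  also have "\<dots> = (\<Sum>j<N. \<Sum>i\<in>{j * m..<j * m + m}. (r j)\<^sup>2)"
  proof (intro sum.cong refl)
    fix j i assume "i \<in> {j * m..<j * m + m}"
    then have "i div m = j" using m by (intro div_nat_eqI) (auto simp: mult.commute)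
    then show "(r (i div m))\<^sup>2 = (r j)\<^sup>2" by simp
  qed
  also have "\<dots> = real m * (\<Sum>j<N. (r j)\<^sup>2)" by (simp add: sum_distrib_left)
  also have "\<dots> \<le> real m * h" using sumr by (intro mult_left_mono) auto
  finally show "(\<Sum>i<N. (r (i div m))\<^sup>2) \<le> real m * h" .
qed

lemma hausdorff_measure_mono:
  assumes "A \<subseteq> B" shows "hausdorff_measure k A \<le> hausdorff_measure k B"
  unfolding hausdorff_measure_def hausdorff_premeasure_def
  using assms by (intro SUP_mono' INF_superset_mono) auto

text \<open>For non-measurable \<open>f\<close> both sides are 0 by convention; in this generality
  approximate limits of arbitrary functions can be translated.\<close>

lemma integral_translate_lebesgue:
  fixes f :: "'a::euclidean_space \<Rightarrow> 'b::{banach, second_countable_topology}"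
  shows "(LINT x|lebesgue. f (a + x)) = (LINT x|lebesgue. f x)"
proof (cases "f \<in> borel_measurable lebesgue")
  case True
  then show ?thesis by (rule integral_lebesgue_translate)
next
  case False
  have "(\<lambda>x. f (a + x)) \<notin> borel_measurable lebesgue"
  proof
    assume "(\<lambda>x. f (a + x)) \<in> borel_measurable lebesgue"
    from measurable_compose[OF measurable_lebesgue_translate[of "- a"] this] False show False by simp
  qed
  then show ?thesis using False
    by (metis borel_measurable_integrable not_integrable_integral_eq)
qed

section \<open>Periodicity and locality of approximate limits and gradients\<close>

lemma set_integral_ball_translate:
  fixes f :: "'a::euclidean_space \<Rightarrow> real"
  shows "(LINT y:ball (x + a) r|lebesgue. f y) = (LINT y:ball x r|lebesgue. f (a + y))"
proof -
  have "(LINT y:ball (x + a) r|lebesgue. f y) = (LINT y|lebesgue. indicator (ball (x + a) r) (a + y) *\<^sub>R f (a + y))"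
    unfolding set_lebesgue_integral_def by (rule integral_translate_lebesgue[symmetric])
  also have "\<dots> = (LINT y:ball x r|lebesgue. f (a + y))"
    unfolding set_lebesgue_integral_def
    by (intro Bochner_Integration.integral_cong) (auto simp: indicator_def dist_norm algebra_simps)
  finally show ?thesis .
qed

lemma measure_ball_translate: "measure lebesgue (ball (x + a) r) = measure lebesgue (ball (x :: 'a::euclidean_space) r)"
  by (cases "r \<ge> 0") (auto simp: content_ball ball_empty)

lemma has_approx_limit_periodic:
  fixes u :: "real^'n \<Rightarrow> real^'m"
  assumes "\<And>y. u (a + y) = u y"
  shows "has_approx_limit u (x + a) l \<longleftrightarrow> has_approx_limit u x l"
  unfolding has_approx_limit_def set_integral_ball_translate measure_ball_translate assms ..

lemma has_approx_gradient_periodic: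
  fixes u :: "real^'n \<Rightarrow> real^'m"
  assumes "\<And>y. u (a + y) = u y"
  shows "has_approx_gradient u (x + a) G \<longleftrightarrow> has_approx_gradient u x G"
proof -
  have e: "a + y - (x + a) = y - x" for y by simp
  show ?thesis
    unfolding has_approx_gradient_def has_approx_limit_periodic[where u=u and a=a, OF assms] set_integral_ball_translate
      measure_ball_translate assms e ..
qed

lemma approx_gradient_periodic:
  fixes u :: "real^'n \<Rightarrow> real^'m"
  assumes "\<And>y. u (a + y) = u y"
  shows "approx_gradient u (x + a) = approx_gradient u x"
  unfolding approx_gradient_def has_approx_gradient_periodic[where u=u and a=a, OF assms] ..

lemma set_integral_ball_cong:
  assumes "\<And>y. y \<in> ball x r \<Longrightarrow> f y = g y"
  shows "(LINT y:ball x r|lebesgue. f y) = (LINT y:ball x r|lebesgue. g y)"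
  unfolding set_lebesgue_integral_def
  by (intro Bochner_Integration.integral_cong) (use assms in \<open>auto simp: indicator_def\<close>)

lemma has_approx_limit_local:
  fixes u v :: "real^'n \<Rightarrow> real^'m"
  assumes R: "R > 0" "\<And>y. y \<in> ball x R \<Longrightarrow> u y = v y"
  shows "has_approx_limit u x l \<longleftrightarrow> has_approx_limit v x l"
  unfolding has_approx_limit_def
proof (rule tendsto_cong, rule eventually_at_right_0I[OF R(1)])
  fix r :: real assume r: "0 < r" "r < R"
  show "(LINT y:ball x r|lebesgue. norm (u y - l)) / measure lebesgue (ball x r) = (LINT y:ball x r|lebesgue. norm (v y - l)) / measure lebesgue (ball x r)"
    by (intro arg_cong2[where f="(/)"] set_integral_ball_cong refl) (use R(2) r in auto)
qed

lemma approx_gradient_local: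
  fixes u v :: "real^'n \<Rightarrow> real^'m"
  assumes R: "R > 0" "\<And>y. y \<in> ball x R \<Longrightarrow> u y = v y"
  shows "approx_gradient u x = approx_gradient v x"
proof -
  have l: "((\<lambda>r. (LINT y:ball x r|lebesgue. norm (u y - l - G *v (y - x)) / r) / measure lebesgue (ball x r)) \<longlongrightarrow> 0) (at_right 0)
    \<longleftrightarrow> ((\<lambda>r. (LINT y:ball x r|lebesgue. norm (v y - l - G *v (y - x)) / r) / measure lebesgue (ball x r)) \<longlongrightarrow> 0) (at_right 0)" for l G
  proof (rule tendsto_cong, rule eventually_at_right_0I[OF R(1)])
    fix r :: real assume r: "0 < r" "r < R"
    show "(LINT y:ball x r|lebesgue. norm (u y - l - G *v (y - x)) / r) / measure lebesgue (ball x r) = (LINT y:ball x r|lebesgue. norm (v y - l - G *v (y - x)) / r) / measure lebesgue (ball x r)"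
      by (intro arg_cong2[where f="(/)"] set_integral_ball_cong refl) (use R(2) r in auto)
  qed
  have "has_approx_gradient u x = has_approx_gradient v x"
    by (rule ext) (simp only: has_approx_gradient_def has_approx_limit_local[OF R] l)
  then show ?thesis unfolding approx_gradient_def by simp
qed

text \<open>The weight lives on two periods around 0. Its pieces over [-3L, -L) and [L, 3L) are
  shifted onto the central period, where the three weights add up to the constant \<open>W\<close>:
  1 for the bump, 0 for its derivative.\<close>

lemma periodic_unfold:
  fixes h :: "real^'n \<Rightarrow> real"
  assumes L: "L > 0" and per: "\<And>x. h ((2 * L) *\<^sub>R axis i 1 + x) = h x"
    and w: "\<And>s. \<bar>s\<bar> \<ge> 2 * L \<Longrightarrow> w s = 0"
    and W: "\<And>s. - L \<le> s \<Longrightarrow> s < L \<Longrightarrow> w (s - 2 * L) + w s + w (s + 2 * L) = W"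
    and int: "integrable lebesgue (\<lambda>x. w (x $ i) * h x)"
  shows "integrable lebesgue (\<lambda>x. indicator {x. - L \<le> x $ i \<and> x $ i < L} x * (W * h x))"
    and "(LINT x|lebesgue. w (x $ i) * h x) = (LINT x|lebesgue. indicator {x. - L \<le> x $ i \<and> x $ i < L} x * (W * h x))"
proof -
  let ?a = "(2 * L) *\<^sub>R axis i 1 :: real^'n"
  let ?Q = "{x::real^'n. - L \<le> x $ i \<and> x $ i < L}"
  define f where "f x = w (x $ i) * h x" for x
  have per': "h (- ?a + x) = h x" for x using per[of "- ?a + x"] by simp
  have Qm: "{x::real^'n. l \<le> x $ i \<and> x $ i < m} \<in> sets lebesgue" for l m
  proof -
    have "{x \<in> space borel. l \<le> (x::real^'n) $ i \<and> x $ i < m} \<in> sets borel" by measurable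
    then show ?thesis by (auto intro: sets_completionI_sets)
  qed
  have piece: "integrable lebesgue (\<lambda>x. indicator {x. l \<le> x $ i \<and> x $ i < m} x * f x)" for l m
    using integrable_mult_indicator[OF Qm int, of l m] by (simp add: f_def)
  have I0: "integrable lebesgue (\<lambda>x. indicator ?Q x * (w (x $ i) * h x))"
    using piece[of "- L" L] by (simp add: f_def)
  have eqp: "indicator {x. - 3 * L \<le> x $ i \<and> x $ i < - L} (- ?a + x) * f (- ?a + x) = indicator ?Q x * (w (x $ i - 2 * L) * h x)" for x
    unfolding f_def per' by (auto simp: indicator_def axis_def)
  have eqm: "indicator {x. L \<le> x $ i \<and> x $ i < 3 * L} (?a + x) * f (?a + x) = indicator ?Q x * (w (x $ i + 2 * L) * h x)" for x
    unfolding f_def per by (auto simp: indicator_def axis_def add.commute)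
  have Ip: "integrable lebesgue (\<lambda>x. indicator ?Q x * (w (x $ i - 2 * L) * h x))"
    and Ep: "(LINT x|lebesgue. indicator ?Q x * (w (x $ i - 2 * L) * h x)) = (LINT x|lebesgue. indicator {x. - 3 * L \<le> x $ i \<and> x $ i < - L} x * f x)"
    using piece[of "- 3 * L" "- L"] integrable_lebesgue_translate[OF borel_measurable_integrable[OF piece[of "- 3 * L" "- L"]], of "- ?a"]
      integral_lebesgue_translate[OF borel_measurable_integrable[OF piece[of "- 3 * L" "- L"]], of "- ?a"]
    unfolding eqp by simp_all
  have Im: "integrable lebesgue (\<lambda>x. indicator ?Q x * (w (x $ i + 2 * L) * h x))"
    and Em: "(LINT x|lebesgue. indicator ?Q x * (w (x $ i + 2 * L) * h x)) = (LINT x|lebesgue. indicator {x. L \<le> x $ i \<and> x $ i < 3 * L} x * f x)"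
    using piece[of L "3 * L"] integrable_lebesgue_translate[OF borel_measurable_integrable[OF piece[of L "3 * L"]], of ?a]
      integral_lebesgue_translate[OF borel_measurable_integrable[OF piece[of L "3 * L"]], of ?a]
    unfolding eqm by simp_all
  have sumW: "indicator ?Q x * (W * h x) = indicator ?Q x * (w (x $ i - 2 * L) * h x) + (indicator ?Q x * (w (x $ i) * h x) + indicator ?Q x * (w (x $ i + 2 * L) * h x))" for x
    using W[of "x $ i", symmetric] by (auto simp: indicator_def algebra_simps)
  show "integrable lebesgue (\<lambda>x. indicator ?Q x * (W * h x))"
    unfolding sumW by (intro Bochner_Integration.integrable_add Ip I0 Im)
  have split: "f x = indicator {x. - 3 * L \<le> x $ i \<and> x $ i < - L} x * f x + (indicator ?Q x * f x + indicator {x. L \<le> x $ i \<and> x $ i < 3 * L} x * f x)" for x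
  proof (cases "\<bar>x $ i\<bar> < 2 * L")
    case True
    then show ?thesis using L by (auto simp: indicator_def)
  next
    case False
    then show ?thesis using w[of "x $ i"] by (simp add: f_def)
  qed
  have "(LINT x|lebesgue. f x) = (LINT x|lebesgue. indicator {x. - 3 * L \<le> x $ i \<and> x $ i < - L} x * f x + (indicator ?Q x * f x + indicator {x. L \<le> x $ i \<and> x $ i < 3 * L} x * f x))"
    by (rule Bochner_Integration.integral_cong[OF refl split])
  also have "\<dots> = (LINT x|lebesgue. indicator {x. - 3 * L \<le> x $ i \<and> x $ i < - L} x * f x) + ((LINT x|lebesgue. indicator ?Q x * f x) + (LINT x|lebesgue. indicator {x. L \<le> x $ i \<and> x $ i < 3 * L} x * f x))"
    by (simp only: Bochner_Integration.integral_add[OF piece Bochner_Integration.integrable_add[OF piece piece]] Bochner_Integration.integral_add[OF piece piece])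
  also have "\<dots> = (LINT x|lebesgue. indicator ?Q x * (w (x $ i - 2 * L) * h x) + (indicator ?Q x * (w (x $ i) * h x) + indicator ?Q x * (w (x $ i + 2 * L) * h x)))"
    unfolding Ep[symmetric] Em[symmetric] Bochner_Integration.integral_add[OF Ip Bochner_Integration.integrable_add[OF I0 Im]]
      Bochner_Integration.integral_add[OF I0 Im] by (simp only: f_def)
  finally show "(LINT x|lebesgue. w (x $ i) * h x) = (LINT x|lebesgue. indicator ?Q x * (W * h x))"
    unfolding sumW f_def .
qed

text \<open>A difference of steps whose arguments are one unit apart, so that translates by 2L
  telescope to 1. Overlapping the neighbouring periods puts the lateral faces into the interior of
  the test region, where a mismatch of boundary values is an ordinary jump.\<close>

definition bump :: "real \<Rightarrow> real \<Rightarrow> real" where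
  "bump L s = smoothstep (1 + s / (2 * L)) - smoothstep (s / (2 * L))"

definition bump' :: "real \<Rightarrow> real \<Rightarrow> real" where
  "bump' L s = (smoothstep' (1 + s / (2 * L)) - smoothstep' (s / (2 * L))) / (2 * L)"

lemma DERIV_bump: "L > 0 \<Longrightarrow> (bump L has_real_derivative bump' L s) (at s)"
  unfolding bump_def[abs_def] bump'_def
  by (auto intro!: derivative_eq_intros DERIV_chain2[OF DERIV_smoothstep] simp: field_simps)

lemma continuous_bump': "L > 0 \<Longrightarrow> continuous_on A (bump' L)"
  unfolding bump'_def[abs_def]
  by (intro continuous_intros continuous_on_compose2[OF continuous_smoothstep'[of UNIV]]) auto

lemma bump_outside:
  assumes "L > 0" "\<bar>s\<bar> \<ge> 2 * L"
  shows "bump L s = 0" "bump' L s = 0"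
proof -
  have "1 \<le> s / (2 * L) \<or> 1 + s / (2 * L) \<le> 0" using assms by (auto simp: field_simps abs_if split: if_splits)
  then show "bump L s = 0" "bump' L s = 0"
    by (auto simp: bump_def bump'_def smoothstep_eq_0 smoothstep_eq_1 smoothstep'_eq_0)
qed

lemma bump_partition:
  assumes "L > 0" "- L \<le> s" "s < L"
  shows "bump L (s - 2 * L) + bump L s + bump L (s + 2 * L) = 1"
    "bump' L (s - 2 * L) + bump' L s + bump' L (s + 2 * L) = 0"
proof -
  have e: "(s - 2 * L) / (2 * L) = s / (2 * L) - 1" "(s + 2 * L) / (2 * L) = s / (2 * L) + 1"
    using assms by (auto simp: field_simps)
  have b: "s / (2 * L) - 1 \<le> 0" "1 \<le> 1 + (s / (2 * L) + 1)" using assms by (auto simp: field_simps)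
  show "bump L (s - 2 * L) + bump L s + bump L (s + 2 * L) = 1"
    unfolding bump_def e using smoothstep_eq_0[OF b(1)] smoothstep_eq_1[OF b(2)] by (simp add: add.commute)
  show "bump' L (s - 2 * L) + bump' L s + bump' L (s + 2 * L) = 0"
    unfolding bump'_def e add_divide_distrib[symmetric] using smoothstep'_eq_0[OF disjI1[OF b(1)]] smoothstep'_eq_0[OF disjI2[OF b(2)]]
    by (simp add: add.commute)
qed

lemma bump_bounds: "L > 0 \<Longrightarrow> 0 \<le> bump L s" "bump L s \<le> 1"
  using smoothstep_mono[of "s / (2 * L)" "1 + s / (2 * L)"] smoothstep_bounds[of "s / (2 * L)"] smoothstep_bounds[of "1 + s / (2 * L)"]
  by (auto simp: bump_def)

text \<open>Equal to 1 on [0, 1] and supported slightly beyond, where the extended map is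
  prescribed; in this way the plates become interior too.\<close>

definition plateau :: "real \<Rightarrow> real \<Rightarrow> real" where
  "plateau e z = smoothstep (1 + z / e) - smoothstep ((z - 1) / e)"

definition plateau' :: "real \<Rightarrow> real \<Rightarrow> real" where
  "plateau' e z = (smoothstep' (1 + z / e) - smoothstep' ((z - 1) / e)) / e"

lemma DERIV_plateau: "e > 0 \<Longrightarrow> (plateau e has_real_derivative plateau' e z) (at z)"
  unfolding plateau_def[abs_def] plateau'_def
  by (auto intro!: derivative_eq_intros DERIV_chain2[OF DERIV_smoothstep] simp: field_simps)

lemma continuous_plateau': "e > 0 \<Longrightarrow> continuous_on A (plateau' e)"
  unfolding plateau'_def[abs_def]
  by (intro continuous_intros continuous_on_compose2[OF continuous_smoothstep'[of UNIV]]) auto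

lemma plateau_inside:
  assumes "e > 0" "0 \<le> z" "z \<le> 1"
  shows "plateau e z = 1" "plateau' e z = 0"
  using assms by (simp_all add: plateau_def plateau'_def smoothstep_eq_0 smoothstep_eq_1 smoothstep'_eq_0 divide_nonpos_pos)

lemma plateau_outside:
  assumes "e > 0" "z \<le> - e \<or> 1 + e \<le> z"
  shows "plateau e z = 0"
proof -
  from assms(2) show ?thesis
  proof
    assume z: "z \<le> - e"
    have "1 + z / e \<le> 0" "(z - 1) / e \<le> 0" using z assms(1) by (auto simp: field_simps)
    then show ?thesis by (simp add: plateau_def smoothstep_eq_0)
  next
    assume z: "1 + e \<le> z"
    have "1 \<le> 1 + z / e" "1 \<le> (z - 1) / e" using z assms(1) by (auto simp: field_simps)
    then show ?thesis by (simp add: plateau_def smoothstep_eq_1)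
  qed
qed

lemma plateau_bounds: "\<bar>plateau e z\<bar> \<le> 1"
  using smoothstep_bounds[of "1 + z / e"] smoothstep_bounds[of "(z - 1) / e"] by (auto simp: plateau_def abs_le_iff)

section \<open>The extended map and its lattice symmetry\<close>

lemma wrap_add_period:
  assumes "L > 0"
  shows "wrap L (2 * L * of_int m + x) = wrap L x"
proof -
  have "(2 * L * of_int m + x + L) / (2 * L) = (x + L) / (2 * L) + of_int m"
    using assms by (simp add: field_simps)
  then show ?thesis by (simp add: wrap_def algebra_simps)
qed

lemma wrap_id:
  assumes "L > 0" "- L \<le> x" "x < L"
  shows "wrap L x = x"
proof -
  have "\<lfloor>(x + L) / (2 * L)\<rfloor> = 0" using assms by (intro floor_unique) auto
  then show ?thesis by (simp add: wrap_def)
qed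

lemma wrap_cases:
  assumes "L > 0" "\<bar>x\<bar> < 3 * L"
  obtains m :: int where "m \<in> {-1, 0, 1}" "wrap L x = x - 2 * L * of_int m" "- L \<le> wrap L x" "wrap L x < L"
proof -
  define q where "q = (x + L) / (2 * L)"
  have x: "x = 2 * L * q - L" using assms(1) by (simp add: q_def)
  have "-1 < q" "q < 2" using assms by (auto simp: q_def field_simps abs_if split: if_splits)
  then have "- 1 \<le> \<lfloor>q\<rfloor>" "\<lfloor>q\<rfloor> < 2" by linarith+
  then have "\<lfloor>q\<rfloor> = -1 \<or> \<lfloor>q\<rfloor> = 0 \<or> \<lfloor>q\<rfloor> = 1" by linarith
  then have m: "\<lfloor>q\<rfloor> \<in> {-1, 0, 1}" by blast
  have "2 * L * of_int \<lfloor>q\<rfloor> \<le> 2 * L * q" "2 * L * q < 2 * L * (of_int \<lfloor>q\<rfloor> + 1)"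
    using assms(1) by (intro mult_left_mono mult_strict_left_mono; linarith)+
  then have "- L \<le> wrap L x" "wrap L x < L" unfolding wrap_def q_def[symmetric] by (simp_all add: x algebra_simps)
  moreover have "wrap L x = x - 2 * L * of_int \<lfloor>q\<rfloor>" by (simp add: wrap_def q_def)
  ultimately show ?thesis using that m by blast
qed

definition lattice_shift :: "real \<Rightarrow> real \<Rightarrow> int \<Rightarrow> int \<Rightarrow> real^3" where
  "lattice_shift L1 L2 k m = vector [2 * L1 * of_int k, 2 * L2 * of_int m, 0]"

lemma lattice_shift_nth [simp]:
  "lattice_shift L1 L2 k m $ 1 = 2 * L1 * of_int k" "lattice_shift L1 L2 k m $ 2 = 2 * L2 * of_int m"
  "lattice_shift L1 L2 k m $ 3 = 0"
  by (simp_all add: lattice_shift_def)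

lemma extend_periodic:
  assumes "L1 > 0" "L2 > 0"
  shows "extend L1 L2 n (lattice_shift L1 L2 k m + p) = extend L1 L2 n p"
  by (simp add: extend_def wrap_add_period[OF assms(1)] wrap_add_period[OF assms(2)])

lemma lattice_shift_axis:
  "lattice_shift L1 L2 1 0 = (2 * L1) *\<^sub>R axis 1 1" "lattice_shift L1 L2 0 1 = (2 * L2) *\<^sub>R axis 2 1"
  by (simp_all add: vec_eq_iff forall_3 axis_def)

lemma extend_cell: "L1 > 0 \<Longrightarrow> L2 > 0 \<Longrightarrow> p \<in> cell L1 L2 \<Longrightarrow> extend L1 L2 n p = n p"
proof -
  assume a: "L1 > 0" "L2 > 0" "p \<in> cell L1 L2"
  then have "vector [wrap L1 (p $ 1), wrap L2 (p $ 2), p $ 3] = p"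
    by (simp add: vec_eq_iff forall_3 cell_def wrap_id)
  then show ?thesis using a by (simp add: extend_def cell_def)
qed

lemma AE_lebesgue_translate:
  fixes P :: "'a::euclidean_space \<Rightarrow> bool"
  assumes "AE x in lebesgue. P x" shows "AE x in lebesgue. P (a + x)"
  using AE_distrD[OF measurable_lebesgue_translate[of a], of P, unfolded lebesgue_translate, OF assms] .

lemma AE_nth_neq: "AE p in lebesgue. (p :: real^'n) $ i \<noteq> c"
proof -
  have "negligible {p :: real^'n. p $ i = c}" 
    using negligible_standard_hyperplane[of "axis i 1 :: real^'n" c] by (simp add: inner_axis)
  then have "AE p in lebesgue. p \<notin> {p :: real^'n. p $ i = c}" by (intro AE_not_in) (simp add: negligible_iff_null_sets)
  then show ?thesis by simp
qed

lemma C1_fun_nth_compose: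
  assumes "\<And>s. (f has_real_derivative f' s) (at s)" "continuous_on UNIV f'"
  shows "C1_fun (\<lambda>p. f (p $ k)) (\<lambda>p. f' (p $ k) *\<^sub>R axis k 1)"
  by (rule C1_fun_compose[OF assms C1_fun_nth])

lemma double_unfold:
  fixes h :: "real^3 \<Rightarrow> real"
  assumes L: "L1 > 0" "L2 > 0"
    and per: "\<And>x. h (lattice_shift L1 L2 1 0 + x) = h x" "\<And>x. h (lattice_shift L1 L2 0 1 + x) = h x"
    and w1: "\<And>s. \<bar>s\<bar> \<ge> 2 * L1 \<Longrightarrow> w1 s = 0" "\<And>s. - L1 \<le> s \<Longrightarrow> s < L1 \<Longrightarrow> w1 (s - 2 * L1) + w1 s + w1 (s + 2 * L1) = W1"
    and w2: "\<And>s. \<bar>s\<bar> \<ge> 2 * L2 \<Longrightarrow> w2 s = 0" "\<And>s. - L2 \<le> s \<Longrightarrow> s < L2 \<Longrightarrow> w2 (s - 2 * L2) + w2 s + w2 (s + 2 * L2) = W2"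
    and int: "integrable lebesgue (\<lambda>p. w1 (p $ 1) * (w2 (p $ 2) * h p))"
  shows "integrable lebesgue (\<lambda>p. indicator {p. - L1 \<le> p $ 1 \<and> p $ 1 < L1 \<and> - L2 \<le> p $ 2 \<and> p $ 2 < L2} p * (W1 * W2 * h p))"
    and "(LINT p|lebesgue. w1 (p $ 1) * (w2 (p $ 2) * h p)) =
      (LINT p|lebesgue. indicator {p. - L1 \<le> p $ 1 \<and> p $ 1 < L1 \<and> - L2 \<le> p $ 2 \<and> p $ 2 < L2} p * (W1 * W2 * h p))"
proof -
  let ?Q1 = "{p::real^3. - L1 \<le> p $ 1 \<and> p $ 1 < L1}" and ?Q2 = "{p::real^3. - L2 \<le> p $ 2 \<and> p $ 2 < L2}"
  have p1: "w2 (((2 * L1) *\<^sub>R axis 1 1 + x) $ 2) * h ((2 * L1) *\<^sub>R axis 1 1 + x) = w2 (x $ 2) * h x" for x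
    using per(1)[of x] by (simp add: lattice_shift_axis axis_def)
  note u1 = periodic_unfold[where i=1 and L=L1 and h="\<lambda>p. w2 (p $ 2) * h p" and w=w1 and W=W1, OF L(1) p1 w1 int]
  have r: "indicator ?Q1 p * (W1 * (w2 (p $ 2) * h p)) = w2 (p $ 2) * (indicator ?Q1 p * (W1 * h p))" for p by simp
  have p2: "indicator ?Q1 ((2 * L2) *\<^sub>R axis 2 1 + x) * (W1 * h ((2 * L2) *\<^sub>R axis 2 1 + x)) = indicator ?Q1 x * (W1 * h x)" for x
    using per(2)[of x] by (simp add: lattice_shift_axis axis_def indicator_def)
  note u2 = periodic_unfold[where i=2 and L=L2 and h="\<lambda>p. indicator ?Q1 p * (W1 * h p)" and w=w2 and W=W2, OF L(2) p2 w2 u1(1)[unfolded r]]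
  have q: "indicator ?Q2 p * (W2 * (indicator ?Q1 p * (W1 * h p))) = indicator {p. - L1 \<le> p $ 1 \<and> p $ 1 < L1 \<and> - L2 \<le> p $ 2 \<and> p $ 2 < L2} p * (W1 * W2 * h p)" for p
    by (auto simp: indicator_def)
  show "integrable lebesgue (\<lambda>p. indicator {p. - L1 \<le> p $ 1 \<and> p $ 1 < L1 \<and> - L2 \<le> p $ 2 \<and> p $ 2 < L2} p * (W1 * W2 * h p))"
    using u2(1) unfolding q .
  show "(LINT p|lebesgue. w1 (p $ 1) * (w2 (p $ 2) * h p)) =
      (LINT p|lebesgue. indicator {p. - L1 \<le> p $ 1 \<and> p $ 1 < L1 \<and> - L2 \<le> p $ 2 \<and> p $ 2 < L2} p * (W1 * W2 * h p))"
    using u1(2) u2(2) unfolding r q by simp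
qed

lemma set_integral_AE_eq_UNIV:
  fixes f g :: "'a::euclidean_space \<Rightarrow> real"
  assumes f: "set_integrable lebesgue V f" and eq: "AE x in lebesgue. x \<in> V \<longrightarrow> f x = g x" and out: "\<And>x. x \<notin> V \<Longrightarrow> g x = 0"
  shows "integrable lebesgue g" "(LINT x:V|lebesgue. f x) = (LINT x|lebesgue. g x)"
proof -
  have ae: "AE x in lebesgue. indicator V x *\<^sub>R f x = g x"
    using eq by eventually_elim (use out in \<open>auto simp: indicator_def\<close>)
  have m: "(\<lambda>x. indicator V x *\<^sub>R f x) \<in> borel_measurable lebesgue" using f by (auto simp: set_integrable_def)
  have gm: "g \<in> borel_measurable lebesgue" by (rule borel_measurable_AE[OF m ae])
  show "integrable lebesgue g"
    using f integrable_cong_AE[OF m gm ae] by (simp add: set_integrable_def)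
  show "(LINT x:V|lebesgue. f x) = (LINT x|lebesgue. g x)"
    unfolding set_lebesgue_integral_def by (rule integral_cong_AE[OF m gm ae])
qed

lemma approx_gradient_locally_const:
  fixes u :: "real^'n \<Rightarrow> real^'m"
  assumes "R > 0" "\<And>y. y \<in> ball x R \<Longrightarrow> u y = c"
  shows "approx_gradient u x = 0" "has_approx_limit u x c"
proof -
  have d: "((\<lambda>_. c) has_derivative (\<lambda>h. (0 :: real^'n^'m) *v h)) (at x)" by simp
  have "approx_gradient (\<lambda>_::real^'n. c) x = 0"
    by (rule approx_gradient_eqI[OF continuous_set_integrable_ball zero_less_one has_derivative_has_approx_gradient[OF d]]) simp
  then show "approx_gradient u x = 0" using approx_gradient_local[where u=u and v="\<lambda>_. c", OF assms] by simp
  show "has_approx_limit u x c"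
    using has_approx_limit_local[where u=u and v="\<lambda>_. c", OF assms] continuous_has_approx_limit[where u="\<lambda>_::real^'n. c" and x=x] by simp
qed

lemma open_cell: "open (cell L1 L2)"
  unfolding cell_def by (intro open_Collect_conj open_Collect_less continuous_intros)

lemma ball_third_component: "y \<in> ball p (r::real) \<Longrightarrow> \<bar>y $ i - (p :: real^3) $ i\<bar> < r"
  using component_le_norm_cart[of "y - p" i] by (simp add: dist_norm norm_minus_commute)

lemma extend_outside:
  assumes "p $ 3 < 0 \<or> 1 < p $ 3"
  obtains R where "R > 0" "\<And>y. y \<in> ball p R \<Longrightarrow> extend L1 L2 n y = (if p $ 3 \<le> 0 then e1 else e3)"
proof -
  from assms show ?thesis
  proof
    assume z: "p $ 3 < 0"
    show ?thesis
    proof (rule that[of "- (p $ 3)"])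
      fix y assume "y \<in> ball p (- (p $ 3))"
      from ball_third_component[OF this, of 3] show "extend L1 L2 n y = (if p $ 3 \<le> 0 then e1 else e3)"
        using z by (simp add: extend_def abs_less_iff)
    qed (use z in simp)
  next
    assume z: "1 < p $ 3"
    show ?thesis
    proof (rule that[of "p $ 3 - 1"])
      fix y assume "y \<in> ball p (p $ 3 - 1)"
      from ball_third_component[OF this, of 3] show "extend L1 L2 n y = (if p $ 3 \<le> 0 then e1 else e3)"
        using z by (simp add: extend_def abs_less_iff)
    qed (use z in simp)
  qed
qed

text \<open>Open, bounded and, for small \<open>e\<close>, contained in the slab, so that
  admissibility speaks about it. The margins 3L and 2e exceed the supports 2L of the bump and
  \<open>e\<close> of the plateau.\<close>

definition period_box :: "real \<Rightarrow> real \<Rightarrow> real \<Rightarrow> (real^3) set" where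
  "period_box L1 L2 e = {p. \<bar>p $ 1\<bar> < 3 * L1 \<and> \<bar>p $ 2\<bar> < 3 * L2 \<and> - 2 * e < p $ 3 \<and> p $ 3 < 1 + 2 * e}"

lemma period_box_open: "open (period_box L1 L2 e)"
  unfolding period_box_def by (intro open_Collect_conj open_Collect_less continuous_intros)

lemma period_box_bounded: "bounded (period_box L1 L2 e)"
proof (rule bounded_subset)
  show "bounded (cbox (vector [- 3 * L1, - 3 * L2, - 2 * e]) (vector [3 * L1, 3 * L2, 1 + 2 * e]) :: (real^3) set)"
    by (rule bounded_cbox)
  show "period_box L1 L2 e \<subseteq> cbox (vector [- 3 * L1, - 3 * L2, - 2 * e]) (vector [3 * L1, 3 * L2, 1 + 2 * e])"
    by (auto simp: period_box_def mem_box_cart forall_3)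
qed

text \<open>Beyond the plates the extension is locally constant, so the box catches the whole jump
  set even when the slab is thicker. Finiteness of the measure of the jump set is derived from this
  inclusion.\<close>

lemma jump_set_subset:
  assumes "L1 > 0" "L2 > 0" "e > 0"
  shows "jump_set L1 L2 \<epsilon> n \<subseteq> approx_discont_set (period_box L1 L2 e) (extend L1 L2 n)"
proof
  fix p assume p: "p \<in> jump_set L1 L2 \<epsilon> n"
  then have nl: "\<not> (\<exists>a. has_approx_limit (extend L1 L2 n) p a)"
    and b: "- L1 \<le> p $ 1" "p $ 1 < L1" "- L2 \<le> p $ 2" "p $ 2 < L2"
    by (auto simp: jump_set_def approx_discont_set_def)
  have "\<not> (p $ 3 < 0 \<or> 1 < p $ 3)"
  proof
    assume "p $ 3 < 0 \<or> 1 < p $ 3"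
    then obtain R where "R > 0" "\<And>y. y \<in> ball p R \<Longrightarrow> extend L1 L2 n y = (if p $ 3 \<le> 0 then e1 else e3)"
      by (rule extend_outside[where n=n and ?L1.0=L1 and ?L2.0=L2]) (rule that)
    from approx_gradient_locally_const(2)[where u="extend L1 L2 n" and x=p, OF this] nl show False by blast
  qed
  then show "p \<in> approx_discont_set (period_box L1 L2 e) (extend L1 L2 n)"
    using nl b assms by (auto simp: approx_discont_set_def period_box_def)
qed

text \<open>Shifts by -1, 0 or 1 periods in each lateral direction bring every point of the box into
  the half-open period. The nine combinations are the factor 9 in the bound on the singular
  part.\<close>

lemma discont_set_subset_translates:
  assumes L: "L1 > 0" "L2 > 0" and e: "period_box L1 L2 e \<subseteq> slab \<epsilon>"
  shows "approx_discont_set (period_box L1 L2 e) (extend L1 L2 n) \<subseteq>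
    (\<Union>k<9. (\<lambda>x. x + lattice_shift L1 L2 (int (k div 3) - 1) (int (k mod 3) - 1)) ` jump_set L1 L2 \<epsilon> n)"
proof
  fix x assume x: "x \<in> approx_discont_set (period_box L1 L2 e) (extend L1 L2 n)"
  then have xb: "\<bar>x $ 1\<bar> < 3 * L1" "\<bar>x $ 2\<bar> < 3 * L2" and xs: "x \<in> slab \<epsilon>"
    and nl: "\<not> (\<exists>a. has_approx_limit (extend L1 L2 n) x a)"
    using e by (auto simp: approx_discont_set_def period_box_def)
  obtain m1 :: int where m1: "m1 \<in> {-1, 0, 1}" "wrap L1 (x $ 1) = x $ 1 - 2 * L1 * of_int m1" "- L1 \<le> wrap L1 (x $ 1)" "wrap L1 (x $ 1) < L1"
    by (rule wrap_cases[OF L(1) xb(1)]) (rule that)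
  obtain m2 :: int where m2: "m2 \<in> {-1, 0, 1}" "wrap L2 (x $ 2) = x $ 2 - 2 * L2 * of_int m2" "- L2 \<le> wrap L2 (x $ 2)" "wrap L2 (x $ 2) < L2"
    by (rule wrap_cases[OF L(2) xb(2)]) (rule that)
  define a where "a = lattice_shift L1 L2 m1 m2"
  define y where "y = x - a"
  have xy: "x = y + a" by (simp add: y_def)
  have per: "extend L1 L2 n (a + z) = extend L1 L2 n z" for z
    unfolding a_def by (rule extend_periodic[OF L])
  have "\<not> (\<exists>l. has_approx_limit (extend L1 L2 n) y l)"
    using nl unfolding xy has_approx_limit_periodic[where u="extend L1 L2 n" and a=a, OF per] .
  moreover have "y \<in> slab \<epsilon>" using xs by (simp add: slab_def y_def a_def)
  ultimately have yJ: "y \<in> jump_set L1 L2 \<epsilon> n"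
    using m1 m2 by (simp add: jump_set_def approx_discont_set_def y_def a_def)
  \<comment> \<open>The two shifts, moved to {0, 1, 2}, are the base-3 digits of the index.\<close>
  define k where "k = nat (3 * (m1 + 1) + (m2 + 1))"
  have "k < 9" "int (k div 3) - 1 = m1" "int (k mod 3) - 1 = m2" using m1(1) m2(1) by (auto simp: k_def)
  then show "x \<in> (\<Union>k<9. (\<lambda>x. x + lattice_shift L1 L2 (int (k div 3) - 1) (int (k mod 3) - 1)) ` jump_set L1 L2 \<epsilon> n)"
    using yJ xy by (intro UN_I[of k]) (auto simp: a_def)
qed

text \<open>The constraint holds almost everywhere in one cell, and the countably many lattice
  translates of the exceptional set still form a null set.\<close>

lemma extend_AE_bound:
  assumes L: "L1 > 0" "L2 > 0" and n: "n \<in> admissible L1 L2 \<epsilon>"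
  shows "AE p in lebesgue. p \<in> period_box L1 L2 e \<longrightarrow> norm (extend L1 L2 n p) \<le> 1"
proof -
  \<comment> \<open>The last two conditions discard the faces that \<open>wrap\<close> can hit, its
    range being half-open, but that the open cell does not contain.\<close>
  define PP where "PP p \<longleftrightarrow> (p \<in> cell L1 L2 \<longrightarrow> n p \<in> sphere 0 1 \<union> {0}) \<and> p $ 1 \<noteq> - L1 \<and> p $ 2 \<noteq> - L2" for p
  have "AE p in lebesgue. p \<in> cell L1 L2 \<longrightarrow> n p \<in> sphere 0 1 \<union> {0}" using n by (simp add: admissible_def)
  with AE_nth_neq[of 1 "- L1"] AE_nth_neq[of 2 "- L2"] have "AE p in lebesgue. PP p"
    unfolding PP_def by eventually_elim auto
  then have "AE p in lebesgue. PP (lattice_shift L1 L2 k m + p)" for k m by (rule AE_lebesgue_translate)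
  then have "AE p in lebesgue. \<forall>k m. PP (lattice_shift L1 L2 k m + p)"
    unfolding AE_all_countable by blast
  then show ?thesis
  proof eventually_elim
    case (elim p)
    show ?case
    proof
      assume p: "p \<in> period_box L1 L2 e"
      show "norm (extend L1 L2 n p) \<le> 1"
      proof (cases "0 < p $ 3 \<and> p $ 3 < 1")
        case False
        then show ?thesis by (auto simp: extend_def)
      next
        case True
        have b: "\<bar>p $ 1\<bar> < 3 * L1" "\<bar>p $ 2\<bar> < 3 * L2" using p by (auto simp: period_box_def)
        obtain m1 :: int where m1: "m1 \<in> {-1, 0, 1}" "wrap L1 (p $ 1) = p $ 1 - 2 * L1 * of_int m1" "- L1 \<le> wrap L1 (p $ 1)" "wrap L1 (p $ 1) < L1"
          by (rule wrap_cases[OF L(1) b(1)]) (rule that)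
        obtain m2 :: int where m2: "m2 \<in> {-1, 0, 1}" "wrap L2 (p $ 2) = p $ 2 - 2 * L2 * of_int m2" "- L2 \<le> wrap L2 (p $ 2)" "wrap L2 (p $ 2) < L2"
          by (rule wrap_cases[OF L(2) b(2)]) (rule that)
        define q where "q = lattice_shift L1 L2 (- m1) (- m2) + p"
        have PPq: "PP q" using elim by (simp add: q_def)
        have q: "q = vector [wrap L1 (p $ 1), wrap L2 (p $ 2), p $ 3]"
          by (simp add: vec_eq_iff forall_3 q_def m1(2) m2(2))
        have "q \<in> cell L1 L2" using PPq m1 m2 True unfolding PP_def by (auto simp: q cell_def)
        then have "n q \<in> sphere 0 1 \<union> {0}" using PPq by (simp add: PP_def)
        then show ?thesis using True by (auto simp: extend_def q)
      qed
    qed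
  qed
qed

section \<open>Integration of the calibration\<close>

context director_profile
begin

context
  fixes L1 L2 \<epsilon> :: real
  assumes L1: "L1 > 0" and L2: "L2 > 0" and eps: "\<epsilon> > 0"
begin

text \<open>A third of \<open>\<epsilon>\<close> because the box reaches 2 * margin beyond the
  plates and must stay in the slab; at most 1/4 so that the bound 100 on the calibration is valid on
  the support of the cut-off.\<close>

definition margin :: real where "margin = min (\<epsilon> / 3) (1 / 4)"

lemma margin: "0 < margin" "2 * margin < \<epsilon>" "margin \<le> 1 / 4"
  using eps by (auto simp: margin_def)

definition calib_cut :: "3 \<Rightarrow> 3 \<Rightarrow> real \<Rightarrow> real" where
  "calib_cut i j z = plateau margin z * calib z $ i $ j"

definition calib_cut' :: "3 \<Rightarrow> 3 \<Rightarrow> real \<Rightarrow> real" where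
  "calib_cut' i j z = plateau' margin z * calib z $ i $ j + calib' z $ i $ j * plateau margin z"

lemma DERIV_calib_cut: "(calib_cut i j has_real_derivative calib_cut' i j z) (at z)"
  unfolding calib_cut_def[abs_def] calib_cut'_def by (rule DERIV_mult[OF DERIV_plateau[OF margin(1)] DERIV_calib])

lemma continuous_calib_cut': "continuous_on A (calib_cut' i j)"
proof -
  have c: "continuous_on A (\<lambda>z. calib z $ i $ j)" "continuous_on A (plateau margin)"
    by (intro continuous_at_imp_continuous_on ballI DERIV_isCont[OF DERIV_calib] DERIV_isCont[OF DERIV_plateau[OF margin(1)]])+
  show ?thesis unfolding calib_cut'_def[abs_def]
    by (intro continuous_on_add continuous_on_mult c continuous_calib' continuous_plateau'[OF margin(1)])
qed

lemma calib_cut_bound: "\<bar>calib_cut i j z\<bar> \<le> 100"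
proof (cases "z \<le> - margin \<or> 1 + margin \<le> z")
  case True
  then show ?thesis by (simp add: calib_cut_def plateau_outside[OF margin(1)])
next
  case False
  then have "\<bar>z - 1/2\<bar> \<le> 3/2" using margin(3) by linarith
  from calib_bound[OF this] have "\<bar>plateau margin z\<bar> * \<bar>calib z $ i $ j\<bar> \<le> 1 * 100"
    by (intro mult_mono plateau_bounds) auto
  then show ?thesis by (simp add: calib_cut_def abs_mult)
qed

definition calib_test :: "3 \<Rightarrow> 3 \<Rightarrow> real^3 \<Rightarrow> real" where
  "calib_test i j p = bump L1 (p $ 1) * (bump L2 (p $ 2) * calib_cut i j (p $ 3))"

definition calib_test' :: "3 \<Rightarrow> 3 \<Rightarrow> real^3 \<Rightarrow> real^3" where
  "calib_test' i j p = vector [bump' L1 (p $ 1) * (bump L2 (p $ 2) * calib_cut i j (p $ 3)),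
     bump L1 (p $ 1) * (bump' L2 (p $ 2) * calib_cut i j (p $ 3)),
     bump L1 (p $ 1) * (bump L2 (p $ 2) * calib_cut' i j (p $ 3))]"

lemma test_function_calib_test: "test_function (period_box L1 L2 margin) (calib_test i j) (calib_test' i j)"
proof (rule test_functionI)
  let ?K = "cbox (vector [- 2 * L1, - 2 * L2, - margin]) (vector [2 * L1, 2 * L2, 1 + margin]) :: (real^3) set"
  have b1: "C1_fun (\<lambda>p::real^3. bump L1 (p $ 1)) (\<lambda>p. bump' L1 (p $ 1) *\<^sub>R axis 1 1)"
    by (rule C1_fun_nth_compose[OF DERIV_bump[OF L1] continuous_bump'[OF L1]])
  have b2: "C1_fun (\<lambda>p::real^3. bump L2 (p $ 2)) (\<lambda>p. bump' L2 (p $ 2) *\<^sub>R axis 2 1)"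
    by (rule C1_fun_nth_compose[OF DERIV_bump[OF L2] continuous_bump'[OF L2]])
  have b3: "C1_fun (\<lambda>p::real^3. calib_cut i j (p $ 3)) (\<lambda>p. calib_cut' i j (p $ 3) *\<^sub>R axis 3 1)"
    by (rule C1_fun_nth_compose[OF DERIV_calib_cut continuous_calib_cut'])
  have e: "calib_test' i j = (\<lambda>p. bump L1 (p $ 1) *\<^sub>R (bump L2 (p $ 2) *\<^sub>R (calib_cut' i j (p $ 3) *\<^sub>R axis 3 1) + calib_cut i j (p $ 3) *\<^sub>R (bump' L2 (p $ 2) *\<^sub>R axis 2 1))
      + (bump L2 (p $ 2) * calib_cut i j (p $ 3)) *\<^sub>R (bump' L1 (p $ 1) *\<^sub>R axis 1 1))"
    by (rule ext) (simp add: calib_test'_def vec_eq_iff forall_3 axis_def)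
  show "C1_fun (calib_test i j) (calib_test' i j)"
    unfolding e calib_test_def[abs_def] by (rule C1_fun_mult[OF b1 C1_fun_mult[OF b2 b3]])
  show "compact ?K" by (rule compact_cbox)
  show "?K \<subseteq> period_box L1 L2 margin"
    using L1 L2 margin(1) by (auto simp: period_box_def mem_box_cart forall_3)
  fix p assume "p \<notin> ?K"
  then have "2 * L1 \<le> \<bar>p $ 1\<bar> \<or> 2 * L2 \<le> \<bar>p $ 2\<bar> \<or> p $ 3 \<le> - margin \<or> 1 + margin \<le> p $ 3"
    by (auto simp: mem_box_cart forall_3)
  then show "calib_test i j p = 0"
    using bump_outside(1)[OF L1, of "p $ 1"] bump_outside(1)[OF L2, of "p $ 2"] plateau_outside[OF margin(1), of "p $ 3"]
    by (auto simp: calib_test_def calib_cut_def)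
qed

lemma calib_test_bound: "\<bar>calib_test i j p\<bar> \<le> 100"
proof -
  have "\<bar>bump L1 (p $ 1)\<bar> * (\<bar>bump L2 (p $ 2)\<bar> * \<bar>calib_cut i j (p $ 3)\<bar>) \<le> 1 * (1 * 100)"
    using bump_bounds(1)[OF L1, of "p $ 1"] bump_bounds(1)[OF L2, of "p $ 2"] bump_bounds(2) calib_cut_bound[of i j "p $ 3"]
    by (intro mult_mono) auto
  then show ?thesis by (simp add: calib_test_def abs_mult)
qed

abbreviation "period_column \<equiv> {p :: real^3. - L1 \<le> p $ 1 \<and> p $ 1 < L1 \<and> - L2 \<le> p $ 2 \<and> p $ 2 < L2}"

lemma calib_test_unfold:
  fixes h :: "real^3 \<Rightarrow> real"
  assumes per: "\<And>k m x. h (lattice_shift L1 L2 k m + x) = h x"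
    and int: "integrable lebesgue (\<lambda>p. bump L1 (p $ 1) * (bump L2 (p $ 2) * (f (p $ 3) * h p)))"
  shows "integrable lebesgue (\<lambda>p. indicator period_column p * (f (p $ 3) * h p))"
    "(LINT p|lebesgue. bump L1 (p $ 1) * (bump L2 (p $ 2) * (f (p $ 3) * h p))) = (LINT p|lebesgue. indicator period_column p * (f (p $ 3) * h p))"
proof -
  note du = double_unfold[where h="\<lambda>p. f (p $ 3) * h p" and ?w1.0="bump L1" and ?w2.0="bump L2" and ?W1.0=1 and ?W2.0=1,
      OF L1 L2 _ _ bump_outside(1)[OF L1] bump_partition(1)[OF L1] bump_outside(1)[OF L2] bump_partition(1)[OF L2] int]
  show "integrable lebesgue (\<lambda>p. indicator period_column p * (f (p $ 3) * h p))"
    "(LINT p|lebesgue. bump L1 (p $ 1) * (bump L2 (p $ 2) * (f (p $ 3) * h p))) = (LINT p|lebesgue. indicator period_column p * (f (p $ 3) * h p))"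
    using du per by simp_all
qed

text \<open>The derivative identity for \<open>calib_test\<close> on the box, unfolded to one
  period. Lateral derivatives fall on a bump, whose derivative sums to zero over the translates, so
  only j = 3 leaves a zero-order term. The rest is the singular integral, at most 300 * 100 * 9 * 3
  = 810000 times the area of the jump set.\<close>

lemma calib_by_parts:
  assumes n: "n \<in> admissible L1 L2 \<epsilon>"
  defines "u \<equiv> extend L1 L2 n"
  shows "integrable lebesgue (\<lambda>p. indicator period_column p * (calib_cut i j (p $ 3) * approx_gradient u p $ i $ j))" (is ?I1)
    and "integrable lebesgue (\<lambda>p. indicator period_column p * (calib_cut' i 3 (p $ 3) * u p $ i))" (is ?I2)
    and "\<bar>(LINT p|lebesgue. indicator period_column p * (calib_cut i j (p $ 3) * approx_gradient u p $ i $ j)) +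
      (if j = 3 then LINT p|lebesgue. indicator period_column p * (calib_cut' i 3 (p $ 3) * u p $ i) else 0)\<bar>
      \<le> 810000 * enn2real (hausdorff_measure 2 (jump_set L1 L2 \<epsilon> n))" (is ?B)
proof -
  let ?V = "period_box L1 L2 margin"
  have Vslab: "?V \<subseteq> slab \<epsilon>" using margin by (auto simp: period_box_def slab_def)
  have uV: "u \<in> SBV2 ?V"
  proof -
    have "\<forall>V. open V \<and> bounded V \<and> V \<subseteq> slab \<epsilon> \<longrightarrow> u \<in> SBV2 V" using n by (simp add: admissible_def u_def)
    from this[rule_format, of ?V] show ?thesis using Vslab period_box_open period_box_bounded by simp
  qed
  have ui: "set_integrable lebesgue ?V u" using uV by (simp add: SBV2_def SBV_def BV_def)
  \<comment> \<open>The decomposition from the definition of \<open>SBV\<close>, whose singular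
    measure sits on the discontinuity set; \<open>Geq\<close> identifies its density with
    \<open>approx_gradient\<close>.\<close>
  obtain G \<mu> \<sigma> where BV: "has_BV_derivative ?V u G \<mu> \<sigma>" and conc: "AE x in \<mu>. x \<in> approx_discont_set ?V u"
    using uV unfolding SBV2_def SBV_def by blast
  have Sfin: "hausdorff_measure 2 (approx_discont_set ?V u) < \<infinity>" using uV by (simp add: SBV2_def)
  have per: "u (lattice_shift L1 L2 k m + x) = u x" for k m x unfolding u_def by (rule extend_periodic[OF L1 L2])
  have perG: "approx_gradient u (lattice_shift L1 L2 k m + x) = approx_gradient u x" for k m x
    using approx_gradient_periodic[where u=u and a="lattice_shift L1 L2 k m", OF per, of x] by (simp add: add.commute)
  let ?J = "jump_set L1 L2 \<epsilon> n"
  have Jfin: "hausdorff_measure 2 ?J < \<infinity>"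
    using hausdorff_measure_mono[OF jump_set_subset[OF L1 L2 margin(1)]] Sfin unfolding u_def by (rule le_less_trans)
  define H where "H = enn2real (hausdorff_measure 2 ?J)"
  have H0: "0 \<le> H" by (simp add: H_def)
  have bd: "AE x in lebesgue. x \<in> ?V \<longrightarrow> \<bar>u x $ i\<bar> \<le> 1" for i
    using extend_AE_bound[OF L1 L2 n, of margin]
  proof eventually_elim
    case (elim x)
    then show ?case using component_le_norm_cart[of "u x" i] unfolding u_def by auto
  qed
  have R: "\<bar>LINT x|\<mu>. calib_test i j x * \<sigma> x $ i $ j\<bar> \<le> 810000 * H" for i j
  proof (rule field_le_epsilon)
    fix e :: real assume e: "e > 0"
    \<comment> \<open>270000 = 300 * 100 * 9 multiplies \<eta> in the bound below.\<close>
    define \<eta> where "\<eta> = e / 270000"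
    have \<eta>: "\<eta> > 0" using e by (simp add: \<eta>_def)
    have "\<bar>LINT x|\<mu>. calib_test i j x * \<sigma> x $ i $ j\<bar> \<le> 300 * 100 * (real 9 * (3 * H + \<eta>))"
    proof (rule singular_part_bound[OF BV period_box_open ui bd conc test_function_calib_test calib_test_bound])
      show "\<exists>c r. small_ball_cover (approx_discont_set ?V u) (real 9 * (3 * H + \<eta>)) \<delta> c r" if \<delta>: "\<delta> > 0" for \<delta>
      proof -
        obtain c r where "small_ball_cover ?J (3 * H + \<eta>) \<delta> c r"
          using small_ball_cover_hausdorff[OF Jfin \<delta> \<eta>] unfolding H_def by blast
        from small_ball_cover_translates[OF this zero_less_numeral discont_set_subset_translates[OF L1 L2 Vslab, of n, folded u_def]]
        show ?thesis by blast
      qed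
      show "0 \<le> real 9 * (3 * H + \<eta>)" using H0 \<eta> by simp
    qed
    also have "\<dots> = 810000 * H + e" by (simp add: \<eta>_def)
    finally show "\<bar>LINT x|\<mu>. calib_test i j x * \<sigma> x $ i $ j\<bar> \<le> 810000 * H + e" .
  qed
  have Geq: "AE x in lebesgue. x \<in> ?V \<longrightarrow> approx_gradient u x = G x"
    using BV_approx_gradient[OF BV ui period_box_open] by eventually_elim blast
  have "set_integrable lebesgue ?V G" using BV by (simp add: has_BV_derivative_def)
  then have Gij: "set_integrable lebesgue ?V (\<lambda>x. G x $ i $ j)" for i j
    by (rule set_integrable_nth[OF set_integrable_nth])
  have uij: "set_integrable lebesgue ?V (\<lambda>x. u x $ i)" for i by (rule set_integrable_nth[OF ui])
  note tf = test_function_calib_test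
  have GI: "integrable lebesgue (\<lambda>p. calib_test i j p * approx_gradient u p $ i $ j)"
    and GE: "(LINT x:?V|lebesgue. calib_test i j x * G x $ i $ j) = (LINT p|lebesgue. calib_test i j p * approx_gradient u p $ i $ j)" for i j
  proof -
    have s: "set_integrable lebesgue ?V (\<lambda>x. calib_test i j x * G x $ i $ j)"
      by (rule set_integrable_bounded_mult(1)[OF Gij test_function_measurable(3)[OF tf] calib_test_bound])
    have ae: "AE x in lebesgue. x \<in> ?V \<longrightarrow> calib_test i j x * G x $ i $ j = calib_test i j x * approx_gradient u x $ i $ j"
      using Geq by eventually_elim simp
    have out: "calib_test i j x * approx_gradient u x $ i $ j = 0" if "x \<notin> ?V" for x
      using test_function_outside(1)[OF tf that] by simp
    show "integrable lebesgue (\<lambda>p. calib_test i j p * approx_gradient u p $ i $ j)"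
      by (rule set_integral_AE_eq_UNIV(1)[OF s ae out])
    show "(LINT x:?V|lebesgue. calib_test i j x * G x $ i $ j) = (LINT p|lebesgue. calib_test i j p * approx_gradient u p $ i $ j)"
      by (rule set_integral_AE_eq_UNIV(2)[OF s ae out])
  qed
  have UI: "integrable lebesgue (\<lambda>p. u p $ i * calib_test' i j p $ l)"
    and UE: "(LINT x:?V|lebesgue. u x $ i * calib_test' i j x $ l) = (LINT p|lebesgue. u p $ i * calib_test' i j p $ l)" for i j l
  proof -
    obtain B where B: "\<And>x. norm (calib_test' i j x) \<le> B" by (rule test_function_bounded[OF tf[of i j]]) blast
    have Bj: "\<bar>calib_test' i j x $ l\<bar> \<le> B" for x by (rule order_trans[OF component_le_norm_cart B])
    have s: "set_integrable lebesgue ?V (\<lambda>x. u x $ i * calib_test' i j x $ l)"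
      by (rule set_integrable_bounded_mult(2)[OF uij test_function_measurable(4)[OF tf] Bj])
    have out: "u x $ i * calib_test' i j x $ l = 0" if "x \<notin> ?V" for x
      using test_function_outside(2)[OF tf that] by simp
    have ae: "AE x in lebesgue. x \<in> ?V \<longrightarrow> u x $ i * calib_test' i j x $ l = u x $ i * calib_test' i j x $ l" by simp
    show "integrable lebesgue (\<lambda>p. u p $ i * calib_test' i j p $ l)"
      by (rule set_integral_AE_eq_UNIV(1)[OF s ae out])
    show "(LINT x:?V|lebesgue. u x $ i * calib_test' i j x $ l) = (LINT p|lebesgue. u p $ i * calib_test' i j p $ l)"
      by (rule set_integral_AE_eq_UNIV(2)[OF s ae out])
  qed
  have e1: "calib_test i j p * approx_gradient u p $ i $ j = bump L1 (p $ 1) * (bump L2 (p $ 2) * (calib_cut i j (p $ 3) * approx_gradient u p $ i $ j))" for i j p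
    by (simp add: calib_test_def)
  have perGij: "approx_gradient u (lattice_shift L1 L2 k m + x) $ i $ j = approx_gradient u x $ i $ j" for k m x i j
    by (simp add: perG)
  have perui: "u (lattice_shift L1 L2 k m + x) $ i = u x $ i" for k m x i by (simp add: per)
  note T = calib_test_unfold[where f="calib_cut i j" and h="\<lambda>p. approx_gradient u p $ i $ j", OF perGij GI[unfolded e1]]
  show ?I1 by (rule T(1))
  have e3: "u p $ i * calib_test' i 3 p $ 3 = bump L1 (p $ 1) * (bump L2 (p $ 2) * (calib_cut' i 3 (p $ 3) * u p $ i))" for p
    by (simp add: calib_test'_def)
  note T3 = calib_test_unfold[where f="calib_cut' i 3" and h="\<lambda>p. u p $ i", OF perui UI[of i 3 3, unfolded e3]]
  show ?I2 by (rule T3(1))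
  have id: "(LINT p|lebesgue. u p $ i * calib_test' i j p $ j) = - (LINT p|lebesgue. calib_test i j p * approx_gradient u p $ i $ j) - (LINT x|\<mu>. calib_test i j x * \<sigma> x $ i $ j)"
    unfolding UE[symmetric] GE[symmetric] using BV tf unfolding has_BV_derivative_def by blast
  have Uj: "(LINT p|lebesgue. u p $ i * calib_test' i j p $ j) = (if j = 3 then LINT p|lebesgue. indicator period_column p * (calib_cut' i 3 (p $ 3) * u p $ i) else 0)"
  proof -
    consider "j = 1" | "j = 2" | "j = 3" using exhaust_3 by blast
    then show ?thesis
    proof cases
      case 1
      have e: "u p $ i * calib_test' i 1 p $ 1 = bump' L1 (p $ 1) * (bump L2 (p $ 2) * (calib_cut i 1 (p $ 3) * u p $ i))" for p
        by (simp add: calib_test'_def)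
      have "(LINT p|lebesgue. u p $ i * calib_test' i 1 p $ 1) = 0"
        using double_unfold(2)[where h="\<lambda>p. calib_cut i 1 (p $ 3) * u p $ i" and ?w1.0="bump' L1" and ?w2.0="bump L2" and ?W1.0=0 and ?W2.0=1,
            OF L1 L2 _ _ bump_outside(2)[OF L1] bump_partition(2)[OF L1] bump_outside(1)[OF L2] bump_partition(1)[OF L2] UI[of i 1 1, unfolded e]]
        unfolding e by (simp add: per)
      then show ?thesis using 1 by simp
    next
      case 2
      have e: "u p $ i * calib_test' i 2 p $ 2 = bump L1 (p $ 1) * (bump' L2 (p $ 2) * (calib_cut i 2 (p $ 3) * u p $ i))" for p
        by (simp add: calib_test'_def)
      have "(LINT p|lebesgue. u p $ i * calib_test' i 2 p $ 2) = 0"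
        using double_unfold(2)[where h="\<lambda>p. calib_cut i 2 (p $ 3) * u p $ i" and ?w1.0="bump L1" and ?w2.0="bump' L2" and ?W1.0=1 and ?W2.0=0,
            OF L1 L2 _ _ bump_outside(1)[OF L1] bump_partition(1)[OF L1] bump_outside(2)[OF L2] bump_partition(2)[OF L2] UI[of i 2 2, unfolded e]]
        unfolding e by (simp add: per)
      then show ?thesis using 2 by simp
    next
      case 3
      then show ?thesis using T3(2) unfolding e3[symmetric] by simp
    qed
  qed
  have "(LINT p|lebesgue. indicator period_column p * (calib_cut i j (p $ 3) * approx_gradient u p $ i $ j)) +
      (if j = 3 then LINT p|lebesgue. indicator period_column p * (calib_cut' i 3 (p $ 3) * u p $ i) else 0) = - (LINT x|\<mu>. calib_test i j x * \<sigma> x $ i $ j)"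
    using id unfolding Uj e1 T(2) by linarith
  then show ?B using R[of i j] unfolding H_def by simp
qed


section \<open>The total of the calibration\<close>

definition beyond_plates :: "(real^3) set" where "beyond_plates = {p. p $ 3 \<le> 0 \<or> 1 \<le> p $ 3}"

definition boundary_value :: "real^3 \<Rightarrow> real^3" where "boundary_value p = (if p $ 3 \<le> 0 then e1 else e3)"

text \<open>What the calibration integrates to in the absence of jumps. The region beyond the plates
  enters only through the cut-off calibration and the prescribed boundary values, so the number is
  the same for every map.\<close>

definition calib_total :: real where
  "calib_total = (LINT p:cell L1 L2|lebesgue. calib_offset (p $ 3))
     - (\<Sum>i\<in>UNIV. LINT p|lebesgue. indicator (period_column \<inter> beyond_plates) p * (calib_cut' i 3 (p $ 3) * boundary_value p $ i))"

lemma integral_AE_eq: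
  fixes f g :: "'a::euclidean_space \<Rightarrow> real"
  assumes "integrable lebesgue f" "AE x in lebesgue. f x = g x"
  shows "integrable lebesgue g" "(LINT x|lebesgue. f x) = (LINT x|lebesgue. g x)"
  using set_integral_AE_eq_UNIV[of UNIV f g] assms by (simp_all add: set_integrable_def set_lebesgue_integral_def)

lemma cell_measurable: "cell L1 L2 \<in> sets lebesgue" "emeasure lebesgue (cell L1 L2) < \<infinity>" "bounded (cell L1 L2)"
proof -
  have "cell L1 L2 \<subseteq> period_box L1 L2 margin" using L1 L2 margin(1) by (auto simp: cell_def period_box_def)
  then show b: "bounded (cell L1 L2)" by (rule bounded_subset[OF period_box_bounded])
  show m: "cell L1 L2 \<in> sets lebesgue" using open_cell[of L1 L2] by auto
  have "cell L1 L2 \<in> lmeasurable" by (rule bounded_set_imp_lmeasurable[OF b m])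
  then show "emeasure lebesgue (cell L1 L2) < \<infinity>" by (auto simp: fmeasurable_def)
qed

lemma calib_offset_integrable: "set_integrable lebesgue (cell L1 L2) (\<lambda>p. calib_offset (p $ 3))"
proof -
  obtain R where R: "cell L1 L2 \<subseteq> ball 0 R" using cell_measurable(3) bounded_subset_ballD by blast
  have "continuous_on UNIV (\<lambda>p::real^3. calib_offset (p $ 3))"
    by (rule continuous_on_compose2[OF continuous_calib_offset[of UNIV]]) (auto intro!: continuous_intros)
  from continuous_set_integrable_ball[OF this, of 0 R] show ?thesis
    by (rule set_integrable_subset) (use cell_measurable R in auto)
qed

lemma AE_generic: "AE p in lebesgue. (p::real^3) $ 1 \<noteq> - L1 \<and> p $ 2 \<noteq> - L2 \<and> p $ 3 \<noteq> 0 \<and> p $ 3 \<noteq> 1"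
  using AE_nth_neq[of 1 "- L1"] AE_nth_neq[of 2 "- L2"] AE_nth_neq[of 3 0] AE_nth_neq[of 3 1] by eventually_elim simp

lemma calib_cut_inside: "p \<in> cell L1 L2 \<Longrightarrow> calib_cut i j (p $ 3) = calib (p $ 3) $ i $ j"
  "p \<in> cell L1 L2 \<Longrightarrow> calib_cut' i j (p $ 3) = calib' (p $ 3) $ i $ j"
  using plateau_inside[OF margin(1), of "p $ 3"] by (simp_all add: cell_def calib_cut_def calib_cut'_def)

lemma approx_gradient_extend_cell:
  assumes "p \<in> cell L1 L2" shows "approx_gradient (extend L1 L2 n) p = approx_gradient n p"
proof -
  obtain R where R: "R > 0" "ball p R \<subseteq> cell L1 L2" using open_cell[of L1 L2] assms open_contains_ball by blast
  have "extend L1 L2 n y = n y" if "y \<in> ball p R" for y using extend_cell[OF L1 L2] R that by blast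
  from approx_gradient_local[where u="extend L1 L2 n" and v=n, OF R(1) this] show ?thesis .
qed

text \<open>The nine component identities are summed, and the zero-order terms beyond the plates are
  moved into \<open>calib_total\<close>. The error is 9 * 810000 = 7290000 times the area of the
  jump set.\<close>

lemma calib_integral:
  assumes n: "n \<in> admissible L1 L2 \<epsilon>"
  shows "set_integrable lebesgue (cell L1 L2) (\<lambda>p. calib_integrand (p $ 3) (n p) (approx_gradient n p))"
    and "\<bar>(LINT p:cell L1 L2|lebesgue. calib_integrand (p $ 3) (n p) (approx_gradient n p)) - calib_total\<bar>
      \<le> 7290000 * enn2real (hausdorff_measure 2 (jump_set L1 L2 \<epsilon> n))"
proof -
  let ?C = "cell L1 L2"
  define u where "u = extend L1 L2 n"
  define H where "H = enn2real (hausdorff_measure 2 (jump_set L1 L2 \<epsilon> n))"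
  define T where "T i j = (LINT p|lebesgue. indicator period_column p * (calib_cut i j (p $ 3) * approx_gradient u p $ i $ j))" for i j
  define F where "F i p = indicator period_column p * (calib_cut' i 3 (p $ 3) * u p $ i)" for i p
  define g where "g i j p = indicator ?C p * (calib (p $ 3) $ i $ j * approx_gradient n p $ i $ j)" for i j p
  define f where "f i p = indicator ?C p * (calib' (p $ 3) $ i $ 3 * n p $ i)" for i p
  note mi = calib_by_parts[OF n, folded u_def]
  have sub: "p \<in> ?C \<Longrightarrow> p \<in> period_column" for p by (auto simp: cell_def)
  \<comment> \<open>Off a null set of faces, a point of the column lies in the cell or strictly
    beyond the plates; there the extension is locally constant and its approximate gradient
    vanishes.\<close>
  have gAE: "AE p in lebesgue. indicator period_column p * (calib_cut i j (p $ 3) * approx_gradient u p $ i $ j) = g i j p" for i j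
    using AE_generic
  proof eventually_elim
    case (elim p)
    consider "p \<in> ?C" | "p \<notin> period_column" | "p \<notin> ?C" "p \<in> period_column" by blast
    then show ?case
    proof cases
      case 1
      then show ?thesis using sub[OF 1] by (simp add: g_def calib_cut_inside u_def approx_gradient_extend_cell)
    next
      case 2
      then have "p \<notin> ?C" using sub by blast
      then show ?thesis using 2 by (simp add: g_def indicator_def)
    next
      case 3
      then have "p $ 3 < 0 \<or> 1 < p $ 3" using elim by (auto simp: cell_def)
      then obtain R where "R > 0" "\<And>y. y \<in> ball p R \<Longrightarrow> extend L1 L2 n y = (if p $ 3 \<le> 0 then e1 else e3)"
        by (rule extend_outside[where n=n and ?L1.0=L1 and ?L2.0=L2]) (rule that)
      from approx_gradient_locally_const(1)[where u="extend L1 L2 n" and x=p, OF this]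
      show ?thesis using 3 by (simp add: g_def u_def)
    qed
  qed
  have gI: "integrable lebesgue (g i j)" and gT: "T i j = (LINT p|lebesgue. g i j p)" for i j
    unfolding T_def using integral_AE_eq[OF mi(1) gAE] by blast+
  have speed: "beyond_plates \<in> sets lebesgue"
  proof -
    have "closed beyond_plates" unfolding beyond_plates_def by (intro closed_Collect_disj closed_Collect_le continuous_intros)
    then show ?thesis by auto
  qed
  have FI: "integrable lebesgue (F i)" for i unfolding F_def by (rule mi(2))
  have FoI: "integrable lebesgue (\<lambda>p. indicator beyond_plates p * F i p)" and FiI: "integrable lebesgue (\<lambda>p. indicator (- beyond_plates) p * F i p)" for i
    using integrable_mult_indicator[OF speed FI] integrable_mult_indicator[OF _ FI, of "- beyond_plates"] speed by (auto simp: Compl_in_sets_lebesgue)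
  have Fsplit: "(LINT p|lebesgue. F i p) = (LINT p|lebesgue. indicator beyond_plates p * F i p) + (LINT p|lebesgue. indicator (- beyond_plates) p * F i p)" for i
    unfolding Bochner_Integration.integral_add[OF FoI FiI, symmetric]
    by (intro Bochner_Integration.integral_cong) (auto simp: indicator_def)
  have Fo: "indicator beyond_plates p * F i p = indicator (period_column \<inter> beyond_plates) p * (calib_cut' i 3 (p $ 3) * boundary_value p $ i)" for i p
    by (auto simp: F_def u_def beyond_plates_def extend_def boundary_value_def indicator_def)
  have fAE: "AE p in lebesgue. indicator (- beyond_plates) p * F i p = f i p" for i
    using AE_generic
  proof eventually_elim
    case (elim p)
    show ?case
    proof (cases "p \<in> ?C")
      case True
      then have "p \<notin> beyond_plates" by (auto simp: cell_def beyond_plates_def)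
      then show ?thesis using True sub[OF True] by (simp add: F_def f_def calib_cut_inside u_def extend_cell[OF L1 L2])
    next
      case False
      then have "p \<in> beyond_plates \<or> p \<notin> period_column" using elim by (auto simp: cell_def beyond_plates_def)
      then show ?thesis using False by (auto simp: F_def f_def)
    qed
  qed
  have fI: "integrable lebesgue (f i)" and fF: "(LINT p|lebesgue. indicator (- beyond_plates) p * F i p) = (LINT p|lebesgue. f i p)" for i
    using integral_AE_eq[OF FiI fAE] by blast+
  have bI: "integrable lebesgue (\<lambda>p. indicator ?C p *\<^sub>R calib_offset (p $ 3))" using calib_offset_integrable by (simp add: set_integrable_def)
  have low: "indicator ?C p *\<^sub>R calib_integrand (p $ 3) (n p) (approx_gradient n p) = ((\<Sum>i\<in>UNIV. \<Sum>j\<in>UNIV. g i j p) + (\<Sum>i\<in>UNIV. f i p)) + indicator ?C p *\<^sub>R calib_offset (p $ 3)" for p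
    unfolding calib_integrand_def g_def f_def by (simp add: sum_distrib_left distrib_left)
  have I1: "integrable lebesgue (\<lambda>p. \<Sum>i\<in>UNIV. \<Sum>j\<in>UNIV. g i j p)" by (intro Bochner_Integration.integrable_sum gI)
  have I2: "integrable lebesgue (\<lambda>p. \<Sum>i\<in>UNIV. f i p)" by (intro Bochner_Integration.integrable_sum fI)
  show "set_integrable lebesgue ?C (\<lambda>p. calib_integrand (p $ 3) (n p) (approx_gradient n p))"
    unfolding set_integrable_def low by (intro Bochner_Integration.integrable_add I1 I2 bI)
  have "(LINT p:?C|lebesgue. calib_integrand (p $ 3) (n p) (approx_gradient n p))
     = (\<Sum>i\<in>UNIV. \<Sum>j\<in>UNIV. LINT p|lebesgue. g i j p) + (\<Sum>i\<in>UNIV. LINT p|lebesgue. f i p) + (LINT p:?C|lebesgue. calib_offset (p $ 3))"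
  proof -
    have s1: "(LINT p|lebesgue. (\<Sum>i\<in>UNIV. \<Sum>j\<in>UNIV. g i j p)) = (\<Sum>i\<in>UNIV. \<Sum>j\<in>UNIV. LINT p|lebesgue. g i j p)"
      by (subst Bochner_Integration.integral_sum, rule Bochner_Integration.integrable_sum, rule gI)
         (intro sum.cong refl Bochner_Integration.integral_sum gI)
    have s2: "(LINT p|lebesgue. (\<Sum>i\<in>UNIV. f i p)) = (\<Sum>i\<in>UNIV. LINT p|lebesgue. f i p)"
      by (rule Bochner_Integration.integral_sum) (rule fI)
    show ?thesis
      unfolding set_lebesgue_integral_def low Bochner_Integration.integral_add[OF Bochner_Integration.integrable_add[OF I1 I2] bI]
        Bochner_Integration.integral_add[OF I1 I2] s1 s2 ..
  qed
  also have "(\<Sum>i\<in>UNIV. LINT p|lebesgue. f i p) = (\<Sum>i\<in>UNIV. (LINT p|lebesgue. F i p) - (LINT p|lebesgue. indicator (period_column \<inter> beyond_plates) p * (calib_cut' i 3 (p $ 3) * boundary_value p $ i)))"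
    by (intro sum.cong refl) (simp add: Fsplit Fo fF)
  also have "\<dots> = (\<Sum>i\<in>UNIV. LINT p|lebesgue. F i p) - (\<Sum>i\<in>UNIV. LINT p|lebesgue. indicator (period_column \<inter> beyond_plates) p * (calib_cut' i 3 (p $ 3) * boundary_value p $ i))"
    by (rule sum_subtractf)
  finally have "(LINT p:?C|lebesgue. calib_integrand (p $ 3) (n p) (approx_gradient n p)) - calib_total
     = (\<Sum>i\<in>UNIV. \<Sum>j\<in>UNIV. T i j) + (\<Sum>i\<in>UNIV. LINT p|lebesgue. F i p)"
    unfolding calib_total_def gT by simp
  also have "\<dots> = (\<Sum>i\<in>UNIV. \<Sum>j\<in>UNIV. T i j + (if j = 3 then LINT p|lebesgue. F i p else 0))"
    by (simp add: sum_3)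
  finally have "\<bar>(LINT p:?C|lebesgue. calib_integrand (p $ 3) (n p) (approx_gradient n p)) - calib_total\<bar>
     \<le> (\<Sum>i\<in>UNIV. \<Sum>j\<in>UNIV. \<bar>T i j + (if j = 3 then LINT p|lebesgue. F i p else 0)\<bar>)"
    by (simp only:) (intro order_trans[OF sum_abs] sum_mono sum_abs)
  also have "\<dots> \<le> (\<Sum>i\<in>(UNIV::3 set). \<Sum>j\<in>(UNIV::3 set). 810000 * H)"
    unfolding T_def F_def H_def by (intro sum_mono mi(3))
  also have "\<dots> = 7290000 * H" by simp
  finally show "\<bar>(LINT p:?C|lebesgue. calib_integrand (p $ 3) (n p) (approx_gradient n p)) - calib_total\<bar> \<le> 7290000 * enn2real (hausdorff_measure 2 (jump_set L1 L2 \<epsilon> n))"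
    unfolding H_def .
qed

section \<open>The lower bound for the energy\<close>

lemma norm_curl_of: "(norm (curl_of G))\<^sup>2 \<le> 2 * (norm G)\<^sup>2"
proof -
  have s: "(a - b)\<^sup>2 \<le> 2 * a\<^sup>2 + 2 * b\<^sup>2" for a b :: real
    using zero_le_power2[of "a + b"] by (simp add: power2_diff power2_sum)
  have add: "X + Y + Z \<le> 2 * (a + b + c + (d + e + f) + (g + h + k))"
    if "X \<le> 2 * h + 2 * f" "Y \<le> 2 * c + 2 * g" "Z \<le> 2 * d + 2 * b" "0 \<le> a" "0 \<le> e" "0 \<le> k"
    for X Y Z a b c d e f g h k :: real using that by (simp add: algebra_simps)
  have "(norm (curl_of G))\<^sup>2 = (G$3$2 - G$2$3)\<^sup>2 + (G$1$3 - G$3$1)\<^sup>2 + (G$2$1 - G$1$2)\<^sup>2"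
    unfolding norm_sq_vec3 curl_of_def vector_3 ..
  moreover have "(norm G)\<^sup>2 = (G$1$1)\<^sup>2 + (G$1$2)\<^sup>2 + (G$1$3)\<^sup>2 + ((G$2$1)\<^sup>2 + (G$2$2)\<^sup>2 + (G$2$3)\<^sup>2) + ((G$3$1)\<^sup>2 + (G$3$2)\<^sup>2 + (G$3$3)\<^sup>2)"
    unfolding norm_sq_mat3 by simp
  ultimately show ?thesis by (simp only:) (intro add s zero_le_power2)
qed

text \<open>A growth bound that makes the energy a genuine integral: with square integrability of
  the gradient on the bounded cell it gives integrability of the density.\<close>

lemma chiral_density_bound:
  assumes "norm n \<le> 1"
  shows "\<bar>chiral_density t n G\<bar> \<le> 2 * (norm G)\<^sup>2 + 2"
proof -
  let ?c = "norm (curl_of G)"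
  have "\<bar>n \<bullet> curl_of G\<bar> \<le> 1 * ?c"
    by (rule order_trans[OF Cauchy_Schwarz_ineq2]) (intro mult_right_mono assms norm_ge_zero)
  moreover have "2 * ?c \<le> ?c\<^sup>2 + 1" using zero_le_power2[of "?c - 1"] by (simp add: power2_diff)
  ultimately have "\<bar>2 * (n \<bullet> curl_of G)\<bar> \<le> 2 * (norm G)\<^sup>2 + 1" using norm_curl_of[of G] by simp
  then have "t * \<bar>2 * (n \<bullet> curl_of G)\<bar> \<le> 1 / 4 * (2 * (norm G)\<^sup>2 + 1)" using t by (intro mult_mono) auto
  moreover have "\<bar>2 * t * (n \<bullet> curl_of G)\<bar> = t * \<bar>2 * (n \<bullet> curl_of G)\<bar>" using t by (simp add: abs_mult)
  moreover have "t\<^sup>2 * (norm n)\<^sup>2 \<le> 1 / 16 * 1"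
    using t_sq power_mono[OF assms norm_ge_zero, of 2] by (intro mult_mono) auto
  moreover have "0 \<le> t\<^sup>2 * (norm n)\<^sup>2" by simp
  moreover have "\<bar>g + x + s\<bar> \<le> 2 * g + 2"
    if "y \<le> 1 / 4 * (2 * g + 1)" "\<bar>x\<bar> = y" "s \<le> 1 / 16 * 1" "0 \<le> s" "0 \<le> g" for g x s y :: real
    using that by (simp add: algebra_simps abs_if split: if_splits)
  ultimately show ?thesis unfolding chiral_density_def using zero_le_power2[of "norm G"] by blast
qed

lemma energy_eq:
  "energy L1 L2 \<epsilon> t K n = (LINT p:cell L1 L2|lebesgue. chiral_density t (n p) (approx_gradient n p))
     + K * enn2real (hausdorff_measure 2 (jump_set L1 L2 \<epsilon> n))"
  by (simp add: energy_def chiral_density_def)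

text \<open>The pointwise comparison holds almost everywhere in the cell, where the approximate
  gradient exists and is tangential. After integration, the error of the calibration is dominated by
  the surface penalty.\<close>

lemma energy_lower_bound:
  assumes n: "n \<in> admissible L1 L2 \<epsilon>" and K: "K > 7290000"
  shows "integrable lebesgue (\<lambda>p. indicator (cell L1 L2) p * (norm (n p - director t \<theta> (p $ 3)))\<^sup>2)"
    and "calib_total + 3 / 10 * (LINT p|lebesgue. indicator (cell L1 L2) p * (norm (n p - director t \<theta> (p $ 3)))\<^sup>2) \<le> energy L1 L2 \<epsilon> t K n"
proof -
  let ?C = "cell L1 L2"
  let ?w = "\<lambda>p. (norm (n p - director t \<theta> (p $ 3)))\<^sup>2"
  let ?L = "\<lambda>p. calib_integrand (p $ 3) (n p) (approx_gradient n p)"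
  let ?D = "\<lambda>p. chiral_density t (n p) (approx_gradient n p)"
  have nC: "n \<in> SBV2 ?C" and sph: "AE p in lebesgue. p \<in> ?C \<longrightarrow> n p \<in> sphere 0 1 \<union> {0}"
    using n by (simp_all add: admissible_def)
  have ni: "set_integrable lebesgue ?C n" using nC by (simp add: SBV2_def SBV_def BV_def)
  have nm: "(\<lambda>p. indicator ?C p *\<^sub>R n p) \<in> borel_measurable lebesgue" using ni by (auto simp: set_integrable_def)
  obtain G \<mu> \<sigma> where BV: "has_BV_derivative ?C n G \<mu> \<sigma>" using nC unfolding SBV2_def SBV_def by blast
  have gm: "(\<lambda>p. indicator ?C p *\<^sub>R approx_gradient n p) \<in> borel_measurable lebesgue"
    using nC by (simp add: SBV2_def set_borel_measurable_def)
  have gsq: "integrable lebesgue (\<lambda>p. indicator ?C p *\<^sub>R (norm (approx_gradient n p))\<^sup>2)"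
    using nC by (simp add: SBV2_def set_integrable_def)
  have sph': "AE p in lebesgue. p \<in> ?C \<longrightarrow> norm (n p) = 1 \<or> n p = 0"
    using sph by eventually_elim auto
  have ae: "AE p in lebesgue. p \<in> ?C \<longrightarrow> ?L p + 3 / 10 * ?w p \<le> ?D p"
    using BV_approx_gradient[OF BV ni open_cell] sph'
  proof eventually_elim
    case (elim p)
    show ?case
    proof
      assume p: "p \<in> ?C"
      let ?G = "approx_gradient n p"
      have al: "has_approx_limit n p (n p)" and ag: "has_approx_gradient n p ?G" using elim p by auto
      obtain R where R: "R > 0" "ball p R \<subseteq> ?C" using open_cell[of L1 L2] p open_contains_ball by blast
      have nB: "set_integrable lebesgue (ball p R) n"
        by (rule set_integrable_subset[OF ni]) (use R cell_measurable in auto)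
      have sphB: "AE y in lebesgue. y \<in> ball p R \<longrightarrow> norm (n y) = 1 \<or> n y = 0"
        using sph' by eventually_elim (use R in auto)
      have "norm (n p) = 1 \<and> n p $ 1 * ?G $ 1 $ 3 + n p $ 2 * ?G $ 2 $ 3 + n p $ 3 * ?G $ 3 $ 3 = 0 \<or> n p = 0"
      proof (cases "n p = 0")
        case False
        then have n1: "norm (n p) = 1" using elim p by auto
        \<comment> \<open>Only the vertical derivative matters, since the null Lagrangian
          differentiates in the height alone.\<close>
        have "n p \<bullet> (?G *v axis 3 1) = 0"
          by (rule approx_gradient_sphere_tangential[OF nB R(1) sphB al n1 ag])
        then show ?thesis using n1 by (simp add: inner_vec_def sum_3 matrix_vector_mult_def axis_def)
      qed simp
      moreover have "p $ 3 \<in> {0..1}" using p by (auto simp: cell_def)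
      ultimately show "?L p + 3 / 10 * ?w p \<le> ?D p" by (intro chiral_density_ge_calib)
    qed
  qed
  have LI: "integrable lebesgue (\<lambda>p. indicator ?C p *\<^sub>R ?L p)" using calib_integral(1)[OF n] by (simp add: set_integrable_def)
  have DI: "integrable lebesgue (\<lambda>p. indicator ?C p *\<^sub>R ?D p)"
  proof (rule Bochner_Integration.integrable_bound)
    show "integrable lebesgue (\<lambda>p. 2 * (indicator ?C p *\<^sub>R (norm (approx_gradient n p))\<^sup>2) + indicator ?C p * 2)"
      using cell_measurable by (intro Bochner_Integration.integrable_add integrable_mult_right gsq integrable_mult_left integrable_real_indicator)
    \<comment> \<open>The density vanishes at (0, 0), so the indicator can be moved into its
      arguments; measurability is available only for the maps restricted to the cell.\<close>
    have e: "indicator ?C p *\<^sub>R ?D p = chiral_density t (indicator ?C p *\<^sub>R n p) (indicator ?C p *\<^sub>R approx_gradient n p)" for p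
      by (cases "p \<in> ?C") (simp_all add: chiral_density_components)
    have c1: "(\<lambda>p. (indicator ?C p *\<^sub>R n p) $ i) \<in> borel_measurable lebesgue" for i
      by (rule measurable_compose[OF nm]) (intro borel_measurable_continuous_onI continuous_intros)
    have c2: "(\<lambda>p. (indicator ?C p *\<^sub>R approx_gradient n p) $ i $ j) \<in> borel_measurable lebesgue" for i j
      by (rule measurable_compose[OF gm]) (intro borel_measurable_continuous_onI continuous_intros)
    have "(\<lambda>p. chiral_density t (indicator ?C p *\<^sub>R n p) (indicator ?C p *\<^sub>R approx_gradient n p)) \<in> borel_measurable lebesgue"
      unfolding chiral_density_components
      by (intro borel_measurable_add borel_measurable_times borel_measurable_diff borel_measurable_power borel_measurable_const c1 c2)
    then show "(\<lambda>p. indicator ?C p *\<^sub>R ?D p) \<in> borel_measurable lebesgue"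
      by (simp only: e)
    show "AE p in lebesgue. norm (indicator ?C p *\<^sub>R ?D p) \<le> norm (2 * (indicator ?C p *\<^sub>R (norm (approx_gradient n p))\<^sup>2) + indicator ?C p * 2)"
      using sph'
    proof eventually_elim
      case (elim p)
      show ?case
      proof (cases "p \<in> ?C")
        case True
        then have "norm (n p) \<le> 1" using elim by auto
        from chiral_density_bound[OF this, of "approx_gradient n p"] show ?thesis using True by simp
      qed simp
    qed
  qed
  have wm: "(\<lambda>p. indicator ?C p * ?w p) \<in> borel_measurable lebesgue"
  proof -
    have cd: "continuous_on UNIV (\<lambda>p::real^3. director t \<theta> (p $ 3))"
      unfolding director_eq vector3_eq_axis
      by (intro continuous_intros continuous_on_compose2[OF continuous_profile(2)[of UNIV]]
            continuous_on_compose2[OF continuous_profile(3)[of UNIV]] continuous_on_compose2[OF continuous_profile(4)[of UNIV]]) auto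
    have dm: "(\<lambda>p. indicator ?C p *\<^sub>R director t \<theta> (p $ 3)) \<in> borel_measurable lebesgue"
      using cell_measurable(1) cd
      by (intro borel_measurable_scaleR borel_measurable_indicator measurable_completion) (auto intro: borel_measurable_continuous_onI)
    have e: "indicator ?C p * ?w p = (norm (indicator ?C p *\<^sub>R n p - indicator ?C p *\<^sub>R director t \<theta> (p $ 3)))\<^sup>2" for p
      by (simp add: indicator_def)
    show ?thesis unfolding e
      by (rule measurable_compose[OF borel_measurable_diff[OF nm dm], of "\<lambda>v. (norm v)\<^sup>2"]) simp
  qed
  have bnd: "AE p in lebesgue. 3 / 10 * (indicator ?C p * ?w p) \<le> indicator ?C p *\<^sub>R ?D p - indicator ?C p *\<^sub>R ?L p"
    using ae by eventually_elim (auto simp: indicator_def)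
  have DLI: "integrable lebesgue (\<lambda>p. indicator ?C p *\<^sub>R ?D p - indicator ?C p *\<^sub>R ?L p)" by (rule Bochner_Integration.integrable_diff[OF DI LI])
  have "integrable lebesgue (\<lambda>p. 3 / 10 * (indicator ?C p * ?w p))"
  proof (rule Bochner_Integration.integrable_bound[OF DLI])
    show "(\<lambda>p. 3 / 10 * (indicator ?C p * ?w p)) \<in> borel_measurable lebesgue"
      by (intro borel_measurable_times borel_measurable_const wm)
    show "AE p in lebesgue. norm (3 / 10 * (indicator ?C p * ?w p)) \<le> norm (indicator ?C p *\<^sub>R ?D p - indicator ?C p *\<^sub>R ?L p)"
      using bnd
    proof eventually_elim
      case (elim p)
      have "0 \<le> 3 / 10 * (indicator ?C p * ?w p)" by simp
      then show ?case using elim unfolding real_norm_def by linarith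
    qed
  qed
  then have wI3: "integrable lebesgue (\<lambda>p. 3 / 10 * (indicator ?C p * ?w p))" .
  from integrable_mult_right[OF wI3, of "10 / 3"]
  show wI: "integrable lebesgue (\<lambda>p. indicator ?C p * ?w p)" by simp
  have "3 / 10 * (LINT p|lebesgue. indicator ?C p * ?w p) = (LINT p|lebesgue. 3 / 10 * (indicator ?C p * ?w p))" by simp
  also have "\<dots> \<le> (LINT p|lebesgue. indicator ?C p *\<^sub>R ?D p - indicator ?C p *\<^sub>R ?L p)"
    by (rule integral_mono_AE[OF wI3 DLI bnd])
  also have "\<dots> = (LINT p:?C|lebesgue. ?D p) - (LINT p:?C|lebesgue. ?L p)"
    unfolding set_lebesgue_integral_def by (rule Bochner_Integration.integral_diff[OF DI LI])
  finally have a: "3 / 10 * (LINT p|lebesgue. indicator ?C p * ?w p) \<le> (LINT p:?C|lebesgue. ?D p) - (LINT p:?C|lebesgue. ?L p)" .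
  define H where "H = enn2real (hausdorff_measure 2 (jump_set L1 L2 \<epsilon> n))"
  have "0 \<le> H" by (simp add: H_def)
  then have "7290000 * H \<le> K * H" using K by (intro mult_right_mono) auto
  then show "calib_total + 3 / 10 * (LINT p|lebesgue. indicator ?C p * ?w p) \<le> energy L1 L2 \<epsilon> t K n"
    using a calib_integral(2)[OF n] unfolding energy_eq H_def[symmetric] abs_le_iff by linarith
qed

section \<open>The candidate as a competitor\<close>

definition director_grad :: "real \<Rightarrow> real^3^3" where
  "director_grad z = vector [vector [0, 0, P1 z], vector [0, 0, P2 z], vector [0, 0, P3 z]]"

lemma director_grad_mult: "director_grad z *v h = h $ 3 *\<^sub>R director_deriv z"
  by (simp add: director_grad_def director_deriv_def vec_eq_iff forall_3 matrix_vector_mult_def sum_3)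

lemma director_has_derivative: "((\<lambda>p::real^3. director t \<theta> (p $ 3)) has_derivative (\<lambda>h. director_grad (p $ 3) *v h)) (at p)"
proof -
  have "((\<lambda>p::real^3. p $ 3) has_derivative (\<lambda>h. h $ 3)) (at p)"
    by (rule bounded_linear_imp_has_derivative) (rule bounded_linear_vec_nth)
  from has_derivative_compose[OF this director_has_vector_derivative[of "p $ 3", unfolded has_vector_derivative_def]]
  show ?thesis by (simp add: director_grad_mult)
qed

lemma director_lipschitz: "norm (director t \<theta> x - director t \<theta> y) \<le> 2 * \<bar>x - y\<bar>"
proof -
  have "norm (director t \<theta> x - director t \<theta> y) \<le> 2 * norm (x - y)"
  proof (rule differentiable_bound[where S=UNIV and f'="\<lambda>z h. h *\<^sub>R director_deriv z"])
    show "(director t \<theta> has_derivative (\<lambda>h. h *\<^sub>R director_deriv z)) (at z within UNIV)" for z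
      using director_has_vector_derivative[of z] by (simp add: has_vector_derivative_def)
    show "onorm (\<lambda>h. h *\<^sub>R director_deriv z) \<le> 2" for z
      by (rule onorm_bound) (use norm_director_deriv[of z] in \<open>auto simp: mult.commute[of 2] intro!: mult_left_mono\<close>)
  qed auto
  then show ?thesis by simp
qed

text \<open>The profile attains the boundary values and does not depend on the lateral variables, so
  extending means clamping the height to [0, 1]. Clamping does not increase distances, and the
  extension is Lipschitz.\<close>

lemma extend_director:
  "extend L1 L2 (\<lambda>p. director t \<theta> (p $ 3)) p = director t \<theta> (max 0 (min 1 (p $ 3)))"
  using director_ends by (auto simp: extend_def max_def min_def)

lemma extend_director_lipschitz:
  "norm (extend L1 L2 (\<lambda>p. director t \<theta> (p $ 3)) p - extend L1 L2 (\<lambda>p. director t \<theta> (p $ 3)) q) \<le> 2 * norm (p - q)"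
proof -
  have "\<bar>max 0 (min 1 (p $ 3)) - max 0 (min 1 (q $ 3))\<bar> \<le> \<bar>p $ 3 - q $ 3\<bar>" by (auto simp: max_def min_def)
  also have "\<dots> \<le> norm (p - q)" using component_le_norm_cart[of "p - q" 3] by simp
  finally show ?thesis unfolding extend_director by (intro order_trans[OF director_lipschitz]) simp
qed

lemma director_admissible: "(\<lambda>p. director t \<theta> (p $ 3)) \<in> admissible L1 L2 \<epsilon>"
proof -
  let ?n = "\<lambda>p::real^3. director t \<theta> (p $ 3)"
  let ?u = "extend L1 L2 ?n"
  have 1: "?n \<in> SBV2 (cell L1 L2)"
  proof (rule lipschitz_SBV2[where L=2 and M=1 and N="{}" and G="\<lambda>p. director_grad (p $ 3)"])
    show "norm (?n x - ?n y) \<le> 2 * norm (x - y)" for x y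
      using director_lipschitz[of "x $ 3" "y $ 3"] component_le_norm_cart[of "x - y" 3] by simp
  qed (auto simp: norm_director intro: director_has_derivative open_cell cell_measurable)
  have 2: "?u \<in> SBV2 V" if V: "open V" "bounded V" for V
  proof (rule lipschitz_SBV2[where L=2 and M=1 and N="{p. p $ 3 = 0} \<union> {p. p $ 3 = 1}" and
        G="\<lambda>p. if 0 < p $ 3 \<and> p $ 3 < 1 then director_grad (p $ 3) else 0"])
    show "norm (?u x - ?u y) \<le> 2 * norm (x - y)" for x y by (rule extend_director_lipschitz)
    show "norm (?u x) \<le> 1" for x by (simp add: extend_director norm_director)
    have "{p::real^3. p $ 3 = c} \<in> null_sets lebesgue" for c
      using negligible_standard_hyperplane[of "axis 3 1 :: real^3" c] by (simp add: inner_axis negligible_iff_null_sets)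
    then show "{p::real^3. p $ 3 = 0} \<union> {p. p $ 3 = 1} \<in> null_sets lebesgue" by blast
    fix p :: "real^3" assume p: "p \<notin> {p. p $ 3 = 0} \<union> {p. p $ 3 = 1}"
    show "(?u has_derivative (\<lambda>h. (if 0 < p $ 3 \<and> p $ 3 < 1 then director_grad (p $ 3) else 0) *v h)) (at p)"
    proof (cases "0 < p $ 3 \<and> p $ 3 < 1")
      case True
      have "(?u has_derivative (\<lambda>h. director_grad (p $ 3) *v h)) (at p)"
      proof (rule has_derivative_transform_within_open[OF director_has_derivative])
        show "open {q::real^3. 0 < q $ 3 \<and> q $ 3 < 1}" by (intro open_Collect_conj open_Collect_less continuous_intros)
        show "director t \<theta> (q $ 3) = ?u q" if "q \<in> {q. 0 < q $ 3 \<and> q $ 3 < 1}" for q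
          using that by (simp add: extend_director)
      qed (use True in simp)
      then show ?thesis using True by simp
    next
      case False
      then have "p $ 3 < 0 \<or> 1 < p $ 3" using p by auto
      then obtain R where R: "R > 0" "\<And>y. y \<in> ball p R \<Longrightarrow> ?u y = (if p $ 3 \<le> 0 then e1 else e3)"
        by (rule extend_outside[where n="?n" and ?L1.0=L1 and ?L2.0=L2]) (rule that)
      have "(?u has_derivative (\<lambda>h. 0)) (at p)"
        by (rule has_derivative_transform_within_open[OF has_derivative_const[of "if p $ 3 \<le> 0 then e1 else e3"] open_ball[of p R]])
           (use R in auto)
      moreover have "(\<lambda>h. (if 0 < p $ 3 \<and> p $ 3 < 1 then director_grad (p $ 3) else 0) *v h) = (\<lambda>h. 0)"
        unfolding if_not_P[OF False] by simp
      ultimately show ?thesis by simp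
    qed
  qed (use V in auto)
  show ?thesis unfolding admissible_def using 1 2 norm_director by simp
qed

lemma director_jump_set: "jump_set L1 L2 \<epsilon> (\<lambda>p. director t \<theta> (p $ 3)) = {}"
proof -
  let ?u = "extend L1 L2 (\<lambda>p. director t \<theta> (p $ 3))"
  have "isCont ?u p" for p
  proof -
    have "((\<lambda>q. ?u q - ?u p) \<longlongrightarrow> 0) (at p)"
    proof (rule Lim_null_comparison)
      show "\<forall>\<^sub>F q in at p. norm (?u q - ?u p) \<le> 2 * norm (q - p)" using extend_director_lipschitz by simp
      show "((\<lambda>q. 2 * norm (q - p)) \<longlongrightarrow> 0) (at p)" by (rule tendsto_eq_rhs, (rule tendsto_intros)+) simp
    qed
    then show ?thesis by (simp add: isCont_def LIM_zero_iff)
  qed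
  then show ?thesis unfolding jump_set_def approx_discont_set_def using continuous_has_approx_limit by blast
qed

text \<open>With an empty jump set the integral of the calibration is exact, and the calibration
  equals the density at the candidate; both sides agree without any integral being computed.\<close>

lemma energy_director: "energy L1 L2 \<epsilon> t K (\<lambda>p. director t \<theta> (p $ 3)) = calib_total"
proof -
  let ?n = "\<lambda>p::real^3. director t \<theta> (p $ 3)"
  have cont: "continuous_on UNIV ?n"
    by (intro continuous_at_imp_continuous_on ballI has_derivative_continuous[OF director_has_derivative])
  have ag: "approx_gradient ?n p = director_grad (p $ 3)" for p
    by (rule approx_gradient_eqI[OF continuous_set_integrable_ball[OF cont] zero_less_one has_derivative_has_approx_gradient[OF director_has_derivative]])
  have eq: "chiral_density t (?n p) (approx_gradient ?n p) = calib_integrand (p $ 3) (?n p) (approx_gradient ?n p)" for p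
    unfolding ag by (rule chiral_density_eq_calib) (rule director_grad_def)
  have "\<bar>(LINT p:cell L1 L2|lebesgue. calib_integrand (p $ 3) (?n p) (approx_gradient ?n p)) - calib_total\<bar> \<le> 0"
    using calib_integral(2)[OF director_admissible] by (simp add: director_jump_set)
  then show ?thesis unfolding energy_eq eq by (simp add: director_jump_set)
qed

text \<open>The excess over \<open>calib_total\<close> is at least 3/10 of the squared L^2 distance
  to the candidate, so equal energy forces equality almost everywhere in the cell.\<close>

theorem director_unique_minimiser:
  assumes K: "K > 7290000" and n: "n \<in> admissible L1 L2 \<epsilon>"
  shows "energy L1 L2 \<epsilon> t K (\<lambda>p. director t \<theta> (p $ 3)) \<le> energy L1 L2 \<epsilon> t K n"
    and "energy L1 L2 \<epsilon> t K n = energy L1 L2 \<epsilon> t K (\<lambda>p. director t \<theta> (p $ 3)) \<Longrightarrow>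
      AE p in lebesgue. p \<in> cell L1 L2 \<longrightarrow> n p = director t \<theta> (p $ 3)"
proof -
  let ?w = "\<lambda>p. indicator (cell L1 L2) p * (norm (n p - director t \<theta> (p $ 3)))\<^sup>2"
  have w0: "0 \<le> (LINT p|lebesgue. ?w p)" by (intro integral_nonneg_AE) simp
  note b = energy_lower_bound[OF n K]
  show "energy L1 L2 \<epsilon> t K (\<lambda>p. director t \<theta> (p $ 3)) \<le> energy L1 L2 \<epsilon> t K n"
    unfolding energy_director using b(2) w0 by linarith
  assume "energy L1 L2 \<epsilon> t K n = energy L1 L2 \<epsilon> t K (\<lambda>p. director t \<theta> (p $ 3))"
  then have "(LINT p|lebesgue. ?w p) = 0" using b(2) w0 unfolding energy_director by linarith
  then have "AE p in lebesgue. ?w p = 0"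
    using integral_nonneg_eq_0_iff_AE[OF b(1)] by simp
  then show "AE p in lebesgue. p \<in> cell L1 L2 \<longrightarrow> n p = director t \<theta> (p $ 3)"
    by eventually_elim (auto simp: indicator_def)
qed

end

end

theorem theorem9p3:
  fixes L1 L2 \<epsilon> :: real
  assumes "L1 > 0" and "L2 > 0" and "\<epsilon> > 0"
  shows "\<exists>tstar > 0. \<exists>Kstar > 0. \<forall>t K. 0 < t \<and> t < tstar \<and> K > Kstar \<longrightarrow>
    (\<exists>D \<theta>. is_profile t D \<theta> \<and>
       (\<forall>D' \<theta>'. is_profile t D' \<theta>' \<longrightarrow> D' = D \<and> (\<forall>z\<in>{0..1}. \<theta>' z = \<theta> z)) \<and>
       smooth_on {0..1} (director t \<theta>) \<and>
       (let nstar = (\<lambda>p. director t \<theta> (p $ 3)) in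
          nstar \<in> admissible L1 L2 \<epsilon> \<and>
          (\<forall>n \<in> admissible L1 L2 \<epsilon>. energy L1 L2 \<epsilon> t K nstar \<le> energy L1 L2 \<epsilon> t K n) \<and>
          (\<forall>n \<in> admissible L1 L2 \<epsilon>. energy L1 L2 \<epsilon> t K n = energy L1 L2 \<epsilon> t K nstar \<longrightarrow>
             (AE p in lebesgue. p \<in> cell L1 L2 \<longrightarrow> n p = nstar p))))"
proof (rule exI[of _ "1 / 4"], rule conjI, simp, rule exI[of _ 7290000], rule conjI, simp, intro allI impI, elim conjE)
  \<comment> \<open>Both thresholds are independent of the size of the cell and of
    \<open>\<epsilon>\<close>.\<close>
  fix t K :: real assume t: "0 < t" "t < 1 / 4" and K: "7290000 < K"
  obtain D \<theta> where D: "t\<^sup>2 < D" "D \<le> t\<^sup>2 + pi\<^sup>2 / 4" and prof: "is_profile t D \<theta>"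
    and uniq: "\<And>D' \<theta>'. is_profile t D' \<theta>' \<Longrightarrow> D' = D \<and> (\<forall>z\<in>{0..1}. \<theta>' z = \<theta> z)"
    and \<theta>: "\<theta> 0 = 0" "\<theta> 1 = pi / 2" "\<And>z. (\<theta> has_real_derivative sqrt (D - t\<^sup>2 * (cos (\<theta> z))\<^sup>2)) (at z)"
    by (rule profile_exists[OF t]) (rule that)
  interpret director_profile t D \<theta> by unfold_locales (fact t D \<theta>)+
  show "\<exists>D \<theta>. is_profile t D \<theta> \<and>
       (\<forall>D' \<theta>'. is_profile t D' \<theta>' \<longrightarrow> D' = D \<and> (\<forall>z\<in>{0..1}. \<theta>' z = \<theta> z)) \<and>
       smooth_on {0..1} (director t \<theta>) \<and>
       (let nstar = (\<lambda>p. director t \<theta> (p $ 3)) in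
          nstar \<in> admissible L1 L2 \<epsilon> \<and>
          (\<forall>n \<in> admissible L1 L2 \<epsilon>. energy L1 L2 \<epsilon> t K nstar \<le> energy L1 L2 \<epsilon> t K n) \<and>
          (\<forall>n \<in> admissible L1 L2 \<epsilon>. energy L1 L2 \<epsilon> t K n = energy L1 L2 \<epsilon> t K nstar \<longrightarrow>
             (AE p in lebesgue. p \<in> cell L1 L2 \<longrightarrow> n p = nstar p)))"
    unfolding Let_def
  proof (rule exI[of _ D], rule exI[of _ \<theta>], intro conjI allI impI ballI)
    show "is_profile t D \<theta>" by (rule prof)
    show "D' = D" if "is_profile t D' \<theta>'" for D' \<theta>' using uniq[OF that] by blast
    show "\<theta>' z = \<theta> z" if "is_profile t D' \<theta>'" "z \<in> {0..1}" for D' \<theta>' z using uniq[OF that(1)] that(2) by blast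
    show "smooth_on {0..1} (director t \<theta>)" by (rule director_smooth_on)
    show "(\<lambda>p. director t \<theta> (p $ 3)) \<in> admissible L1 L2 \<epsilon>" by (rule director_admissible[OF assms])
    show "energy L1 L2 \<epsilon> t K (\<lambda>p. director t \<theta> (p $ 3)) \<le> energy L1 L2 \<epsilon> t K n" if "n \<in> admissible L1 L2 \<epsilon>" for n
      by (rule director_unique_minimiser(1)[OF assms K that])
    show "AE p in lebesgue. p \<in> cell L1 L2 \<longrightarrow> n p = director t \<theta> (p $ 3)"
      if "n \<in> admissible L1 L2 \<epsilon>" "energy L1 L2 \<epsilon> t K n = energy L1 L2 \<epsilon> t K (\<lambda>p. director t \<theta> (p $ 3))" for n
      by (rule director_unique_minimiser(2)[OF assms K that])
  qed
qed

end
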